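(* Let $\mathbb{D}^n$ be the polydisk in $\mathbb{C}^n$ and let $\phi,\psi\in C^1(\overline{\mathbb{D}^n})$ be non-constant. Assume that for any holomorphic function $g:\mathbb{D}\to\partial\mathbb{D}^n$, either $\phi\circ g$ and $\psi\circ g$ are both holomorphic, or $\overline{\phi}\circ g$ and $\overline{\psi}\circ g$ are both holomorphic. Then the commutator $[T_{\phi},T_{\psi}]=T_\phi T_\psi-T_\psi T_\phi$ is compact on $A^2(\mathbb{D}^n)$.
   Context: $\mathbb{D}$ is the open unit disk in $\mathbb{C}$, $\mathbb{D}^n$ is the product of $n$ copies of it, and $\partial\mathbb{D}^n$ is its topological boundary in $\mathbb{C}^n$. A holomorphic function $g:\mathbb{D}\to\partial\mathbb{D}^n$ is a holomorphic map $g:\mathbb{D}\to\mathbb{C}^n$ whose image is contained in $\partial\mathbb{D}^n$. Symbols are complex-valued, and $C^1(\overline{\mathbb{D}^n})$ denotes functions that are continuously differentiable (in the real sense) up to the boundary. For a domain $\Omega\subset\mathbb{C}^n$ with Lebesgue volume measure $dV$, the Bergman space $A^2(\Omega)$ is the closed subspace of $L^2(\Omega,dV)$ consisting of holomorphic functions, and $P:L^2(\Omega)\to A^2(\Omega)$ is the orthogonal projection. For $\phi\in L^\infty(\Omega)$, the Toeplitz operator $T_\phi:A^2(\Omega)\to A^2(\Omega)$ is $T_\phi f=P(\phi f)$. *)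

theory Defs
  imports "HOL-Complex_Analysis.Complex_Analysis"
begin

definition polydisk :: "(complex ^ 'n) set" where
  "polydisk = {z. \<forall>i. norm (z $ i) < 1}"

definition holomorphic_fun_on :: "(complex ^ 'n \<Rightarrow> complex) \<Rightarrow> (complex ^ 'n) set \<Rightarrow> bool" where
  "holomorphic_fun_on f \<Omega> \<longleftrightarrow>
     (\<forall>z\<in>\<Omega>. \<exists>D. (f has_derivative D) (at z) \<and> (\<forall>c v. D (c *s v) = c * D v))"

definition holomorphic_map_on :: "(complex \<Rightarrow> complex ^ 'n) \<Rightarrow> complex set \<Rightarrow> bool" where
  "holomorphic_map_on g S \<longleftrightarrow> (\<forall>i. (\<lambda>\<zeta>. g \<zeta> $ i) holomorphic_on S)"

text \<open>
  The class \<open>C\<^sup>1\<close> up to the boundary, in the real sense: the function is continuous on the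
  closure and its real Frechet derivative on \<open>\<Omega>\<close> extends continuously to the closure. Values of
  the function off the closure play no role.
\<close>

definition C1_closure :: "(complex ^ 'n) set \<Rightarrow> (complex ^ 'n \<Rightarrow> complex) \<Rightarrow> bool" where
  "C1_closure \<Omega> \<phi> \<longleftrightarrow>
     continuous_on (closure \<Omega>) \<phi> \<and>
     (\<exists>\<phi>' :: complex ^ 'n \<Rightarrow> (complex ^ 'n) \<Rightarrow>\<^sub>L complex.
        continuous_on (closure \<Omega>) \<phi>' \<and>
        (\<forall>z\<in>\<Omega>. (\<phi> has_derivative blinfun_apply (\<phi>' z)) (at z)))"

text \<open>
  Square-integrable functions are kept as functions, not as classes modulo null sets; the inner
  product and the norm only see the values on \<open>\<Omega>\<close>, up to null sets.
\<close>

definition L2_space :: "(complex ^ 'n) set \<Rightarrow> (complex ^ 'n \<Rightarrow> complex) set" where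
  "L2_space \<Omega> = {f. f \<in> borel_measurable (lebesgue_on \<Omega>) \<and>
                    integrable (lebesgue_on \<Omega>) (\<lambda>z. (norm (f z))\<^sup>2)}"

definition L2_inner ::
  "(complex ^ 'n) set \<Rightarrow> (complex ^ 'n \<Rightarrow> complex) \<Rightarrow> (complex ^ 'n \<Rightarrow> complex) \<Rightarrow> complex" where
  "L2_inner \<Omega> f g = (LINT z|lebesgue_on \<Omega>. f z * cnj (g z))"

definition L2_norm :: "(complex ^ 'n) set \<Rightarrow> (complex ^ 'n \<Rightarrow> complex) \<Rightarrow> real" where
  "L2_norm \<Omega> f = sqrt (LINT z|lebesgue_on \<Omega>. (norm (f z))\<^sup>2)"

text \<open>
  HOL functions are total, so elements of the Bergman space are normalised to vanish off \<open>\<Omega>\<close>.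
  For open \<open>\<Omega>\<close> this makes every element the unique representative of its class, which the
  definite description below relies on.
\<close>

definition bergman_space :: "(complex ^ 'n) set \<Rightarrow> (complex ^ 'n \<Rightarrow> complex) set" where
  "bergman_space \<Omega> =
     {f \<in> L2_space \<Omega>. holomorphic_fun_on f \<Omega> \<and> (\<forall>z. z \<notin> \<Omega> \<longrightarrow> f z = 0)}"

definition bergman_projection ::
  "(complex ^ 'n) set \<Rightarrow> (complex ^ 'n \<Rightarrow> complex) \<Rightarrow> (complex ^ 'n \<Rightarrow> complex)" where
  "bergman_projection \<Omega> f =
     (THE h. h \<in> bergman_space \<Omega> \<and>
             (\<forall>k\<in>bergman_space \<Omega>. L2_inner \<Omega> (\<lambda>z. f z - h z) k = 0))"

definition toeplitz ::
  "(complex ^ 'n) set \<Rightarrow> (complex ^ 'n \<Rightarrow> complex) \<Rightarrow>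
   (complex ^ 'n \<Rightarrow> complex) \<Rightarrow> (complex ^ 'n \<Rightarrow> complex)" where
  "toeplitz \<Omega> \<phi> f = bergman_projection \<Omega> (\<lambda>z. \<phi> z * f z)"

definition toeplitz_commutator ::
  "(complex ^ 'n) set \<Rightarrow> (complex ^ 'n \<Rightarrow> complex) \<Rightarrow> (complex ^ 'n \<Rightarrow> complex) \<Rightarrow>
   (complex ^ 'n \<Rightarrow> complex) \<Rightarrow> (complex ^ 'n \<Rightarrow> complex)" where
  "toeplitz_commutator \<Omega> \<phi> \<psi> f =
     (\<lambda>z. toeplitz \<Omega> \<phi> (toeplitz \<Omega> \<psi> f) z - toeplitz \<Omega> \<psi> (toeplitz \<Omega> \<phi> f) z)"

text \<open>
  A compact operator on the Bergman space: a linear self-map under which the image of every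
  norm-bounded sequence has a norm-convergent subsequence.
\<close>

definition compact_operator_on_bergman ::
  "(complex ^ 'n) set \<Rightarrow> ((complex ^ 'n \<Rightarrow> complex) \<Rightarrow> (complex ^ 'n \<Rightarrow> complex)) \<Rightarrow> bool" where
  "compact_operator_on_bergman \<Omega> T \<longleftrightarrow>
     (\<forall>f\<in>bergman_space \<Omega>. T f \<in> bergman_space \<Omega>) \<and>
     (\<forall>f\<in>bergman_space \<Omega>. \<forall>g\<in>bergman_space \<Omega>. \<forall>a b.
        T (\<lambda>z. a * f z + b * g z) = (\<lambda>z. a * T f z + b * T g z)) \<and>
     (\<forall>F :: nat \<Rightarrow> complex ^ 'n \<Rightarrow> complex.
        (\<forall>k. F k \<in> bergman_space \<Omega>) \<and> (\<exists>B. \<forall>k. L2_norm \<Omega> (F k) \<le> B) \<longrightarrow>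
        (\<exists>h\<in>bergman_space \<Omega>. \<exists>r :: nat \<Rightarrow> nat. strict_mono r \<and>
           (\<lambda>k. L2_norm \<Omega> (\<lambda>z. T (F (r k)) z - h z)) \<longlonglongrightarrow> 0))"

end

theory Submission
  imports Defs
begin

text \<open>
  For a coordinate \<open>j\<close> put \<open>M = 1 - T\<^bsub>\<bar>z\<^sub>j\<bar>\<^sup>2\<^esub>\<close>. Functions concentrated near \<open>\<bar>z\<^sub>j\<bar> = 1\<close> are those
  with \<open>M g\<close> small, and an operator \<open>X\<close> is called null if \<open>\<parallel>X g\<parallel> \<le> \<epsilon> \<parallel>g\<parallel> + C \<parallel>M g\<parallel>\<close> for all
  \<open>\<epsilon> > 0\<close> with suitable \<open>C\<close>. For continuous \<open>\<kappa>\<close> the Toeplitz operator with symbol \<open>\<kappa>(z\<^sub>j)\<close>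
  agrees with multiplication by \<open>\<kappa>(z\<^sub>j)\<close> modulo null operators and commutes modulo null operators
  with Toeplitz operators with continuous symbols; so on functions concentrated near
  \<open>z\<^sub>j = \<theta>\<close>, \<open>\<bar>\<theta>\<bar> = 1\<close>, the symbols may be replaced by their slices at \<open>z\<^sub>j = \<theta>\<close>. Analytic discs
  in the boundary that degenerate to pairs of coordinate discs show that the two slices are both
  holomorphic or both antiholomorphic, hence their Toeplitz operators commute. With a partition of
  unity in \<open>z\<^sub>j\<close> the commutator is null for every \<open>j\<close>. Finally, a bounded sequence \<open>f\<^sub>k\<close> that
  tends to \<open>0\<close> locally uniformly has \<open>T\<^sub>w f\<^sub>k \<rightarrow> 0\<close> for the weight
  \<open>w = \<Prod>\<^sub>j (1 - \<bar>z\<^sub>j\<bar>\<^sup>2)\<close>, and nullity in all coordinates turns this into \<open>[T\<^sub>\<phi>, T\<^sub>\<psi>] f\<^sub>k \<rightarrow> 0\<close>.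
\<close>

text \<open>The hypothesis offers its alternative separately for each disc, while commutation on a
  slice needs one alternative for both symbols on the entire slice; this is why discs passing close
  to two prescribed coordinate discs at once are required.

  The operator M is diagonal: on functions of degree m in z_j it is multiplication by 1/(m+2). So M
  g is small against g when g lives in high degrees, the algebraic form of concentration near the
  circle. For linear X the null estimate says that X is a norm limit of operators that factor
  through M on the right. The M of different coordinates commute and multiply to T_w, so nullity in
  every coordinate approximates X by operators that factor through T_w.

  The obstacle is composition. Null operators absorb bounded operators on the left, but on the right
  only those that keep M g small. This forces explicit relations between M, multiplication by z_j
  and its adjoint, all of which come from one identity for the Bergman shift; continuous symbols
  then follow by uniform approximation.\<close>

section \<open>Lebesgue measure on C and C^n: products and rotations\<close>

text \<open>Identifies C with \<open>real^2\<close> as measure spaces, so that invariance under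
  orthogonal maps of \<open>real^2\<close> applies to multiplication by unimodular numbers.\<close>

lemma lborel_complex_eq_distr:
  "(lborel :: complex measure) = distr lborel borel (\<lambda>x::real^2. Complex (x $ 1) (x $ 2))"
proof (rule lborel_eqI)
  define T where "T = (\<lambda>x::real^2. Complex (x $ 1) (x $ 2))"
  have T_eq: "T = (\<lambda>x. of_real (x $ 1) + \<i> * of_real (x $ 2))"
    by (auto simp: T_def fun_eq_iff complex_eq_iff)
  have T_meas [measurable]: "T \<in> borel_measurable borel"
    unfolding T_eq by measurable
  fix l u :: complex
  assume le: "\<And>b. b \<in> Basis \<Longrightarrow> l \<bullet> b \<le> u \<bullet> b"
  define l' u' :: "real^2" where "l' = (\<chi> i. if i = 1 then Re l else Im l)"
    and "u' = (\<chi> i. if i = 1 then Re u else Im u)"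
  have le': "Re l \<le> Re u" "Im l \<le> Im u"
    using le[of 1] le[of \<i>] by (auto simp: Basis_complex_def)
  have "T -` box l u \<inter> space lborel = box l' u'"
    by (auto simp: T_def l'_def u'_def mem_box_cart forall_2 in_box_complex_iff)
  moreover have "emeasure lborel (box l' u') = (\<Prod>b\<in>Basis. (u' - l') \<bullet> b)"
    by (rule emeasure_lborel_box) 
       (auto simp: Basis_vec_def inner_axis l'_def u'_def le')
  moreover have "(\<Prod>b\<in>Basis. (u' - l') \<bullet> b) = (\<Prod>b\<in>Basis. (u - l) \<bullet> b)"
  proof -
    have "(\<Prod>b\<in>Basis. (u' - l') \<bullet> b) = (\<Prod>b\<in>{axis 1 1, axis (2::2) 1}. (u' - l') \<bullet> b)"
      by (rule arg_cong[where f = "\<lambda>A. prod _ A"]) (auto simp: Basis_vec_def UNIV_2)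
    also have "\<dots> = (Re u - Re l) * (Im u - Im l)"
      by (subst prod.insert) (auto simp: axis_eq_axis inner_axis l'_def u'_def)
    also have "\<dots> = (\<Prod>b\<in>Basis. (u - l) \<bullet> b)"
      by (simp add: Basis_complex_def complex_eq_iff)
    finally show ?thesis .
  qed
  ultimately show "emeasure (distr lborel borel (\<lambda>x::real^2. Complex (x $ 1) (x $ 2))) (box l u)
      = (\<Prod>b\<in>Basis. (u - l) \<bullet> b)"
    unfolding T_def[symmetric] by (simp add: emeasure_distr)
qed auto

lemma lborel_rotate_complex:
  fixes w :: complex
  assumes w: "norm w = 1" and A: "A \<in> sets borel"
  shows "emeasure lborel ((\<lambda>z. w * z) -` A) = emeasure lborel A"
proof -
  have "(lborel :: complex measure) = distr lborel borel (\<lambda>z. w * z)"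
  proof (rule lborel_eqI)
    fix l u :: complex
    assume le: "\<And>b. b \<in> Basis \<Longrightarrow> l \<bullet> b \<le> u \<bullet> b"
    define T where "T = (\<lambda>x::real^2. Complex (x $ 1) (x $ 2))"
    have T_eq: "T = (\<lambda>x. of_real (x $ 1) + \<i> * of_real (x $ 2))"
      by (auto simp: T_def fun_eq_iff complex_eq_iff)
    have T_meas [measurable]: "T \<in> borel_measurable borel"
      unfolding T_eq by measurable
    \<comment> \<open>The preimage under multiplication by \<open>w\<close> is the image under
      multiplication by its inverse \<open>cnj w\<close>; \<open>R\<close> is that inverse in real
      coordinates.\<close>
    define R :: "real^2 \<Rightarrow> real^2" where
      "R = (\<lambda>x. \<chi> i. if i = 1 then Re (cnj w * T x) else Im (cnj w * T x))"
    have TR: "T (R x) = cnj w * T x" for x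
      by (simp add: R_def T_def complex_eq_iff)
    have ww: "w * cnj w = 1" using w by (simp add: complex_norm_square[symmetric])
    have nrm: "(norm w)\<^sup>2 = (Re w)\<^sup>2 + (Im w)\<^sup>2" by (simp add: cmod_power2)
    have n1: "(Re w)\<^sup>2 + (Im w)\<^sup>2 = 1" using nrm w by simp
    have "linear R"
      by (rule linearI) (auto simp: R_def T_def vec_eq_iff algebra_simps forall_2)
    moreover have "norm (R x) = norm x" for x
    proof -
      have "(R x $ 1)\<^sup>2 + (R x $ 2)\<^sup>2 = ((Re w)\<^sup>2 + (Im w)\<^sup>2) * ((x$1)\<^sup>2 + (x$2)\<^sup>2)"
        by (simp add: R_def T_def power2_eq_square algebra_simps)
      thus ?thesis using n1 by (simp add: norm_vec_def L2_set_def sum_2)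
    qed
    ultimately have orth: "orthogonal_transformation R"
      by (simp add: orthogonal_transformation)
    have bm: "box l u \<in> sets borel" by simp
    define S where "S = T -` (box l u)"
    have Sb: "S = box (\<chi> i. if i = 1 then Re l else Im l) (\<chi> i. if i = 1 then Re u else Im u)"
      by (auto simp: S_def T_def mem_box_cart forall_2 in_box_complex_iff)
    hence Sl: "S \<in> lmeasurable" by (simp add: lmeasurable_box)
    have RS: "R ` S = T -` ((\<lambda>z. w * z) -` box l u)"
    proof (intro set_eqI iffI)
      fix v assume "v \<in> R ` S"
      then obtain x where x: "v = R x" "x \<in> S" by blast
      thus "v \<in> T -` ((\<lambda>z. w * z) -` box l u)"
        using ww by (simp add: TR S_def mult.assoc[symmetric])
    next
      fix x assume "x \<in> T -` ((\<lambda>z. w * z) -` box l u)"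
      hence x: "w * T x \<in> box l u" by simp
      define y :: "real^2" where "y = (\<chi> i. if i = 1 then Re (w * T x) else Im (w * T x))"
      have Ty: "T y = w * T x" by (simp add: y_def T_def complex_eq_iff)
      have "T (R y) = cnj w * w * T x" by (simp add: TR Ty mult.assoc)
      also have "cnj w * w = 1" using ww by (simp add: mult.commute)
      finally have "T (R y) = T x" by simp
      hence "R y = x" by (simp add: T_def vec_eq_iff forall_2)
      moreover have "y \<in> S" using x by (simp add: S_def Ty)
      ultimately show "x \<in> R ` S" by blast
    qed
    have m[measurable]: "(\<lambda>z. w * z) \<in> borel_measurable borel" by measurable
    have pb: "(\<lambda>z. w * z) -` box l u \<in> sets borel"
      using measurable_sets[OF m bm] by simp
    have RSb: "R ` S \<in> sets borel" unfolding RS using measurable_sets[OF T_meas pb] by simp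
    have "emeasure (distr lborel borel (\<lambda>z. w * z)) (box l u) = emeasure lborel ((\<lambda>z. w * z) -` box l u)"
      by (simp add: emeasure_distr)
    also have "\<dots> = emeasure lborel (R ` S)"
      using pb by (subst lborel_complex_eq_distr) (simp add: emeasure_distr T_def[symmetric] RS)
    also have "\<dots> = emeasure lebesgue (R ` S)" using RSb by (simp add: emeasure_completion)
    also have "\<dots> = emeasure lebesgue S"
      using measure_orthogonal_image[OF orth Sl] measurable_orthogonal_image[OF orth Sl] Sl
      by (simp add: emeasure_eq_measure2 fmeasurableD2)
    also have "\<dots> = emeasure lborel S" using Sb by (simp add: emeasure_completion)
    also have "\<dots> = emeasure (lborel :: complex measure) (box l u)"
      by (subst lborel_complex_eq_distr) (simp add: emeasure_distr T_def[symmetric] S_def)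
    also have "\<dots> = (\<Prod>b\<in>Basis. (u - l) \<bullet> b)" using le by (rule emeasure_lborel_box)
    finally show "emeasure (distr lborel borel (\<lambda>z. w * z)) (box l u) = (\<Prod>b\<in>Basis. (u - l) \<bullet> b)" .
  qed auto
  hence "emeasure lborel A = emeasure (distr lborel borel (\<lambda>z. w * z)) A" by simp
  also have "\<dots> = emeasure lborel ((\<lambda>z. w * z) -` A)"
    using A by (simp add: emeasure_distr)
  finally show ?thesis by simp
qed

lemma prod_Basis_vec:
  fixes f :: "'a::euclidean_space ^ 'n \<Rightarrow> 'b::comm_monoid_mult"
  shows "(\<Prod>b\<in>Basis. f b) = (\<Prod>i\<in>UNIV. \<Prod>b\<in>Basis. f (axis i b))"
proof -
  have inj: "inj_on (\<lambda>p. axis (fst p) (snd p)) ((UNIV::'n set) \<times> (Basis::'a set))"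
    by (auto simp: inj_on_def axis_eq_axis nonzero_Basis)
  have B: "(Basis :: ('a^'n) set) = (\<lambda>p. axis (fst p) (snd p)) ` (UNIV \<times> Basis)"
    unfolding Basis_vec_def by (force simp: image_iff)
  have "(\<Prod>b\<in>Basis. f b) = (\<Prod>p\<in>UNIV \<times> Basis. f (axis (fst p) (snd p)))"
    using prod.reindex[OF inj, of f] unfolding B[symmetric] o_def .
  also have "\<dots> = (\<Prod>i\<in>UNIV. \<Prod>b\<in>Basis. f (axis i b))"
    by (simp add: prod.cartesian_product split_def)
  finally show ?thesis .
qed

text \<open>Lebesgue measure and the image of the product measure under \<open>V\<close> agree on
  boxes, hence everywhere; the product formula thereby extends from boxes to products of arbitrary
  Borel sets.\<close>

lemma emeasure_lborel_vec_prod: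
  fixes A :: "'n::finite \<Rightarrow> complex set"
  assumes A: "\<And>i. A i \<in> sets borel"
  shows "emeasure lborel {z :: complex ^ 'n. \<forall>i. z $ i \<in> A i} = (\<Prod>i\<in>UNIV. emeasure lborel (A i))"
proof -
  interpret product_sigma_finite "\<lambda>_::'n. lborel :: complex measure" ..
  let ?P = "Pi\<^sub>M (UNIV::'n set) (\<lambda>_. lborel :: complex measure)"
  define V where "V = (\<lambda>f::'n \<Rightarrow> complex. (\<chi> i. f i))"
  have V_eq: "V = (\<lambda>f. \<Sum>i\<in>UNIV. \<Sum>b\<in>Basis. (f i \<bullet> b) *\<^sub>R axis i b)"
  proof (intro ext vec_eq_iff[THEN iffD2] allI)
    fix f :: "'n \<Rightarrow> complex" and k
    have "(\<Sum>i\<in>UNIV. \<Sum>b\<in>Basis. (f i \<bullet> b) *\<^sub>R axis i b) $ k = (\<Sum>i\<in>UNIV. if k = i then f i else 0)"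
      unfolding sum_component
    proof (rule sum.cong)
      fix i
      show "(\<Sum>b\<in>Basis. ((f i \<bullet> b) *\<^sub>R axis i b) $ k) = (if k = i then f i else 0)"
        using euclidean_representation[of "f i"] by (simp add: axis_def)
    qed auto
    thus "V f $ k = (\<Sum>i\<in>UNIV. \<Sum>b\<in>Basis. (f i \<bullet> b) *\<^sub>R axis i b) $ k"
      by (simp add: V_def)
  qed
  have Vm [measurable]: "V \<in> borel_measurable ?P"
    unfolding V_eq by measurable
  have eq: "(lborel :: (complex^'n) measure) = distr ?P borel V"
  proof (rule lborel_eqI)
    fix l u :: "complex^'n"
    assume le: "\<And>b. b \<in> Basis \<Longrightarrow> l \<bullet> b \<le> u \<bullet> b"
    have le': "l $ i \<bullet> b \<le> u $ i \<bullet> b" if "b \<in> Basis" for i b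
      using le[of "axis i b"] that by (auto simp: Basis_vec_def inner_axis)
    have "V -` box l u \<inter> space ?P = Pi\<^sub>E UNIV (\<lambda>i. box (l $ i) (u $ i))"
      by (auto simp: V_def mem_box Basis_vec_def inner_axis space_PiM PiE_def Pi_def)
    hence "emeasure (distr ?P borel V) (box l u) = emeasure ?P (Pi\<^sub>E UNIV (\<lambda>i. box (l $ i) (u $ i)))"
      by (simp add: emeasure_distr)
    also have "\<dots> = (\<Prod>i\<in>UNIV. emeasure lborel (box (l $ i) (u $ i)))"
      by (rule emeasure_PiM) auto
    also have "\<dots> = (\<Prod>i\<in>UNIV. ennreal (\<Prod>b\<in>Basis. (u $ i - l $ i) \<bullet> b))"
      using le' by (intro prod.cong refl emeasure_lborel_box) auto
    also have "\<dots> = ennreal (\<Prod>i\<in>UNIV. (\<Prod>b\<in>Basis. (u $ i - l $ i) \<bullet> b))"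
      using le' by (intro prod_ennreal prod_nonneg) (auto simp: inner_diff_left)
    also have "\<dots> = ennreal (\<Prod>b\<in>Basis. (u - l) \<bullet> b)"
      by (subst prod_Basis_vec) (simp add: inner_axis)
    finally show "emeasure (distr ?P borel V) (box l u) = (\<Prod>b\<in>Basis. (u - l) \<bullet> b)" .
  qed auto
  have Am: "{z :: complex ^ 'n. \<forall>i. z $ i \<in> A i} \<in> sets borel"
  proof -
    have "{z :: complex ^ 'n. \<forall>i. z $ i \<in> A i} = (\<Inter>i\<in>UNIV. (\<lambda>z. z $ i) -` A i \<inter> space borel)" by auto
    also have "\<dots> \<in> sets borel"
      using A by (intro sets.finite_INT measurable_sets[of _ borel borel] borel_measurable_continuous_onI) (auto intro!: continuous_intros)
    finally show ?thesis .
  qed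
  have "V -` {z. \<forall>i. z $ i \<in> A i} \<inter> space ?P = Pi\<^sub>E UNIV A"
    by (auto simp: V_def space_PiM PiE_def Pi_def)
  hence "emeasure (distr ?P borel V) {z. \<forall>i. z $ i \<in> A i} = emeasure ?P (Pi\<^sub>E UNIV A)"
    using Am by (simp add: emeasure_distr)
  also have "\<dots> = (\<Prod>i\<in>UNIV. emeasure lborel (A i))"
    using A by (intro emeasure_PiM) auto
  finally show ?thesis using eq by simp
qed

section \<open>Replacing a single coordinate\<close>

definition upd :: "'a ^ 'n \<Rightarrow> 'n \<Rightarrow> 'a \<Rightarrow> 'a ^ 'n" where
  "upd z j w = (\<chi> i. if i = j then w else z $ i)"

lemma upd_nth: "upd z j w $ i = (if i = j then w else z $ i)"
  by (simp add: upd_def)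

lemma upd_same [simp]: "upd z j w $ j = w"
  by (simp add: upd_def)

lemma upd_other [simp]: "i \<noteq> j \<Longrightarrow> upd z j w $ i = z $ i"
  by (simp add: upd_def)

lemma upd_upd [simp]: "upd (upd z j v) j w = upd z j w"
  by (simp add: upd_def vec_eq_iff)

lemma upd_triv [simp]: "upd z j (z $ j) = z"
  by (simp add: upd_def vec_eq_iff)

lemma upd_swap: "i \<noteq> j \<Longrightarrow> upd (upd z i v) j w = upd (upd z j w) i v"
  by (auto simp: upd_def vec_eq_iff)

lemma continuous_on_upd [continuous_intros]:
  fixes f :: "'b::topological_space \<Rightarrow> 'a::topological_space ^ 'n"
  assumes "continuous_on S f" "continuous_on S g"
  shows "continuous_on S (\<lambda>x. upd (f x) j (g x))"
  unfolding upd_def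
proof (rule continuous_on_vec_lambda)
  fix i show "continuous_on S (\<lambda>x. if i = j then g x else f x $ i)"
    using assms by (cases "i = j") (auto intro!: continuous_intros)
qed

text \<open>The preimage of a box is again a product, but its j-th factor is a rotated rectangle;
  this is why the product formula is needed for general Borel factors.\<close>

lemma lborel_rotate:
  fixes w :: complex and j :: "'n::finite"
  assumes w: "norm w = 1"
  shows "distr lborel borel (\<lambda>z::complex^'n. upd z j (w * z $ j)) = lborel"
proof (rule lborel_eqI[symmetric])
  let ?R = "\<lambda>z::complex^'n. upd z j (w * z $ j)"
  have R[measurable]: "?R \<in> borel_measurable borel"
    by (intro borel_measurable_continuous_onI continuous_intros)
  fix l u :: "complex^'n"
  assume le: "\<And>b. b \<in> Basis \<Longrightarrow> l \<bullet> b \<le> u \<bullet> b"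
  define A where "A = (\<lambda>i. if i = j then (\<lambda>z. w * z) -` box (l $ i) (u $ i) else box (l $ i) (u $ i))"
  have m: "(\<lambda>z. w * z) \<in> borel_measurable borel" by measurable
  have A: "A i \<in> sets borel" for i
    unfolding A_def using measurable_sets[OF m, of "box (l $ i) (u $ i)"] by auto
  have box_eq: "box l u = {z. \<forall>i. z $ i \<in> box (l $ i) (u $ i)}"
    by (auto simp: mem_box Basis_vec_def inner_axis)
  have "?R -` box l u = {z. \<forall>i. z $ i \<in> A i}"
    by (auto simp: box_eq A_def upd_nth split: if_splits)
  hence "emeasure (distr lborel borel ?R) (box l u) = emeasure lborel {z. \<forall>i. z $ i \<in> A i}"
    by (simp add: emeasure_distr)
  also have "\<dots> = (\<Prod>i\<in>UNIV. emeasure lborel (A i))" using A by (rule emeasure_lborel_vec_prod)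
  also have "\<dots> = (\<Prod>i\<in>UNIV. emeasure lborel (box (l $ i) (u $ i)))"
    by (rule prod.cong) (auto simp: A_def lborel_rotate_complex[OF w])
  also have "\<dots> = emeasure lborel (box l u)"
    unfolding box_eq by (rule emeasure_lborel_vec_prod[symmetric]) auto
  also have "\<dots> = (\<Prod>b\<in>Basis. (u - l) \<bullet> b)" using le by (rule emeasure_lborel_box)
  finally show "emeasure (distr lborel borel ?R) (box l u) = (\<Prod>b\<in>Basis. (u - l) \<bullet> b)" .
qed auto

subsection \<open>Square integrable functions\<close>

lemma borel_measurable_cnj [measurable (raw)]:
  "f \<in> borel_measurable M \<Longrightarrow> (\<lambda>x. cnj (f x)) \<in> borel_measurable M"
  by (rule borel_measurable_continuous_on[where f = cnj]) (auto intro: continuous_intros)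

lemma L2_spaceI:
  "f \<in> borel_measurable (lebesgue_on S) \<Longrightarrow> integrable (lebesgue_on S) (\<lambda>z. (norm (f z))\<^sup>2) \<Longrightarrow> f \<in> L2_space S"
  by (simp add: L2_space_def)

lemma L2_meas [measurable_dest]: "f \<in> L2_space S \<Longrightarrow> f \<in> borel_measurable (lebesgue_on S)"
  by (simp add: L2_space_def)

lemma L2_integrable: "f \<in> L2_space S \<Longrightarrow> integrable (lebesgue_on S) (\<lambda>z. (norm (f z))\<^sup>2)"
  by (simp add: L2_space_def)

lemma L2_dominated:
  assumes "g \<in> L2_space S" "f \<in> borel_measurable (lebesgue_on S)" "\<And>z. z \<in> S \<Longrightarrow> norm (f z) \<le> C * norm (g z)"
  shows "f \<in> L2_space S"
proof (rule L2_spaceI)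
  note [measurable] = assms(2)
  show "integrable (lebesgue_on S) (\<lambda>z. (norm (f z))\<^sup>2)"
  proof (rule Bochner_Integration.integrable_bound)
    show "integrable (lebesgue_on S) (\<lambda>z. C\<^sup>2 * (norm (g z))\<^sup>2)"
      using L2_integrable[OF assms(1)] by simp
    show "AE z in lebesgue_on S. norm ((norm (f z))\<^sup>2) \<le> norm (C\<^sup>2 * (norm (g z))\<^sup>2)"
      using assms(3) by (intro AE_I2) (auto simp: space_restrict_space power_mult_distrib[symmetric] intro!: power_mono)
  qed measurable
qed fact

lemma L2_inner_integrable:
  assumes [measurable]: "f \<in> L2_space S" "g \<in> L2_space S"
  shows "integrable (lebesgue_on S) (\<lambda>z. f z * cnj (g z))"
proof (rule Bochner_Integration.integrable_bound)
  show "integrable (lebesgue_on S) (\<lambda>z. (norm (f z))\<^sup>2 + (norm (g z))\<^sup>2)"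
    using assms by (intro Bochner_Integration.integrable_add L2_integrable)
  show "AE z in lebesgue_on S. norm (f z * cnj (g z)) \<le> norm ((norm (f z))\<^sup>2 + (norm (g z))\<^sup>2)"
  proof (intro AE_I2)
    fix z
    have "2 * (norm (f z) * norm (g z)) \<le> (norm (f z))\<^sup>2 + (norm (g z))\<^sup>2"
      using sum_squares_bound[of "norm (f z)" "norm (g z)"] by (simp add: mult_ac)
    moreover have "0 \<le> norm (f z) * norm (g z)" by simp
    ultimately show "norm (f z * cnj (g z)) \<le> norm ((norm (f z))\<^sup>2 + (norm (g z))\<^sup>2)"
      unfolding norm_mult complex_mod_cnj real_norm_def by linarith
  qed
  show "(\<lambda>z. f z * cnj (g z)) \<in> borel_measurable (lebesgue_on S)"
    using assms by measurable
qed

lemma L2_add: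
  assumes "f \<in> L2_space S" "g \<in> L2_space S"
  shows "(\<lambda>z. f z + g z) \<in> L2_space S"
proof (rule L2_spaceI)
  note [measurable] = L2_meas[OF assms(1)] L2_meas[OF assms(2)]
  show "integrable (lebesgue_on S) (\<lambda>z. (norm (f z + g z))\<^sup>2)"
  proof (rule Bochner_Integration.integrable_bound)
    show "integrable (lebesgue_on S) (\<lambda>z. 2 * (norm (f z))\<^sup>2 + 2 * (norm (g z))\<^sup>2)"
      using assms by (intro Bochner_Integration.integrable_add integrable_mult_right L2_integrable)
    show "AE z in lebesgue_on S. norm ((norm (f z + g z))\<^sup>2) \<le> norm (2 * (norm (f z))\<^sup>2 + 2 * (norm (g z))\<^sup>2)"
    proof (intro AE_I2)
      fix z
      have "(norm (f z + g z))\<^sup>2 \<le> (norm (f z) + norm (g z))\<^sup>2"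
        by (intro power_mono norm_triangle_ineq) auto
      also have "\<dots> \<le> 2 * (norm (f z))\<^sup>2 + 2 * (norm (g z))\<^sup>2"
        using sum_squares_bound[of "norm (f z)" "norm (g z)"] by (simp add: power2_sum)
      finally show "norm ((norm (f z + g z))\<^sup>2) \<le> norm (2 * (norm (f z))\<^sup>2 + 2 * (norm (g z))\<^sup>2)"
        by simp
    qed
  qed measurable
  show "(\<lambda>z. f z + g z) \<in> borel_measurable (lebesgue_on S)" by measurable
qed

section \<open>Bounded symbols\<close>

text \<open>Stands in for L-infinity, with a bound at every point instead of almost
  everywhere.\<close>

definition bdd_symbol :: "(complex ^ 'n) set \<Rightarrow> (complex ^ 'n \<Rightarrow> complex) \<Rightarrow> bool" where
  "bdd_symbol S \<phi> \<longleftrightarrow> \<phi> \<in> borel_measurable (lebesgue_on S) \<and> (\<exists>C. \<forall>z\<in>S. norm (\<phi> z) \<le> C)"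

lemma L2_mult:
  assumes "bdd_symbol S \<phi>" "f \<in> L2_space S"
  shows "(\<lambda>z. \<phi> z * f z) \<in> L2_space S"
proof -
  from assms obtain C where C: "\<And>z. z \<in> S \<Longrightarrow> norm (\<phi> z) \<le> C" by (auto simp: bdd_symbol_def)
  have [measurable]: "\<phi> \<in> borel_measurable (lebesgue_on S)" using assms by (auto simp: bdd_symbol_def)
  note [measurable] = L2_meas[OF assms(2)]
  show ?thesis
    by (rule L2_dominated[OF assms(2), where C = C]) (auto simp: norm_mult intro!: mult_right_mono C)
qed

lemma bdd_symbol_const: "bdd_symbol S (\<lambda>_. c)"
  by (auto simp: bdd_symbol_def)

lemma L2_scale: "f \<in> L2_space S \<Longrightarrow> (\<lambda>z. c * f z) \<in> L2_space S"
  by (rule L2_mult[OF bdd_symbol_const])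

lemma L2_zero: "(\<lambda>_. 0) \<in> L2_space S"
  by (rule L2_spaceI) auto

lemma L2_diff:
  assumes "f \<in> L2_space S" "g \<in> L2_space S"
  shows "(\<lambda>z. f z - g z) \<in> L2_space S"
  using L2_add[OF assms(1) L2_scale[OF assms(2), of "-1"]] by simp

lemma L2_sum:
  assumes "\<And>i. i \<in> I \<Longrightarrow> f i \<in> L2_space S"
  shows "(\<lambda>z. \<Sum>i\<in>I. f i z) \<in> L2_space S"
  using assms by (induction I rule: infinite_finite_induct) (auto intro: L2_zero L2_add)

lemma bdd_symbol_add:
  assumes "bdd_symbol S \<phi>" "bdd_symbol S \<psi>" shows "bdd_symbol S (\<lambda>z. \<phi> z + \<psi> z)"
proof -
  from assms obtain A B where "\<forall>z\<in>S. norm (\<phi> z) \<le> A" "\<forall>z\<in>S. norm (\<psi> z) \<le> B"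
    by (auto simp: bdd_symbol_def)
  hence "\<forall>z\<in>S. norm (\<phi> z + \<psi> z) \<le> A + B" by (meson add_mono norm_triangle_mono)
  thus ?thesis using assms by (auto simp: bdd_symbol_def)
qed

lemma bdd_symbol_mult:
  assumes "bdd_symbol S \<phi>" "bdd_symbol S \<psi>" shows "bdd_symbol S (\<lambda>z. \<phi> z * \<psi> z)"
proof -
  from assms obtain A B where "\<forall>z\<in>S. norm (\<phi> z) \<le> A" "\<forall>z\<in>S. norm (\<psi> z) \<le> B"
    by (auto simp: bdd_symbol_def)
  hence "\<forall>z\<in>S. norm (\<phi> z * \<psi> z) \<le> A * B"
    by (auto simp: norm_mult intro!: mult_mono intro: order_trans[OF norm_ge_zero])
  thus ?thesis using assms by (auto simp: bdd_symbol_def)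
qed

lemma bdd_symbol_diff:
  assumes "bdd_symbol S \<phi>" "bdd_symbol S \<psi>" shows "bdd_symbol S (\<lambda>z. \<phi> z - \<psi> z)"
  using bdd_symbol_add[OF assms(1) bdd_symbol_mult[OF bdd_symbol_const[of S "-1"] assms(2)]] by simp

lemma bdd_symbol_cnj: "bdd_symbol S \<phi> \<Longrightarrow> bdd_symbol S (\<lambda>z. cnj (\<phi> z))"
  by (auto simp: bdd_symbol_def)

section \<open>Inner product and norm\<close>

lemma L2_inner_add_left:
  "f \<in> L2_space S \<Longrightarrow> g \<in> L2_space S \<Longrightarrow> h \<in> L2_space S \<Longrightarrow>
   L2_inner S (\<lambda>z. f z + g z) h = L2_inner S f h + L2_inner S g h"
  unfolding L2_inner_def distrib_right
  by (intro Bochner_Integration.integral_add L2_inner_integrable)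

lemma L2_inner_scale_left:
  "L2_inner S (\<lambda>z. c * f z) h = c * L2_inner S f h"
  unfolding L2_inner_def mult.assoc by simp

lemma L2_inner_diff_left:
  "f \<in> L2_space S \<Longrightarrow> g \<in> L2_space S \<Longrightarrow> h \<in> L2_space S \<Longrightarrow>
   L2_inner S (\<lambda>z. f z - g z) h = L2_inner S f h - L2_inner S g h"
  unfolding L2_inner_def left_diff_distrib
  by (intro Bochner_Integration.integral_diff L2_inner_integrable)

lemma L2_inner_cnj: "L2_inner S g f = cnj (L2_inner S f g)"
  unfolding L2_inner_def by (subst Bochner_Integration.integral_cnj[symmetric]) (simp add: mult.commute)

lemma L2_inner_add_right:
  "f \<in> L2_space S \<Longrightarrow> g \<in> L2_space S \<Longrightarrow> h \<in> L2_space S \<Longrightarrow>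
   L2_inner S h (\<lambda>z. f z + g z) = L2_inner S h f + L2_inner S h g"
  by (simp add: L2_inner_cnj[of S h] L2_inner_add_left)

lemma L2_inner_diff_right:
  "f \<in> L2_space S \<Longrightarrow> g \<in> L2_space S \<Longrightarrow> h \<in> L2_space S \<Longrightarrow>
   L2_inner S h (\<lambda>z. f z - g z) = L2_inner S h f - L2_inner S h g"
  by (simp add: L2_inner_cnj[of S h] L2_inner_diff_left)

lemma L2_inner_scale_right:
  "L2_inner S h (\<lambda>z. c * f z) = cnj c * L2_inner S h f"
  by (simp add: L2_inner_cnj[of S h] L2_inner_scale_left)

lemma L2_inner_mult: "L2_inner S (\<lambda>z. \<phi> z * f z) g = L2_inner S f (\<lambda>z. cnj (\<phi> z) * g z)"
  unfolding L2_inner_def by (simp add: mult_ac)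

lemma L2_norm_nonneg [simp]: "0 \<le> L2_norm S f"
  by (simp add: L2_norm_def integral_nonneg_AE)

lemma L2_norm_sq: "(L2_norm S f)\<^sup>2 = (LINT z|lebesgue_on S. (norm (f z))\<^sup>2)"
  by (simp add: L2_norm_def integral_nonneg_AE)

lemma L2_inner_self: "L2_inner S f f = of_real ((L2_norm S f)\<^sup>2)"
  unfolding L2_norm_sq L2_inner_def by (simp add: complex_norm_square[symmetric] flip: of_real_power)

lemma L2_inner_cong:
  "(\<And>z. z \<in> S \<Longrightarrow> f z = f' z) \<Longrightarrow> (\<And>z. z \<in> S \<Longrightarrow> g z = g' z) \<Longrightarrow> L2_inner S f g = L2_inner S f' g'"
  unfolding L2_inner_def by (intro Bochner_Integration.integral_cong) (auto simp: space_restrict_space)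

lemma L2_norm_cong:
  "(\<And>z. z \<in> S \<Longrightarrow> norm (f z) = norm (g z)) \<Longrightarrow> L2_norm S f = L2_norm S g"
  unfolding L2_norm_def
  by (intro arg_cong[where f = sqrt] Bochner_Integration.integral_cong) (auto simp: space_restrict_space)

lemma L2_space_cong:
  assumes "\<And>z. z \<in> S \<Longrightarrow> f z = g z"
  shows "f \<in> L2_space S \<longleftrightarrow> g \<in> L2_space S"
proof -
  have "f \<in> borel_measurable (lebesgue_on S) \<longleftrightarrow> g \<in> borel_measurable (lebesgue_on S)"
    by (rule measurable_cong) (auto simp: space_restrict_space assms)
  moreover have "integrable (lebesgue_on S) (\<lambda>z. (norm (f z))\<^sup>2) \<longleftrightarrow> integrable (lebesgue_on S) (\<lambda>z. (norm (g z))\<^sup>2)"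
    by (rule Bochner_Integration.integrable_cong) (auto simp: space_restrict_space assms)
  ultimately show ?thesis by (simp add: L2_space_def)
qed

lemma L2_norm_zero [simp]: "L2_norm S (\<lambda>_. 0) = 0"
  by (simp add: L2_norm_def)

lemma L2_inner_zero_left [simp]: "L2_inner S (\<lambda>_. 0) h = 0"
  by (simp add: L2_inner_def)

lemma L2_norm_scale: "L2_norm S (\<lambda>z. c * f z) = norm c * L2_norm S f"
  unfolding L2_norm_def by (simp add: norm_mult power_mult_distrib real_sqrt_mult)

lemma L2_norm_mono:
  assumes "g \<in> L2_space S" "f \<in> L2_space S" "\<And>z. z \<in> S \<Longrightarrow> norm (f z) \<le> norm (g z)"
  shows "L2_norm S f \<le> L2_norm S g"
  unfolding L2_norm_def
  by (intro real_sqrt_le_mono integral_mono_AE L2_integrable assms AE_I2)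
     (auto simp: space_restrict_space intro!: power_mono assms)

lemma L2_norm_mult_le:
  assumes "bdd_symbol S \<phi>" "f \<in> L2_space S" "\<And>z. z \<in> S \<Longrightarrow> norm (\<phi> z) \<le> C" "0 \<le> C"
  shows "L2_norm S (\<lambda>z. \<phi> z * f z) \<le> C * L2_norm S f"
proof -
  have "L2_norm S (\<lambda>z. \<phi> z * f z) \<le> L2_norm S (\<lambda>z. of_real C * f z)"
    using assms(3,4) by (intro L2_norm_mono L2_scale L2_mult assms(1,2)) (auto simp: norm_mult intro!: mult_right_mono)
  thus ?thesis using assms(4) by (simp add: L2_norm_scale)
qed

text \<open>Integrating 2ab <= t a^2 + b^2/t bounds the inner product for every t > 0, and t is then
  optimised. A function of norm zero need not be the zero function here, so the degenerate cases are
  treated by letting t grow or shrink.\<close>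

lemma L2_cauchy_schwarz:
  assumes f: "f \<in> L2_space S" and g: "g \<in> L2_space S"
  shows "norm (L2_inner S f g) \<le> L2_norm S f * L2_norm S g"
proof -
  let ?a = "L2_norm S f" and ?b = "L2_norm S g"
  have key: "norm (L2_inner S f g) \<le> (t * ?a\<^sup>2 + ?b\<^sup>2 / t) / 2" if t: "t > 0" for t :: real
  proof -
    have "norm (L2_inner S f g) \<le> (LINT z|lebesgue_on S. norm (f z * cnj (g z)))"
      unfolding L2_inner_def by (rule integral_norm_bound)
    also have "\<dots> \<le> (LINT z|lebesgue_on S. (t * (norm (f z))\<^sup>2 + (norm (g z))\<^sup>2 / t) / 2)"
    proof (intro integral_mono_AE AE_I2)
      show "integrable (lebesgue_on S) (\<lambda>z. norm (f z * cnj (g z)))"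
        using L2_inner_integrable[OF f g] by (rule integrable_norm)
      show "integrable (lebesgue_on S) (\<lambda>z. (t * (norm (f z))\<^sup>2 + (norm (g z))\<^sup>2 / t) / 2)"
        using f g by (intro integrable_divide Bochner_Integration.integrable_add integrable_mult_right L2_integrable)
      fix z
      have "2 * (sqrt t * norm (f z)) * (norm (g z) / sqrt t) \<le> (sqrt t * norm (f z))\<^sup>2 + (norm (g z) / sqrt t)\<^sup>2"
        by (rule sum_squares_bound)
      thus "norm (f z * cnj (g z)) \<le> (t * (norm (f z))\<^sup>2 + (norm (g z))\<^sup>2 / t) / 2"
        using t by (simp add: norm_mult power_mult_distrib power_divide)
    qed
    also have "\<dots> = (t * ?a\<^sup>2 + ?b\<^sup>2 / t) / 2"
      unfolding L2_norm_sq using f g by (simp add: L2_integrable)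
    finally show ?thesis .
  qed
  consider "?a > 0 \<and> ?b > 0" | "?a = 0" | "?b = 0"
    using L2_norm_nonneg[of S f] L2_norm_nonneg[of S g] by linarith
  thus ?thesis
  proof cases
    case 1
    \<comment> \<open>The minimiser of t a^2 + b^2/t.\<close>
    thus ?thesis using key[of "?b / ?a"] by (simp add: power2_eq_square field_simps)
  next
    case 2
    have "norm (L2_inner S f g) \<le> e" if "e > 0" for e
    proof (cases "?b = 0")
      case True thus ?thesis using key[of 1] 2 that by simp
    next
      case False
      hence "?b > 0" using L2_norm_nonneg[of S g] by linarith
      \<comment> \<open>Only b^2/(2t) is left when the first norm vanishes, and this t makes it
        equal to \<open>e\<close>.\<close>
      thus ?thesis using key[of "?b\<^sup>2 / (2 * e)"] 2 that by (simp add: field_simps)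
    qed
    hence "norm (L2_inner S f g) \<le> 0" by (rule field_le_epsilon[of _ 0, simplified])
    thus ?thesis using 2 by simp
  next
    case 3
    have "norm (L2_inner S f g) \<le> e" if "e > 0" for e
    proof (cases "?a = 0")
      case True thus ?thesis using key[of 1] 3 that by simp
    next
      case False
      hence "?a > 0" using L2_norm_nonneg[of S f] by linarith
      thus ?thesis using key[of "2 * e / ?a\<^sup>2"] 3 that by (simp add: field_simps)
    qed
    hence "norm (L2_inner S f g) \<le> 0" by (rule field_le_epsilon[of _ 0, simplified])
    thus ?thesis using 3 by simp
  qed
qed

lemma L2_norm_sq_add:
  assumes f: "f \<in> L2_space S" and g: "g \<in> L2_space S"
  shows "(L2_norm S (\<lambda>z. f z + g z))\<^sup>2 = (L2_norm S f)\<^sup>2 + 2 * Re (L2_inner S f g) + (L2_norm S g)\<^sup>2"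
proof -
  have "complex_of_real ((L2_norm S (\<lambda>z. f z + g z))\<^sup>2)
      = L2_inner S (\<lambda>z. f z + g z) (\<lambda>z. f z + g z)" by (simp add: L2_inner_self)
  also have "\<dots> = L2_inner S f f + (L2_inner S f g + cnj (L2_inner S f g)) + L2_inner S g g"
    using f g by (simp add: L2_inner_add_left L2_inner_add_right L2_add L2_inner_cnj[of S g f])
  also have "\<dots> = of_real ((L2_norm S f)\<^sup>2 + 2 * Re (L2_inner S f g) + (L2_norm S g)\<^sup>2)"
    by (simp add: L2_inner_self complex_add_cnj)
  finally show ?thesis using of_real_eq_iff by blast
qed

lemma L2_norm_triangle:
  assumes f: "f \<in> L2_space S" and g: "g \<in> L2_space S"
  shows "L2_norm S (\<lambda>z. f z + g z) \<le> L2_norm S f + L2_norm S g"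
proof (rule power2_le_imp_le)
  have "Re (L2_inner S f g) \<le> L2_norm S f * L2_norm S g"
    using L2_cauchy_schwarz[OF f g] complex_Re_le_cmod[of "L2_inner S f g"] by linarith
  thus "(L2_norm S (\<lambda>z. f z + g z))\<^sup>2 \<le> (L2_norm S f + L2_norm S g)\<^sup>2"
    by (simp add: L2_norm_sq_add[OF f g] power2_sum)
qed simp

lemma L2_norm_triangle_diff:
  assumes f: "f \<in> L2_space S" and g: "g \<in> L2_space S"
  shows "L2_norm S (\<lambda>z. f z - g z) \<le> L2_norm S f + L2_norm S g"
  using L2_norm_triangle[OF f L2_scale[OF g, of "-1"]] L2_norm_scale[of S "-1" g] by simp

lemma L2_norm_triangle_sub:
  assumes f: "f \<in> L2_space S" and g: "g \<in> L2_space S"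
  shows "L2_norm S f \<le> L2_norm S g + L2_norm S (\<lambda>z. f z - g z)"
  using L2_norm_triangle[OF g L2_diff[OF f g]] by simp

lemma L2_norm_sum_le:
  assumes "\<And>i. i \<in> I \<Longrightarrow> f i \<in> L2_space S"
  shows "L2_norm S (\<lambda>z. \<Sum>i\<in>I. f i z) \<le> (\<Sum>i\<in>I. L2_norm S (f i))"
  using assms
proof (induction I rule: infinite_finite_induct)
  case (insert i I)
  have "L2_norm S (\<lambda>z. f i z + (\<Sum>i\<in>I. f i z)) \<le> L2_norm S (f i) + L2_norm S (\<lambda>z. \<Sum>i\<in>I. f i z)"
    using insert by (intro L2_norm_triangle L2_sum) auto
  thus ?case using insert by force
qed auto

lemma L2_parallelogram:
  assumes f: "f \<in> L2_space S" and g: "g \<in> L2_space S"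
  shows "(L2_norm S (\<lambda>z. f z + g z))\<^sup>2 + (L2_norm S (\<lambda>z. f z - g z))\<^sup>2 = 2 * (L2_norm S f)\<^sup>2 + 2 * (L2_norm S g)\<^sup>2"
  using L2_norm_sq_add[OF f g] L2_norm_sq_add[OF f L2_scale[OF g, of "-1"]]
  by (simp add: L2_norm_scale[of S "-1" g, simplified] L2_inner_scale_right[of S f "-1" g, simplified])

lemma L2_norm_sq_diff:
  assumes f: "f \<in> L2_space S" and g: "g \<in> L2_space S"
  shows "(L2_norm S (\<lambda>z. f z - g z))\<^sup>2 = (L2_norm S f)\<^sup>2 - 2 * Re (L2_inner S f g) + (L2_norm S g)\<^sup>2"
  using L2_norm_sq_add[OF f L2_scale[OF g, of "-1"]]
  by (simp add: L2_norm_scale[of S "-1" g, simplified] L2_inner_scale_right[of S f "-1" g, simplified])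

subsection \<open>Holomorphic functions on the polydisk\<close>

text \<open>For r < 1 these closed polydisks exhaust the polydisk and take the place of arbitrary
  compact subsets in locally uniform convergence; \<open>cpoly 1\<close> is the closure.\<close>

definition cpoly :: "real \<Rightarrow> (complex ^ 'n) set" where
  "cpoly r = {z. \<forall>i. norm (z $ i) \<le> r}"

lemma open_polydisk: "open (polydisk :: (complex ^ 'n) set)"
proof -
  have "polydisk = (\<Inter>i\<in>UNIV. (\<lambda>z::complex^'n. norm (z $ i)) -` {..<1})"
    by (auto simp: polydisk_def)
  also have "open \<dots>"
    by (intro open_INT open_vimage ballI) (auto intro!: continuous_intros)
  finally show ?thesis .
qed

lemma closed_cpoly: "closed (cpoly r :: (complex ^ 'n) set)"
proof -
  have "cpoly r = (\<Inter>i\<in>UNIV. (\<lambda>z::complex^'n. norm (z $ i)) -` {..r})"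
    by (auto simp: cpoly_def)
  also have "closed \<dots>"
    by (intro closed_INT closed_vimage ballI) (auto intro!: continuous_intros)
  finally show ?thesis .
qed

lemma bounded_cpoly: "bounded (cpoly r :: (complex ^ 'n) set)"
proof (rule boundedI)
  fix z :: "complex ^ 'n" assume "z \<in> cpoly r"
  have "norm z \<le> (\<Sum>i\<in>UNIV. norm (z $ i))" unfolding norm_vec_def by (rule L2_set_le_sum) auto
  also have "\<dots> \<le> (\<Sum>i\<in>(UNIV::'n set). r)" using \<open>z \<in> cpoly r\<close> by (intro sum_mono) (auto simp: cpoly_def)
  finally show "norm z \<le> (\<Sum>i\<in>(UNIV::'n set). r)" .
qed

lemma compact_cpoly: "compact (cpoly r :: (complex ^ 'n) set)"
  using closed_cpoly bounded_cpoly compact_eq_bounded_closed by blast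

lemma cpoly_subset_polydisk: "r < 1 \<Longrightarrow> cpoly r \<subseteq> polydisk"
  by (auto simp: cpoly_def polydisk_def intro: le_less_trans)

lemma cpoly_mono: "r \<le> s \<Longrightarrow> cpoly r \<subseteq> cpoly s"
  by (auto simp: cpoly_def intro: order_trans)

text \<open>Asking for the interior, and not only for membership, lets continuity on each smaller
  polydisk yield continuity at z.\<close>

lemma polydisk_interior_cpoly:
  assumes "z \<in> polydisk"
  obtains r where "0 < r" "r < 1" "z \<in> interior (cpoly r)"
proof -
  let ?m = "Max (range (\<lambda>i. norm (z $ i)))"
  have m: "?m < 1" using assms by (auto simp: polydisk_def)
  have m0: "0 \<le> ?m" by (rule order_trans[OF norm_ge_zero Max_ge[of _ "norm (z $ undefined)"]]) auto
  define r where "r = (?m + 1) / 2"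
  have r: "?m < r" "r < 1" "0 < r" using m m0 by (auto simp: r_def)
  let ?U = "{z :: complex ^ 'a. \<forall>i. norm (z $ i) < r}"
  have "?U = (\<Inter>i\<in>UNIV. (\<lambda>z. norm (z $ i)) -` {..<r})" by auto
  hence "open ?U" by (auto intro!: open_INT open_vimage continuous_intros)
  moreover have "z \<in> ?U"
  proof safe
    fix i have "norm (z $ i) \<le> ?m" by (rule Max_ge) auto
    thus "norm (z $ i) < r" using r by linarith
  qed
  moreover have "?U \<subseteq> cpoly r" by (auto simp: cpoly_def intro: less_imp_le)
  ultimately have "z \<in> interior (cpoly r)" by (meson interior_maximal subsetD)
  with r show ?thesis using that by blast
qed

lemma upd_polydisk: "z \<in> polydisk \<Longrightarrow> norm w < 1 \<Longrightarrow> upd z j w \<in> polydisk"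
  by (auto simp: polydisk_def upd_nth)

lemma upd_cpoly: "z \<in> cpoly r \<Longrightarrow> norm w \<le> r \<Longrightarrow> upd z j w \<in> cpoly r"
  by (auto simp: cpoly_def upd_nth)

lemma polydisk_nth: "z \<in> polydisk \<Longrightarrow> norm (z $ i) < 1"
  by (auto simp: polydisk_def)

lemma closure_polydisk: "closure (polydisk :: (complex ^ 'n) set) = cpoly 1"
proof
  have "polydisk \<subseteq> (cpoly 1 :: (complex ^ 'n) set)" by (auto simp: polydisk_def cpoly_def intro: less_imp_le)
  thus "closure polydisk \<subseteq> (cpoly 1 :: (complex ^ 'n) set)" by (intro closure_minimal closed_cpoly)
  show "cpoly 1 \<subseteq> closure (polydisk :: (complex ^ 'n) set)"
  proof
    fix z :: "complex ^ 'n" assume z: "z \<in> cpoly 1"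
    have lim: "(\<lambda>k. (1 - 1 / real (Suc k)) *\<^sub>R z) \<longlonglongrightarrow> (1 - 0) *\<^sub>R z"
      by (intro tendsto_intros LIMSEQ_Suc lim_1_over_n)
    moreover have "(1 - 1 / real (Suc k)) *\<^sub>R z \<in> polydisk" for k
    proof -
      have "norm (((1 - 1 / real (Suc k)) *\<^sub>R z) $ i) < 1" for i
      proof -
        have "norm (z $ i) \<le> 1" using z by (auto simp: cpoly_def)
        hence "(1 - 1 / real (Suc k)) * norm (z $ i) \<le> (1 - 1 / real (Suc k)) * 1"
          by (intro mult_left_mono) auto
        moreover have "norm (((1 - 1 / real (Suc k)) *\<^sub>R z) $ i) = (1 - 1 / real (Suc k)) * norm (z $ i)"
          by (subst vector_scaleR_component) simp
        moreover have "(1 - 1 / real (Suc k)) * 1 < 1" by simp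
        ultimately show ?thesis by linarith
      qed
      thus ?thesis by (auto simp: polydisk_def)
    qed
    ultimately show "z \<in> closure polydisk" unfolding closure_sequential by (intro exI[of _ "\<lambda>k. (1 - 1 / real (Suc k)) *\<^sub>R z"]) auto
  qed
qed

section \<open>Separate holomorphy\<close>

text \<open>One coordinate at a time, so that one-variable theorems apply directly; joint continuity
  is included because it is stable under locally uniform limits and turns separate into full
  holomorphy.\<close>

definition hol_in :: "'n \<Rightarrow> (complex ^ 'n \<Rightarrow> complex) \<Rightarrow> bool" where
  "hol_in j u \<longleftrightarrow> continuous_on polydisk u \<and> (\<forall>z\<in>polydisk. (\<lambda>w. u (upd z j w)) holomorphic_on ball 0 1)"

definition sephol :: "(complex ^ 'n \<Rightarrow> complex) \<Rightarrow> bool" where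
  "sephol f \<longleftrightarrow> (\<forall>j. hol_in j f)"

lemma hol_inD: "hol_in j u \<Longrightarrow> z \<in> polydisk \<Longrightarrow> (\<lambda>w. u (upd z j w)) holomorphic_on ball 0 1"
  by (simp add: hol_in_def)

lemma hol_in_continuous: "hol_in j u \<Longrightarrow> continuous_on polydisk u"
  by (simp add: hol_in_def)

lemma sephol_continuous: "sephol u \<Longrightarrow> continuous_on polydisk u"
  by (simp add: sephol_def hol_in_def)

lemma hol_in_add: "hol_in j u \<Longrightarrow> hol_in j v \<Longrightarrow> hol_in j (\<lambda>z. u z + v z)"
  by (auto simp: hol_in_def intro!: continuous_intros holomorphic_intros)

lemma hol_in_mult: "hol_in j u \<Longrightarrow> hol_in j v \<Longrightarrow> hol_in j (\<lambda>z. u z * v z)"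
  by (auto simp: hol_in_def intro!: continuous_intros holomorphic_intros)

lemma hol_in_const: "hol_in j (\<lambda>_. c)"
  by (auto simp: hol_in_def)

lemma hol_in_coord: "hol_in j (\<lambda>z. z $ k)"
  by (cases "k = j") (auto simp: hol_in_def upd_nth intro!: continuous_intros holomorphic_intros)

lemma hol_in_sum: "(\<And>k. k \<in> K \<Longrightarrow> hol_in j (u k)) \<Longrightarrow> hol_in j (\<lambda>z. \<Sum>k\<in>K. u k z)"
  by (induction K rule: infinite_finite_induct) (auto intro: hol_in_const hol_in_add)

lemma continuous_on_polydiskI:
  assumes "\<And>r. 0 < r \<Longrightarrow> r < 1 \<Longrightarrow> continuous_on (cpoly r) u"
  shows "continuous_on polydisk u"
proof -
  have "isCont u z" if z: "z \<in> polydisk" for z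
  proof -
    obtain r where r: "0 < r" "r < 1" "z \<in> interior (cpoly r)" using polydisk_interior_cpoly[OF z] .
    thus ?thesis using assms[of r] continuous_on_interior by blast
  qed
  thus ?thesis using continuous_at_imp_continuous_on by blast
qed

lemma hol_in_cong:
  assumes "\<And>z. z \<in> polydisk \<Longrightarrow> u z = v z" shows "hol_in j u \<longleftrightarrow> hol_in j v"
proof -
  have "(\<lambda>w. u (upd z j w)) holomorphic_on ball 0 1 \<longleftrightarrow> (\<lambda>w. v (upd z j w)) holomorphic_on ball 0 1"
    if "z \<in> polydisk" for z
    using that by (intro holomorphic_cong) (auto intro!: assms upd_polydisk)
  thus ?thesis using assms by (auto simp: hol_in_def cong: continuous_on_cong)
qed

text \<open>The Weierstrass theorem on each coordinate disc, once small closed discs are placed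
  inside a single \<open>cpoly s\<close>.\<close>

lemma hol_in_uniform_limit:
  assumes u: "\<And>n. hol_in j (u n)"
    and lim: "\<And>r. 0 < r \<Longrightarrow> r < 1 \<Longrightarrow> uniform_limit (cpoly r) u v sequentially"
  shows "hol_in j v"
  unfolding hol_in_def
proof safe
  show "continuous_on polydisk v"
  proof (rule continuous_on_polydiskI)
    fix r :: real assume r: "0 < r" "r < 1"
    show "continuous_on (cpoly r) v"
      by (intro uniform_limit_theorem[OF _ lim[OF r]] always_eventually allI
            continuous_on_subset[OF hol_in_continuous[OF u] cpoly_subset_polydisk[OF r(2)]]) auto
  qed
  fix z :: "complex ^ 'a" assume z: "z \<in> polydisk"
  show "(\<lambda>w. v (upd z j w)) holomorphic_on ball 0 1"
  proof (rule holomorphic_uniform_sequence[where f = "\<lambda>n w. u n (upd z j w)"])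
    fix x :: complex assume x: "x \<in> ball 0 1"
    obtain r where r: "0 < r" "r < 1" "z \<in> interior (cpoly r)" using polydisk_interior_cpoly[OF z] .
    \<comment> \<open>At least \<open>r\<close>, so that \<open>cpoly s\<close> contains z, and
      larger than the modulus of \<open>x\<close>, so that all replacements near \<open>x\<close>
      stay in the same \<open>cpoly s\<close>.\<close>
    define s where "s = max r ((norm x + 1) / 2)"
    have "norm x < (norm x + 1) / 2" "(norm x + 1) / 2 < 1" using x by auto
    hence s: "0 < s" "s < 1" "norm x < s" using r unfolding s_def by linarith+
    have sub: "cball x (s - norm x) \<subseteq> cball 0 s"
    proof
      fix y assume "y \<in> cball x (s - norm x)"
      thus "y \<in> cball 0 s" using norm_triangle_sub[of y x] by (auto simp: dist_norm norm_minus_commute)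
    qed
    have "z \<in> cpoly r" using r interior_subset by blast
    moreover have "r \<le> s" by (simp add: s_def)
    ultimately have zs: "z \<in> cpoly s" using cpoly_mono by blast
    show "\<exists>d>0. cball x d \<subseteq> ball 0 1 \<and>
       uniform_limit (cball x d) (\<lambda>n w. u n (upd z j w)) (\<lambda>w. v (upd z j w)) sequentially"
    proof (intro exI conjI)
      show "uniform_limit (cball x (s - norm x)) (\<lambda>n w. u n (upd z j w)) (\<lambda>w. v (upd z j w)) sequentially"
      proof (rule uniform_limitI)
        fix e :: real assume "e > 0"
        from uniform_limitD[OF lim[OF s(1,2)] this]
        show "\<forall>\<^sub>F n in sequentially. \<forall>w\<in>cball x (s - norm x). dist (u n (upd z j w)) (v (upd z j w)) < e"
          by eventually_elim (use sub zs upd_cpoly[of z s] in auto)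
      qed
    qed (use s sub in auto)
  qed (use hol_inD[OF u z] in auto)
qed

lemma sephol_uniform_limit:
  assumes "\<And>n. sephol (u n)"
    and "\<And>r. 0 < r \<Longrightarrow> r < 1 \<Longrightarrow> uniform_limit (cpoly r) u v sequentially"
  shows "sephol v"
  using assms hol_in_uniform_limit unfolding sephol_def by blast

section \<open>Continuous and separately holomorphic functions are holomorphic\<close>

text \<open>Parametrised by the displacement, so that \<open>deriv (line f z i) 0\<close> is the
  i-th complex partial derivative at z.\<close>

definition line :: "(complex ^ 'n \<Rightarrow> complex) \<Rightarrow> complex ^ 'n \<Rightarrow> 'n \<Rightarrow> complex \<Rightarrow> complex" where
  "line f z i = (\<lambda>\<zeta>. f (z + axis i \<zeta>))"

lemma upd_eq_plus: 
  fixes z :: "complex ^ 'n"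
  shows "upd z i (z $ i + \<zeta>) = z + axis i \<zeta>"
  by (simp add: vec_eq_iff upd_nth axis_def)

lemma line_holomorphic:
  fixes z :: "complex ^ 'n"
  assumes f: "sephol f" and z: "z \<in> polydisk" and s: "s + norm (z $ i) \<le> 1"
  shows "line f z i holomorphic_on ball 0 s"
proof -
  have "(\<lambda>w. f (upd z i w)) holomorphic_on ball 0 1"
    using f z by (auto simp: sephol_def hol_in_def)
  hence "(\<lambda>w. f (upd z i w)) \<circ> (\<lambda>\<zeta>. z $ i + \<zeta>) holomorphic_on ball 0 s"
  proof (intro holomorphic_on_compose_gen)
    show "(\<lambda>\<zeta>. z $ i + \<zeta>) ` ball 0 s \<subseteq> ball 0 1"
    proof safe
      fix \<zeta> :: complex assume "\<zeta> \<in> ball 0 s"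
      thus "z $ i + \<zeta> \<in> ball 0 1" using s norm_triangle_ineq[of "z $ i" \<zeta>] by auto
    qed
  qed (auto intro!: holomorphic_intros)
  thus ?thesis by (simp add: o_def upd_eq_plus line_def)
qed

lemma norm_axis: "norm (axis i (x::complex)) = norm x"
  by (simp add: norm_axis_1 norm_vec_def L2_set_def axis_def if_distrib[of norm] if_distrib[of "\<lambda>x. x\<^sup>2"] cong: if_cong)

text \<open>One radius serves twice: it bounds the distance from \<open>z0\<close> and leaves room
  for coordinate discs of the same size around every such point.\<close>

lemma cpoly_box_in:
  fixes z0 :: "complex ^ 'n"
  assumes z0: "z0 \<in> polydisk"
  obtains \<rho> where "\<rho> > 0" "\<And>z. norm (z - z0) \<le> 2 * \<rho> \<Longrightarrow> z \<in> polydisk" 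
    "\<And>z i. norm (z - z0) \<le> 2 * \<rho> \<Longrightarrow> norm (z $ i) + 2 * \<rho> \<le> 1"
proof -
  obtain e where e: "e > 0" "cball z0 e \<subseteq> polydisk"
    using open_polydisk z0 open_contains_cball by blast
  obtain r where r: "0 < r" "r < 1" "z0 \<in> interior (cpoly r)" using polydisk_interior_cpoly[OF z0] .
  define \<rho> where "\<rho> = min (e / 2) ((1 - r) / 4)"
  have \<rho>: "\<rho> > 0" using e r by (simp add: \<rho>_def)
  have "z \<in> polydisk \<and> norm (z $ i) + 2 * \<rho> \<le> 1" if "norm (z - z0) \<le> 2 * \<rho>" for z i
  proof
    have "2 * \<rho> \<le> e" by (simp add: \<rho>_def)
    thus "z \<in> polydisk" using that e by (auto simp: dist_norm norm_minus_commute subset_iff)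
    have "norm (z $ i) \<le> norm (z0 $ i) + norm ((z - z0) $ i)"
      using norm_triangle_sub[of "z $ i" "z0 $ i"] by simp
    also have "norm ((z - z0) $ i) \<le> norm (z - z0)" by (rule Finite_Cartesian_Product.norm_nth_le)
    also have "norm (z0 $ i) \<le> r" using r interior_subset by (auto simp: cpoly_def)
    also have "norm (z - z0) \<le> 2 * \<rho>" by fact
    finally have "norm (z $ i) \<le> r + 2 * \<rho>" by simp
    moreover have "\<rho> \<le> (1 - r) / 4" unfolding \<rho>_def by (rule min.cobounded2)
    hence "4 * \<rho> \<le> 1 - r" by (simp add: field_simps)
    ultimately show "norm (z $ i) + 2 * \<rho> \<le> 1" by (simp add: algebra_simps)
  qed
  thus ?thesis using that \<rho> by blast
qed

text \<open>The difference of the two functions on parallel lines is small on a circle of radius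
  \<rho> by uniform continuity; Cauchy's estimate passes this on to the derivatives.\<close>

lemma partial_deriv_continuous:
  assumes f: "sephol f" and z0: "z0 \<in> polydisk" and e: "e > 0"
  shows "\<exists>\<delta>>0. \<forall>z. norm (z - z0) < \<delta> \<longrightarrow> norm (deriv (line f z i) 0 - deriv (line f z0 i) 0) \<le> e"
proof -
  obtain \<rho> where \<rho>: "\<rho> > 0" "\<And>z. norm (z - z0) \<le> 2 * \<rho> \<Longrightarrow> z \<in> polydisk" 
    "\<And>z i. norm (z - z0) \<le> 2 * \<rho> \<Longrightarrow> norm (z $ i) + 2 * \<rho> \<le> 1"
    using cpoly_box_in[OF z0] by blast
  have cont: "continuous_on (cball z0 (2 * \<rho>)) f"
    using sephol_continuous[OF f] by (rule continuous_on_subset) (auto simp: dist_norm norm_minus_commute \<rho>(2))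
  hence "uniformly_continuous_on (cball z0 (2 * \<rho>)) f" by (intro compact_uniformly_continuous) auto
  then obtain d where d: "d > 0" "\<And>x y. x \<in> cball z0 (2 * \<rho>) \<Longrightarrow> y \<in> cball z0 (2 * \<rho>) \<Longrightarrow> dist y x < d \<Longrightarrow> dist (f y) (f x) < e * \<rho>"
    unfolding uniformly_continuous_on_def using e \<rho>(1) by (metis mult_pos_pos)
  show ?thesis
  proof (intro exI conjI allI impI)
    show "min d \<rho> > 0" using d \<rho> by simp
    fix z assume z: "norm (z - z0) < min d \<rho>"
    have hol: "line f y i holomorphic_on ball 0 (2 * \<rho>)" if "norm (y - z0) \<le> 2 * \<rho>" for y
      using \<rho>(2)[OF that] \<rho>(3)[OF that, of i] by (intro line_holomorphic f) auto
    have h1: "line f z i holomorphic_on ball 0 (2 * \<rho>)" using z \<rho>(1) by (intro hol) auto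
    have h2: "line f z0 i holomorphic_on ball 0 (2 * \<rho>)" using \<rho>(1) by (intro hol) auto
    have dd: "deriv (\<lambda>\<zeta>. line f z i \<zeta> - line f z0 i \<zeta>) 0 = deriv (line f z i) 0 - deriv (line f z0 i) 0"
      using h1 h2 \<rho>(1) by (intro deriv_diff) (auto intro: holomorphic_on_imp_differentiable_at)
    have hd: "(\<lambda>\<zeta>. line f z i \<zeta> - line f z0 i \<zeta>) holomorphic_on ball 0 (2 * \<rho>)"
      using h1 h2 by (intro holomorphic_intros)
    have "norm ((deriv ^^ 1) (\<lambda>\<zeta>. line f z i \<zeta> - line f z0 i \<zeta>) 0) \<le> fact 1 * (e * \<rho>) / \<rho> ^ 1"
    proof (rule Cauchy_inequality)
      show "(\<lambda>\<zeta>. line f z i \<zeta> - line f z0 i \<zeta>) holomorphic_on ball 0 \<rho>"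
        using hd \<rho>(1) by (rule_tac holomorphic_on_subset[OF hd]) auto
      have "cball 0 \<rho> \<subseteq> ball (0::complex) (2*\<rho>)" using \<rho>(1) by auto
      thus "continuous_on (cball 0 \<rho>) (\<lambda>\<zeta>. line f z i \<zeta> - line f z0 i \<zeta>)"
        using holomorphic_on_imp_continuous_on[OF hd] continuous_on_subset by blast
      fix x :: complex assume x: "norm (0 - x) = \<rho>"
      have "norm (z + axis i x - z0) \<le> norm (z - z0) + norm (axis i x)" 
        using norm_triangle_ineq[of "z - z0" "axis i x"] by (simp add: algebra_simps)
      hence "z + axis i x \<in> cball z0 (2 * \<rho>)" using z x by (simp add: norm_axis dist_norm norm_minus_commute)
      moreover have "z0 + axis i x \<in> cball z0 (2 * \<rho>)" using x \<rho>(1) by (simp add: norm_axis dist_norm)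
      moreover have "dist (z + axis i x) (z0 + axis i x) < d" using z by (simp add: dist_norm)
      ultimately have "dist (f (z + axis i x)) (f (z0 + axis i x)) < e * \<rho>" using d(2) by blast
      thus "norm (line f z i x - line f z0 i x) \<le> e * \<rho>" by (simp add: line_def dist_norm)
    qed (use \<rho> in auto)
    thus "norm (deriv (line f z i) 0 - deriv (line f z0 i) 0) \<le> e" using \<rho>(1) by (simp add: dd)
  qed
qed

text \<open>Leads from a point to a displaced point by moving only the coordinates in S, so that a
  displacement can be built up one coordinate at a time.\<close>

definition restr :: "'n set \<Rightarrow> complex ^ 'n \<Rightarrow> complex ^ 'n" where
  "restr S v = (\<chi> i. if i \<in> S then v $ i else 0)"

lemma norm_restr_le: "norm (restr S v) \<le> norm v"
  unfolding norm_vec_def by (rule L2_set_mono) (auto simp: restr_def)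

lemma deriv_line_shift:
  assumes "sephol f" "z + axis i \<xi> \<in> polydisk" "z \<in> polydisk" 
  shows "(line f z i has_field_derivative deriv (line f (z + axis i \<xi>) i) 0) (at \<xi>)"
proof -
  have "z + axis i \<xi> = upd z i (z $ i + \<xi>)" by (simp add: upd_eq_plus)
  hence n: "norm ((z + axis i \<xi>) $ i) < 1" using assms polydisk_nth by blast
  have "line f (z + axis i \<xi>) i holomorphic_on ball 0 (1 - norm ((z + axis i \<xi>) $ i))"
    by (rule line_holomorphic[OF assms(1,2)]) simp
  hence "(line f (z + axis i \<xi>) i has_field_derivative deriv (line f (z + axis i \<xi>) i) 0) (at (\<xi> + - \<xi>))"
    using n by (auto intro: holomorphic_derivI[OF _ open_ball])
  hence "((\<lambda>x. line f (z + axis i \<xi>) i (x + - \<xi>)) has_field_derivative deriv (line f (z + axis i \<xi>) i) 0) (at \<xi>)"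
    unfolding DERIV_shift .
  moreover have "axis i \<xi> + axis i (x - \<xi>) = axis i x" for x :: complex
    by (simp add: vec_eq_iff axis_def)
  hence "line f (z + axis i \<xi>) i (x + - \<xi>) = line f z i x" for x
    by (simp add: line_def add.assoc)
  ultimately show ?thesis by simp
qed

text \<open>The classical argument that continuous partial derivatives give differentiability:
  induction over the set of coordinates already moved, with the mean value inequality for each new
  one.\<close>

lemma sephol_has_derivative:
  fixes f :: "complex ^ 'n \<Rightarrow> complex"
  assumes f: "sephol f" and z0: "z0 \<in> polydisk"
  shows "(f has_derivative (\<lambda>v. \<Sum>i\<in>UNIV. deriv (line f z0 i) 0 * v $ i)) (at z0)"
proof -
  let ?d = "\<lambda>i. deriv (line f z0 i) 0"
  have main: "\<forall>e>0. \<exists>\<delta>>0. \<forall>v. norm v < \<delta> \<longrightarrow>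
      norm (f (z0 + restr S v) - f z0 - (\<Sum>i\<in>S. ?d i * v $ i)) \<le> e * norm v" for S :: "'n set"
    using finite[of S]
  proof (induction S rule: finite_induct)
    case empty
    have "restr {} v = 0" for v :: "complex ^ 'n" by (simp add: restr_def vec_eq_iff)
    thus ?case by (auto intro!: exI[of _ 1])
  next
    case (insert i S)
    show ?case
    proof safe
      fix e :: real assume e: "e > 0"
      obtain \<delta>1 where \<delta>1: "\<delta>1 > 0" "\<And>v. norm v < \<delta>1 \<Longrightarrow>
        norm (f (z0 + restr S v) - f z0 - (\<Sum>i\<in>S. ?d i * v $ i)) \<le> e / 2 * norm v"
        using insert.IH e by (meson half_gt_zero)
      obtain \<delta>2 where \<delta>2: "\<delta>2 > 0" "\<And>z. norm (z - z0) < \<delta>2 \<Longrightarrow> norm (deriv (line f z i) 0 - ?d i) \<le> e / 2"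
        using partial_deriv_continuous[OF f z0, of "e/2" i] e by (meson half_gt_zero)
      obtain \<delta>3 where \<delta>3: "\<delta>3 > 0" "ball z0 \<delta>3 \<subseteq> polydisk" using open_polydisk z0 open_contains_ball by blast
      show "\<exists>\<delta>>0. \<forall>v. norm v < \<delta> \<longrightarrow>
          norm (f (z0 + restr (insert i S) v) - f z0 - (\<Sum>i\<in>insert i S. ?d i * v $ i)) \<le> e * norm v"
      proof (intro exI conjI allI impI)
        \<comment> \<open>Halves, because the intermediate points are displaced by at most twice the
          norm of \<open>v\<close>.\<close>
        show "min \<delta>1 (min (\<delta>2/2) (\<delta>3/2)) > 0" using \<delta>1 \<delta>2 \<delta>3 by simp
        fix v :: "complex ^ 'n" assume v: "norm v < min \<delta>1 (min (\<delta>2/2) (\<delta>3/2))"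
        define z where "z = z0 + restr S v"
        have near: "norm (z + axis i \<xi> - z0) < min \<delta>2 \<delta>3" if "norm \<xi> \<le> norm (v $ i)" for \<xi>
        proof -
          have "norm (z + axis i \<xi> - z0) \<le> norm (restr S v) + norm (axis i \<xi>)"
            using norm_triangle_ineq[of "restr S v" "axis i \<xi>"] by (simp add: z_def algebra_simps)
          also have "\<dots> \<le> norm v + norm v"
            using norm_restr_le[of S v] that Finite_Cartesian_Product.norm_nth_le[of v i] by (simp add: norm_axis)
          finally show ?thesis using v by simp
        qed
        have inD: "z + axis i \<xi> \<in> polydisk" if "norm \<xi> \<le> norm (v $ i)" for \<xi>
          using near[OF that] \<delta>3(2) by (auto simp: dist_norm norm_minus_commute subset_iff)
        have ax0: "axis i 0 = (0 :: complex ^ 'n)" by (simp add: vec_eq_iff axis_def)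
        have zD: "z \<in> polydisk" using inD[of 0] by (simp add: ax0)
        \<comment> \<open>Mean value inequality after subtracting the linear part at
          \<open>z0\<close>: the remaining derivative is a difference of partial derivatives at
          nearby points.\<close>
        have "norm ((line f z i (v $ i) - ?d i * v $ i) - (line f z i 0 - ?d i * 0)) \<le> e / 2 * norm (v $ i - 0)"
        proof (rule field_differentiable_bound[where S = "cball 0 (norm (v $ i))" and f' = "\<lambda>\<xi>. deriv (line f (z + axis i \<xi>) i) 0 - ?d i"])
          fix \<xi> :: complex assume "\<xi> \<in> cball 0 (norm (v $ i))"
          hence n: "norm \<xi> \<le> norm (v $ i)" by simp
          show "((\<lambda>\<zeta>. line f z i \<zeta> - ?d i * \<zeta>) has_field_derivative deriv (line f (z + axis i \<xi>) i) 0 - ?d i)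
                 (at \<xi> within cball 0 (norm (v $ i)))"
            by (rule derivative_eq_intros DERIV_subset[OF deriv_line_shift[OF f inD[OF n] zD]] refl | simp)+
          show "norm (deriv (line f (z + axis i \<xi>) i) 0 - ?d i) \<le> e / 2"
            using near[OF n] by (intro \<delta>2) auto
        qed auto
        moreover have "line f z i (v $ i) = f (z0 + restr (insert i S) v)"
        proof -
          have "restr S v + axis i (v $ i) = restr (insert i S) v"
            using insert.hyps by (auto simp: restr_def axis_def vec_eq_iff)
          thus ?thesis by (simp add: line_def z_def add.assoc)
        qed
        moreover have "line f z i 0 = f z" by (simp add: line_def ax0)
        ultimately have 1: "norm (f (z0 + restr (insert i S) v) - f z - ?d i * v $ i) \<le> e / 2 * norm (v $ i)"
          by (simp add: algebra_simps)
        also have "\<dots> \<le> e / 2 * norm v" using e Finite_Cartesian_Product.norm_nth_le[of v i] by (intro mult_left_mono) auto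
        finally have 2: "norm (f (z0 + restr (insert i S) v) - f z - ?d i * v $ i) \<le> e / 2 * norm v" .
        have 3: "norm (f z - f z0 - (\<Sum>i\<in>S. ?d i * v $ i)) \<le> e / 2 * norm v"
          unfolding z_def using v by (intro \<delta>1) auto
        have eq: "f (z0 + restr (insert i S) v) - f z0 - (\<Sum>i\<in>insert i S. ?d i * v $ i)
            = (f (z0 + restr (insert i S) v) - f z - ?d i * v $ i) + (f z - f z0 - (\<Sum>i\<in>S. ?d i * v $ i))"
          using insert.hyps by simp
        thus "norm (f (z0 + restr (insert i S) v) - f z0 - (\<Sum>i\<in>insert i S. ?d i * v $ i)) \<le> e * norm v"
          unfolding eq using norm_triangle_mono[OF 2 3] by simp
      qed
    qed
  qed
  have restr_UNIV: "restr UNIV v = v" for v :: "complex ^ 'n" by (simp add: restr_def)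
  show ?thesis
    unfolding has_derivative_at_alt
  proof (intro conjI allI impI)
    show "bounded_linear (\<lambda>v. \<Sum>i\<in>UNIV. ?d i * v $ i)"
      by (intro bounded_linear_sum bounded_linear_const_mult bounded_linear_vec_nth)
    fix e :: real assume "e > 0"
    then obtain \<delta> where \<delta>: "\<delta> > 0" "\<And>v. norm v < \<delta> \<Longrightarrow> norm (f (z0 + v) - f z0 - (\<Sum>i\<in>UNIV. ?d i * v $ i)) \<le> e * norm v"
      using main[of UNIV] unfolding restr_UNIV by blast
    show "\<exists>d>0. \<forall>y. norm (y - z0) < d \<longrightarrow>
        norm (f y - f z0 - (\<Sum>i\<in>UNIV. ?d i * (y - z0) $ i)) \<le> e * norm (y - z0)"
    proof (intro exI conjI allI impI)
      fix y assume "norm (y - z0) < \<delta>"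
      thus "norm (f y - f z0 - (\<Sum>i\<in>UNIV. ?d i * (y - z0) $ i)) \<le> e * norm (y - z0)"
        using \<delta>(2)[of "y - z0"] by simp
    qed fact
  qed
qed

text \<open>One direction is Osgood's lemma; the other is the chain rule along a coordinate axis,
  where complex homogeneity of the derivative makes the restriction complex differentiable. It lets
  Bergman functions be handled coordinate by coordinate.\<close>

lemma sephol_iff_holomorphic:
  "sephol f \<longleftrightarrow> holomorphic_fun_on f polydisk"
proof
  assume f: "sephol f"
  show "holomorphic_fun_on f polydisk" unfolding holomorphic_fun_on_def
    by (intro ballI exI conjI, rule sephol_has_derivative[OF f])
       (auto simp: sum_distrib_left mult_ac)
next
  assume f: "holomorphic_fun_on f polydisk"
  have cont: "continuous_on polydisk f"
    using f unfolding holomorphic_fun_on_def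
    by (meson continuous_at_imp_continuous_on has_derivative_continuous)
  have lineD: "(\<lambda>w. f (upd z j w)) field_differentiable at w within ball 0 1" if z: "z \<in> polydisk" and w: "w \<in> ball 0 1" for z j w
  proof -
    have "upd z j w \<in> polydisk" using z w by (auto intro: upd_polydisk)
    then obtain D where D: "(f has_derivative D) (at (upd z j w))" "\<And>c v. D (c *s v) = c * D v"
      using f unfolding holomorphic_fun_on_def by blast
    have eq: "upd z j = (\<lambda>w. upd z j 0 + axis j w)" by (auto simp: fun_eq_iff vec_eq_iff upd_nth axis_def)
    have bl: "bounded_linear (\<lambda>w::complex. axis j w)"
      by (rule bounded_linear_intro[of _ 1]) (simp_all add: norm_axis, simp_all add: vec_eq_iff axis_def)
    have "(upd z j has_derivative (\<lambda>w. axis j w)) (at w)"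
      by (subst eq, (rule derivative_eq_intros bounded_linear_imp_has_derivative[OF bl] refl | simp)+)
    from diff_chain_at[OF this D(1)]
    have "((\<lambda>w. f (upd z j w)) has_derivative (\<lambda>w. D (axis j w))) (at w)" by (simp add: o_def)
    moreover have "(\<lambda>w. D (axis j w)) = (*) (D (axis j 1))"
    proof
      fix w :: complex
      have "axis j w = w *s axis j 1" by (simp add: vec_eq_iff axis_def)
      thus "D (axis j w) = D (axis j 1) * w" using D(2)[of w "axis j 1"] by simp
    qed
    ultimately have "((\<lambda>w. f (upd z j w)) has_field_derivative D (axis j 1)) (at w)"
      unfolding has_field_derivative_def by simp
    thus ?thesis using field_differentiable_at_within field_differentiable_def by blast
  qed
  show "sephol f" unfolding sephol_def hol_in_def
  proof (intro allI conjI ballI cont)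
    fix j and z :: "complex ^ 'a" assume "z \<in> polydisk"
    thus "(\<lambda>w. f (upd z j w)) holomorphic_on ball 0 1"
      unfolding holomorphic_on_def using lineD by blast
  qed
qed

subsection \<open>Homogeneous components in one coordinate\<close>

definition rot :: "'n \<Rightarrow> complex \<Rightarrow> complex ^ 'n \<Rightarrow> complex ^ 'n" where
  "rot j w z = upd z j (w * z $ j)"

definition taylor_coeff :: "'n \<Rightarrow> nat \<Rightarrow> (complex ^ 'n \<Rightarrow> complex) \<Rightarrow> complex ^ 'n \<Rightarrow> complex" where
  "taylor_coeff j m u z = (deriv ^^ m) (\<lambda>w. u (upd z j w)) 0 / fact m"

text \<open>The value 0 off the polydisk makes the homogeneous parts of Bergman functions members of
  the Bergman space again.\<close>

definition hom_part :: "'n \<Rightarrow> nat \<Rightarrow> (complex ^ 'n \<Rightarrow> complex) \<Rightarrow> complex ^ 'n \<Rightarrow> complex" where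
  "hom_part j m u z = (if z \<in> polydisk then (z $ j) ^ m * taylor_coeff j m u z else 0)"

definition unit_root :: "nat \<Rightarrow> nat \<Rightarrow> complex" where
  "unit_root M k = cis (2 * pi * real k / real M)"

text \<open>Averages over the \<open>M\<close>-th roots of unity replace the usual integral over the circle, so that
  only finite sums of rotations have to be interchanged with the inner product.\<close>

definition root_avg :: "'n \<Rightarrow> nat \<Rightarrow> nat \<Rightarrow> (complex ^ 'n \<Rightarrow> complex) \<Rightarrow> complex ^ 'n \<Rightarrow> complex" where
  "root_avg j m M u z = (\<Sum>k<M. cnj (unit_root M k) ^ m * u (rot j (unit_root M k) z)) / of_nat M"

lemma norm_unit_root [simp]: "norm (unit_root M k) = 1"
  by (simp add: unit_root_def)

lemma unit_root_cnj: "unit_root M k * cnj (unit_root M k) = 1"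
  using complex_norm_square[of "unit_root M k"] by simp

text \<open>Below M, congruence modulo M is equality, so the orthogonality relation shows no
  aliasing.\<close>

lemma unit_root_sum:
  assumes "n < M" "m < M"
  shows "(\<Sum>k<M. cnj (unit_root M k) ^ m * unit_root M k ^ n) = (if n = m then of_nat M else 0)"
proof (cases "n = m")
  case True
  have "cnj (unit_root M k) ^ m * unit_root M k ^ n = 1" for k
    using unit_root_cnj[of M k] True by (simp add: power_mult_distrib[symmetric] mult.commute)
  thus ?thesis using True by simp
next
  case False
  define x where "x = cis (2 * pi * (real n - real m) / real M)"
  have term_eq: "cnj (unit_root M k) ^ m * unit_root M k ^ n = x ^ k" for k
  proof -
    have "cnj (unit_root M k) ^ m * unit_root M k ^ n = cis (real n * (2 * pi * real k / real M) - real m * (2 * pi * real k / real M))"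
      unfolding unit_root_def cis_cnj by (simp only: Complex.DeMoivre cis_mult) (simp add: algebra_simps)
    also have "real n * (2 * pi * real k / real M) - real m * (2 * pi * real k / real M)
        = real k * (2 * pi * (real n - real m) / real M)"
      by (simp add: algebra_simps diff_divide_distrib)
    finally show ?thesis unfolding x_def by (simp only: Complex.DeMoivre)
  qed
  have "x ^ M = cis (2 * pi * (real n - real m))"
    using assms by (simp add: x_def Complex.DeMoivre)
  also have "\<dots> = 1" by (rule cis_multiple_2pi) auto
  finally have xM: "x ^ M = 1" .
  have "x \<noteq> 1"
  proof
    assume "x = 1"
    hence "cos (2 * pi * (real n - real m) / real M) = 1" by (metis x_def cis.sel(1) one_complex.sel(1))
    then obtain k :: int where k: "2 * pi * (real n - real m) / real M = of_int k * 2 * pi"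
      by (auto simp: cos_one_2pi_int)
    hence "(2 * pi) * (real n - real m) = (2 * pi) * (of_int k * real M)" using assms by (simp add: field_simps)
    hence "real n - real m = of_int k * real M" unfolding mult_cancel_left by simp
    hence "of_int (int n - int m) = (of_int (k * int M) :: real)" by simp
    hence eq: "int n - int m = k * int M" by linarith
    have "\<bar>int n - int m\<bar> < int M" using assms by auto
    hence "\<bar>k\<bar> * int M < 1 * int M" using eq by (simp add: abs_mult)
    hence "\<bar>k\<bar> < 1" using mult_less_cancel_right_pos[of "int M"] assms by auto
    hence "k = 0" by simp
    thus False using eq False by simp
  qed
  hence "(\<Sum>k<M. x ^ k) = 0" using xM by (simp add: sum_gp_strict)
  thus ?thesis using False by (simp add: term_eq)
qed

lemma rot_polydisk: "norm w = 1 \<Longrightarrow> z \<in> polydisk \<Longrightarrow> rot j w z \<in> polydisk"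
  using polydisk_nth[of z j] by (auto simp: rot_def norm_mult intro!: upd_polydisk)

lemma hol_in_rot:
  assumes u: "hol_in i u" and w: "norm w = 1"
  shows "hol_in i (\<lambda>z. u (rot j w z))"
  unfolding hol_in_def
proof (intro conjI ballI)
  show "continuous_on polydisk (\<lambda>z. u (rot j w z))"
  proof (rule continuous_on_compose2[OF hol_in_continuous[OF u]])
    show "continuous_on polydisk (rot j w)" unfolding rot_def by (intro continuous_intros)
    show "rot j w ` polydisk \<subseteq> polydisk" using rot_polydisk[OF w] by blast
  qed
  fix z :: "complex ^ 'a" assume z: "z \<in> polydisk"
  show "(\<lambda>v. u (rot j w (upd z i v))) holomorphic_on ball 0 1"
  proof (cases "i = j")
    case True
    have "(\<lambda>v. u (upd z j v)) \<circ> (\<lambda>v. w * v) holomorphic_on ball 0 1"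
      using hol_inD[OF u z] True w
      by (intro holomorphic_on_compose_gen[where t = "ball 0 1"]) (auto intro!: holomorphic_intros simp: norm_mult)
    thus ?thesis using True by (simp add: rot_def o_def)
  next
    case False
    hence "rot j w (upd z i v) = upd (rot j w z) i v" for v by (simp add: rot_def upd_swap)
    thus ?thesis using hol_inD[OF u rot_polydisk[OF w z]] by simp
  qed
qed

lemma hol_in_root_avg:
  assumes "hol_in i u" shows "hol_in i (root_avg j m M u)"
proof -
  have "hol_in i (\<lambda>z. (\<Sum>k<M. cnj (unit_root M k) ^ m * u (rot j (unit_root M k) z)) * (1 / of_nat M))"
    by (intro hol_in_mult hol_in_sum hol_in_const hol_in_rot assms norm_unit_root)
  thus ?thesis by (simp add: root_avg_def[abs_def])
qed

lemma taylor_sums: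
  assumes u: "hol_in j u" and z: "z \<in> polydisk" and w: "norm w < 1"
  shows "(\<lambda>n. taylor_coeff j n u z * w ^ n) sums u (upd z j w)"
  using holomorphic_power_series[OF hol_inD[OF u z], of w] w
  by (simp add: taylor_coeff_def)

lemma taylor_bound:
  assumes u: "hol_in j u" and z: "z \<in> cpoly R" and R: "0 < R" "R < 1"
    and C: "\<And>z. z \<in> cpoly R \<Longrightarrow> norm (u z) \<le> C"
  shows "norm (taylor_coeff j n u z) \<le> C / R ^ n"
proof -
  have zD: "z \<in> polydisk" using z cpoly_subset_polydisk[OF R(2)] by blast
  note hol = hol_inD[OF u zD]
  have "norm ((deriv ^^ n) (\<lambda>w. u (upd z j w)) 0) \<le> fact n * C / R ^ n"
  proof (rule Cauchy_inequality)
    have "ball 0 R \<subseteq> ball (0::complex) 1" "cball 0 R \<subseteq> ball (0::complex) 1" using R by auto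
    thus "(\<lambda>w. u (upd z j w)) holomorphic_on ball 0 R" "continuous_on (cball 0 R) (\<lambda>w. u (upd z j w))"
      using hol holomorphic_on_imp_continuous_on[OF hol] holomorphic_on_subset continuous_on_subset by blast+
    show "norm (u (upd z j x)) \<le> C" if "norm (0 - x) = R" for x
      using that z by (intro C upd_cpoly) auto
  qed (use R in auto)
  thus ?thesis by (simp add: taylor_coeff_def norm_divide field_simps)
qed

text \<open>The average reproduces the Taylor terms of degree below M exactly. Terms of degree at
  least M are multiplied by factors of modulus at most 1, and Cauchy's estimate on the larger radius
  bounds them by a geometric tail.\<close>

lemma root_avg_estimate:
  assumes u: "hol_in j u" and z: "z \<in> cpoly r" and r: "0 \<le> r" "r < R" "R < 1"
    and C: "\<And>z. z \<in> cpoly R \<Longrightarrow> norm (u z) \<le> C" and M: "m < M"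
  shows "norm (root_avg j m M u z - hom_part j m u z) \<le> C * (r / R) ^ M / (1 - r / R)"
proof -
  define a where "a = (\<lambda>n. taylor_coeff j n u z)"
  define q where "q = r / R"
  have q: "0 \<le> q" "q < 1" using r by (auto simp: q_def)
  have zR: "z \<in> cpoly R" using z cpoly_mono[of r R] r by auto
  have zD: "z \<in> polydisk" using zR cpoly_subset_polydisk[of R] r by auto
  have zj: "norm (z $ j) \<le> r" using z by (simp add: cpoly_def)
  have C0: "0 \<le> C" using C[OF zR] norm_ge_zero order_trans by blast
  \<comment> \<open>The factor by which averaging multiplies the n-th Taylor term.\<close>
  define s where "s = (\<lambda>n. (\<Sum>k<M. cnj (unit_root M k) ^ m * unit_root M k ^ n) / of_nat M)"
  have s1: "norm (s n) \<le> 1" for n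
  proof -
    have "norm (\<Sum>k<M. cnj (unit_root M k) ^ m * unit_root M k ^ n) \<le> (\<Sum>k<M. 1)"
      by (rule order_trans[OF norm_sum sum_mono]) (simp add: norm_mult norm_power)
    thus ?thesis using M by (simp add: s_def norm_divide)
  qed
  have s2: "s n = (if n = m then 1 else 0)" if "n < M" for n
    using unit_root_sum[OF that M] M by (auto simp: s_def)
  define b where "b = (\<lambda>n. a n * (z $ j) ^ n * (s n - (if n = m then 1 else 0)))"
  have "(\<lambda>n. cnj (unit_root M k) ^ m * (a n * (unit_root M k * z $ j) ^ n)) sums
          (cnj (unit_root M k) ^ m * u (rot j (unit_root M k) z))" for k
    unfolding a_def rot_def using polydisk_nth[OF zD, of j] by (intro sums_mult taylor_sums[OF u zD]) (simp add: norm_mult)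
  hence "(\<lambda>n. (\<Sum>k<M. cnj (unit_root M k) ^ m * (a n * (unit_root M k * z $ j) ^ n)) / of_nat M) sums root_avg j m M u z"
    unfolding root_avg_def by (intro sums_divide sums_sum) auto
  moreover have "(\<Sum>k<M. cnj (unit_root M k) ^ m * (a n * (unit_root M k * z $ j) ^ n)) / of_nat M
      = a n * (z $ j) ^ n * s n" for n
    by (simp add: s_def sum_distrib_left sum_divide_distrib power_mult_distrib mult_ac)
  ultimately have "(\<lambda>n. a n * (z $ j) ^ n * s n) sums root_avg j m M u z" by simp
  moreover have "(\<lambda>n. if n = m then a n * (z $ j) ^ n else 0) sums (a m * (z $ j) ^ m)"
    by (rule sums_single)
  ultimately have "(\<lambda>n. a n * (z $ j) ^ n * s n - (if n = m then a n * (z $ j) ^ n else 0)) sums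
     (root_avg j m M u z - a m * (z $ j) ^ m)" by (rule sums_diff)
  moreover have "a n * (z $ j) ^ n * s n - (if n = m then a n * (z $ j) ^ n else 0) = b n" for n
    by (simp add: b_def algebra_simps)
  moreover have "a m * (z $ j) ^ m = hom_part j m u z"
    using zD by (simp add: hom_part_def a_def mult.commute)
  ultimately have bs: "b sums (root_avg j m M u z - hom_part j m u z)" by simp
  have b0: "b n = 0" if "n < M" for n using s2[OF that] by (simp add: b_def)
  have bn: "norm (b (n + M)) \<le> C * q ^ M * q ^ n" for n
  proof -
    have "norm (b (n + M)) = norm (a (n + M)) * norm (z $ j) ^ (n + M) * norm (s (n + M))"
      using M by (simp add: b_def norm_mult norm_power)
    also have "\<dots> \<le> C / R ^ (n + M) * r ^ (n + M) * 1"
      unfolding a_def using r C0 zj by (intro mult_mono taylor_bound[OF u zR _ _ C] s1 power_mono) auto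
    also have "\<dots> = C * q ^ M * q ^ n" by (simp add: q_def power_divide power_add mult_ac)
    finally show ?thesis .
  qed
  have "(\<lambda>n. b (n + M)) sums (root_avg j m M u z - hom_part j m u z)"
    using sums_split_initial_segment[OF bs, of M] b0 by simp
  hence "root_avg j m M u z - hom_part j m u z = (\<Sum>n. b (n + M))" by (simp add: sums_iff)
  also have "norm \<dots> \<le> (\<Sum>n. C * q ^ M * q ^ n)"
    using q by (intro norm_suminf_le bn summable_mult summable_geometric) auto
  also have "\<dots> = C * q ^ M / (1 - q)"
    using q by (simp add: suminf_mult suminf_geometric)
  finally show ?thesis by (simp add: q_def)
qed

lemma continuous_bounded_cpoly:
  assumes "continuous_on polydisk u" "r < 1"
  obtains C where "\<And>z. z \<in> cpoly r \<Longrightarrow> norm (u z) \<le> C"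
proof -
  have "compact (u ` cpoly r)"
    using assms cpoly_subset_polydisk continuous_on_subset compact_cpoly by (intro compact_continuous_image) blast+
  then obtain C where "\<forall>y\<in>u ` cpoly r. norm y \<le> C" using compact_imp_bounded bounded_iff by blast
  thus ?thesis using that by blast
qed

lemma root_avg_uniform_limit:
  assumes u: "hol_in j u" and r: "0 < r" "r < 1"
  shows "uniform_limit (cpoly r) (\<lambda>M. root_avg j m M u) (hom_part j m u) sequentially"
proof -
  define R where "R = (r + 1) / 2"
  have R: "r < R" "R < 1" using r by (auto simp: R_def)
  obtain C where C: "\<And>z. z \<in> cpoly R \<Longrightarrow> norm (u z) \<le> C"
    using continuous_bounded_cpoly[OF hol_in_continuous[OF u] R(2)] by blast
  have "(\<lambda>M. C * (r / R) ^ M / (1 - r / R)) \<longlonglongrightarrow> C * 0 / (1 - r / R)"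
    using r R by (intro tendsto_intros LIMSEQ_power_zero) auto
  hence lim: "(\<lambda>M. C * (r / R) ^ M / (1 - r / R)) \<longlonglongrightarrow> 0" by simp
  show ?thesis
  proof (rule uniform_limitI)
    fix e :: real assume "e > 0"
    hence "\<forall>\<^sub>F M in sequentially. C * (r / R) ^ M / (1 - r / R) < e"
      using lim by (auto dest: order_tendstoD)
    thus "\<forall>\<^sub>F M in sequentially. \<forall>z\<in>cpoly r. dist (root_avg j m M u z) (hom_part j m u z) < e"
      using eventually_gt_at_top[of m]
    proof eventually_elim
      case (elim M)
      show ?case
      proof
        fix z :: "complex ^ 'a" assume z: "z \<in> cpoly r"
        show "dist (root_avg j m M u z) (hom_part j m u z) < e"
          using root_avg_estimate[OF u z _ R C elim(2)] r elim(1) by (simp add: dist_norm)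
      qed
    qed
  qed
qed

lemma root_avg_tendsto:
  assumes u: "hol_in j u" and z: "z \<in> polydisk"
  shows "(\<lambda>M. root_avg j m M u z) \<longlonglongrightarrow> hom_part j m u z"
proof -
  obtain r where r: "0 < r" "r < 1" "z \<in> interior (cpoly r)" using polydisk_interior_cpoly[OF z] .
  hence "z \<in> cpoly r" using interior_subset by blast
  thus ?thesis using tendsto_uniform_limitI[OF root_avg_uniform_limit[OF u r(1,2)]] by blast
qed

lemma hol_in_hom_part:
  assumes "hol_in j u" "hol_in i u" shows "hol_in i (hom_part j m u)"
  by (rule hol_in_uniform_limit[OF hol_in_root_avg[OF assms(2)] root_avg_uniform_limit[OF assms(1)]])

lemma sephol_hom_part: "sephol u \<Longrightarrow> sephol (hom_part j m u)"
  unfolding sephol_def using hol_in_hom_part by blast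

section \<open>Coefficient functions and factors independent of a coordinate\<close>

definition indep :: "'n \<Rightarrow> (complex ^ 'n \<Rightarrow> 'b) \<Rightarrow> bool" where
  "indep j h \<longleftrightarrow> (\<forall>z w. h (upd z j w) = h z)"

lemma indepD: "indep j h \<Longrightarrow> h (upd z j w) = h z"
  by (simp add: indep_def)

lemma indep_taylor_coeff: "indep j (taylor_coeff j m u)"
  by (simp add: indep_def taylor_coeff_def)

text \<open>The coefficient does not see z_j, so it can be read off at z_j = 1/2, where the power of
  z_j is invertible. Regularity passes from \<open>hom_part\<close> to the coefficient without
  dividing by a vanishing function.\<close>

lemma taylor_coeff_eq_hom_part:
  assumes "z \<in> polydisk"
  shows "taylor_coeff j m u z = 2 ^ m * hom_part j m u (upd z j (1/2))"
proof -
  have "upd z j (1/2) \<in> polydisk" using assms by (intro upd_polydisk) auto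
  thus ?thesis by (simp add: hom_part_def indepD[OF indep_taylor_coeff] power_divide)
qed

lemma hol_in_taylor_coeff:
  assumes u: "hol_in j u" "hol_in i u"
  shows "hol_in i (taylor_coeff j m u)"
proof -
  have E: "hol_in i (hom_part j m u)" using u by (intro hol_in_hom_part)
  have "hol_in i (\<lambda>z. 2 ^ m * hom_part j m u (upd z j (1/2)))"
    unfolding hol_in_def
  proof (intro conjI ballI)
    show "continuous_on polydisk (\<lambda>z. 2 ^ m * hom_part j m u (upd z j (1/2)))"
      by (intro continuous_intros continuous_on_compose2[OF hol_in_continuous[OF E]])
         (auto intro!: upd_polydisk continuous_intros)
    fix z :: "complex ^ 'a" assume z: "z \<in> polydisk"
    have zj: "upd z j (1/2) \<in> polydisk" using z by (intro upd_polydisk) auto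
    show "(\<lambda>w. 2 ^ m * hom_part j m u (upd (upd z i w) j (1/2))) holomorphic_on ball 0 1"
    proof (cases "i = j")
      case True thus ?thesis by simp
    next
      case False
      thus ?thesis using hol_inD[OF E zj] by (simp add: upd_swap) (intro holomorphic_intros)
    qed
  qed
  thus ?thesis by (subst hol_in_cong[OF taylor_coeff_eq_hom_part])
qed

lemma hom_part_eq: "z \<in> polydisk \<Longrightarrow> hom_part j m u z = (z $ j) ^ m * taylor_coeff j m u z"
  by (simp add: hom_part_def)

text \<open>The averages rotate only z_j, so a factor free of z_j comes out of each of them and out
  of their limit.\<close>

lemma hom_part_mult_indep:
  assumes h: "indep j h" and u: "hol_in j u" "hol_in j (\<lambda>z. h z * u z)" and z: "z \<in> polydisk"
  shows "hom_part j m (\<lambda>z. h z * u z) z = h z * hom_part j m u z"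
proof -
  have "root_avg j m M (\<lambda>z. h z * u z) z = h z * root_avg j m M u z" for M
    by (simp add: root_avg_def rot_def indepD[OF h] sum_distrib_left mult_ac)
  hence "(\<lambda>M. h z * root_avg j m M u z) \<longlonglongrightarrow> hom_part j m (\<lambda>z. h z * u z) z"
    using root_avg_tendsto[OF u(2) z, of m] by simp
  moreover have "(\<lambda>M. h z * root_avg j m M u z) \<longlonglongrightarrow> h z * hom_part j m u z"
    by (intro tendsto_intros root_avg_tendsto u z)
  ultimately show ?thesis by (rule LIMSEQ_unique)
qed

lemma hom_part_coord_Suc:
  assumes u: "hol_in j u" and z: "z \<in> polydisk"
  shows "hom_part j (Suc m) (\<lambda>z. z $ j * u z) z = z $ j * hom_part j m u z"
proof -
  have t1: "cnj (unit_root M k) ^ Suc m * (unit_root M k * z $ j * v) = z $ j * (cnj (unit_root M k) ^ m * v)" for M k v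
    using unit_root_cnj[of M k] by (simp add: mult_ac)
  have "root_avg j (Suc m) M (\<lambda>z. z $ j * u z) z = z $ j * root_avg j m M u z" for M
    by (simp only: root_avg_def rot_def upd_same t1 sum_distrib_left[symmetric] times_divide_eq_right)
  hence "(\<lambda>M. z $ j * root_avg j m M u z) \<longlonglongrightarrow> hom_part j (Suc m) (\<lambda>z. z $ j * u z) z"
    using root_avg_tendsto[OF hol_in_mult[OF hol_in_coord u] z, of "Suc m" j] by simp
  moreover have "(\<lambda>M. z $ j * root_avg j m M u z) \<longlonglongrightarrow> z $ j * hom_part j m u z"
    by (intro tendsto_intros root_avg_tendsto u z)
  ultimately show ?thesis by (rule LIMSEQ_unique)
qed

lemma hom_part_0: "z \<in> polydisk \<Longrightarrow> hom_part j 0 u z = u (upd z j 0)"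
  by (simp add: hom_part_def taylor_coeff_def)

lemma hom_part_coord_0: "z \<in> polydisk \<Longrightarrow> hom_part j 0 (\<lambda>z. z $ j * u z) z = 0"
  by (simp add: hom_part_0)

lemma hom_part_homogeneous:
  assumes c: "indep j c" and u: "hol_in j u" and eq: "\<And>z. z \<in> polydisk \<Longrightarrow> u z = (z $ j) ^ m * c z"
    and z: "z \<in> polydisk"
  shows "hom_part j m u z = u z"
proof -
  have "\<forall>\<^sub>F M in sequentially. root_avg j m M u z = u z"
    using eventually_gt_at_top[of 0]
  proof eventually_elim
    case (elim M)
    have "cnj (unit_root M k) ^ m * u (rot j (unit_root M k) z) = u z" for k
    proof -
      have "u (rot j (unit_root M k) z) = (unit_root M k) ^ m * u z"
        using z by (simp add: eq rot_polydisk) (simp add: rot_def indepD[OF c] power_mult_distrib)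
      moreover have "cnj (unit_root M k) ^ m * unit_root M k ^ m = 1"
        using unit_root_cnj[of M k] by (simp add: power_mult_distrib[symmetric] mult.commute)
      ultimately show ?thesis by (simp add: mult.assoc[symmetric])
    qed
    thus ?case using elim by (simp add: root_avg_def)
  qed
  hence "(\<lambda>M. root_avg j m M u z) \<longlonglongrightarrow> u z" by (rule tendsto_eventually)
  thus ?thesis using root_avg_tendsto[OF u z] LIMSEQ_unique by blast
qed

lemma hom_part_idem:
  assumes u: "hol_in j u" and z: "z \<in> polydisk"
  shows "hom_part j m (hom_part j m u) z = hom_part j m u z"
  by (rule hom_part_homogeneous[OF indep_taylor_coeff[of j m u]])
     (use assms in \<open>auto simp: hom_part_eq intro: hol_in_hom_part\<close>)

lemma all_hom_part_zero:
  assumes u: "hol_in j u" and z: "z \<in> polydisk" and eq: "\<And>m z. z \<in> polydisk \<Longrightarrow> hom_part j m u z = 0"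
  shows "u z = 0"
proof -
  have "taylor_coeff j n u z = 0" for n
    using taylor_coeff_eq_hom_part[OF z, of j n u] eq[OF upd_polydisk[OF z, of "1/2"]] by simp
  hence "(\<lambda>n. 0) sums u (upd z j (z $ j))"
    using taylor_sums[OF u z polydisk_nth[OF z, of j]] by simp
  thus ?thesis using sums_unique2[OF sums_zero] by auto
qed

subsection \<open>Integration over the polydisk\<close>

abbreviation pdm :: "(complex ^ 'n) measure" where "pdm \<equiv> lebesgue_on polydisk"
abbreviation ip :: "(complex ^ 'n \<Rightarrow> complex) \<Rightarrow> (complex ^ 'n \<Rightarrow> complex) \<Rightarrow> complex" where "ip \<equiv> L2_inner polydisk"
abbreviation nrm :: "(complex ^ 'n \<Rightarrow> complex) \<Rightarrow> real" where "nrm \<equiv> L2_norm polydisk"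
abbreviation L2 :: "(complex ^ 'n \<Rightarrow> complex) set" where "L2 \<equiv> L2_space polydisk"
abbreviation A2 :: "(complex ^ 'n \<Rightarrow> complex) set" where "A2 \<equiv> bergman_space polydisk"
abbreviation bdd :: "(complex ^ 'n \<Rightarrow> complex) \<Rightarrow> bool" where "bdd \<equiv> bdd_symbol polydisk"

lemma polydisk_borel [measurable, simp]: "polydisk \<in> sets borel"
  using open_polydisk by (rule borel_open)

lemma polydisk_lebesgue [measurable, simp]: "polydisk \<in> sets lebesgue"
  using polydisk_borel sets_completionI_sets[of polydisk lborel] by auto

lemma space_pdm: "space pdm = polydisk"
  by (simp add: space_restrict_space)

lemma pd_indicator_borel:
  fixes u :: "complex ^ 'n \<Rightarrow> 'b::real_normed_vector"
  assumes "continuous_on polydisk u"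
  shows "(\<lambda>z. indicator polydisk z *\<^sub>R u z) \<in> borel_measurable borel"
  using assms by (intro borel_measurable_continuous_on_indicator) auto

lemma pd_measurable: "continuous_on polydisk u \<Longrightarrow> u \<in> borel_measurable pdm"
  by (rule continuous_imp_measurable_on_sets_lebesgue) auto

text \<open>Leads to \<open>lborel\<close>, where integrals can be transported along the Borel maps
  \<open>rot\<close> and \<open>aff\<close>; continuity on the polydisk makes the function cut off
  by the indicator Borel.\<close>

lemma pd_integrable_iff:
  fixes u :: "complex ^ 'n \<Rightarrow> 'b::{banach, second_countable_topology}"
  assumes "continuous_on polydisk u"
  shows "integrable pdm u \<longleftrightarrow> integrable lborel (\<lambda>z. indicator polydisk z *\<^sub>R u z)"
  using pd_indicator_borel[OF assms] by (simp add: integrable_restrict_space integrable_completion)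

lemma pd_integral:
  fixes u :: "complex ^ 'n \<Rightarrow> 'b::{banach, second_countable_topology}"
  assumes "continuous_on polydisk u"
  shows "(LINT z|pdm. u z) = (LINT z|lborel. indicator polydisk z *\<^sub>R u z)"
  using pd_indicator_borel[OF assms] by (simp add: integral_restrict_space integral_completion)

lemma rot_iff: 
  assumes "norm w = 1" shows "rot j w z \<in> polydisk \<longleftrightarrow> z \<in> polydisk"
proof
  assume "rot j w z \<in> polydisk"
  hence "rot j (cnj w) (rot j w z) \<in> polydisk" using assms by (rule_tac rot_polydisk) auto
  moreover have "cnj w * w = 1" using complex_norm_square[of w] assms by (simp add: mult.commute)
  hence "rot j (cnj w) (rot j w z) = z" by (simp add: rot_def mult.assoc[symmetric])
  ultimately show "z \<in> polydisk" by simp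
qed (use rot_polydisk[OF assms] in auto)

lemma lborel_rot: "norm w = 1 \<Longrightarrow> distr lborel borel (rot j w) = lborel"
  using lborel_rotate[of w j] by (simp add: rot_def[abs_def])

lemma rot_borel [measurable]: "rot j w \<in> borel_measurable borel"
  unfolding rot_def by (intro borel_measurable_continuous_onI continuous_intros)

lemma continuous_on_rot:
  assumes "continuous_on polydisk u" "norm w = 1"
  shows "continuous_on polydisk (\<lambda>z. u (rot j w z))"
proof (rule continuous_on_compose2[OF assms(1)])
  show "continuous_on polydisk (rot j w)" unfolding rot_def by (intro continuous_intros)
  show "rot j w ` polydisk \<subseteq> polydisk" using rot_polydisk[OF assms(2)] by blast
qed

lemma rot_integrable_iff:
  fixes u :: "complex ^ 'n \<Rightarrow> 'b::{banach, second_countable_topology}"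
  assumes u: "continuous_on polydisk u" and w: "norm w = 1"
  shows "integrable pdm (\<lambda>z. u (rot j w z)) \<longleftrightarrow> integrable pdm u"
proof -
  have "integrable pdm u \<longleftrightarrow> integrable (distr lborel borel (rot j w)) (\<lambda>z. indicator polydisk z *\<^sub>R u z)"
    using u lborel_rot[OF w, of j] by (simp add: pd_integrable_iff)
  also have "\<dots> \<longleftrightarrow> integrable lborel (\<lambda>z. indicator polydisk (rot j w z) *\<^sub>R u (rot j w z))"
    using pd_indicator_borel[OF u] by (subst integrable_distr_eq) auto
  also have "\<dots> \<longleftrightarrow> integrable lborel (\<lambda>z. indicator polydisk z *\<^sub>R u (rot j w z))"
    using w by (simp add: indicator_def rot_iff)
  also have "\<dots> \<longleftrightarrow> integrable pdm (\<lambda>z. u (rot j w z))"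
    by (rule pd_integrable_iff[symmetric, OF continuous_on_rot[OF u w]])
  finally show ?thesis by simp
qed

lemma rot_integral:
  fixes u :: "complex ^ 'n \<Rightarrow> 'b::{banach, second_countable_topology}"
  assumes u: "continuous_on polydisk u" and w: "norm w = 1"
  shows "(LINT z|pdm. u (rot j w z)) = (LINT z|pdm. u z)"
proof -
  have "(LINT z|pdm. u z) = (LINT z|distr lborel borel (rot j w). indicator polydisk z *\<^sub>R u z)"
    using u lborel_rot[OF w, of j] by (simp add: pd_integral)
  also have "\<dots> = (LINT z|lborel. indicator polydisk (rot j w z) *\<^sub>R u (rot j w z))"
    using pd_indicator_borel[OF u] by (subst integral_distr) auto
  also have "\<dots> = (LINT z|lborel. indicator polydisk z *\<^sub>R u (rot j w z))"
    using w by (simp add: indicator_def rot_iff)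
  also have "\<dots> = (LINT z|pdm. u (rot j w z))"
    by (rule pd_integral[symmetric, OF continuous_on_rot[OF u w]])
  finally show ?thesis by simp
qed

section \<open>Affine substitutions and finite volume\<close>

definition aff :: "complex ^ 'n \<Rightarrow> ('n \<Rightarrow> real) \<Rightarrow> complex ^ 'n \<Rightarrow> complex ^ 'n" where
  "aff a \<rho> z = (\<chi> i. a $ i + of_real (\<rho> i) * z $ i)"

lemma sum_Basis_vec:
  fixes f :: "'a::euclidean_space ^ 'n \<Rightarrow> 'b::comm_monoid_add"
  shows "(\<Sum>b\<in>Basis. f b) = (\<Sum>i\<in>UNIV. \<Sum>b\<in>Basis. f (axis i b))"
proof -
  have inj: "inj_on (\<lambda>p. axis (fst p) (snd p)) ((UNIV::'n set) \<times> (Basis::'a set))"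
    by (auto simp: inj_on_def axis_eq_axis nonzero_Basis)
  have B: "(Basis :: ('a^'n) set) = (\<lambda>p. axis (fst p) (snd p)) ` (UNIV \<times> Basis)"
    unfolding Basis_vec_def by (force simp: image_iff)
  have "(\<Sum>b\<in>Basis. f b) = (\<Sum>p\<in>UNIV \<times> Basis. f (axis (fst p) (snd p)))"
    using sum.reindex[OF inj, of f] unfolding B[symmetric] o_def .
  also have "\<dots> = (\<Sum>i\<in>UNIV. \<Sum>b\<in>Basis. f (axis i b))"
    by (simp add: sum.cartesian_product split_def)
  finally show ?thesis .
qed

text \<open>Each complex coordinate carries two real basis directions with the same scale, hence the
  squares in the density.\<close>

lemma lborel_aff:
  fixes a :: "complex ^ 'n"
  assumes \<rho>: "\<And>i. \<rho> i > 0"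
  shows "lborel = density (distr lborel borel (aff a \<rho>)) (\<lambda>_. ennreal (\<Prod>i\<in>UNIV. (\<rho> i)\<^sup>2))"
proof -
  \<comment> \<open>A formula for the scale of a basis vector that avoids decoding it: on
    \<open>axis i b\<close> it gives \<rho> i, because basis vectors of C have norm 1.\<close>
  define c where "c = (\<lambda>b::complex^'n. \<Sum>i\<in>UNIV. \<rho> i * norm (b $ i))"
  have c_axis: "c (axis i b) = \<rho> i * norm b" for i and b :: complex
    by (simp add: c_def axis_def if_distrib[of norm] if_distrib[of "\<lambda>x. _ * x"] cong: if_cong)
  have nb: "norm b = 1" if "b \<in> Basis" for b :: complex using that by simp
  have c0: "c b \<noteq> 0" if "b \<in> Basis" for b :: "complex ^ 'n"
    using that \<rho> by (auto simp: Basis_vec_def c_axis less_imp_neq[THEN not_sym])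
  have "a + (\<Sum>b\<in>Basis. (c b * (x \<bullet> b)) *\<^sub>R b) = aff a \<rho> x" for x :: "complex ^ 'n"
  proof (rule vec_eq_iff[THEN iffD2], rule allI)
    fix k
    have "(\<Sum>b\<in>Basis. (c b * (x \<bullet> b)) *\<^sub>R b) $ k = (\<Sum>i\<in>UNIV. if k = i then of_real (\<rho> i) * x $ i else 0)"
      unfolding sum_Basis_vec sum_component
    proof (rule sum.cong)
      fix i
      have "(\<Sum>b\<in>Basis. (\<rho> i * (x $ i \<bullet> b)) *\<^sub>R b) = \<rho> i *\<^sub>R x $ i"
        using euclidean_representation[of "x $ i"] by (simp add: scaleR_scaleR[symmetric] scaleR_sum_right[symmetric] del: scaleR_scaleR)
      moreover have "((c (axis i b) * (x \<bullet> axis i b)) *\<^sub>R axis i b) $ k = (if k = i then (\<rho> i * (x $ i \<bullet> b)) *\<^sub>R b else 0)"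
        if "b \<in> Basis" for b
        using that by (simp add: c_axis nb inner_axis) (simp add: axis_def)
      hence "(\<Sum>b\<in>Basis. ((c (axis i b) * (x \<bullet> axis i b)) *\<^sub>R axis i b) $ k)
          = (\<Sum>b\<in>Basis. (if k = i then (\<rho> i * (x $ i \<bullet> b)) *\<^sub>R b else 0))"
        by (intro sum.cong refl)
      ultimately show "(\<Sum>b\<in>Basis. ((c (axis i b) * (x \<bullet> axis i b)) *\<^sub>R axis i b) $ k) = (if k = i then of_real (\<rho> i) * x $ i else 0)"
        by (cases "k = i") (simp_all only: if_True if_False simp_thms sum.neutral_const scaleR_conv_of_real)
    qed auto
    thus "(a + (\<Sum>b\<in>Basis. (c b * (x \<bullet> b)) *\<^sub>R b)) $ k = aff a \<rho> x $ k"
      by (simp add: aff_def)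
  qed
  hence T: "(\<lambda>x. a + (\<Sum>b\<in>Basis. (c b * (x \<bullet> b)) *\<^sub>R b)) = aff a \<rho>" by auto
  have "(\<Prod>b\<in>Basis. \<bar>c b\<bar>) = (\<Prod>i\<in>UNIV. \<Prod>b\<in>(Basis::complex set). \<rho> i)"
    unfolding prod_Basis_vec using \<rho> by (intro prod.cong) (auto simp: c_axis nb less_imp_le)
  also have "\<dots> = (\<Prod>i\<in>UNIV. (\<rho> i)\<^sup>2)" by simp
  finally show ?thesis using lborel_affine_euclidean[of c a, OF c0] unfolding T by simp
qed

lemma aff_borel [measurable]: "aff a \<rho> \<in> borel_measurable borel"
  unfolding aff_def by (intro borel_measurable_continuous_onI continuous_intros)

lemma aff_integral:
  fixes F :: "complex ^ 'n \<Rightarrow> 'b::{banach, second_countable_topology}"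
  assumes \<rho>: "\<And>i. \<rho> i > 0" and F: "F \<in> borel_measurable borel"
  shows "(LINT z|lborel. F z) = (\<Prod>i\<in>UNIV. (\<rho> i)\<^sup>2) *\<^sub>R (LINT z|lborel. F (aff a \<rho> z))"
    and "integrable lborel F \<longleftrightarrow> integrable lborel (\<lambda>z. F (aff a \<rho> z))"
proof -
  let ?c = "\<Prod>i\<in>UNIV. (\<rho> i)\<^sup>2"
  have c: "?c > 0" using less_imp_neq[OF \<rho>] by (intro prod_pos) (auto simp: zero_less_power2)
  have "(LINT z|lborel. F z) = (LINT z|density (distr lborel borel (aff a \<rho>)) (\<lambda>_. ennreal ?c). F z)"
    using lborel_aff[OF \<rho>, of a] by simp
  also have "\<dots> = (LINT z|distr lborel borel (aff a \<rho>). ?c *\<^sub>R F z)"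
    using F c by (subst integral_density) auto
  also have "\<dots> = (LINT z|lborel. ?c *\<^sub>R F (aff a \<rho> z))"
    using F by (subst integral_distr) auto
  finally show "(LINT z|lborel. F z) = ?c *\<^sub>R (LINT z|lborel. F (aff a \<rho> z))" by simp
  have "integrable lborel F \<longleftrightarrow> integrable (density (distr lborel borel (aff a \<rho>)) (\<lambda>_. ennreal ?c)) F"
    using lborel_aff[OF \<rho>, of a] by simp
  also have "\<dots> \<longleftrightarrow> integrable (distr lborel borel (aff a \<rho>)) (\<lambda>z. ?c *\<^sub>R F z)"
    using F c by (subst integrable_density) auto
  also have "\<dots> \<longleftrightarrow> integrable lborel (\<lambda>z. ?c *\<^sub>R F (aff a \<rho> z))"
    using F by (subst integrable_distr_eq) auto
  also have "\<dots> \<longleftrightarrow> integrable lborel (\<lambda>z. F (aff a \<rho> z))"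
  proof
    assume "integrable lborel (\<lambda>z. ?c *\<^sub>R F (aff a \<rho> z))"
    hence "integrable lborel (\<lambda>z. inverse ?c *\<^sub>R (?c *\<^sub>R F (aff a \<rho> z)))" by (rule integrable_scaleR_right)
    moreover have "inverse ?c * ?c = 1" using c by (intro left_inverse) linarith
    ultimately show "integrable lborel (\<lambda>z. F (aff a \<rho> z))"
      by (simp only: scaleR_scaleR scaleR_one)
  qed (rule integrable_scaleR_right)
  finally show "integrable lborel F \<longleftrightarrow> integrable lborel (\<lambda>z. F (aff a \<rho> z))" .
qed

lemma emeasure_polydisk_finite: "emeasure lebesgue (polydisk :: (complex ^ 'n) set) < \<infinity>"
proof -
  have "bounded (polydisk :: (complex^'n) set)"
    using bounded_cpoly closure_polydisk closure_subset bounded_subset by metis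
  then obtain a :: "complex ^ 'n" where "polydisk \<subseteq> cbox (-a) a" using bounded_subset_cbox_symmetric by blast
  hence "emeasure lborel (polydisk :: (complex^'n) set) \<le> emeasure lborel (cbox (-a) a)"
    by (intro emeasure_mono) auto
  also have "\<dots> < \<infinity>" by (rule emeasure_lborel_cbox_finite)
  finally show ?thesis by (simp add: emeasure_completion)
qed

lemma finite_measure_pdm: "finite_measure pdm"
  using emeasure_polydisk_finite
  by (intro finite_measureI) (simp add: space_pdm emeasure_restrict_space less_top)

lemma bdd_in_L2: "bdd \<phi> \<Longrightarrow> \<phi> \<in> L2"
proof (rule L2_spaceI)
  assume \<phi>: "bdd \<phi>"
  then obtain C where C: "\<And>z. z \<in> polydisk \<Longrightarrow> norm (\<phi> z) \<le> C" by (auto simp: bdd_symbol_def)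
  show m: "\<phi> \<in> borel_measurable pdm" using \<phi> by (simp add: bdd_symbol_def)
  have m2: "(\<lambda>z. (norm (\<phi> z))\<^sup>2) \<in> borel_measurable pdm" using m by measurable
  show "integrable pdm (\<lambda>z. (norm (\<phi> z))\<^sup>2)"
    using C by (intro finite_measure.integrable_const_bound[OF finite_measure_pdm, of _ "C\<^sup>2"] AE_I2 m2)
       (auto simp: space_pdm intro!: power_mono)
qed

lemma one_in_L2: "(\<lambda>_. 1) \<in> L2"
  by (intro bdd_in_L2 bdd_symbol_const)

lemma nrm_one_pos: "nrm (\<lambda>_::complex^'n. 1) > 0"
proof -
  have "measure lebesgue (polydisk :: (complex^'n) set) \<noteq> 0"
  proof
    assume "measure lebesgue (polydisk :: (complex^'n) set) = 0"
    hence "negligible (polydisk :: (complex^'n) set)"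
      using emeasure_polydisk_finite fmeasurableI[OF polydisk_lebesgue]
      by (subst negligible_iff_measure) blast
    moreover have "(0 :: complex^'n) \<in> polydisk" by (simp add: polydisk_def)
    ultimately show False using open_not_negligible[OF open_polydisk] by blast
  qed
  moreover have "(nrm (\<lambda>_::complex^'n. 1))\<^sup>2 = measure lebesgue (polydisk :: (complex^'n) set)"
    by (simp add: L2_norm_sq measure_restrict_space space_pdm)
  ultimately show ?thesis by (metis L2_norm_nonneg order_le_less zero_power2)
qed

section \<open>Rotations and root averages as operators on L2\<close>

lemma L2_rot:
  assumes u: "continuous_on polydisk u" "u \<in> L2" and w: "norm w = 1"
  shows "(\<lambda>z. u (rot j w z)) \<in> L2" "nrm (\<lambda>z. u (rot j w z)) = nrm u"
proof -
  have c: "continuous_on polydisk (\<lambda>z. (norm (u z))\<^sup>2)" using u by (intro continuous_intros)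
  show "(\<lambda>z. u (rot j w z)) \<in> L2"
    using rot_integrable_iff[OF c w, of j] L2_integrable[OF u(2)]
    by (intro L2_spaceI pd_measurable continuous_on_rot u w) simp
  show "nrm (\<lambda>z. u (rot j w z)) = nrm u"
    unfolding L2_norm_def using rot_integral[OF c w, of j] by simp
qed

lemma ip_rot:
  assumes "continuous_on polydisk u" "continuous_on polydisk v" "norm w = 1"
  shows "ip (\<lambda>z. u (rot j w z)) v = ip u (\<lambda>z. v (rot j (cnj w) z))"
proof -
  have "cnj w * w = 1" using complex_norm_square[of w] assms by (simp add: mult.commute)
  hence r: "rot j (cnj w) (rot j w z) = z" for z
    by (simp add: rot_def mult.assoc[symmetric])
  have c: "continuous_on polydisk (\<lambda>z. u z * cnj (v (rot j (cnj w) z)))"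
    using assms by (intro continuous_intros continuous_on_rot) auto
  show ?thesis
    using rot_integral[OF c assms(3), of j] by (simp add: L2_inner_def r)
qed

lemma L2_inner_sum_left:
  assumes "\<And>k. k \<in> K \<Longrightarrow> u k \<in> L2_space S" "v \<in> L2_space S"
  shows "L2_inner S (\<lambda>z. \<Sum>k\<in>K. u k z) v = (\<Sum>k\<in>K. L2_inner S (u k) v)"
  using assms by (induction K rule: infinite_finite_induct) (auto simp: L2_inner_add_left L2_sum)

lemma L2_inner_sum_right:
  assumes "\<And>k. k \<in> K \<Longrightarrow> u k \<in> L2_space S" "v \<in> L2_space S"
  shows "L2_inner S v (\<lambda>z. \<Sum>k\<in>K. u k z) = (\<Sum>k\<in>K. L2_inner S v (u k))"
  using assms by (induction K rule: infinite_finite_induct)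
   (auto simp: L2_inner_add_right L2_sum L2_inner_cnj[of S v "\<lambda>_. 0"])

lemma L2_root_avg:
  assumes u: "continuous_on polydisk u" "u \<in> L2"
  shows "root_avg j m M u \<in> L2" "nrm (root_avg j m M u) \<le> nrm u"
proof -
  have eq: "root_avg j m M u = (\<lambda>z. (1 / of_nat M) * (\<Sum>k<M. cnj (unit_root M k) ^ m * u (rot j (unit_root M k) z)))"
    by (simp add: root_avg_def fun_eq_iff)
  have L: "(\<lambda>z. cnj (unit_root M k) ^ m * u (rot j (unit_root M k) z)) \<in> L2" for k
    by (intro L2_scale L2_rot u norm_unit_root)
  show "root_avg j m M u \<in> L2" unfolding eq by (intro L2_scale L2_sum L)
  have "nrm (\<lambda>z. \<Sum>k<M. cnj (unit_root M k) ^ m * u (rot j (unit_root M k) z)) \<le> (\<Sum>k<M. nrm u)"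
    by (rule order_trans[OF L2_norm_sum_le[OF L]])
       (auto simp: L2_norm_scale L2_rot(2)[OF u] norm_power intro!: sum_mono)
  thus "nrm (root_avg j m M u) \<le> nrm u"
    unfolding eq L2_norm_scale by (cases "M = 0") (auto simp: norm_divide field_simps)
qed

text \<open>The adjoint of a rotation is the inverse rotation; conjugation permutes the roots of
  unity, so the average is its own adjoint.\<close>

lemma ip_root_avg:
  assumes u: "continuous_on polydisk u" "u \<in> L2" and v: "continuous_on polydisk v" "v \<in> L2"
  shows "ip (root_avg j m M u) v = ip u (root_avg j m M v)"
proof (cases "M = 0")
  case True
  thus ?thesis by (simp add: root_avg_def[abs_def] L2_inner_cnj[of _ u])
next
  case False
  have eq: "root_avg j m M u = (\<lambda>z. (1 / of_nat M) * (\<Sum>k<M. cnj (unit_root M k) ^ m * u (rot j (unit_root M k) z)))" for u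
    by (simp add: root_avg_def fun_eq_iff)
  let ?R = "{z::complex. z ^ M = 1}"
  have bij: "bij_betw (unit_root M) {..<M} ?R"
    unfolding unit_root_def[abs_def] by (rule Complex.bij_betw_roots_unity) (use False in auto)
  \<comment> \<open>Conjugation is a bijection of the M-th roots of unity, which are used as a set
    for this reindexing.\<close>
  have cnjR: "(\<Sum>w\<in>?R. f (cnj w)) = (\<Sum>w\<in>?R. f w)" for f :: "complex \<Rightarrow> complex"
    by (rule sum.reindex_bij_witness[of _ cnj cnj]) (auto simp flip: complex_cnj_power)
  have L: "(\<lambda>z. c * u (rot j (unit_root M k) z)) \<in> L2" if "continuous_on polydisk u" "u \<in> L2" for k c u
    by (intro L2_scale L2_rot that norm_unit_root)
  have "ip (root_avg j m M u) v = (1 / of_nat M) * (\<Sum>k<M. cnj (unit_root M k) ^ m * ip u (\<lambda>z. v (rot j (cnj (unit_root M k)) z)))"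
    unfolding eq L2_inner_scale_left
    by (subst L2_inner_sum_left[OF L[OF u] v(2)])
       (simp_all add: L2_inner_scale_left ip_rot[OF u(1) v(1)])
  also have "(\<Sum>k<M. cnj (unit_root M k) ^ m * ip u (\<lambda>z. v (rot j (cnj (unit_root M k)) z)))
     = (\<Sum>w\<in>?R. cnj w ^ m * ip u (\<lambda>z. v (rot j (cnj w) z)))"
    by (rule sum.reindex_bij_betw[OF bij])
  also have "\<dots> = (\<Sum>w\<in>?R. w ^ m * ip u (\<lambda>z. v (rot j w z)))"
    by (rule cnjR)
  also have "\<dots> = (\<Sum>k<M. unit_root M k ^ m * ip u (\<lambda>z. v (rot j (unit_root M k) z)))"
    by (rule sum.reindex_bij_betw[OF bij, symmetric])
  also have "(1 / of_nat M) * \<dots> = ip u (root_avg j m M v)"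
    unfolding eq L2_inner_scale_right
    by (subst L2_inner_sum_right[OF L[OF v] u(2)]) (simp_all add: L2_inner_scale_right)
  finally show ?thesis .
qed

section \<open>Limits of bounded sequences\<close>

text \<open>Besides the norm bound it yields membership: pointwise limits of averages or of Bergman
  functions are square integrable.\<close>

lemma L2_fatou:
  assumes g: "\<And>n. g n \<in> L2" "\<And>n. nrm (g n) \<le> B" and lim: "\<And>z. z \<in> polydisk \<Longrightarrow> (\<lambda>n. g n z) \<longlonglongrightarrow> h z"
    and h: "h \<in> borel_measurable pdm"
  shows "h \<in> L2" "nrm h \<le> B"
proof -
  note [measurable] = h L2_meas[OF g(1)]
  have B: "0 \<le> B" using g(2)[of 0] L2_norm_nonneg order_trans by blast
  have "(\<integral>\<^sup>+z. ennreal ((norm (h z))\<^sup>2) \<partial>pdm) = (\<integral>\<^sup>+z. liminf (\<lambda>n. ennreal ((norm (g n z))\<^sup>2)) \<partial>pdm)"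
  proof (rule nn_integral_cong)
    fix z :: "complex ^ 'a" assume "z \<in> space pdm"
    hence "(\<lambda>n. ennreal ((norm (g n z))\<^sup>2)) \<longlonglongrightarrow> ennreal ((norm (h z))\<^sup>2)"
      by (intro tendsto_intros lim) (auto simp: space_pdm)
    thus "ennreal ((norm (h z))\<^sup>2) = liminf (\<lambda>n. ennreal ((norm (g n z))\<^sup>2))"
      by (intro lim_imp_Liminf[symmetric]) auto
  qed
  also have "\<dots> \<le> liminf (\<lambda>n. \<integral>\<^sup>+z. ennreal ((norm (g n z))\<^sup>2) \<partial>pdm)"
    by (rule nn_integral_liminf) measurable
  also have "\<dots> \<le> liminf (\<lambda>n. ennreal (B\<^sup>2))"
  proof (rule Liminf_mono, rule always_eventually, rule allI)
    fix n
    have "(\<integral>\<^sup>+z. ennreal ((norm (g n z))\<^sup>2) \<partial>pdm) = ennreal (LINT z|pdm. (norm (g n z))\<^sup>2)"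
      by (rule nn_integral_eq_integral[OF L2_integrable[OF g(1)]]) auto
    also have "\<dots> \<le> ennreal (B\<^sup>2)"
      using g(2)[of n] power_mono[OF g(2)[of n] L2_norm_nonneg, of 2] by (intro ennreal_leI) (simp add: L2_norm_sq)
    finally show "(\<integral>\<^sup>+z. ennreal ((norm (g n z))\<^sup>2) \<partial>pdm) \<le> ennreal (B\<^sup>2)" .
  qed
  also have "\<dots> = ennreal (B\<^sup>2)" by (simp add: Liminf_const)
  finally have le: "(\<integral>\<^sup>+z. ennreal ((norm (h z))\<^sup>2) \<partial>pdm) \<le> ennreal (B\<^sup>2)" .
  have int: "integrable pdm (\<lambda>z. (norm (h z))\<^sup>2)"
    using le by (intro integrableI_bounded) (auto intro: le_less_trans)
  show "h \<in> L2" by (rule L2_spaceI[OF h int])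
  have "ennreal ((nrm h)\<^sup>2) \<le> ennreal (B\<^sup>2)"
    using le nn_integral_eq_integral[OF int] by (simp add: L2_norm_sq)
  hence "(nrm h)\<^sup>2 \<le> B\<^sup>2" by (simp add: ennreal_le_iff)
  thus "nrm h \<le> B" using B by (rule power2_le_imp_le)
qed

lemma cpoly_lebesgue [measurable]: "cpoly r \<in> sets lebesgue"
  by (rule sets_completionI_sets) (simp add: closed_cpoly borel_closed)

lemma indicator_cpoly_bdd: "bdd (\<lambda>z. indicator (cpoly r) z)"
  unfolding bdd_symbol_def
  by (auto intro!: exI[of _ 1] simp: indicator_def intro: measurable_restrict_space1 borel_measurable_indicator)

lemma L2_exhaust:
  assumes u: "u \<in> L2" and e: "e > 0"
  obtains r where "0 < r" "r < 1" "nrm (\<lambda>z. u z - indicator (cpoly r) z * u z) < e"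
proof -
  note [measurable] = L2_meas[OF u]
  define r where "r = (\<lambda>n::nat. 1 - 1 / (real n + 2))"
  have r: "0 < r n" "r n < 1" for n by (auto simp: r_def field_simps)
  let ?v = "\<lambda>n z. u z - indicator (cpoly (r n)) z * u z"
  have [measurable]: "(\<lambda>z. indicator (cpoly (r n)) z :: complex) \<in> borel_measurable pdm" for n
    using indicator_cpoly_bdd by (auto simp: bdd_symbol_def)
  have "(\<lambda>n. LINT z|pdm. (norm (?v n z))\<^sup>2) \<longlonglongrightarrow> (LINT z|(pdm :: (complex ^ 'a) measure). 0)"
  proof (rule integral_dominated_convergence)
    show "integrable pdm (\<lambda>z. (norm (u z))\<^sup>2)" by (rule L2_integrable[OF u])
    show "AE z in pdm. (\<lambda>n. (norm (?v n z))\<^sup>2) \<longlonglongrightarrow> 0"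
    proof (rule AE_I2)
      fix z :: "complex ^ 'a" assume "z \<in> space pdm"
      then obtain s where s: "0 < s" "s < 1" "z \<in> interior (cpoly s)" using polydisk_interior_cpoly space_pdm by blast
      hence zs: "z \<in> cpoly s" using interior_subset by blast
      have "(\<lambda>n. 1 / (real n + 2)) \<longlonglongrightarrow> 0" by real_asymp
      hence "\<forall>\<^sub>F n in sequentially. 1 / (real n + 2) < 1 - s" using s by (intro order_tendstoD(2)) auto
      hence "\<forall>\<^sub>F n in sequentially. (norm (?v n z))\<^sup>2 = 0"
      proof eventually_elim
        case (elim n)
        hence "z \<in> cpoly (r n)" using zs cpoly_mono[of s "r n"] by (auto simp: r_def)
        thus ?case by simp
      qed
      thus "(\<lambda>n. (norm (?v n z))\<^sup>2) \<longlonglongrightarrow> 0" by (rule tendsto_eventually)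
    qed
    show "AE z in pdm. norm ((norm (?v n z))\<^sup>2) \<le> (norm (u z))\<^sup>2" for n
      by (rule AE_I2) (auto simp: indicator_def)
  qed measurable
  hence "(\<lambda>n. sqrt ((nrm (?v n))\<^sup>2)) \<longlonglongrightarrow> sqrt 0" unfolding L2_norm_sq by (intro tendsto_intros) simp
  hence "(\<lambda>n. nrm (?v n)) \<longlonglongrightarrow> 0" by simp
  hence "\<forall>\<^sub>F n in sequentially. nrm (?v n) < e" using e by (intro order_tendstoD(2))
  then obtain n where "nrm (?v n) < e" using eventually_happens by force
  thus ?thesis using that r by blast
qed

text \<open>Split \<open>u\<close> into its part on \<open>cpoly r\<close> and a tail of small norm.
  The tail is paired with differences of norm at most 2B; on \<open>cpoly r\<close> the convergence
  is uniform.\<close>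

lemma weak_limit:
  assumes u: "u \<in> L2" and g: "\<And>n. g n \<in> L2" "\<And>n. nrm (g n) \<le> B" and h: "h \<in> L2" "nrm h \<le> B"
    and lim: "\<And>r. 0 < r \<Longrightarrow> r < 1 \<Longrightarrow> uniform_limit (cpoly r) g h sequentially"
  shows "(\<lambda>n. ip u (g n)) \<longlonglongrightarrow> ip u h"
proof (rule LIMSEQ_I)
  fix e :: real assume e: "e > 0"
  have B: "0 \<le> B" using h(2) L2_norm_nonneg order_trans by blast
  \<comment> \<open>A uniform bound on \<open>cpoly r\<close> becomes an L2 bound through the norm
    of the constant 1; \<open>V\<close> collects this and the norm of \<open>u\<close>.\<close>
  define V where "V = nrm (\<lambda>_::complex^'a. 1) * nrm u"
  have V: "0 \<le> V" by (simp add: V_def)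
  obtain r where r: "0 < r" "r < 1" "nrm (\<lambda>z. u z - indicator (cpoly r) z * u z) < e / (4 * (B + 1))"
    using L2_exhaust[OF u, of "e / (4 * (B + 1))"] e B by auto
  let ?v = "\<lambda>z. u z - indicator (cpoly r) z * u z"
  have v: "?v \<in> L2" and u1: "(\<lambda>z. indicator (cpoly r) z * u z) \<in> L2" 
    by (intro L2_diff u L2_mult indicator_cpoly_bdd)+
  have "e / (4 * (V + 1)) > 0" using e V by simp
  from uniform_limitD[OF lim[OF r(1,2)] this]
  obtain N where N: "\<And>n z. n \<ge> N \<Longrightarrow> z \<in> cpoly r \<Longrightarrow> dist (g n z) (h z) < e / (4 * (V + 1))"
    unfolding eventually_sequentially by blast
  show "\<exists>N. \<forall>n\<ge>N. norm (ip u (g n) - ip u h) < e"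
  proof (intro exI allI impI)
    fix n assume n: "n \<ge> N"
    let ?d = "\<lambda>z. g n z - h z"
    have d: "?d \<in> L2" by (intro L2_diff g h)
    have d1: "(\<lambda>z. indicator (cpoly r) z * ?d z) \<in> L2" by (intro L2_mult indicator_cpoly_bdd d)
    have nd: "nrm ?d \<le> 2 * B" using L2_norm_triangle_diff[OF g(1)[of n] h(1)] g(2)[of n] h(2) by simp
    have "ip u (g n) - ip u h = ip u ?d" using u g h by (simp add: L2_inner_diff_right)
    also have "u = (\<lambda>z. ?v z + indicator (cpoly r) z * u z)" by auto
    also have "ip \<dots> ?d = ip ?v ?d + ip (\<lambda>z. indicator (cpoly r) z * u z) ?d"
      by (rule L2_inner_add_left[OF v u1 d])
    also have "ip (\<lambda>z. indicator (cpoly r) z * u z) ?d = ip u (\<lambda>z. indicator (cpoly r) z * ?d z)"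
      unfolding L2_inner_mult by (intro L2_inner_cong) (auto simp: indicator_def)
    finally have eq: "ip u (g n) - ip u h = ip ?v ?d + ip u (\<lambda>z. indicator (cpoly r) z * ?d z)" by simp
    have "norm (ip ?v ?d) \<le> nrm ?v * nrm ?d" by (rule L2_cauchy_schwarz[OF v d])
    also have "\<dots> \<le> e / (4 * (B + 1)) * (2 * B)" using r nd B e by (intro mult_mono) auto
    also have "\<dots> \<le> e / 2" using B e by (simp add: field_simps)
    finally have 1: "norm (ip ?v ?d) \<le> e / 2" .
    have "norm (ip u (\<lambda>z. indicator (cpoly r) z * ?d z)) \<le> nrm u * nrm (\<lambda>z. indicator (cpoly r) z * ?d z)"
      by (rule L2_cauchy_schwarz[OF u d1])
    also have "nrm (\<lambda>z. indicator (cpoly r) z * ?d z) \<le> nrm (\<lambda>z::complex^'a. of_real (e / (4 * (V + 1))) * 1)"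
    proof (intro L2_norm_mono d1 L2_scale one_in_L2)
      fix z
      have n: "norm (complex_of_real (e / (4 * (V + 1))) * 1) = e / (4 * (V + 1))"
        unfolding mult_1_right norm_of_real using e V by simp
      show "norm (indicator (cpoly r) z * ?d z) \<le> norm (complex_of_real (e / (4 * (V + 1))) * 1)"
        unfolding n using N[OF \<open>n \<ge> N\<close>, of z] e V by (auto simp: indicator_def dist_norm)
    qed
    also have "\<dots> = e / (4 * (V + 1)) * nrm (\<lambda>_::complex^'a. 1)"
      unfolding L2_norm_scale norm_of_real using e V by simp
    also have "nrm u * (e / (4 * (V + 1)) * nrm (\<lambda>_::complex^'a. 1)) = e / (4 * (V + 1)) * V"
      by (simp add: V_def)
    also have "\<dots> < e / 2" using V e by (auto simp: field_simps intro!: add_pos_nonneg)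
    finally have 2: "norm (ip u (\<lambda>z. indicator (cpoly r) z * ?d z)) < e / 2" by (simp add: mult_left_mono)
    show "norm (ip u (g n) - ip u h) < e"
      unfolding eq using norm_triangle_ineq[of "ip ?v ?d" "ip u (\<lambda>z. indicator (cpoly r) z * ?d z)"] 1 2 by linarith
  qed
qed

lemma L2_hom_part:
  assumes u: "hol_in j u" "u \<in> L2"
  shows "hom_part j m u \<in> L2" "nrm (hom_part j m u) \<le> nrm u"
proof -
  note c = hol_in_continuous[OF u(1)]
  have m: "hom_part j m u \<in> borel_measurable pdm"
    by (intro pd_measurable hol_in_continuous[OF hol_in_hom_part[OF u(1) u(1)]])
  note L2_fatou[OF L2_root_avg(1)[OF c u(2)] L2_root_avg(2)[OF c u(2)] root_avg_tendsto[OF u(1)] m]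
  thus "hom_part j m u \<in> L2" "nrm (hom_part j m u) \<le> nrm u" by auto
qed

text \<open>Self-adjointness of the averages survives the weak limit; with idempotence,
  \<open>hom_part\<close> behaves as an orthogonal projection.\<close>

lemma ip_hom_part:
  assumes u: "hol_in j u" "u \<in> L2" and v: "hol_in j v" "v \<in> L2"
  shows "ip (hom_part j m u) v = ip u (hom_part j m v)"
proof -
  note cu = hol_in_continuous[OF u(1)] and cv = hol_in_continuous[OF v(1)]
  have 1: "(\<lambda>M. ip w (root_avg j m M x)) \<longlonglongrightarrow> ip w (hom_part j m x)"
    if x: "hol_in j x" "x \<in> L2" and w: "w \<in> L2" for w x
    by (rule weak_limit[OF w L2_root_avg[OF hol_in_continuous[OF x(1)] x(2)] L2_hom_part[OF x] root_avg_uniform_limit[OF x(1)]])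
  have "(\<lambda>M. ip (root_avg j m M u) v) \<longlonglongrightarrow> ip u (hom_part j m v)"
    using 1[OF v u(2)] by (simp add: ip_root_avg[OF cu u(2) cv v(2)])
  moreover have "(\<lambda>M. cnj (ip v (root_avg j m M u))) \<longlonglongrightarrow> cnj (ip v (hom_part j m u))"
    by (intro tendsto_intros 1[OF u v(2)])
  hence "(\<lambda>M. ip (root_avg j m M u) v) \<longlonglongrightarrow> ip (hom_part j m u) v"
    by (simp add: L2_inner_cnj[of _ v, symmetric] L2_inner_cnj[symmetric])
  ultimately show ?thesis using LIMSEQ_unique by blast
qed

subsection \<open>Integrals of homogeneous functions\<close>

lemma aff_upd:
  "aff (axis j b) (\<lambda>i. if i = j then r else 1) z = upd z j (b + of_real r * z $ j)"
  by (simp add: aff_def vec_eq_iff upd_nth axis_def)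

lemma prod_single_coord: "(\<Prod>i\<in>(UNIV :: 'n::finite set). (if i = j then r else 1)\<^sup>2) = (r::real)\<^sup>2"
  by (simp add: if_distrib[of "\<lambda>x. x\<^sup>2"] prod.delta cong: if_cong)

text \<open>A dilation of one coordinate replaces polar coordinates: the mass of
  \<open>\<bar>z\<^sub>j\<bar>\<^sup>2\<^sup>m \<Phi>\<close> on the shell \<open>r \<le> \<bar>z\<^sub>j\<bar> < 1\<close> is \<open>1 - r\<^sup>2\<^sup>m\<^sup>+\<^sup>2\<close> times the total
  mass, and comparing shells for \<open>m\<close> and for \<open>0\<close> as \<open>r \<rightarrow> 1\<close> gives the ratio of the integrals.\<close>

lemma integral_homogeneous:
  fixes \<Phi> :: "complex ^ 'n \<Rightarrow> complex"
  assumes c: "continuous_on polydisk \<Phi>" and i: "indep j \<Phi>" and int: "integrable pdm \<Phi>"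
  shows "of_nat (Suc m) * (LINT z|pdm. of_real (norm (z $ j) ^ (2 * m)) * \<Phi> z) = (LINT z|pdm. \<Phi> z)"
proof -
  define w where "w = (\<lambda>m z. of_real (norm (z $ j) ^ (2 * m)) * \<Phi> z)"
  define I where "I = (\<lambda>m. LINT z|pdm. w m z)"
  define J where "J = (LINT z|pdm. norm (\<Phi> z))"
  have cw: "continuous_on polydisk (w m)" for m unfolding w_def by (intro continuous_intros c)
  have intw: "integrable pdm (w m)" for m
  proof (rule Bochner_Integration.integrable_bound[OF int pd_measurable[OF cw] AE_I2])
    fix z :: "complex ^ 'n" assume "z \<in> space pdm"
    hence "norm (z $ j) \<le> 1" using polydisk_nth[of z j] by (simp add: space_pdm)
    hence "norm (z $ j) ^ (2 * m) \<le> 1" by (intro power_le_one) auto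
    thus "norm (w m z) \<le> norm (\<Phi> z)"
      by (simp add: w_def norm_mult norm_power mult_left_le_one_le)
  qed
  \<comment> \<open>Dilating z_j by r carries the polydisk onto the part with |z_j| < r: the
    Jacobian gives r^2 and homogeneity of the weight gives r^(2m).\<close>
  have scale: "(LINT z|lborel. indicator {z \<in> polydisk. norm (z $ j) < r} z *\<^sub>R w m z) = r ^ (2 * m + 2) *\<^sub>R I m
     \<and> (LINT z|lborel. indicator {z \<in> polydisk. norm (z $ j) < r} z *\<^sub>R norm (w m z)) = r ^ (2 * m + 2) *\<^sub>R (LINT z|pdm. norm (w m z))"
    if r: "0 < r" "r < 1" for r m
  proof -
    let ?S = "{z \<in> polydisk. norm (z $ j) < r}" and ?\<rho> = "\<lambda>i. if i = j then r else (1::real)"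
    let ?T = "aff (axis j 0) ?\<rho> :: complex ^ 'n \<Rightarrow> complex ^ 'n"
    have T: "?T z = upd z j (of_real r * z $ j)" for z by (simp add: aff_upd)
    have "?S = polydisk \<inter> (\<lambda>z. norm (z $ j)) -` {..<r}" by auto
    hence "open ?S" using open_polydisk by (auto intro!: open_Int open_vimage continuous_intros)
    hence S: "?S \<in> sets borel" by (rule borel_open)
    have ind: "indicator ?S (?T z) = (indicator polydisk z :: real)" for z
    proof -
      have nr: "norm (of_real r * z $ j) = r * norm (z $ j)" "r * norm (z $ j) < r \<longleftrightarrow> norm (z $ j) < 1"
        using r by (simp_all add: norm_mult)
      have "?T z \<in> ?S \<longleftrightarrow> z \<in> polydisk"
      proof
        assume T1: "?T z \<in> ?S"
        hence 1: "norm (z $ j) < 1" and 2: "upd z j (of_real r * z $ j) \<in> polydisk"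
          unfolding T mem_Collect_eq upd_same nr by auto
        have "norm (z $ i) < 1" for i
          using polydisk_nth[OF 2, of i] 1 by (cases "i = j") auto
        thus "z \<in> polydisk" by (simp add: polydisk_def)
      next
        assume z: "z \<in> polydisk"
        have "norm (z $ j) < 1" using z by (rule polydisk_nth)
        hence "r * norm (z $ j) < r" by (simp add: nr)
        moreover have "norm (of_real r * z $ j) < 1" using calculation r nr(1) by linarith
        hence "upd z j (of_real r * z $ j) \<in> polydisk" by (rule upd_polydisk[OF z])
        ultimately show "?T z \<in> ?S" unfolding T mem_Collect_eq upd_same nr by auto
      qed
      thus ?thesis by (simp add: indicator_def)
    qed
    have wT: "w m (?T z) = r ^ (2 * m) *\<^sub>R w m z" for z
      using r by (simp add: T w_def indepD[OF i] norm_mult power_mult_distrib scaleR_conv_of_real mult_ac)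
    have m1: "(\<lambda>z. indicator ?S z *\<^sub>R w m z) \<in> borel_measurable borel"
      using cw S by (intro borel_measurable_continuous_on_indicator) (auto intro: continuous_on_subset)
    have m2: "(\<lambda>z. indicator ?S z *\<^sub>R norm (w m z)) \<in> borel_measurable borel"
      using cw S by (intro borel_measurable_continuous_on_indicator continuous_intros) (auto intro: continuous_on_subset)
    have "(LINT z|lborel. indicator ?S z *\<^sub>R w m z) = r\<^sup>2 *\<^sub>R (LINT z|lborel. indicator ?S (?T z) *\<^sub>R w m (?T z))"
      using r by (subst aff_integral(1)[OF _ m1, of ?\<rho> "axis j 0"]) (auto simp: prod_single_coord)
    also have "\<dots> = r ^ (2 * m + 2) *\<^sub>R I m"
    proof -
      have "indicator ?S (?T z) *\<^sub>R w m (?T z) = r ^ (2 * m) *\<^sub>R (indicator polydisk z *\<^sub>R w m z)" for z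
        unfolding ind wT by (rule scaleR_left_commute)
      hence "(LINT z|lborel. indicator ?S (?T z) *\<^sub>R w m (?T z)) = r ^ (2 * m) *\<^sub>R I m"
        by (simp only: I_def pd_integral[OF cw] integral_scaleR_right)
      thus ?thesis by (simp add: power_add power2_eq_square mult_ac)
    qed
    finally have 1: "(LINT z|lborel. indicator ?S z *\<^sub>R w m z) = r ^ (2 * m + 2) *\<^sub>R I m" .
    have "(LINT z|lborel. indicator ?S z *\<^sub>R norm (w m z)) = r\<^sup>2 *\<^sub>R (LINT z|lborel. indicator ?S (?T z) *\<^sub>R norm (w m (?T z)))"
      using r by (subst aff_integral(1)[OF _ m2, of ?\<rho> "axis j 0"]) (auto simp: prod_single_coord)
    also have "\<dots> = r ^ (2 * m + 2) *\<^sub>R (LINT z|pdm. norm (w m z))"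
    proof -
      have "norm (w m (?T z)) = r ^ (2 * m) *\<^sub>R norm (w m z)" for z
        unfolding wT using r by simp
      hence "indicator ?S (?T z) *\<^sub>R norm (w m (?T z)) = r ^ (2 * m) *\<^sub>R (indicator polydisk z *\<^sub>R norm (w m z))" for z
        unfolding ind by (simp only: scaleR_left_commute)
      hence "(LINT z|lborel. indicator ?S (?T z) *\<^sub>R norm (w m (?T z))) = r ^ (2 * m) *\<^sub>R (LINT z|pdm. norm (w m z))"
        by (simp only: pd_integral[OF continuous_on_norm[OF cw]] integral_scaleR_right)
      thus ?thesis by (simp add: power_add power2_eq_square mult_ac)
    qed
    finally show ?thesis using 1 by blast
  qed
  have shell: "norm ((1 - r ^ (2 * m + 2)) *\<^sub>R I m - (1 - r\<^sup>2) *\<^sub>R I 0) \<le> (1 - r ^ (2 * m)) * ((1 - r\<^sup>2) * J)"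
    if r: "0 < r" "r < 1" for r
  proof -
    let ?S = "{z \<in> polydisk. norm (z $ j) < r}"
    let ?C = "{z \<in> polydisk. \<not> norm (z $ j) < r}"
    have "?S = polydisk \<inter> (\<lambda>z. norm (z $ j)) -` {..<r}" by auto
    hence "open ?S" using open_polydisk by (auto intro!: open_Int open_vimage continuous_intros)
    hence S: "?S \<in> sets borel" by (rule borel_open)
    have iD: "integrable lborel (\<lambda>z. indicator polydisk z *\<^sub>R w m z)" for m
      using intw pd_integrable_iff[OF cw] by blast
    have iDn: "integrable lborel (\<lambda>z. indicator polydisk z *\<^sub>R norm (w m z))" for m
      using integrable_norm[OF iD[of m]] by simp
    have iS: "integrable lborel (\<lambda>z. indicator ?S z *\<^sub>R w m z)" for m
    proof (rule Bochner_Integration.integrable_bound[OF iD[of m]])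
      show "(\<lambda>z. indicator ?S z *\<^sub>R w m z) \<in> borel_measurable lborel"
        using borel_measurable_continuous_on_indicator[OF S, of "w m"] cw by (auto intro: continuous_on_subset)
    qed (auto simp: indicator_def)
    have iSn: "integrable lborel (\<lambda>z. indicator ?S z *\<^sub>R norm (w m z))" for m
      using integrable_norm[OF iS[of m]] by simp
    have C1: "indicator ?C z *\<^sub>R w m z = indicator polydisk z *\<^sub>R w m z - indicator ?S z *\<^sub>R w m z" for z m
      by (auto simp: indicator_def)
    have C2: "indicator ?C z *\<^sub>R norm (w m z) = indicator polydisk z *\<^sub>R norm (w m z) - indicator ?S z *\<^sub>R norm (w m z)" for z m
      by (auto simp: indicator_def)
    have iC: "integrable lborel (\<lambda>z. indicator ?C z *\<^sub>R w m z)" for m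
      unfolding C1 by (intro Bochner_Integration.integrable_diff iD iS)
    have iCn: "integrable lborel (\<lambda>z. indicator ?C z *\<^sub>R norm (w m z))" for m
      unfolding C2 by (intro Bochner_Integration.integrable_diff iDn iSn)
    have vC: "(LINT z|lborel. indicator ?C z *\<^sub>R w m z) = (1 - r ^ (2 * m + 2)) *\<^sub>R I m" for m
      unfolding C1 using iD[of m] iS[of m] scale[OF r, of m]
      by (simp add: I_def pd_integral[OF cw] scaleR_left_diff_distrib)
    have "(LINT z|lborel. indicator ?C z *\<^sub>R norm (w 0 z)) = (LINT z|pdm. norm (w 0 z)) - r ^ (2 * 0 + 2) * (LINT z|pdm. norm (w 0 z))"
      unfolding C2 using iDn[of 0] iSn[of 0] scale[OF r, of 0] pd_integral[of "\<lambda>z. norm (w 0 z)"] cw[of 0]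
      by (simp add: continuous_intros)
    hence vCn: "(LINT z|lborel. indicator ?C z *\<^sub>R norm (w 0 z)) = (1 - r\<^sup>2) * J"
      by (simp add: J_def w_def left_diff_distrib power2_eq_square)
    have "(1 - r ^ (2 * m + 2)) *\<^sub>R I m - (1 - r\<^sup>2) *\<^sub>R I 0
      = (LINT z|lborel. indicator ?C z *\<^sub>R w m z - indicator ?C z *\<^sub>R w 0 z)"
      using vC[of m] vC[of 0] iC by (simp add: power2_eq_square)
    also have "norm \<dots> \<le> (LINT z|lborel. norm (indicator ?C z *\<^sub>R w m z - indicator ?C z *\<^sub>R w 0 z))"
      by (rule integral_norm_bound)
    also have "\<dots> \<le> (LINT z|lborel. (1 - r ^ (2 * m)) * (indicator ?C z *\<^sub>R norm (w 0 z)))"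
    proof (intro integral_mono_AE AE_I2 integrable_norm Bochner_Integration.integrable_diff iC integrable_mult_right iCn)
      fix z :: "complex ^ 'n"
      show "norm (indicator ?C z *\<^sub>R w m z - indicator ?C z *\<^sub>R w 0 z) \<le> (1 - r ^ (2 * m)) * (indicator ?C z *\<^sub>R norm (w 0 z))"
      proof (cases "z \<in> ?C")
        case True
        hence z: "r \<le> norm (z $ j)" "norm (z $ j) \<le> 1" using polydisk_nth[of z j] by auto
        have p: "r ^ (2 * m) \<le> norm (z $ j) ^ (2 * m)" "norm (z $ j) ^ (2 * m) \<le> 1"
          using z r by (auto intro!: power_mono power_le_one)
        have "w m z - w 0 z = of_real (norm (z $ j) ^ (2 * m) - 1) * \<Phi> z" by (simp add: w_def algebra_simps)
        hence "norm (w m z - w 0 z) = \<bar>norm (z $ j) ^ (2 * m) - 1\<bar> * norm (\<Phi> z)"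
          by (simp only: norm_mult norm_of_real)
        also have "\<dots> \<le> (1 - r ^ (2 * m)) * norm (\<Phi> z)" using p by (intro mult_right_mono) auto
        finally show ?thesis using True by (simp add: w_def)
      qed auto
    qed
    also have "\<dots> = (1 - r ^ (2 * m)) * ((1 - r\<^sup>2) * J)" using vCn by simp
    finally show ?thesis .
  qed
  define t where "t = (\<lambda>n::nat. 1 - 1 / (real n + 2))"
  have t: "0 < t n" "t n < 1" for n by (auto simp: t_def field_simps)
  have tl: "t \<longlonglongrightarrow> 1" unfolding t_def by real_asymp
  \<comment> \<open>Division by 1 - t^2 turns 1 - t^(2m+2) into a geometric sum with limit m + 1,
    while the error factor 1 - t^(2m) tends to 0.\<close>
  have bound: "norm ((\<Sum>k<Suc m. (t n)\<^sup>2 ^ k) *\<^sub>R I m - I 0) \<le> (1 - (t n) ^ (2 * m)) * J" for n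
  proof -
    have p: "1 - (t n)\<^sup>2 > 0" using t[of n] by (simp add: abs_square_less_1)
    have "(1 - (t n)\<^sup>2) * norm ((\<Sum>k<Suc m. (t n)\<^sup>2 ^ k) *\<^sub>R I m - I 0)
        = norm ((1 - (t n)\<^sup>2) *\<^sub>R ((\<Sum>k<Suc m. (t n)\<^sup>2 ^ k) *\<^sub>R I m - I 0))"
      using p by simp
    also have "(1 - (t n)\<^sup>2) *\<^sub>R ((\<Sum>k<Suc m. (t n)\<^sup>2 ^ k) *\<^sub>R I m - I 0)
        = (1 - t n ^ (2 * m + 2)) *\<^sub>R I m - (1 - (t n)\<^sup>2) *\<^sub>R I 0"
      using one_diff_power_eq[of "(t n)\<^sup>2" "Suc m"] by (simp add: scaleR_right_diff_distrib power_mult[symmetric]) (auto simp: power2_eq_square mult.assoc)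
    also have "norm \<dots> \<le> (1 - (t n)\<^sup>2) * ((1 - (t n) ^ (2 * m)) * J)"
      using shell[OF t] by (simp add: mult_ac)
    finally show ?thesis using p by (simp add: mult_le_cancel_left_pos)
  qed
  have "(\<lambda>n. norm ((\<Sum>k<Suc m. (t n)\<^sup>2 ^ k) *\<^sub>R I m - I 0)) \<longlonglongrightarrow> norm ((\<Sum>k<Suc m. 1\<^sup>2 ^ k) *\<^sub>R I m - I 0)"
    by (intro tendsto_intros tl)
  moreover have "(\<lambda>n. (1 - (t n) ^ (2 * m)) * J) \<longlonglongrightarrow> (1 - 1 ^ (2 * m)) * J"
    by (intro tendsto_intros tl)
  ultimately have "norm ((\<Sum>k<Suc m. 1\<^sup>2 ^ k) *\<^sub>R I m - I 0) \<le> (1 - 1 ^ (2 * m)) * J"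
    by (rule LIMSEQ_le) (use bound in blast)
  hence "real (Suc m) *\<^sub>R I m = I 0" by simp
  thus ?thesis by (simp add: I_def w_def scaleR_conv_of_real)
qed

text \<open>The factor z_j^m is harmful only near z_j = 0. On the disc of radius 1/8 about 3/4 one
  has |z_j| >= 1/2, and an affine map carries the unit disc onto that disc without changing
  \<Phi>.\<close>

lemma integrable_homogeneous:
  fixes \<Phi> :: "complex ^ 'n \<Rightarrow> complex"
  assumes c: "continuous_on polydisk \<Phi>" and i: "indep j \<Phi>" and int: "integrable pdm (\<lambda>z. (z $ j) ^ m * \<Phi> z)"
  shows "integrable pdm \<Phi>"
proof -
  let ?S = "{z \<in> polydisk. norm (z $ j - 3/4) < 1/8}" and ?\<rho> = "\<lambda>i. if i = j then 1/8 else (1::real)"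
  let ?T = "aff (axis j (3/4)) ?\<rho> :: complex ^ 'n \<Rightarrow> complex ^ 'n"
  have T: "?T z = upd z j (3/4 + z $ j / 8)" for z by (simp add: aff_upd)
  have "?S = polydisk \<inter> (\<lambda>z. norm (z $ j - 3/4)) -` {..<1/8}" by auto
  hence "open ?S" using open_polydisk by (auto intro!: open_Int open_vimage continuous_intros)
  hence S: "?S \<in> sets borel" by (rule borel_open)
  have ind: "indicator ?S (?T z) = (indicator polydisk z :: real)" for z
  proof -
    have "norm (3/4 + z $ j / 8) < 1" if "norm (z $ j) < 1"
      using norm_triangle_ineq[of "3/4" "z $ j / 8"] that by (simp add: norm_divide)
    hence "?T z \<in> ?S \<longleftrightarrow> z \<in> polydisk"
      unfolding T by (auto simp: polydisk_def upd_nth norm_divide split: if_splits)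
    thus ?thesis by (simp add: indicator_def)
  qed
  have cw: "continuous_on polydisk (\<lambda>z. (z $ j) ^ m * \<Phi> z)" by (intro continuous_intros c)
  have m1: "(\<lambda>z. indicator ?S z *\<^sub>R \<Phi> z) \<in> borel_measurable borel"
    using c S by (intro borel_measurable_continuous_on_indicator) (auto intro: continuous_on_subset)
  have "integrable lborel (\<lambda>z. indicator polydisk z *\<^sub>R ((z $ j) ^ m * \<Phi> z))"
    using int pd_integrable_iff[OF cw] by blast
  hence "integrable lborel (\<lambda>z. 2 ^ m *\<^sub>R (indicator polydisk z *\<^sub>R ((z $ j) ^ m * \<Phi> z)))"
    by (rule integrable_scaleR_right)
  hence "integrable lborel (\<lambda>z. indicator ?S z *\<^sub>R \<Phi> z)"
  proof (rule Bochner_Integration.integrable_bound)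
    show "AE z in lborel. norm (indicator ?S z *\<^sub>R \<Phi> z) \<le> norm (2 ^ m *\<^sub>R (indicator polydisk z *\<^sub>R ((z $ j) ^ m * \<Phi> z)))"
    proof (rule AE_I2)
      fix z :: "complex ^ 'n"
      show "norm (indicator ?S z *\<^sub>R \<Phi> z) \<le> norm (2 ^ m *\<^sub>R (indicator polydisk z *\<^sub>R ((z $ j) ^ m * \<Phi> z)))"
      proof (cases "z \<in> ?S")
        case True
        have "norm (3/4 :: complex) \<le> norm (z $ j) + norm (z $ j - 3/4)"
          using norm_triangle_sub[of "3/4" "z $ j"] by (simp add: norm_minus_commute)
        hence "1 \<le> 2 * norm (z $ j)" using True by simp
        hence "1 \<le> (2 * norm (z $ j)) ^ m" by (rule one_le_power)
        hence "1 * norm (\<Phi> z) \<le> (2 * norm (z $ j)) ^ m * norm (\<Phi> z)" by (rule mult_right_mono) auto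
        thus ?thesis using True by (simp add: norm_mult norm_power power_mult_distrib mult_ac)
      qed auto
    qed
  qed (use m1 in auto)
  hence "integrable lborel (\<lambda>z. indicator ?S (?T z) *\<^sub>R \<Phi> (?T z))"
    by (subst (asm) aff_integral(2)[OF _ m1, of ?\<rho> "axis j (3/4)"]) auto
  moreover have "\<Phi> (?T z) = \<Phi> z" for z unfolding T by (rule indepD[OF i])
  ultimately show ?thesis by (simp only: ind pd_integrable_iff[OF c])
qed

subsection \<open>Point evaluations and completeness\<close>

lemma A2_iff: "f \<in> A2 \<longleftrightarrow> f \<in> L2 \<and> sephol f \<and> (\<forall>z. z \<notin> polydisk \<longrightarrow> f z = 0)"
  by (simp add: bergman_space_def sephol_iff_holomorphic)

lemma A2_L2: "f \<in> A2 \<Longrightarrow> f \<in> L2" by (simp add: A2_iff)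
lemma A2_sephol: "f \<in> A2 \<Longrightarrow> sephol f" by (simp add: A2_iff)
lemma A2_hol_in: "f \<in> A2 \<Longrightarrow> hol_in j f" by (simp add: A2_iff sephol_def)
lemma A2_off: "f \<in> A2 \<Longrightarrow> z \<notin> polydisk \<Longrightarrow> f z = 0" by (simp add: A2_iff)

text \<open>Taking the part of degree 0 sets one coordinate to 0. It is self-adjoint and fixes the
  constant 1, so the pairing with 1 does not change while all coordinates are set to 0 in
  turn.\<close>

lemma sephol_mean_value:
  fixes f :: "complex ^ 'n \<Rightarrow> complex"
  assumes f: "sephol f" "f \<in> L2"
  shows "ip f (\<lambda>_. 1) = f 0 * of_real ((nrm (\<lambda>_::complex^'n. 1))\<^sup>2)"
proof -
  have "\<exists>g. (\<forall>z\<in>polydisk. g z = f (restr (-S) z)) \<and> sephol g \<and> g \<in> L2 \<and> ip g (\<lambda>_. 1) = ip f (\<lambda>_. 1)" for S :: "'n set"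
    using finite[of S]
  proof (induction S rule: finite_induct)
    case empty
    show ?case using f by (auto simp: restr_def intro!: exI[of _ f])
  next
    case (insert j S)
    then obtain g where g: "\<forall>z\<in>polydisk. g z = f (restr (-S) z)" "sephol g" "g \<in> L2" "ip g (\<lambda>_. 1) = ip f (\<lambda>_. 1)"
      by blast
    have h: "hol_in j g" using g by (simp add: sephol_def)
    show ?case
    proof (intro exI conjI ballI)
      fix z :: "complex ^ 'n" assume z: "z \<in> polydisk"
      have "hom_part j 0 g z = g (upd z j 0)" using z by (rule hom_part_0)
      also have "\<dots> = f (restr (-S) (upd z j 0))" using g(1) upd_polydisk[OF z, of 0 j] by simp
      also have "restr (-S) (upd z j 0) = restr (- insert j S) z"
        by (auto simp: restr_def vec_eq_iff upd_nth)
      finally show "hom_part j 0 g z = f (restr (- insert j S) z)" .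
    next
      have "ip (hom_part j 0 g) (\<lambda>_. 1) = ip g (hom_part j 0 (\<lambda>_. 1))"
        by (rule ip_hom_part[OF h g(3) hol_in_const one_in_L2])
      also have "\<dots> = ip g (\<lambda>_. 1)"
        by (rule L2_inner_cong) (simp_all add: hom_part_0)
      finally show "ip (hom_part j 0 g) (\<lambda>_. 1) = ip f (\<lambda>_. 1)" using g by simp
    qed (use sephol_hom_part[OF g(2)] L2_hom_part[OF h g(3)] in auto)
  qed
  from this[of UNIV] obtain g where g: "\<forall>z\<in>polydisk. g z = f (restr {} z)" "ip g (\<lambda>_. 1) = ip f (\<lambda>_. 1)" by auto
  have "restr {} z = 0" for z :: "complex ^ 'n" by (simp add: restr_def vec_eq_iff)
  hence "ip g (\<lambda>_. 1) = ip (\<lambda>_::complex^'n. f 0 * 1) (\<lambda>_. 1)" using g by (intro L2_inner_cong) auto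
  also have "\<dots> = f 0 * of_real ((nrm (\<lambda>_::complex^'n. 1))\<^sup>2)"
    by (simp only: L2_inner_scale_left L2_inner_self)
  finally show ?thesis using g by simp
qed

text \<open>A polydisk of radius 1 - r about \<open>a\<close> fits inside. Rescaled to the full
  polydisk, the mean value property at the centre and Cauchy-Schwarz give a constant that depends on
  r alone.\<close>

lemma point_evaluation_bound:
  assumes r: "0 < r" "r < 1"
  obtains K where "K \<ge> 0" "\<And>f a. sephol f \<Longrightarrow> f \<in> L2 \<Longrightarrow> a \<in> (cpoly r :: (complex ^ 'n) set) \<Longrightarrow> norm (f a) \<le> K * nrm f"
proof
  define V where "V = nrm (\<lambda>_::complex^'n. 1)"
  define c where "c = (\<Prod>i\<in>(UNIV::'n set). (1 - r)\<^sup>2)"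
  have c: "c > 0" unfolding c_def using r by (intro prod_pos) (auto simp: zero_less_power2)
  have V: "V > 0" unfolding V_def by (rule nrm_one_pos)
  show "sqrt (1 / c) / V \<ge> 0" using c V by simp
  fix f :: "complex ^ 'n \<Rightarrow> complex" and a :: "complex ^ 'n" assume f: "sephol f" "f \<in> L2" and a: "a \<in> cpoly r"
  let ?T = "aff a (\<lambda>_. 1 - r)"
  let ?S = "{z. \<forall>i. norm (z $ i - a $ i) < 1 - r}"
  have nr: "norm (complex_of_real (1 - r)) = 1 - r" unfolding norm_of_real using r by simp
  have "(1 - r) * x < 1 - r \<longleftrightarrow> x < 1" for x :: real
    using r mult_less_cancel_left_pos[of "1 - r" x 1] by simp
  hence TS: "?T z \<in> ?S \<longleftrightarrow> z \<in> polydisk" for z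
    using r by (simp add: aff_def polydisk_def norm_mult del: of_real_diff)
  have SD: "?S \<subseteq> polydisk"
  proof
    fix z assume z: "z \<in> ?S"
    have "norm (z $ i) < 1" for i
    proof -
      have "norm (z $ i) \<le> norm (a $ i) + norm (z $ i - a $ i)" by (rule norm_triangle_sub)
      also have "\<dots> < r + (1 - r)" using z a by (intro add_le_less_mono) (auto simp: cpoly_def)
      finally show ?thesis by simp
    qed
    thus "z \<in> polydisk" by (simp add: polydisk_def)
  qed
  have "?S = (\<Inter>i\<in>UNIV. (\<lambda>z. norm (z $ i - a $ i)) -` {..<1-r})" by auto
  hence "open ?S" by (auto intro!: open_INT open_vimage continuous_intros)
  hence S: "?S \<in> sets borel" by (rule borel_open)
  \<comment> \<open>\<open>f\<close> zoomed to the small polydisk about \<open>a\<close>: its value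
    at 0 is \<open>f a\<close>, and its squared norm exceeds that of \<open>f\<close> by at most the
    factor 1/c.\<close>
  define g where "g = (\<lambda>z. f (?T z))"
  have TD: "?T z \<in> polydisk" if "z \<in> polydisk" for z using TS[of z] SD that by blast
  have cT: "continuous_on X ?T" for X unfolding aff_def by (intro continuous_intros)
  have cg: "continuous_on polydisk g" unfolding g_def
    by (rule continuous_on_compose2[OF sephol_continuous[OF f(1)] cT]) (use TD in blast)
  have g: "sephol g"
    unfolding sephol_def hol_in_def
  proof (intro allI conjI ballI cg)
    fix j and z :: "complex ^ 'n" assume z: "z \<in> polydisk"
    have e: "?T (upd z j w) = upd (?T z) j (a $ j + of_real (1 - r) * w)" for w
      by (simp add: aff_def vec_eq_iff upd_nth)
    have "(\<lambda>w. f (upd (?T z) j w)) \<circ> (\<lambda>w. a $ j + of_real (1 - r) * w) holomorphic_on ball 0 1"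
    proof (rule holomorphic_on_compose_gen)
      show "(\<lambda>w. f (upd (?T z) j w)) holomorphic_on ball 0 1"
        using f(1) TD[OF z] by (auto simp: sephol_def hol_in_def)
      show "(\<lambda>w. a $ j + of_real (1 - r) * w) ` ball 0 1 \<subseteq> ball 0 1"
      proof safe
        fix w :: complex assume w: "w \<in> ball 0 1"
        have "norm (a $ j + of_real (1 - r) * w) \<le> norm (a $ j) + norm (of_real (1 - r) * w)" by (rule norm_triangle_ineq)
        also have "norm (of_real (1 - r) * w) = (1 - r) * norm w" unfolding norm_mult nr ..
        also have "norm (a $ j) + (1 - r) * norm w < r + (1 - r) * 1"
          using w a r by (intro add_le_less_mono mult_strict_left_mono) (auto simp: cpoly_def)
        finally show "a $ j + of_real (1 - r) * w \<in> ball 0 1" by simp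
      qed
    qed (auto intro!: holomorphic_intros)
    thus "(\<lambda>w. g (upd z j w)) holomorphic_on ball 0 1" by (simp add: g_def e o_def)
  qed
  have cf2: "continuous_on polydisk (\<lambda>z. (norm (f z))\<^sup>2)" and cg2: "continuous_on polydisk (\<lambda>z. (norm (g z))\<^sup>2)"
    using sephol_continuous[OF f(1)] cg by (intro continuous_intros; simp)+
  have m: "(\<lambda>z. indicator ?S z *\<^sub>R (norm (f z))\<^sup>2) \<in> borel_measurable borel"
    using S by (intro borel_measurable_continuous_on_indicator continuous_on_subset[OF cf2 SD])
  have intf: "integrable lborel (\<lambda>z. indicator polydisk z *\<^sub>R (norm (f z))\<^sup>2)"
    using L2_integrable[OF f(2)] pd_integrable_iff[OF cf2] by blast
  have intS: "integrable lborel (\<lambda>z. indicator ?S z *\<^sub>R (norm (f z))\<^sup>2)"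
    by (rule Bochner_Integration.integrable_bound[OF intf]) (use m SD in \<open>auto simp: indicator_def intro!: AE_I2\<close>)
  have eqg: "indicator ?S (?T z) *\<^sub>R (norm (f (?T z)))\<^sup>2 = indicator polydisk z *\<^sub>R (norm (g z))\<^sup>2" for z
    using TS[of z] by (simp add: g_def indicator_def)
  have "integrable lborel (\<lambda>z. indicator polydisk z *\<^sub>R (norm (g z))\<^sup>2)"
    using intS aff_integral(2)[OF _ m, of "\<lambda>_. 1 - r" a] r by (simp only: eqg)
  hence gL: "g \<in> L2" using pd_integrable_iff[OF cg2] by (intro L2_spaceI pd_measurable cg) blast
  have "c * (nrm g)\<^sup>2 = (LINT z|lborel. indicator ?S z *\<^sub>R (norm (f z))\<^sup>2)"
    using aff_integral(1)[OF _ m, of "\<lambda>_. 1 - r" a] r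
    by (simp only: eqg) (simp add: L2_norm_sq pd_integral[OF cg2] c_def)
  also have "\<dots> \<le> (LINT z|lborel. indicator polydisk z *\<^sub>R (norm (f z))\<^sup>2)"
    using SD by (intro integral_mono_AE intS intf AE_I2) (auto simp: indicator_def)
  also have "\<dots> = (nrm f)\<^sup>2" by (simp add: L2_norm_sq pd_integral[OF cf2])
  finally have "(nrm g)\<^sup>2 \<le> (nrm f)\<^sup>2 / c" using c by (simp add: field_simps)
  hence "sqrt ((nrm g)\<^sup>2) \<le> sqrt ((nrm f)\<^sup>2 / c)" by (rule real_sqrt_le_mono)
  hence ng: "nrm g \<le> sqrt (1 / c) * nrm f" by (simp add: real_sqrt_divide)
  have "g 0 = f a" by (simp add: g_def aff_def vec_eq_iff)
  hence "norm (f a) * V\<^sup>2 = norm (ip g (\<lambda>_. 1))"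
    using sephol_mean_value[OF g gL] by (simp add: norm_mult V_def norm_power)
  also have "\<dots> \<le> nrm g * V" unfolding V_def by (rule L2_cauchy_schwarz[OF gL one_in_L2])
  also have "\<dots> \<le> sqrt (1 / c) * nrm f * V" using ng V by (intro mult_right_mono) auto
  finally show "norm (f a) \<le> sqrt (1 / c) / V * nrm f" using V by (simp add: field_simps power2_eq_square)
qed

lemma A2_norm_zero:
  assumes f: "f \<in> A2" "nrm f = 0" shows "f = (\<lambda>_. 0)"
proof
  fix z
  show "f z = 0"
  proof (cases "z \<in> polydisk")
    case True
    obtain r where r: "0 < r" "r < 1" "z \<in> interior (cpoly r)" using polydisk_interior_cpoly[OF True] .
    have z: "z \<in> cpoly r" using r interior_subset by blast
    obtain K where "\<And>f a. sephol f \<Longrightarrow> f \<in> L2 \<Longrightarrow> a \<in> (cpoly r :: (complex ^ 'a) set) \<Longrightarrow> norm (f a) \<le> K * nrm f"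
      using point_evaluation_bound[OF r(1,2)] by metis
    from this[OF A2_sephol[OF f(1)] A2_L2[OF f(1)] z] show ?thesis using f by simp
  qed (use A2_off[OF f(1)] in auto)
qed

lemma A2_add: "f \<in> A2 \<Longrightarrow> g \<in> A2 \<Longrightarrow> (\<lambda>z. f z + g z) \<in> A2"
  by (auto simp: A2_iff sephol_def intro: L2_add hol_in_add)

lemma A2_scale: "f \<in> A2 \<Longrightarrow> (\<lambda>z. c * f z) \<in> A2"
  by (auto simp: A2_iff sephol_def intro: L2_scale hol_in_mult hol_in_const)

lemma A2_diff: "f \<in> A2 \<Longrightarrow> g \<in> A2 \<Longrightarrow> (\<lambda>z. f z - g z) \<in> A2"
  using A2_add[of f "\<lambda>z. -1 * g z"] A2_scale[of g "-1"] by simp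

lemma A2_zero: "(\<lambda>_. 0) \<in> A2"
  by (auto simp: A2_iff sephol_def L2_zero hol_in_const)

lemma A2_mult_sephol:
  assumes "f \<in> A2" "sephol \<phi>" "bdd \<phi>"
  shows "(\<lambda>z. \<phi> z * f z) \<in> A2"
  using assms by (auto simp: A2_iff sephol_def intro: L2_mult hol_in_mult)

lemma A2_sequence_limit:
  assumes F: "\<And>n. F n \<in> A2" "\<And>n. nrm (F n) \<le> B"
    and lim: "\<And>r. 0 < r \<Longrightarrow> r < 1 \<Longrightarrow> uniform_limit (cpoly r) F h sequentially"
    and off: "\<And>z. z \<notin> polydisk \<Longrightarrow> h z = 0"
  shows "h \<in> A2" "nrm h \<le> B"
proof -
  have h: "sephol h" by (rule sephol_uniform_limit[OF A2_sephol[OF F(1)] lim])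
  have pt: "(\<lambda>n. F n z) \<longlonglongrightarrow> h z" if zD: "z \<in> polydisk" for z
  proof -
    obtain r where r: "0 < r" "r < 1" "z \<in> interior (cpoly r)" using polydisk_interior_cpoly[OF zD] .
    hence "z \<in> cpoly r" using interior_subset by blast
    thus ?thesis using tendsto_uniform_limitI[OF lim[OF r(1,2)]] by blast
  qed
  note L2_fatou[OF A2_L2[OF F(1)] F(2) pt pd_measurable[OF sephol_continuous[OF h]]]
  thus "h \<in> A2" "nrm h \<le> B" using h off by (auto simp: A2_iff)
qed

lemma cpoly_Cauchy_limit:
  fixes F :: "nat \<Rightarrow> complex ^ 'n \<Rightarrow> complex"
  assumes F: "\<And>r. 0 < r \<Longrightarrow> r < 1 \<Longrightarrow> uniformly_Cauchy_on (cpoly r) F"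
  obtains h where "\<And>z. z \<notin> polydisk \<Longrightarrow> h z = 0" 
    "\<And>r. 0 < r \<Longrightarrow> r < 1 \<Longrightarrow> uniform_limit (cpoly r) F h sequentially"
proof
  let ?h = "\<lambda>z. if z \<in> polydisk then lim (\<lambda>n. F n z) else 0"
  fix r :: real assume r: "0 < r" "r < 1"
  have "uniformly_convergent_on (cpoly r) F" using F[OF r] by (rule Cauchy_uniformly_convergent)
  then obtain l where l: "uniform_limit (cpoly r) F l sequentially" by (auto simp: uniformly_convergent_on_def)
  have "l z = ?h z" if "z \<in> cpoly r" for z
    using tendsto_uniform_limitI[OF l that] that cpoly_subset_polydisk[OF r(2)] limI by force
  thus "uniform_limit (cpoly r) F ?h sequentially" using l uniform_limit_cong'[of "cpoly r" F F l ?h] by simp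
qed simp

text \<open>Point evaluations turn norm Cauchy sequences into locally uniform ones, which supplies a
  holomorphic limit; Fatou's lemma brings the convergence back to the norm.\<close>

lemma A2_complete:
  fixes F :: "nat \<Rightarrow> complex ^ 'n \<Rightarrow> complex"
  assumes F: "\<And>n. F n \<in> A2" and cauchy: "\<And>e. e > 0 \<Longrightarrow> \<exists>N. \<forall>m\<ge>N. \<forall>n\<ge>N. nrm (\<lambda>z. F m z - F n z) < e"
  obtains h where "h \<in> A2" "(\<lambda>n. nrm (\<lambda>z. F n z - h z)) \<longlonglongrightarrow> 0"
proof -
  have "uniformly_Cauchy_on (cpoly r) F" if r: "0 < r" "r < 1" for r
  proof -
    obtain K where K: "K \<ge> 0" "\<And>f a. sephol f \<Longrightarrow> f \<in> L2 \<Longrightarrow> a \<in> (cpoly r :: (complex ^ 'n) set) \<Longrightarrow> norm (f a) \<le> K * nrm f"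
      using point_evaluation_bound[OF r] by metis
    show ?thesis
      unfolding uniformly_Cauchy_on_def
    proof (intro allI impI)
      fix e :: real assume e: "e > 0"
      hence "e / (K + 1) > 0" using K(1) by simp
      from cauchy[OF this] obtain N where N: "\<And>m n. m \<ge> N \<Longrightarrow> n \<ge> N \<Longrightarrow> nrm (\<lambda>z. F m z - F n z) < e / (K + 1)"
        by blast
      show "\<exists>M. \<forall>x\<in>cpoly r. \<forall>m\<ge>M. \<forall>n\<ge>M. dist (F m x) (F n x) < e"
      proof (intro exI ballI allI impI)
        fix x :: "complex ^ 'n" and m n assume x: "x \<in> cpoly r" and mn: "m \<ge> N" "n \<ge> N"
        have d: "(\<lambda>z. F m z - F n z) \<in> A2" by (intro A2_diff F)
        have "dist (F m x) (F n x) \<le> K * nrm (\<lambda>z. F m z - F n z)"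
          unfolding dist_norm using K(2)[OF A2_sephol[OF d] A2_L2[OF d] x] .
        also have "\<dots> \<le> K * (e / (K + 1))" using N[OF mn] K by (intro mult_left_mono) auto
        also have "\<dots> < e" using K e by (simp add: field_simps)
        finally show "dist (F m x) (F n x) < e" .
      qed
    qed
  qed
  then obtain h where off: "\<And>z. z \<notin> polydisk \<Longrightarrow> h z = 0" 
    and unif: "\<And>r. 0 < r \<Longrightarrow> r < 1 \<Longrightarrow> uniform_limit (cpoly r) F h sequentially"
    using cpoly_Cauchy_limit by blast
  obtain N0 where N0: "\<And>n. n \<ge> N0 \<Longrightarrow> nrm (\<lambda>z. F n z - F N0 z) < 1"
    using cauchy[OF zero_less_one] by blast
  have shift: "uniform_limit (cpoly r) (\<lambda>n. F (n + N)) h sequentially" if r: "0 < r" "r < 1" for r N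
  proof (rule uniform_limitI)
    fix e :: real assume "e > 0"
    from uniform_limitD[OF unif[OF r] this]
    show "\<forall>\<^sub>F n in sequentially. \<forall>x\<in>cpoly r. dist (F (n + N) x) (h x) < e"
      by (rule sequentially_offset)
  qed
  have hA: "h \<in> A2"
  proof (rule A2_sequence_limit(1)[of "\<lambda>n. F (n + N0)" "nrm (F N0) + 1"])
    show "nrm (F (n + N0)) \<le> nrm (F N0) + 1" for n
      using L2_norm_triangle_sub[OF A2_L2[OF F[of "n + N0"]] A2_L2[OF F[of N0]]] N0[of "n + N0"] by simp
  qed (use F shift off in auto)
  have "(\<lambda>n. nrm (\<lambda>z. F n z - h z)) \<longlonglongrightarrow> 0"
  proof (rule LIMSEQ_I)
    fix e :: real assume e: "e > 0"
    hence "e / 2 > 0" by simp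
    from cauchy[OF this] obtain N where N: "\<And>m n. m \<ge> N \<Longrightarrow> n \<ge> N \<Longrightarrow> nrm (\<lambda>z. F m z - F n z) < e / 2"
      by blast
    show "\<exists>N. \<forall>n\<ge>N. norm (nrm (\<lambda>z. F n z - h z) - 0) < e"
    proof (intro exI allI impI)
      fix n assume n: "n \<ge> N"
      \<comment> \<open>The bound for \<open>F n - F (m + N)\<close> passes to the limit in m with n
        fixed.\<close>
      have "nrm (\<lambda>z. F n z - h z) \<le> e / 2"
      proof (rule A2_sequence_limit(2)[of "\<lambda>m z. F n z - F (m + N) z"])
        show "nrm (\<lambda>z. F n z - F (m + N) z) \<le> e / 2" for m using N[of n "m + N"] n by simp
        show "uniform_limit (cpoly r) (\<lambda>m z. F n z - F (m + N) z) (\<lambda>z. F n z - h z) sequentially" if "0 < r" "r < 1" for r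
          by (intro uniform_limit_intros shift that)
        show "(\<lambda>z. F n z - F (m + N) z) \<in> A2" for m by (intro A2_diff F)
      qed (use A2_off[OF F] off in auto)
      thus "norm (nrm (\<lambda>z. F n z - h z) - 0) < e" using e by simp
    qed
  qed
  thus ?thesis using that hA by blast
qed

subsection \<open>The Bergman projection and Toeplitz operators\<close>

abbreviation proj :: "(complex ^ 'n \<Rightarrow> complex) \<Rightarrow> (complex ^ 'n \<Rightarrow> complex)" where
  "proj \<equiv> bergman_projection polydisk"
abbreviation T :: "(complex ^ 'n \<Rightarrow> complex) \<Rightarrow> (complex ^ 'n \<Rightarrow> complex) \<Rightarrow> (complex ^ 'n \<Rightarrow> complex)" where
  "T \<equiv> toeplitz polydisk"

lemma A2_ext: "f \<in> A2 \<Longrightarrow> g \<in> A2 \<Longrightarrow> (\<And>z. z \<in> polydisk \<Longrightarrow> f z = g z) \<Longrightarrow> f = g"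
  using A2_off by (metis ext)

text \<open>The Hilbert space projection theorem: by the parallelogram law a sequence minimising the
  distance to the subspace is Cauchy, and a minimiser is orthogonal by variation.\<close>

lemma proj_exists:
  fixes f :: "complex ^ 'n \<Rightarrow> complex"
  assumes f: "f \<in> L2"
  shows "\<exists>h\<in>A2. \<forall>k\<in>A2. ip (\<lambda>z. f z - h z) k = 0"
proof -
  define D where "D = (\<lambda>h. (nrm (\<lambda>z. f z - h z))\<^sup>2)"
  define d where "d = Inf (D ` A2)"
  have bdd: "bdd_below (D ` A2)" by (rule bdd_belowI[of _ 0]) (auto simp: D_def)
  have ne: "D ` A2 \<noteq> {}" using A2_zero by blast
  have dle: "d \<le> D h" if "h \<in> A2" for h unfolding d_def using bdd that by (intro cInf_lower) auto
  have "\<exists>h\<in>A2. D h < d + 1 / real (Suc n)" for n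
    using cInf_lessD[OF ne, of "d + 1 / real (Suc n)"] by (auto simp: d_def)
  then obtain H where H: "\<And>n. H n \<in> A2" "\<And>n. D (H n) < d + 1 / real (Suc n)" by metis
  have fh: "(\<lambda>z. f z - h z) \<in> L2" if "h \<in> A2" for h by (intro L2_diff f A2_L2 that)
  \<comment> \<open>The midpoint of two near-minimisers lies in the space, so its distance is
    bounded below by the infimum \<open>d\<close>.\<close>
  have close: "(nrm (\<lambda>z. H m z - H n z))\<^sup>2 \<le> 2 * (D (H m) - d) + 2 * (D (H n) - d)" for m n
  proof -
    have mid: "(\<lambda>z. (1/2) * (H m z + H n z)) \<in> A2" by (intro A2_scale A2_add H)
    have "(nrm (\<lambda>z. (f z - H n z) + (f z - H m z)))\<^sup>2 + (nrm (\<lambda>z. (f z - H n z) - (f z - H m z)))\<^sup>2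
       = 2 * D (H n) + 2 * D (H m)"
      unfolding D_def by (rule L2_parallelogram[OF fh[OF H(1)] fh[OF H(1)]])
    moreover have "(\<lambda>z. (f z - H n z) - (f z - H m z)) = (\<lambda>z. H m z - H n z)" by auto
    moreover have "(\<lambda>z. (f z - H n z) + (f z - H m z)) = (\<lambda>z. 2 * (f z - (1/2) * (H m z + H n z)))"
      by (auto simp: algebra_simps)
    moreover have "(nrm (\<lambda>z. 2 * (f z - (1/2) * (H m z + H n z))))\<^sup>2 = 4 * D (\<lambda>z. (1/2) * (H m z + H n z))"
      unfolding D_def L2_norm_scale by (simp add: power_mult_distrib)
    moreover have "4 * d \<le> 4 * D (\<lambda>z. (1/2) * (H m z + H n z))" using dle[OF mid] by simp
    moreover define W where "W = D (\<lambda>z. (1/2) * (H m z + H n z))"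
    ultimately have "4 * W + (nrm (\<lambda>z. H m z - H n z))\<^sup>2 = 2 * D (H n) + 2 * D (H m)" "4 * d \<le> 4 * W"
      by (simp_all only: W_def)
    moreover have "N \<le> 2 * (y - d) + 2 * (x - d)" if "4 * w + N = 2 * x + 2 * y" "4 * d \<le> 4 * w" for w N x y :: real
      using that by argo
    ultimately show ?thesis by blast
  qed
  obtain h where h: "h \<in> A2" "(\<lambda>n. nrm (\<lambda>z. H n z - h z)) \<longlonglongrightarrow> 0"
  proof (rule A2_complete[OF H(1)])
    fix e :: real assume e: "e > 0"
    have "(\<lambda>n. 4 * (1 / real (Suc n))) \<longlonglongrightarrow> 4 * 0" by (intro tendsto_intros LIMSEQ_Suc[OF lim_1_over_n])
    moreover have "4 * 0 < e\<^sup>2" using e by simp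
    ultimately have "\<forall>\<^sub>F n in sequentially. 4 * (1 / real (Suc n)) < e\<^sup>2" by (rule order_tendstoD(2))
    then obtain N where N: "\<And>n. n \<ge> N \<Longrightarrow> 4 * (1 / real (Suc n)) < e\<^sup>2" unfolding eventually_sequentially by blast
    show "\<exists>N. \<forall>m\<ge>N. \<forall>n\<ge>N. nrm (\<lambda>z. H m z - H n z) < e"
    proof (intro exI allI impI)
      fix m n assume mn: "m \<ge> N" "n \<ge> N"
      have "(nrm (\<lambda>z. H m z - H n z))\<^sup>2 \<le> 2 * (1 / real (Suc m)) + 2 * (1 / real (Suc n))"
        using close[of m n] H(2)[of m] H(2)[of n] by argo
      also have "\<dots> < e\<^sup>2" using N[OF mn(1)] N[OF mn(2)] by linarith
      finally show "nrm (\<lambda>z. H m z - H n z) < e" using e by (intro power2_less_imp_less[of _ e]) auto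
    qed
  qed blast
  have sqrt_le: "nrm (\<lambda>z. f z - h z) \<le> sqrt (d + 1 / real (Suc n)) + nrm (\<lambda>z. H n z - h z)" for n
  proof -
    have "nrm (\<lambda>z. (f z - H n z) + (H n z - h z)) \<le> nrm (\<lambda>z. f z - H n z) + nrm (\<lambda>z. H n z - h z)"
      by (rule L2_norm_triangle[OF fh[OF H(1)] L2_diff[OF A2_L2[OF H(1)] A2_L2[OF h(1)]]])
    moreover have "nrm (\<lambda>z. f z - H n z) \<le> sqrt (d + 1 / real (Suc n))"
      using H(2)[of n] by (intro real_le_rsqrt) (simp add: D_def)
    ultimately show ?thesis by simp
  qed
  have "(\<lambda>n. sqrt (d + 1 / real (Suc n)) + nrm (\<lambda>z. H n z - h z)) \<longlonglongrightarrow> sqrt (d + 0) + 0"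
    by (intro tendsto_intros LIMSEQ_Suc[OF lim_1_over_n] h(2))
  hence "nrm (\<lambda>z. f z - h z) \<le> sqrt (d + 0) + 0"
    by (intro LIMSEQ_le_const) (use sqrt_le in auto)
  hence nle: "nrm (\<lambda>z. f z - h z) \<le> sqrt d" by simp
  have d0: "0 \<le> d" unfolding d_def using ne by (intro cInf_greatest) (auto simp: D_def)
  have min: "D h \<le> D h'" if "h' \<in> A2" for h'
  proof -
    have "D h \<le> d" using power_mono[OF nle L2_norm_nonneg, of 2] d0 by (simp add: D_def)
    thus ?thesis using dle[OF that] by (rule order_trans)
  qed
  have "ip (\<lambda>z. f z - h z) k = 0" if k: "k \<in> A2" for k
  proof -
    let ?v = "\<lambda>z. f z - h z"
    define a where "a = ip ?v k"
    \<comment> \<open>Small enough for the quadratic term of the variation to stay below the linear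
      one; the summand 1 keeps it defined when \<open>k\<close> has norm zero.\<close>
    define t where "t = 1 / ((nrm k)\<^sup>2 + 1)"
    have p: "0 < (nrm k)\<^sup>2 + 1" by (rule add_nonneg_pos) auto
    hence t: "t > 0" "t * (nrm k)\<^sup>2 < 1"
      unfolding t_def by (simp, simp add: divide_less_eq_1_pos)
    have hk: "(\<lambda>z. h z + (of_real t * a) * k z) \<in> A2" by (intro A2_add A2_scale h k)
    have "D h \<le> (nrm (\<lambda>z. ?v z - (of_real t * a) * k z))\<^sup>2"
      using min[OF hk] by (simp add: D_def diff_diff_eq)
    also have "\<dots> = D h - 2 * Re (ip ?v (\<lambda>z. (of_real t * a) * k z)) + (nrm (\<lambda>z. (of_real t * a) * k z))\<^sup>2"
      unfolding D_def by (rule L2_norm_sq_diff[OF fh[OF h(1)] L2_scale[OF A2_L2[OF k]]])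
    also have "ip ?v (\<lambda>z. (of_real t * a) * k z) = of_real (t * (norm a)\<^sup>2)"
    proof -
      have "a * cnj a = of_real ((norm a)\<^sup>2)" by (rule complex_norm_square[symmetric])
      thus ?thesis unfolding L2_inner_scale_right by (simp add: a_def[symmetric] mult_ac)
    qed
    also have "(nrm (\<lambda>z. (of_real t * a) * k z))\<^sup>2 = t\<^sup>2 * (norm a)\<^sup>2 * (nrm k)\<^sup>2"
      unfolding L2_norm_scale by (simp add: norm_mult power_mult_distrib)
    finally have "2 * (t * (norm a)\<^sup>2) \<le> t\<^sup>2 * (norm a)\<^sup>2 * (nrm k)\<^sup>2" by simp
    also have "\<dots> = (t * (norm a)\<^sup>2) * (t * (nrm k)\<^sup>2)" by (simp add: power2_eq_square)
    also have "\<dots> \<le> (t * (norm a)\<^sup>2) * 1" using t by (intro mult_left_mono) auto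
    finally have "t * (norm a)\<^sup>2 \<le> 0" by simp
    hence "(norm a)\<^sup>2 \<le> 0" using t by (simp add: mult_le_0_iff)
    thus ?thesis by (simp add: a_def)
  qed
  thus ?thesis using h(1) by blast
qed

lemma proj_unique:
  fixes f :: "complex ^ 'n \<Rightarrow> complex"
  assumes f: "f \<in> L2" and h: "h \<in> A2" "\<And>k. k \<in> A2 \<Longrightarrow> ip (\<lambda>z. f z - h z) k = 0"
    and h': "h' \<in> A2" "\<And>k. k \<in> A2 \<Longrightarrow> ip (\<lambda>z. f z - h' z) k = 0"
  shows "h = h'"
proof -
  let ?d = "\<lambda>z. h z - h' z"
  have d: "?d \<in> A2" by (intro A2_diff h h')
  have "ip ?d ?d = ip (\<lambda>z. (f z - h' z) - (f z - h z)) ?d" by (intro L2_inner_cong) auto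
  also have "\<dots> = 0"
    unfolding L2_inner_diff_left[OF L2_diff[OF f A2_L2[OF h'(1)]] L2_diff[OF f A2_L2[OF h(1)]] A2_L2[OF d]]
    using h(2)[OF d] h'(2)[OF d] by simp
  finally have "nrm ?d = 0" unfolding L2_inner_self by simp
  from A2_norm_zero[OF d this] have "h z - h' z = 0" for z by metis
  thus ?thesis by (simp add: fun_eq_iff)
qed

text \<open>Existence and uniqueness together give meaning to the definite description; every later
  fact on projections goes through the orthogonality obtained here.\<close>

lemma proj_works:
  fixes f :: "complex ^ 'n \<Rightarrow> complex"
  assumes f: "f \<in> L2"
  shows "proj f \<in> A2 \<and> (\<forall>k\<in>A2. ip (\<lambda>z. f z - proj f z) k = 0)"
proof -
  let ?P = "\<lambda>h. h \<in> A2 \<and> (\<forall>k\<in>A2. ip (\<lambda>z. f z - h z) k = 0)"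
  have "\<exists>!h. ?P h" using proj_exists[OF f] proj_unique[OF f] by blast
  hence "?P (THE h. ?P h)" by (rule theI')
  thus ?thesis unfolding bergman_projection_def .
qed

lemma proj_A2: "f \<in> L2 \<Longrightarrow> proj f \<in> A2"
  and proj_orth: "f \<in> L2 \<Longrightarrow> k \<in> A2 \<Longrightarrow> ip (\<lambda>z. f z - proj f z) k = 0"
  using proj_works by blast+

lemma proj_L2: "f \<in> L2 \<Longrightarrow> proj f \<in> L2"
  by (rule A2_L2[OF proj_A2])

lemma ip_proj: "f \<in> L2 \<Longrightarrow> k \<in> A2 \<Longrightarrow> ip (proj f) k = ip f k"
  using proj_orth[of f k] by (simp add: L2_inner_diff_left proj_L2 A2_L2)

lemma ip_proj_right: "f \<in> L2 \<Longrightarrow> k \<in> A2 \<Longrightarrow> ip k (proj f) = ip k f"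
  using ip_proj[of f k] by (simp add: L2_inner_cnj[of _ k])

lemma proj_eqI:
  fixes f :: "complex ^ 'n \<Rightarrow> complex"
  assumes f: "f \<in> L2" and h: "h \<in> A2" and eq: "\<And>k. k \<in> A2 \<Longrightarrow> ip f k = ip h k"
  shows "proj f = h"
proof (rule proj_unique[OF f proj_A2[OF f] proj_orth[OF f] h])
  fix k :: "complex ^ 'n \<Rightarrow> complex" assume k: "k \<in> A2"
  show "ip (\<lambda>z. f z - h z) k = 0"
    unfolding L2_inner_diff_left[OF f A2_L2[OF h] A2_L2[OF k]] using eq[OF k] by simp
qed

lemma proj_id: "f \<in> A2 \<Longrightarrow> proj f = f"
  by (rule proj_eqI[OF A2_L2]) auto

lemma proj_add:
  fixes f :: "complex ^ 'n \<Rightarrow> complex"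
  assumes f: "f \<in> L2" and g: "g \<in> L2"
  shows "proj (\<lambda>z::complex ^ 'n. f z + g z) = (\<lambda>z. proj f z + proj g z)"
proof (rule proj_eqI)
  show "(\<lambda>z. f z + g z) \<in> L2" by (rule L2_add[OF f g])
  show "(\<lambda>z. proj f z + proj g z) \<in> A2" by (rule A2_add[OF proj_A2[OF f] proj_A2[OF g]])
  fix k :: "complex ^ 'n \<Rightarrow> complex" assume k: "k \<in> A2"
  show "ip (\<lambda>z. f z + g z) k = ip (\<lambda>z. proj f z + proj g z) k"
    unfolding L2_inner_add_left[OF f g A2_L2[OF k]] L2_inner_add_left[OF proj_L2[OF f] proj_L2[OF g] A2_L2[OF k]]
      ip_proj[OF f k] ip_proj[OF g k] ..
qed

lemma proj_diff:
  fixes f :: "complex ^ 'n \<Rightarrow> complex"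
  assumes f: "f \<in> L2" and g: "g \<in> L2"
  shows "proj (\<lambda>z::complex ^ 'n. f z - g z) = (\<lambda>z. proj f z - proj g z)"
proof (rule proj_eqI)
  show "(\<lambda>z. f z - g z) \<in> L2" by (rule L2_diff[OF f g])
  show "(\<lambda>z. proj f z - proj g z) \<in> A2" by (rule A2_diff[OF proj_A2[OF f] proj_A2[OF g]])
  fix k :: "complex ^ 'n \<Rightarrow> complex" assume k: "k \<in> A2"
  show "ip (\<lambda>z. f z - g z) k = ip (\<lambda>z. proj f z - proj g z) k"
    unfolding L2_inner_diff_left[OF f g A2_L2[OF k]] L2_inner_diff_left[OF proj_L2[OF f] proj_L2[OF g] A2_L2[OF k]]
      ip_proj[OF f k] ip_proj[OF g k] ..
qed

lemma proj_scale:
  assumes f: "f \<in> L2" shows "proj (\<lambda>z. c * f z) = (\<lambda>z. c * proj f z)"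
  by (rule proj_eqI[OF L2_scale[OF f] A2_scale[OF proj_A2[OF f]]]) (simp add: L2_inner_scale_left ip_proj[OF f])

lemma nrm_proj_pythagoras:
  assumes f: "f \<in> L2"
  shows "(nrm f)\<^sup>2 = (nrm (proj f))\<^sup>2 + (nrm (\<lambda>z. f z - proj f z))\<^sup>2"
proof -
  have "(nrm (\<lambda>z. (f z - proj f z) + proj f z))\<^sup>2
      = (nrm (\<lambda>z. f z - proj f z))\<^sup>2 + 2 * Re (ip (\<lambda>z. f z - proj f z) (proj f)) + (nrm (proj f))\<^sup>2"
    by (rule L2_norm_sq_add[OF L2_diff[OF f proj_L2[OF f]] proj_L2[OF f]])
  thus ?thesis using proj_orth[OF f proj_A2[OF f]] by simp
qed

lemma nrm_proj_le: "f \<in> L2 \<Longrightarrow> nrm (proj f) \<le> nrm f"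
  by (rule power2_le_imp_le) (simp_all add: nrm_proj_pythagoras)

lemma nrm_coproj_le: "f \<in> L2 \<Longrightarrow> nrm (\<lambda>z. f z - proj f z) \<le> nrm f"
  by (rule power2_le_imp_le) (simp_all add: nrm_proj_pythagoras)

section \<open>Algebraic rules for Toeplitz operators\<close>

lemma T_eq: "T \<phi> f = proj (\<lambda>z. \<phi> z * f z)"
  by (simp add: toeplitz_def)

lemma sym_L2: "bdd \<phi> \<Longrightarrow> f \<in> A2 \<Longrightarrow> (\<lambda>z. \<phi> z * f z) \<in> L2"
  by (intro L2_mult A2_L2)

lemma T_A2: "bdd \<phi> \<Longrightarrow> f \<in> A2 \<Longrightarrow> T \<phi> f \<in> A2"
  unfolding T_eq by (intro proj_A2 sym_L2)

lemma T_L2: "bdd \<phi> \<Longrightarrow> f \<in> A2 \<Longrightarrow> T \<phi> f \<in> L2"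
  by (intro A2_L2 T_A2)

lemma ip_T: "bdd \<phi> \<Longrightarrow> f \<in> A2 \<Longrightarrow> k \<in> A2 \<Longrightarrow> ip (T \<phi> f) k = ip (\<lambda>z. \<phi> z * f z) k"
  unfolding T_eq by (rule ip_proj[OF sym_L2])

lemma T_eqI:
  assumes "bdd \<phi>" "f \<in> A2" "h \<in> A2" "\<And>k. k \<in> A2 \<Longrightarrow> ip (\<lambda>z. \<phi> z * f z) k = ip h k"
  shows "T \<phi> f = h"
  unfolding T_eq using assms by (intro proj_eqI sym_L2)

lemma T_adjoint:
  assumes "bdd \<phi>" "f \<in> A2" "g \<in> A2"
  shows "ip (T \<phi> f) g = ip f (T (\<lambda>z. cnj (\<phi> z)) g)"
proof -
  have "ip f (T (\<lambda>z. cnj (\<phi> z)) g) = ip f (\<lambda>z. cnj (\<phi> z) * g z)"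
    unfolding T_eq by (intro ip_proj_right sym_L2 bdd_symbol_cnj assms)
  thus ?thesis using assms by (simp add: ip_T L2_inner_mult)
qed

lemma T_add: "bdd \<phi> \<Longrightarrow> f \<in> A2 \<Longrightarrow> g \<in> A2 \<Longrightarrow> T \<phi> (\<lambda>z. f z + g z) = (\<lambda>z. T \<phi> f z + T \<phi> g z)"
  unfolding T_eq distrib_left by (intro proj_add sym_L2)

lemma T_diff: "bdd \<phi> \<Longrightarrow> f \<in> A2 \<Longrightarrow> g \<in> A2 \<Longrightarrow> T \<phi> (\<lambda>z. f z - g z) = (\<lambda>z. T \<phi> f z - T \<phi> g z)"
  unfolding T_eq right_diff_distrib by (intro proj_diff sym_L2)

lemma T_scale: "bdd \<phi> \<Longrightarrow> f \<in> A2 \<Longrightarrow> T \<phi> (\<lambda>z. c * f z) = (\<lambda>z. c * T \<phi> f z)"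
  unfolding T_eq mult.left_commute[of _ c] by (intro proj_scale sym_L2)

lemma T_sym_add: "bdd \<phi> \<Longrightarrow> bdd \<psi> \<Longrightarrow> f \<in> A2 \<Longrightarrow> T (\<lambda>z. \<phi> z + \<psi> z) f = (\<lambda>z. T \<phi> f z + T \<psi> f z)"
  unfolding T_eq distrib_right by (intro proj_add sym_L2)

lemma T_sym_diff: "bdd \<phi> \<Longrightarrow> bdd \<psi> \<Longrightarrow> f \<in> A2 \<Longrightarrow> T (\<lambda>z. \<phi> z - \<psi> z) f = (\<lambda>z. T \<phi> f z - T \<psi> f z)"
  unfolding T_eq left_diff_distrib by (intro proj_diff sym_L2)

lemma T_norm_le:
  assumes "bdd \<phi>" "f \<in> A2" "\<And>z. z \<in> polydisk \<Longrightarrow> norm (\<phi> z) \<le> C" "0 \<le> C"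
  shows "nrm (T \<phi> f) \<le> C * nrm f"
  unfolding T_eq
  using nrm_proj_le[OF sym_L2[OF assms(1,2)]] L2_norm_mult_le[OF assms(1) A2_L2[OF assms(2)] assms(3,4)]
  by linarith

lemma T_holomorphic:
  assumes "bdd \<phi>" "sephol \<phi>" "f \<in> A2" shows "T \<phi> f = (\<lambda>z. \<phi> z * f z)"
  unfolding T_eq by (intro proj_id A2_mult_sephol assms)

lemma T_T_holomorphic:
  assumes "bdd \<phi>" "sephol \<phi>" "bdd h" "f \<in> A2"
  shows "T h (T \<phi> f) = T (\<lambda>z. h z * \<phi> z) f"
  using assms by (simp add: T_holomorphic) (simp add: T_eq mult.assoc)

text \<open>The adjoint counterpart of \<open>T_T_holomorphic\<close>: a conjugate holomorphic
  factor moves to the test function, where it acts as multiplication within the Bergman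
  space.\<close>

lemma T_antiholomorphic_T:
  fixes f :: "complex ^ 'n \<Rightarrow> complex"
  assumes "bdd \<phi>" "sephol \<phi>" "bdd h" "f \<in> A2"
  shows "T (\<lambda>z. cnj (\<phi> z)) (T h f) = T (\<lambda>z. cnj (\<phi> z) * h z) f"
proof (rule T_eqI[symmetric])
  show "bdd (\<lambda>z. cnj (\<phi> z) * h z)" "T (\<lambda>z. cnj (\<phi> z)) (T h f) \<in> A2"
    by (intro bdd_symbol_mult bdd_symbol_cnj T_A2 assms)+
  fix k :: "complex ^ 'n \<Rightarrow> complex" assume k: "k \<in> A2"
  have k': "(\<lambda>z. \<phi> z * k z) \<in> A2" by (intro A2_mult_sephol k assms)
  have "ip (T (\<lambda>z. cnj (\<phi> z)) (T h f)) k = ip (T h f) (\<lambda>z. \<phi> z * k z)"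
    using assms k by (simp add: ip_T bdd_symbol_cnj T_A2 L2_inner_mult)
  also have "\<dots> = ip (\<lambda>z. h z * f z) (\<lambda>z. \<phi> z * k z)" by (rule ip_T[OF assms(3,4) k'])
  also have "\<dots> = ip (\<lambda>z. cnj (\<phi> z) * h z * f z) k"
    unfolding L2_inner_def by (simp add: mult_ac)
  finally show "ip (\<lambda>z. cnj (\<phi> z) * h z * f z) k = ip (T (\<lambda>z. cnj (\<phi> z)) (T h f)) k" by simp
qed (use assms in auto)

lemma bdd_coord: "bdd (\<lambda>z. z $ j)"
  unfolding bdd_symbol_def
  by (auto intro!: exI[of _ 1] pd_measurable continuous_intros simp: polydisk_nth less_imp_le)

lemma sephol_coord: "sephol (\<lambda>z. z $ j)"
  by (simp add: sephol_def hol_in_coord)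

lemma A2_coord: "f \<in> A2 \<Longrightarrow> (\<lambda>z. z $ j * f z) \<in> A2"
  by (intro A2_mult_sephol sephol_coord bdd_coord)

section \<open>Toeplitz operators with symbols free of z_j, degree by degree\<close>

lemma hol_in_indep:
  assumes "continuous_on polydisk h" "indep j h" shows "hol_in j h"
  using assms by (simp add: hol_in_def indepD)

lemma hom_part_A2:
  assumes f: "f \<in> A2" shows "hom_part j m f \<in> A2"
  unfolding A2_iff
proof (intro conjI allI impI)
  show "hom_part j m f \<in> L2" by (rule L2_hom_part(1)[OF A2_hol_in[OF f] A2_L2[OF f]])
  show "sephol (hom_part j m f)" by (rule sephol_hom_part[OF A2_sephol[OF f]])
qed (simp add: hom_part_def)

lemma hom_part_diff:
  assumes u: "hol_in j u" "hol_in j v" and z: "z \<in> polydisk"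
  shows "hom_part j m (\<lambda>z. u z - v z) z = hom_part j m u z - hom_part j m v z"
proof -
  have d: "hol_in j (\<lambda>z. u z - v z)"
    using hol_in_add[OF u(1) hol_in_mult[OF hol_in_const[of j "-1"] u(2)]] by simp
  have "root_avg j m M (\<lambda>z. u z - v z) z = root_avg j m M u z - root_avg j m M v z" for M
    by (simp add: root_avg_def sum_subtractf right_diff_distrib diff_divide_distrib)
  hence "(\<lambda>M. root_avg j m M u z - root_avg j m M v z) \<longlonglongrightarrow> hom_part j m (\<lambda>z. u z - v z) z"
    using root_avg_tendsto[OF d z, of m] by simp
  moreover have "(\<lambda>M. root_avg j m M u z - root_avg j m M v z) \<longlonglongrightarrow> hom_part j m u z - hom_part j m v z"
    by (intro tendsto_intros root_avg_tendsto u z)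
  ultimately show ?thesis by (rule LIMSEQ_unique)
qed

lemma L2_homogeneous:
  assumes c: "continuous_on polydisk u" and i: "indep j u" and L: "(\<lambda>z. (z $ j) ^ m * u z) \<in> L2"
  shows "u \<in> L2"
proof (rule L2_spaceI[OF pd_measurable[OF c]])
  have "integrable pdm (\<lambda>z. of_real ((norm ((z $ j) ^ m * u z))\<^sup>2) :: complex)"
    using L2_integrable[OF L] by (rule integrable_of_real)
  \<comment> \<open>Integrability of homogeneous functions is phrased with powers of z_j itself;
    z_j^(2m) has the same modulus as the squared factor.\<close>
  moreover have "(\<lambda>z. (z $ j) ^ (2 * m) * (u z * cnj (u z))) \<in> borel_measurable pdm"
    by (intro pd_measurable continuous_intros c)
  ultimately have "integrable pdm (\<lambda>z. (z $ j) ^ (2 * m) * (u z * cnj (u z)))"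
    by (rule Bochner_Integration.integrable_bound)
       (auto intro!: AE_I2 simp: norm_mult norm_power power_mult power_mult_distrib power2_eq_square mult_ac)
  moreover have "continuous_on polydisk (\<lambda>z. u z * cnj (u z))" by (intro continuous_intros c)
  moreover have "indep j (\<lambda>z. u z * cnj (u z))" using i by (simp add: indep_def)
  ultimately have "integrable pdm (\<lambda>z. u z * cnj (u z))" using integrable_homogeneous by blast
  hence "integrable pdm (\<lambda>z. Re (u z * cnj (u z)))" by (rule integrable_Re)
  thus "integrable pdm (\<lambda>z. (norm (u z))\<^sup>2)"
    by (simp add: complex_norm_square[symmetric] flip: of_real_power)
qed

lemma ip_homogeneous:
  assumes u: "continuous_on polydisk u" "indep j u" "u \<in> L2" and v: "continuous_on polydisk v" "indep j v" "v \<in> L2"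
  shows "of_nat (Suc m) * ip (\<lambda>z. (z $ j) ^ m * u z) (\<lambda>z. (z $ j) ^ m * v z) = ip u v"
proof -
  have "ip (\<lambda>z. (z $ j) ^ m * u z) (\<lambda>z. (z $ j) ^ m * v z) = (LINT z|pdm. of_real (norm (z $ j) ^ (2 * m)) * (u z * cnj (v z)))"
    unfolding L2_inner_def
  proof (intro Bochner_Integration.integral_cong refl)
    fix z :: "complex ^ 'a"
    have "(z $ j) ^ m * cnj ((z $ j) ^ m) = of_real ((norm ((z $ j) ^ m))\<^sup>2)" by (rule complex_norm_square[symmetric])
    thus "(z $ j) ^ m * u z * cnj ((z $ j) ^ m * v z) = of_real (norm (z $ j) ^ (2 * m)) * (u z * cnj (v z))"
      by (simp add: norm_power power_mult[symmetric] mult_ac)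
  qed
  moreover have "indep j (\<lambda>z. u z * cnj (v z))" using u v by (simp add: indep_def)
  ultimately show ?thesis
    using integral_homogeneous[of "\<lambda>z. u z * cnj (v z)" j m] u v L2_inner_integrable[OF u(3) v(3)]
    by (simp add: L2_inner_def continuous_intros)
qed

lemma taylor_coeff_L2:
  assumes "hol_in j f" "f \<in> L2" shows "taylor_coeff j m f \<in> L2"
proof (rule L2_homogeneous[OF hol_in_continuous[OF hol_in_taylor_coeff[OF assms(1,1)]] indep_taylor_coeff])
  show "(\<lambda>z. (z $ j) ^ m * taylor_coeff j m f z) \<in> L2"
    using L2_hom_part(1)[OF assms, of m] L2_space_cong[of polydisk "hom_part j m f" "\<lambda>z. (z $ j) ^ m * taylor_coeff j m f z"]
    by (simp add: hom_part_eq)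
qed

text \<open>The factor m + 1 is the Bergman weight of z_j^m. Pairings of homogeneous parts become
  pairings of coefficient functions, and operator identities become scalar identities in m.\<close>

lemma ip_hom_coeff:
  assumes u: "hol_in j u" "u \<in> L2" and v: "hol_in j v" "v \<in> L2"
  shows "of_nat (Suc m) * ip (hom_part j m u) v = ip (taylor_coeff j m u) (taylor_coeff j m v)"
proof -
  have "ip (hom_part j m u) v = ip (hom_part j m (hom_part j m u)) v"
    by (rule L2_inner_cong) (simp_all add: hom_part_idem[OF u(1)])
  also have "\<dots> = ip (hom_part j m u) (hom_part j m v)"
    by (rule ip_hom_part[OF hol_in_hom_part[OF u(1,1)] L2_hom_part(1)[OF u] v])
  also have "\<dots> = ip (\<lambda>z. (z $ j) ^ m * taylor_coeff j m u z) (\<lambda>z. (z $ j) ^ m * taylor_coeff j m v z)"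
    by (rule L2_inner_cong) (simp_all add: hom_part_eq)
  finally show ?thesis
    using ip_homogeneous[OF hol_in_continuous[OF hol_in_taylor_coeff[OF u(1,1)]] indep_taylor_coeff taylor_coeff_L2[OF u]
      hol_in_continuous[OF hol_in_taylor_coeff[OF v(1,1)]] indep_taylor_coeff taylor_coeff_L2[OF v]] by simp
qed

lemma taylor_coeff_coord:
  assumes u: "hol_in j u" and z: "z \<in> polydisk"
  shows "taylor_coeff j (Suc m) (\<lambda>z. z $ j * u z) z = taylor_coeff j m u z"
proof -
  have zj: "upd z j (1/2) \<in> polydisk" using z by (intro upd_polydisk) auto
  show ?thesis
    unfolding taylor_coeff_eq_hom_part[OF z] using hom_part_coord_Suc[OF u zj] by (simp add: mult.commute)
qed

lemma taylor_coeff_mult_indep: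
  assumes h: "indep j h" "continuous_on polydisk h" and u: "hol_in j u" and z: "z \<in> polydisk"
  shows "taylor_coeff j m (\<lambda>z. h z * u z) z = h z * taylor_coeff j m u z"
proof -
  have zj: "upd z j (1/2) \<in> polydisk" using z by (intro upd_polydisk) auto
  have hu: "hol_in j (\<lambda>z. h z * u z)" by (intro hol_in_mult hol_in_indep h u)
  show ?thesis
    unfolding taylor_coeff_eq_hom_part[OF z] using hom_part_mult_indep[OF h(1) u hu zj] by (simp add: indepD[OF h(1)])
qed

lemma hom_part_separates:
  assumes X: "X \<in> A2" and 0: "\<And>m. nrm (hom_part j m X) = 0" shows "X = (\<lambda>_. 0)"
proof (rule A2_ext[OF X A2_zero])
  fix z :: "complex ^ 'a" assume z: "z \<in> polydisk"
  have "hom_part j m X = (\<lambda>_. 0)" for m by (rule A2_norm_zero[OF hom_part_A2[OF X] 0])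
  thus "X z = 0" by (intro all_hom_part_zero[OF A2_hol_in[OF X, of j] z]) simp
qed

lemma T_indep_hom_part:
  fixes f :: "complex ^ 'n \<Rightarrow> complex"
  assumes h: "indep j h" "continuous_on polydisk h" "bdd h" and f: "f \<in> A2"
  shows "T h (hom_part j m f) = hom_part j m (T h f)"
proof (rule T_eqI)
  fix k :: "complex ^ 'n \<Rightarrow> complex" assume k: "k \<in> A2"
  have hf: "hol_in j (\<lambda>z. h z * f z)" by (intro hol_in_mult hol_in_indep h A2_hol_in f)
  have "ip (\<lambda>z. h z * hom_part j m f z) k = ip (hom_part j m (\<lambda>z. h z * f z)) k"
    by (intro L2_inner_cong) (simp_all add: hom_part_mult_indep[OF h(1) A2_hol_in[OF f] hf])
  also have "\<dots> = ip (\<lambda>z. h z * f z) (hom_part j m k)"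
    by (rule ip_hom_part[OF hf sym_L2[OF h(3) f] A2_hol_in[OF k] A2_L2[OF k]])
  also have "\<dots> = ip (T h f) (hom_part j m k)"
    by (rule ip_T[OF h(3) f hom_part_A2[OF k], symmetric])
  also have "\<dots> = ip (hom_part j m (T h f)) k"
    by (rule ip_hom_part[OF A2_hol_in[OF T_A2[OF h(3) f]] T_L2[OF h(3) f] A2_hol_in[OF k] A2_L2[OF k], symmetric])
  finally show "ip (\<lambda>z. h z * hom_part j m f z) k = ip (hom_part j m (T h f)) k" .
qed (intro h hom_part_A2 T_A2 f)+

text \<open>Shifts change the degree, so a coefficient of degree m has to be tested against
  coefficients of another degree l; z_j^m times the l-th coefficient is a Bergman function that
  makes this possible.\<close>

lemma coeff_lift:
  fixes k :: "complex ^ 'a \<Rightarrow> complex"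
  assumes k: "k \<in> A2"
  obtains G where "G \<in> A2" "\<And>z. z \<in> polydisk \<Longrightarrow> taylor_coeff j m G z = taylor_coeff j l k z"
proof
  let ?c = "taylor_coeff j l k"
  define G where "G = (\<lambda>z. if z \<in> polydisk then (z $ j) ^ m * ?c z else 0)"
  have G: "G z = (z $ j) ^ m * ?c z" if "z \<in> polydisk" for z using that by (simp add: G_def)
  have c: "hol_in i ?c" for i by (intro hol_in_taylor_coeff A2_hol_in k)
  have pw: "hol_in i (\<lambda>z. (z $ j) ^ m)" for i
    by (induction m) (auto intro: hol_in_const hol_in_mult hol_in_coord)
  have bpw: "bdd (\<lambda>z. (z $ j) ^ m)"
    by (induction m) (auto intro: bdd_symbol_const bdd_symbol_mult bdd_coord)
  have hG: "hol_in i G" for i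
    using hol_in_mult[OF pw c] hol_in_cong[where u = G and v = "\<lambda>z. (z $ j) ^ m * ?c z" and j = i] G by blast
  have "(\<lambda>z. (z $ j) ^ m * ?c z) \<in> L2"
    by (intro L2_mult bpw taylor_coeff_L2 A2_hol_in A2_L2 k)
  hence "G \<in> L2" using L2_space_cong[of polydisk G, OF G] by blast
  thus "G \<in> A2" using hG by (simp add: A2_iff sephol_def G_def)
  fix z :: "complex ^ 'a" assume z: "z \<in> polydisk"
  have zj: "upd z j (1/2) \<in> polydisk" using z by (intro upd_polydisk) auto
  have "hom_part j m G (upd z j (1/2)) = G (upd z j (1/2))"
    by (rule hom_part_homogeneous[OF indep_taylor_coeff hG G zj])
  thus "taylor_coeff j m G z = ?c z"
    using G[OF zj] by (subst taylor_coeff_eq_hom_part[OF z]) (simp add: indepD[OF indep_taylor_coeff] power_divide)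
qed

lemma T_coord: "f \<in> A2 \<Longrightarrow> T (\<lambda>z. z $ j) f = (\<lambda>z. z $ j * f z)"
  by (intro T_holomorphic bdd_coord sephol_coord)

lemma hom_part_ip_cong:
  fixes X :: "complex ^ 'n \<Rightarrow> complex"
  assumes "X \<in> A2" "Y \<in> A2" "\<And>m k. k \<in> A2 \<Longrightarrow> ip (hom_part j m X) k = ip (hom_part j m Y) k"
  shows "X = Y"
proof -
  let ?d = "\<lambda>z. X z - Y z"
  have d: "?d \<in> A2" by (intro A2_diff assms)
  have "nrm (hom_part j m ?d) = 0" for m
  proof -
    have "ip (hom_part j m ?d) (hom_part j m ?d) = ip (\<lambda>z. hom_part j m X z - hom_part j m Y z) (hom_part j m ?d)"
      by (intro L2_inner_cong) (simp_all add: hom_part_diff A2_hol_in assms(1,2))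
    also have "\<dots> = ip (hom_part j m X) (hom_part j m ?d) - ip (hom_part j m Y) (hom_part j m ?d)"
      by (intro L2_inner_diff_left A2_L2 hom_part_A2 assms d)
    also have "\<dots> = 0" using assms(3)[OF hom_part_A2[OF d], of m] by simp
    finally show ?thesis by (simp add: L2_inner_self)
  qed
  from hom_part_separates[OF d this] have "X z - Y z = 0" for z by metis
  thus ?thesis by (simp add: fun_eq_iff)
qed

text \<open>On coefficient functions \<open>T h\<close> acts as multiplication by \<open>h\<close>,
  seen only against other coefficient functions, and in the same way for every degree. This
  uniformity is what makes it commute with the shift.\<close>

lemma T_indep_coeff:
  fixes f :: "complex ^ 'n \<Rightarrow> complex"
  assumes h: "indep j h" "continuous_on polydisk h" "bdd h" and f: "f \<in> A2" and k: "k \<in> A2"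
  shows "ip (taylor_coeff j m (T h f)) (taylor_coeff j l k) = ip (\<lambda>z. h z * taylor_coeff j m f z) (taylor_coeff j l k)"
proof -
  obtain G where G: "G \<in> A2" "\<And>z. z \<in> polydisk \<Longrightarrow> taylor_coeff j m G z = taylor_coeff j l k z"
    using coeff_lift[OF k] by blast
  have hf: "hol_in j (\<lambda>z. h z * f z)" by (intro hol_in_mult hol_in_indep h A2_hol_in f)
  have Tf: "T h f \<in> A2" by (intro T_A2 h f)
  have "ip (taylor_coeff j m (T h f)) (taylor_coeff j l k) = ip (taylor_coeff j m (T h f)) (taylor_coeff j m G)"
    by (intro L2_inner_cong) (simp_all add: G)
  also have "\<dots> = of_nat (Suc m) * ip (hom_part j m (T h f)) G"
    by (rule ip_hom_coeff[OF A2_hol_in[OF Tf] A2_L2[OF Tf] A2_hol_in[OF G(1)] A2_L2[OF G(1)], symmetric])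
  also have "ip (hom_part j m (T h f)) G = ip (T h f) (hom_part j m G)"
    by (rule ip_hom_part[OF A2_hol_in[OF Tf] A2_L2[OF Tf] A2_hol_in[OF G(1)] A2_L2[OF G(1)]])
  also have "\<dots> = ip (\<lambda>z. h z * f z) (hom_part j m G)"
    by (rule ip_T[OF h(3) f hom_part_A2[OF G(1)]])
  also have "\<dots> = ip (hom_part j m (\<lambda>z. h z * f z)) G"
    by (rule ip_hom_part[OF hf sym_L2[OF h(3) f] A2_hol_in[OF G(1)] A2_L2[OF G(1)], symmetric])
  also have "of_nat (Suc m) * \<dots> = ip (taylor_coeff j m (\<lambda>z. h z * f z)) (taylor_coeff j m G)"
    by (rule ip_hom_coeff[OF hf sym_L2[OF h(3) f] A2_hol_in[OF G(1)] A2_L2[OF G(1)]])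
  also have "\<dots> = ip (\<lambda>z. h z * taylor_coeff j m f z) (taylor_coeff j l k)"
    by (intro L2_inner_cong) (simp_all add: G taylor_coeff_mult_indep[OF h(1,2) A2_hol_in[OF f]])
  finally show ?thesis .
qed

lemma ip_hom_part_A2:
  assumes "f \<in> A2" "k \<in> A2"
  shows "ip (hom_part j m f) k = ip (taylor_coeff j m f) (taylor_coeff j m k) / of_nat (Suc m)"
  using ip_hom_coeff[OF A2_hol_in[OF assms(1)] A2_L2[OF assms(1)] A2_hol_in[OF assms(2)] A2_L2[OF assms(2)], where m = m]
  by (simp add: field_simps del: of_nat_Suc)

lemma ip_taylor_coeff_coord:
  assumes "f \<in> A2"
  shows "ip (taylor_coeff j (Suc m) (\<lambda>z. z $ j * f z)) c = ip (taylor_coeff j m f) c"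
  by (intro L2_inner_cong) (simp_all add: taylor_coeff_coord[OF A2_hol_in[OF assms]])

lemma ip_taylor_coeff_coord_right:
  assumes "f \<in> A2"
  shows "ip c (taylor_coeff j (Suc m) (\<lambda>z. z $ j * f z)) = ip c (taylor_coeff j m f)"
  by (intro L2_inner_cong) (simp_all add: taylor_coeff_coord[OF A2_hol_in[OF assms]])

lemma hom_part_coord_0_ip:
  "ip (hom_part j 0 (\<lambda>z. z $ j * f z)) k = 0"
proof -
  have "ip (hom_part j 0 (\<lambda>z. z $ j * f z)) k = ip (\<lambda>_. 0) k"
    by (intro L2_inner_cong) (simp_all add: hom_part_coord_0)
  thus ?thesis by simp
qed

text \<open>Multiplication by z_j only relabels the coefficients, and \<open>T h\<close> treats all
  degrees alike.\<close>

lemma T_indep_commutes_coord: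
  fixes f :: "complex ^ 'n \<Rightarrow> complex"
  assumes h: "indep j h" "continuous_on polydisk h" "bdd h" and f: "f \<in> A2"
  shows "T h (\<lambda>z. z $ j * f z) = (\<lambda>z. z $ j * T h f z)"
proof (rule hom_part_ip_cong[where j = j])
  have Tf: "T h f \<in> A2" by (intro T_A2 h f)
  have zf: "(\<lambda>z. z $ j * f z) \<in> A2" by (intro A2_coord f)
  show "T h (\<lambda>z. z $ j * f z) \<in> A2" by (intro T_A2 h zf)
  show zT: "(\<lambda>z. z $ j * T h f z) \<in> A2" by (intro A2_coord Tf)
  fix m and k :: "complex ^ 'n \<Rightarrow> complex" assume k: "k \<in> A2"
  show "ip (hom_part j m (T h (\<lambda>z. z $ j * f z))) k = ip (hom_part j m (\<lambda>z. z $ j * T h f z)) k"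
  proof (cases m)
    case 0
    \<comment> \<open>There is no coefficient of degree -1 to compare with; both sides vanish
      because \<open>T h\<close> preserves degrees.\<close>
    have "hom_part j 0 (\<lambda>z. z $ j * f z) = (\<lambda>_. 0)"
      by (rule A2_ext[OF hom_part_A2[OF zf] A2_zero]) (simp add: hom_part_coord_0)
    hence "ip (hom_part j 0 (T h (\<lambda>z. z $ j * f z))) k = ip (T h (\<lambda>_. 0)) k"
      using T_indep_hom_part[OF h zf, where m = 0] by simp
    also have "\<dots> = 0" by (simp add: ip_T[OF h(3) A2_zero k])
    finally show ?thesis unfolding 0 hom_part_coord_0_ip .
  next
    case (Suc l)
    have "ip (taylor_coeff j m (T h (\<lambda>z. z $ j * f z))) (taylor_coeff j m k)
        = ip (\<lambda>z. h z * taylor_coeff j m (\<lambda>z. z $ j * f z) z) (taylor_coeff j m k)"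
      by (rule T_indep_coeff[OF h zf k])
    also have "\<dots> = ip (\<lambda>z. h z * taylor_coeff j l f z) (taylor_coeff j m k)"
      unfolding Suc by (intro L2_inner_cong) (simp_all add: taylor_coeff_coord[OF A2_hol_in[OF f]])
    also have "\<dots> = ip (taylor_coeff j l (T h f)) (taylor_coeff j m k)"
      by (rule T_indep_coeff[OF h f k, symmetric])
    also have "\<dots> = ip (taylor_coeff j m (\<lambda>z. z $ j * T h f z)) (taylor_coeff j m k)"
      unfolding Suc by (rule ip_taylor_coeff_coord[OF Tf, symmetric])
    finally show ?thesis
      by (simp add: ip_hom_part_A2[OF T_A2[OF h(3) zf] k] ip_hom_part_A2[OF zT k])
  qed
qed

section \<open>The adjoint of multiplication by z_j\<close>

abbreviation Bs :: "'n \<Rightarrow> (complex ^ 'n \<Rightarrow> complex) \<Rightarrow> complex ^ 'n \<Rightarrow> complex" where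
  "Bs j \<equiv> T (\<lambda>z. cnj (z $ j))"

lemma bdd_cnj_coord: "bdd (\<lambda>z. cnj (z $ j))"
  by (intro bdd_symbol_cnj bdd_coord)

lemma Bs_A2: "f \<in> A2 \<Longrightarrow> Bs j f \<in> A2"
  by (intro T_A2 bdd_cnj_coord)

lemma ip_Bs: "f \<in> A2 \<Longrightarrow> k \<in> A2 \<Longrightarrow> ip (Bs j f) k = ip f (\<lambda>z. z $ j * k z)"
  using ip_T[OF bdd_cnj_coord, of f k j] by (simp add: L2_inner_mult)

text \<open>\<open>Bs\<close> is a weighted backward shift; (m+1)/(m+2) is the quotient of the
  Bergman weights 1/(m+2) and 1/(m+1) of two neighbouring degrees.\<close>

lemma Bs_coeff:
  assumes g: "g \<in> A2" and k: "k \<in> A2"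
  shows "of_nat (m + 2) * ip (taylor_coeff j m (Bs j g)) (taylor_coeff j l k)
    = of_nat (m + 1) * ip (taylor_coeff j (Suc m) g) (taylor_coeff j l k)"
proof -
  obtain G where G: "G \<in> A2" "\<And>z. z \<in> polydisk \<Longrightarrow> taylor_coeff j m G z = taylor_coeff j l k z"
    using coeff_lift[OF k] by blast
  have zG: "(\<lambda>z. z $ j * G z) \<in> A2" by (intro A2_coord G)
  have e: "ip c (taylor_coeff j l k) = ip c (taylor_coeff j m G)" for c
    by (intro L2_inner_cong) (simp_all add: G)
  have "ip (taylor_coeff j m (Bs j g)) (taylor_coeff j m G) / of_nat (Suc m) = ip (hom_part j m (Bs j g)) G"
    by (rule ip_hom_part_A2[OF Bs_A2[OF g] G(1), symmetric])
  also have "\<dots> = ip (Bs j g) (hom_part j m G)"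
    by (intro ip_hom_part A2_hol_in A2_L2 Bs_A2 g G)
  also have "\<dots> = ip g (\<lambda>z. z $ j * hom_part j m G z)"
    by (intro ip_Bs g hom_part_A2 G)
  also have "\<dots> = ip g (hom_part j (Suc m) (\<lambda>z. z $ j * G z))"
    by (intro L2_inner_cong) (simp_all add: hom_part_coord_Suc[OF A2_hol_in[OF G(1)]])
  also have "\<dots> = ip (hom_part j (Suc m) g) (\<lambda>z. z $ j * G z)"
    by (intro ip_hom_part[symmetric] A2_hol_in A2_L2 g zG)
  also have "\<dots> = ip (taylor_coeff j (Suc m) g) (taylor_coeff j m G) / of_nat (Suc (Suc m))"
    unfolding ip_hom_part_A2[OF g zG] ip_taylor_coeff_coord_right[OF G(1)] ..
  finally show ?thesis unfolding e by (simp add: field_simps add_eq_0_iff2 del: of_nat_Suc of_nat_add)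
qed

text \<open>This is \<open>A (2 - B B\<^sup>*) = 1\<close> with \<open>B = T\<^bsub>z\<^sub>j\<^esub>\<close> and \<open>A = B\<^sup>* B\<close>; on the
  component of degree \<open>m\<close> it reads \<open>(m+1)/(m+2) \<cdot> (2 - m/(m+1)) = 1\<close>.\<close>

lemma bergman_shift_identity:
  fixes g :: "complex ^ 'n \<Rightarrow> complex"
  assumes g: "g \<in> A2"
  shows "Bs j (\<lambda>z. z $ j * (2 * g z - z $ j * Bs j g z)) = g"
proof (rule hom_part_ip_cong[where j = j])
  define F where "F = (\<lambda>z. 2 * g z - z $ j * Bs j g z)"
  have zB: "(\<lambda>z. z $ j * Bs j g z) \<in> A2" by (intro A2_coord Bs_A2 g)
  have F: "F \<in> A2" unfolding F_def by (intro A2_diff A2_scale g zB)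
  have zF: "(\<lambda>z. z $ j * F z) \<in> A2" by (intro A2_coord F)
  show BF: "Bs j (\<lambda>z. z $ j * (2 * g z - z $ j * Bs j g z)) \<in> A2"
    using Bs_A2[OF zF] unfolding F_def .
  fix m and k :: "complex ^ 'n \<Rightarrow> complex" assume k: "k \<in> A2"
  have L: "taylor_coeff j m f \<in> L2" if "f \<in> A2" for f m by (intro taylor_coeff_L2 A2_hol_in A2_L2 that)
  have tF: "taylor_coeff j m F z = 2 * taylor_coeff j m g z - taylor_coeff j m (\<lambda>z. z $ j * Bs j g z) z"
    if z: "z \<in> polydisk" for z m
  proof -
    have zj: "upd z j (1/2) \<in> polydisk" using z by (intro upd_polydisk) auto
    have "hom_part j m (\<lambda>z. 2 * g z) (upd z j (1/2)) = 2 * hom_part j m g (upd z j (1/2))"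
      using A2_scale[OF g, of 2] by (intro hom_part_mult_indep[OF _ A2_hol_in[OF g] _ zj]) (auto simp: indep_def A2_hol_in)
    hence "hom_part j m (\<lambda>z. 2 * g z - z $ j * Bs j g z) (upd z j (1/2))
        = 2 * hom_part j m g (upd z j (1/2)) - hom_part j m (\<lambda>z. z $ j * Bs j g z) (upd z j (1/2))"
      using hom_part_diff[OF A2_hol_in[OF A2_scale[OF g, of 2]] A2_hol_in[OF zB] zj, where j = j and m = m] by simp
    thus ?thesis
      unfolding taylor_coeff_eq_hom_part[OF z] F_def by (simp add: right_diff_distrib)
  qed
  have ipF: "ip (taylor_coeff j m F) (taylor_coeff j m k) 
      = 2 * ip (taylor_coeff j m g) (taylor_coeff j m k) - ip (taylor_coeff j m (\<lambda>z. z $ j * Bs j g z)) (taylor_coeff j m k)"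
  proof -
    have "ip (taylor_coeff j m F) (taylor_coeff j m k) 
      = ip (\<lambda>z. 2 * taylor_coeff j m g z - taylor_coeff j m (\<lambda>z. z $ j * Bs j g z) z) (taylor_coeff j m k)"
      by (intro L2_inner_cong) (simp_all add: tF)
    thus ?thesis using L[OF g] L[OF zB] L[OF k]
      by (simp add: L2_inner_diff_left L2_scale L2_inner_scale_left)
  qed
  \<comment> \<open>Denominators: \<open>z_j F\<close> meets the weight of degree m + 1, namely
    1/(m+2), while \<open>g\<close> meets the weight 1/(m+1) of degree m.\<close>
  have main: "ip (taylor_coeff j m F) (taylor_coeff j m k) / of_nat (m + 2) = ip (taylor_coeff j m g) (taylor_coeff j m k) / of_nat (m + 1)"
  proof (cases m)
    case 0
    have "ip (taylor_coeff j 0 (\<lambda>z. z $ j * Bs j g z)) (taylor_coeff j 0 k) = 0"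
      using ip_hom_part_A2[OF zB k, where j = j and m = 0] hom_part_coord_0_ip[of j "Bs j g" k] by simp
    thus ?thesis using ipF 0 by simp
  next
    case (Suc l)
    have "of_nat (l + 2) * ip (taylor_coeff j l (Bs j g)) (taylor_coeff j m k) = of_nat (l + 1) * ip (taylor_coeff j m g) (taylor_coeff j m k)"
      unfolding Suc by (rule Bs_coeff[OF g k])
    moreover have "ip (taylor_coeff j m (\<lambda>z. z $ j * Bs j g z)) (taylor_coeff j m k) = ip (taylor_coeff j l (Bs j g)) (taylor_coeff j m k)"
      unfolding Suc by (rule ip_taylor_coeff_coord[OF Bs_A2[OF g]])
    ultimately have "of_nat (l + 2) * ip (taylor_coeff j m F) (taylor_coeff j m k) = of_nat (l + 3) * ip (taylor_coeff j m g) (taylor_coeff j m k)"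
      unfolding ipF by (simp add: algebra_simps)
    moreover have "(of_nat (l + 2) :: complex) \<noteq> 0" "(of_nat (l + 3) :: complex) \<noteq> 0" by (simp_all only: of_nat_eq_0_iff)
    ultimately show ?thesis unfolding Suc by (simp add: field_simps del: of_nat_Suc of_nat_add)
  qed
  have "ip (hom_part j m (Bs j (\<lambda>z. z $ j * F z))) k = ip (Bs j (\<lambda>z. z $ j * F z)) (hom_part j m k)"
    by (intro ip_hom_part A2_hol_in A2_L2 Bs_A2 zF k)
  also have "\<dots> = ip (\<lambda>z. z $ j * F z) (\<lambda>z. z $ j * hom_part j m k z)"
    by (intro ip_Bs zF hom_part_A2 k)
  also have "\<dots> = ip (\<lambda>z. z $ j * F z) (hom_part j (Suc m) (\<lambda>z. z $ j * k z))"
    by (intro L2_inner_cong) (simp_all add: hom_part_coord_Suc[OF A2_hol_in[OF k]])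
  also have "\<dots> = ip (hom_part j (Suc m) (\<lambda>z. z $ j * F z)) (\<lambda>z. z $ j * k z)"
    by (intro ip_hom_part[symmetric] A2_hol_in A2_L2 zF A2_coord k)
  also have "\<dots> = ip (taylor_coeff j m F) (taylor_coeff j m k) / of_nat (m + 2)"
    unfolding ip_hom_part_A2[OF zF A2_coord[OF k]] ip_taylor_coeff_coord_right[OF k] ip_taylor_coeff_coord[OF F] by simp
  also have "\<dots> = ip (hom_part j m g) k" unfolding main ip_hom_part_A2[OF g k] by simp
  finally show "ip (hom_part j m (Bs j (\<lambda>z. z $ j * (2 * g z - z $ j * Bs j g z)))) k = ip (hom_part j m g) k"
    unfolding F_def .
qed (rule g)

subsection \<open>The operator \<open>M = 1 - T\<^bsub>z\<^sub>j\<^esub>\<^sup>* T\<^bsub>z\<^sub>j\<^esub>\<close>\<close>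

definition Aop :: "'n \<Rightarrow> (complex ^ 'n \<Rightarrow> complex) \<Rightarrow> complex ^ 'n \<Rightarrow> complex" where
  "Aop j g = Bs j (\<lambda>z. z $ j * g z)"

definition Mop :: "'n \<Rightarrow> (complex ^ 'n \<Rightarrow> complex) \<Rightarrow> complex ^ 'n \<Rightarrow> complex" where
  "Mop j g = (\<lambda>z. g z - Aop j g z)"

text \<open>The inverse of \<open>Aop\<close>, by the Bergman shift identity.\<close>

definition Dop :: "'n \<Rightarrow> (complex ^ 'n \<Rightarrow> complex) \<Rightarrow> complex ^ 'n \<Rightarrow> complex" where
  "Dop j g = (\<lambda>z. 2 * g z - z $ j * Bs j g z)"

lemma Aop_A2: "g \<in> A2 \<Longrightarrow> Aop j g \<in> A2"
  unfolding Aop_def by (intro Bs_A2 A2_coord)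

lemma Mop_A2: "g \<in> A2 \<Longrightarrow> Mop j g \<in> A2"
  unfolding Mop_def by (intro A2_diff Aop_A2)

lemma Dop_A2: "g \<in> A2 \<Longrightarrow> Dop j g \<in> A2"
  unfolding Dop_def by (intro A2_diff A2_scale A2_coord Bs_A2)

lemma norm_coord_le: "z \<in> polydisk \<Longrightarrow> norm (z $ j) \<le> 1"
  using polydisk_nth[of z j] by simp

lemma nrm_coord_le: "g \<in> A2 \<Longrightarrow> nrm (\<lambda>z. z $ j * g z) \<le> nrm g"
  using L2_norm_mult_le[OF bdd_coord[of j] A2_L2, of g 1] norm_coord_le by force

lemma nrm_Bs_le: "g \<in> A2 \<Longrightarrow> nrm (Bs j g) \<le> nrm g"
  using T_norm_le[OF bdd_cnj_coord[of j], of g 1] norm_coord_le by force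

lemma nrm_Aop_le: "g \<in> A2 \<Longrightarrow> nrm (Aop j g) \<le> nrm g"
  unfolding Aop_def using nrm_Bs_le[OF A2_coord, of g j j] nrm_coord_le[of g j] by linarith

lemma nrm_Mop_le: "g \<in> A2 \<Longrightarrow> nrm (Mop j g) \<le> 2 * nrm g"
  unfolding Mop_def
  using L2_norm_triangle_diff[OF A2_L2 A2_L2[OF Aop_A2], of g g j] nrm_Aop_le[of g j] by linarith

lemma nrm_Dop_le:
  assumes g: "g \<in> A2" shows "nrm (Dop j g) \<le> 3 * nrm g"
proof -
  have "nrm (Dop j g) \<le> nrm (\<lambda>z. 2 * g z) + nrm (\<lambda>z. z $ j * Bs j g z)"
    unfolding Dop_def by (intro L2_norm_triangle_diff A2_L2[OF A2_scale[OF g]] A2_L2[OF A2_coord[OF Bs_A2[OF g]]])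
  also have "nrm (\<lambda>z. 2 * g z) = 2 * nrm g" unfolding L2_norm_scale by simp
  also have "nrm (\<lambda>z. z $ j * Bs j g z) \<le> nrm g"
    using nrm_coord_le[OF Bs_A2[OF g]] nrm_Bs_le[OF g] by (rule order_trans)
  finally show ?thesis by simp
qed

lemma Aop_diff: "f \<in> A2 \<Longrightarrow> g \<in> A2 \<Longrightarrow> Aop j (\<lambda>z. f z - g z) = (\<lambda>z. Aop j f z - Aop j g z)"
  unfolding Aop_def right_diff_distrib by (intro T_diff bdd_cnj_coord A2_coord)

lemma Aop_add: "f \<in> A2 \<Longrightarrow> g \<in> A2 \<Longrightarrow> Aop j (\<lambda>z. f z + g z) = (\<lambda>z. Aop j f z + Aop j g z)"
  unfolding Aop_def distrib_left by (intro T_add bdd_cnj_coord A2_coord)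

lemma Mop_diff: "f \<in> A2 \<Longrightarrow> g \<in> A2 \<Longrightarrow> Mop j (\<lambda>z. f z - g z) = (\<lambda>z. Mop j f z - Mop j g z)"
  unfolding Mop_def by (simp add: Aop_diff algebra_simps)

lemma Dop_diff: "f \<in> A2 \<Longrightarrow> g \<in> A2 \<Longrightarrow> Dop j (\<lambda>z. f z - g z) = (\<lambda>z. Dop j f z - Dop j g z)"
  unfolding Dop_def by (simp add: T_diff bdd_cnj_coord algebra_simps)

lemma A2_ip_eqI:
  assumes X: "X \<in> A2" and Y: "Y \<in> A2" and eq: "\<And>k. k \<in> A2 \<Longrightarrow> ip X k = ip Y k"
  shows "X = Y"
  using proj_eqI[OF A2_L2[OF X] Y eq] proj_id[OF X] by simp

lemma ip_Aop:
  assumes "f \<in> A2" "g \<in> A2" shows "ip (Aop j f) g = ip (\<lambda>z. z $ j * f z) (\<lambda>z. z $ j * g z)"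
  unfolding Aop_def by (intro ip_Bs A2_coord assms)

lemma cnj_L2_inner: "cnj (L2_inner S f g) = L2_inner S g f"
  using L2_inner_cnj[of S g f] by simp

lemma Aop_selfadjoint:
  assumes "f \<in> A2" "g \<in> A2" shows "ip (Aop j f) g = ip f (Aop j g)"
proof -
  have "ip f (Aop j g) = cnj (ip (Aop j g) f)" by (simp only: cnj_L2_inner)
  also have "\<dots> = ip (\<lambda>z. z $ j * f z) (\<lambda>z. z $ j * g z)" by (simp only: ip_Aop[OF assms(2,1)] cnj_L2_inner)
  finally show ?thesis by (simp only: ip_Aop[OF assms])
qed

lemma ip_coord_Bs:
  assumes "f \<in> A2" "g \<in> A2" shows "ip (\<lambda>z. z $ j * Bs j f z) g = ip (Bs j f) (Bs j g)"
proof -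
  have "ip (\<lambda>z. z $ j * Bs j f z) g = cnj (ip g (\<lambda>z. z $ j * Bs j f z))" by (simp only: cnj_L2_inner)
  also have "\<dots> = cnj (ip (Bs j g) (Bs j f))" by (simp only: ip_Bs[OF assms(2) Bs_A2[OF assms(1)]])
  finally show ?thesis by (simp only: cnj_L2_inner)
qed

lemma ip_Dop:
  assumes f: "f \<in> A2" and g: "g \<in> A2" shows "ip (Dop j f) g = 2 * ip f g - ip (Bs j f) (Bs j g)"
  unfolding Dop_def ip_coord_Bs[OF f g, symmetric]
  by (simp add: L2_inner_diff_left[OF L2_scale[OF A2_L2[OF f]] A2_L2[OF A2_coord[OF Bs_A2[OF f]]] A2_L2[OF g]] L2_inner_scale_left)

lemma Dop_selfadjoint:
  assumes f: "f \<in> A2" and g: "g \<in> A2" shows "ip (Dop j f) g = ip f (Dop j g)"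
proof -
  have "ip f (Dop j g) = cnj (ip (Dop j g) f)" by (simp only: cnj_L2_inner)
  also have "\<dots> = 2 * ip f g - ip (Bs j f) (Bs j g)" by (simp add: ip_Dop[OF g f] cnj_L2_inner)
  finally show ?thesis by (simp only: ip_Dop[OF f g])
qed

lemma Aop_Dop: "g \<in> A2 \<Longrightarrow> Aop j (Dop j g) = g"
  unfolding Aop_def Dop_def by (rule bergman_shift_identity)

text \<open>A right inverse of a self-adjoint operator is also a left inverse when it is itself
  self-adjoint.\<close>

lemma Dop_Aop:
  assumes g: "g \<in> A2" shows "Dop j (Aop j g) = g"
proof (rule A2_ip_eqI[OF Dop_A2[OF Aop_A2[OF g]] g])
  fix k :: "complex ^ 'a \<Rightarrow> complex" assume k: "k \<in> A2"
  show "ip (Dop j (Aop j g)) k = ip g k"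
    unfolding Dop_selfadjoint[OF Aop_A2[OF g] k] Aop_selfadjoint[OF g Dop_A2[OF k]] Aop_Dop[OF k] ..
qed

lemma Dop_Mop: "g \<in> A2 \<Longrightarrow> Dop j (Mop j g) = (\<lambda>z. Dop j g z - g z)"
  unfolding Mop_def by (simp add: Dop_diff Aop_A2 Dop_Aop)

lemma Mop_selfadjoint:
  assumes f: "f \<in> A2" and g: "g \<in> A2" shows "ip (Mop j f) g = ip f (Mop j g)"
  unfolding Mop_def using A2_L2[OF f] A2_L2[OF g] A2_L2[OF Aop_A2[OF f]] A2_L2[OF Aop_A2[OF g]] 
  by (simp add: L2_inner_diff_left L2_inner_diff_right Aop_selfadjoint[OF f g])

lemma ip_Mop_self:
  assumes g: "g \<in> A2" shows "Re (ip (Mop j g) g) = (nrm g)\<^sup>2 - (nrm (\<lambda>z. z $ j * g z))\<^sup>2"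
  unfolding Mop_def using A2_L2[OF g] A2_L2[OF Aop_A2[OF g]] 
  by (simp add: L2_inner_diff_left ip_Aop[OF g g] L2_inner_self)

text \<open>With B multiplication by z_j, A = \<open>Aop\<close> and D = \<open>Dop\<close>, the
  squared norm is the quadratic form of A - B Bs = A + D - 2. Since D inverts A, this equals (1 - A)
  D (1 - A), and D <= 2 gives the factor 2.\<close>

lemma hankel_cnj_coord:
  assumes g: "g \<in> A2"
  shows "(nrm (\<lambda>z. cnj (z $ j) * g z - Bs j g z))\<^sup>2 \<le> 2 * (nrm (Mop j g))\<^sup>2"
proof -
  note M = Mop_A2[OF g, of j] and D = Dop_A2[OF g, of j] and A = Aop_A2[OF g, of j]
  have n: "(nrm (\<lambda>z. cnj (z $ j) * g z))\<^sup>2 = (nrm (Bs j g))\<^sup>2 + (nrm (\<lambda>z. cnj (z $ j) * g z - Bs j g z))\<^sup>2"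
    using nrm_proj_pythagoras[OF sym_L2[OF bdd_cnj_coord g]] by (simp add: T_eq)
  have "nrm (\<lambda>z. cnj (z $ j) * g z) = nrm (\<lambda>z. z $ j * g z)"
    by (rule L2_norm_cong) (simp add: norm_mult)
  hence q: "(nrm (\<lambda>z. cnj (z $ j) * g z - Bs j g z))\<^sup>2 = Re (ip (Aop j g) g) - Re (ip (\<lambda>z. z $ j * Bs j g z) g)"
    using n by (simp add: ip_Aop[OF g g] ip_coord_Bs[OF g g] L2_inner_self)
  have zB: "ip (\<lambda>z. z $ j * Bs j g z) g = 2 * ip g g - ip (Dop j g) g"
    using ip_Dop[OF g g] ip_coord_Bs[OF g g] by simp
  have "ip (Dop j (Mop j g)) (Mop j g) = ip (Dop j g) (Mop j g) - ip g (Mop j g)"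
    unfolding Dop_Mop[OF g] by (rule L2_inner_diff_left[OF A2_L2[OF D] A2_L2[OF g] A2_L2[OF M]])
  also have "ip (Dop j g) (Mop j g) = ip (Dop j g) g - ip g g"
    unfolding Mop_def
    by (simp add: L2_inner_diff_right[OF A2_L2[OF g] A2_L2[OF A] A2_L2[OF D]] Aop_selfadjoint[OF D g, symmetric] Aop_Dop[OF g])
  also have "ip g (Mop j g) = ip g g - ip (Aop j g) g"
    unfolding Mop_def by (simp add: L2_inner_diff_right[OF A2_L2[OF g] A2_L2[OF A] A2_L2[OF g]] Aop_selfadjoint[OF g g])
  finally have "Re (ip (Dop j (Mop j g)) (Mop j g)) = (nrm (\<lambda>z. cnj (z $ j) * g z - Bs j g z))\<^sup>2"
    unfolding q zB by simp
  moreover have "Re (ip (Dop j (Mop j g)) (Mop j g)) = 2 * (nrm (Mop j g))\<^sup>2 - (nrm (Bs j (Mop j g)))\<^sup>2"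
    unfolding ip_Dop[OF M M] by (simp add: L2_inner_self)
  moreover have "0 \<le> (nrm (Bs j (Mop j g)))\<^sup>2" by simp
  ultimately show ?thesis by argo
qed

text \<open>M Bs = Bs D M, because D M = D - 1 = 1 - B Bs and A = Bs B.\<close>

lemma nrm_Mop_Bs:
  assumes g: "g \<in> A2" shows "nrm (Mop j (Bs j g)) \<le> 3 * nrm (Mop j g)"
proof -
  have "Bs j (Dop j (Mop j g)) = Bs j (\<lambda>z. g z - z $ j * Bs j g z)"
    unfolding Dop_Mop[OF g] by (intro arg_cong[where f = "Bs j"]) (simp add: fun_eq_iff Dop_def)
  also have "\<dots> = Mop j (Bs j g)"
    unfolding Mop_def Aop_def by (intro T_diff bdd_cnj_coord g A2_coord Bs_A2)
  finally have "nrm (Mop j (Bs j g)) \<le> nrm (Dop j (Mop j g))"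
    using nrm_Bs_le[OF Dop_A2[OF Mop_A2[OF g]], of j j j] by simp
  thus ?thesis using nrm_Dop_le[OF Mop_A2[OF g], of j j] by linarith
qed

text \<open>M B = A B M, obtained by applying A D = 1 to z_j g; both A and B are
  contractions.\<close>

lemma nrm_Mop_coord:
  assumes g: "g \<in> A2" shows "nrm (Mop j (\<lambda>z. z $ j * g z)) \<le> nrm (Mop j g)"
proof -
  define f where "f = (\<lambda>z. z $ j * g z)"
  have f: "f \<in> A2" unfolding f_def by (rule A2_coord[OF g])
  have zA: "(\<lambda>z. z $ j * Aop j g z) \<in> A2" by (intro A2_coord Aop_A2 g)
  have e1: "Aop j (\<lambda>z. 2 * f z - z $ j * Aop j g z) = f"
    using Aop_Dop[OF f, of j] unfolding Dop_def f_def Aop_def .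
  have e2: "Aop j (\<lambda>z. 2 * f z - z $ j * Aop j g z) = (\<lambda>z. Aop j (\<lambda>z. f z + f z) z - Aop j (\<lambda>z. z $ j * Aop j g z) z)"
    using Aop_diff[OF A2_add[OF f f] zA, of j] unfolding mult_2 .
  have e: "(\<lambda>z. Aop j f z + Aop j f z - Aop j (\<lambda>z. z $ j * Aop j g z) z) = f"
    using trans[OF e2[symmetric] e1] unfolding Aop_add[OF f f] .
  have "Aop j (\<lambda>z. z $ j * Mop j g z) = (\<lambda>z. Aop j f z - Aop j (\<lambda>z. z $ j * Aop j g z) z)"
    using Aop_diff[OF f zA, of j] by (simp add: Mop_def f_def right_diff_distrib)
  also have "\<dots> = Mop j f" unfolding Mop_def using fun_cong[OF e] by (auto simp: fun_eq_iff algebra_simps)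
  finally have "nrm (Mop j f) \<le> nrm (\<lambda>z. z $ j * Mop j g z)"
    using nrm_Aop_le[OF A2_coord[OF Mop_A2[OF g]], of j j j] by simp
  thus ?thesis using nrm_coord_le[OF Mop_A2[OF g], of j j] by (simp add: f_def)
qed

lemma indep_cnj: "indep j h \<Longrightarrow> indep j (\<lambda>z. cnj (h z))"
  by (simp add: indep_def)

text \<open>The adjoint of \<open>T_indep_commutes_coord\<close>, applied to the conjugate
  symbol.\<close>

lemma T_indep_Bs:
  assumes h: "indep j h" "continuous_on polydisk h" "bdd h" and g: "g \<in> A2"
  shows "T h (Bs j g) = Bs j (T h g)"
proof (rule A2_ip_eqI)
  fix k :: "complex ^ 'a \<Rightarrow> complex" assume k: "k \<in> A2"
  have c: "indep j (\<lambda>z. cnj (h z))" "continuous_on polydisk (\<lambda>z. cnj (h z))" "bdd (\<lambda>z. cnj (h z))"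
    using h by (auto intro: indep_cnj bdd_symbol_cnj continuous_intros)
  have "ip (T h (Bs j g)) k = ip g (\<lambda>z. z $ j * T (\<lambda>z. cnj (h z)) k z)"
    by (simp add: T_adjoint[OF h(3) Bs_A2[OF g] k] ip_Bs[OF g T_A2[OF c(3) k]])
  also have "\<dots> = ip (T h g) (\<lambda>z. z $ j * k z)"
    by (simp add: T_indep_commutes_coord[OF c k, symmetric] T_adjoint[OF h(3) g A2_coord[OF k]])
  also have "\<dots> = ip (Bs j (T h g)) k" by (rule ip_Bs[OF T_A2[OF h(3) g] k, symmetric])
  finally show "ip (T h (Bs j g)) k = ip (Bs j (T h g)) k" .
qed (intro T_A2 Bs_A2 h g)+

lemma T_indep_Aop:
  assumes h: "indep j h" "continuous_on polydisk h" "bdd h" and g: "g \<in> A2"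
  shows "T h (Aop j g) = Aop j (T h g)"
  unfolding Aop_def T_indep_Bs[OF h A2_coord[OF g]] T_indep_commutes_coord[OF h g] ..

lemma T_indep_Mop:
  assumes h: "indep j h" "continuous_on polydisk h" "bdd h" and g: "g \<in> A2"
  shows "T h (Mop j g) = Mop j (T h g)"
  unfolding Mop_def T_diff[OF h(3) g Aop_A2[OF g]] T_indep_Aop[OF h g] ..

lemma Aop_pow_A2: "g \<in> A2 \<Longrightarrow> (Aop j ^^ s) g \<in> A2"
  by (induction s) (auto intro: Aop_A2)

lemma nrm_Aop_pow: "g \<in> A2 \<Longrightarrow> nrm ((Aop j ^^ s) g) \<le> nrm g"
proof (induction s)
  case (Suc s)
  thus ?case using nrm_Aop_le[OF Aop_pow_A2[OF Suc.prems, where j = j and s = s], where j = j] by simp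
qed simp

text \<open>The telescoping quantity is \<open>\<langle>M x\<^sub>l, x\<^sub>l\<rangle>\<close> with \<open>x\<^sub>l = A\<^sup>l f\<close>: it is non-negative and drops by at
  least \<open>\<parallel>M x\<^sub>l\<parallel>\<^sup>2\<close> in each step.\<close>

lemma Mop_Aop_pow:
  assumes f: "f \<in> A2"
  shows "real (Suc s) * (nrm (Mop j ((Aop j ^^ s) f)))\<^sup>2 \<le> (nrm f)\<^sup>2"
proof -
  define x where "x = (\<lambda>l. (Aop j ^^ l) f)"
  define c where "c = (\<lambda>l. Re (ip (Mop j (x l)) (x l)))"
  have x: "x l \<in> A2" for l unfolding x_def by (rule Aop_pow_A2[OF f])
  have xS: "x (Suc l) = Aop j (x l)" for l by (simp add: x_def)
  have step: "(nrm (Mop j (x l)))\<^sup>2 \<le> c l - c (Suc l)" for l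
  proof -
    define y where "y = Mop j (x l)"
    have y: "y \<in> A2" and My: "Mop j y \<in> A2" unfolding y_def by (intro Mop_A2 x)+
    note L = A2_L2[OF y] A2_L2[OF My] A2_L2[OF x, of l]
    have s: "x (Suc l) = (\<lambda>z. x l z - y z)" by (simp add: xS y_def Mop_def)
    have "ip (Mop j (x (Suc l))) (x (Suc l)) = ip (\<lambda>z. y z - Mop j y z) (\<lambda>z. x l z - y z)"
      unfolding s by (simp only: Mop_diff[OF x y] y_def[symmetric])
    also have "\<dots> = ip y (x l) - ip y y - (ip (Mop j y) (x l) - ip (Mop j y) y)"
      using L by (simp add: L2_inner_diff_left L2_inner_diff_right L2_diff)
    also have "ip (Mop j y) (x l) = ip y y" by (simp only: Mop_selfadjoint[OF y x] y_def[symmetric])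
    finally have "c (Suc l) = c l - 2 * (nrm y)\<^sup>2 + Re (ip (Mop j y) y)"
      by (simp add: c_def L2_inner_self y_def[symmetric])
    \<comment> \<open>One of the two copies of the squared norm of \<open>y\<close> is spent on the
      form of M at \<open>y\<close>, which is at most that.\<close>
    thus ?thesis using ip_Mop_self[OF y, of j] by (simp add: y_def[symmetric])
  qed
  have c0: "0 \<le> c l" for l
    unfolding c_def ip_Mop_self[OF x] using nrm_coord_le[OF x] by (simp add: power_mono)
  \<comment> \<open>The norms decrease in l, so the last square is at most each of the s + 1 drops
    that are summed.\<close>
  have dec: "nrm (Mop j (x (Suc l))) \<le> nrm (Mop j (x l))" for l
  proof -
    have "Mop j (x (Suc l)) = Aop j (Mop j (x l))"
      unfolding xS Mop_def by (simp add: Aop_diff[OF x Aop_A2[OF x]])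
    thus ?thesis using nrm_Aop_le[OF Mop_A2[OF x]] by simp
  qed
  have mono: "nrm (Mop j (x s)) \<le> nrm (Mop j (x l))" if "l \<le> s" for l
    using that by (induction s rule: dec_induct) (auto intro: order_trans[OF dec])
  have "real (Suc s) * (nrm (Mop j (x s)))\<^sup>2 = (\<Sum>l<Suc s. (nrm (Mop j (x s)))\<^sup>2)" by simp
  also have "\<dots> \<le> (\<Sum>l<Suc s. c l - c (Suc l))"
    by (intro sum_mono order_trans[OF _ step] power_mono mono) auto
  also have "\<dots> = c 0 - c (Suc s)" by (rule sum_lessThan_telescope')
  also have "\<dots> \<le> c 0" using c0 by simp
  also have "\<dots> \<le> (nrm f)\<^sup>2" using ip_Mop_self[OF f, of j] by (simp add: c_def x_def)
  finally show ?thesis by (simp add: x_def)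
qed

text \<open>The form of M at g is the integral of (1 - |z_j|^2) |g|^2, and a weight with values
  between 0 and 1 dominates its square. This links M with genuine localisation away from the
  circle.\<close>

lemma weighted_norm_le:
  assumes g: "g \<in> A2"
  shows "(nrm (\<lambda>z. of_real (1 - (norm (z $ j))\<^sup>2) * g z))\<^sup>2 \<le> nrm (Mop j g) * nrm g"
proof -
  have b: "bdd (\<lambda>z. of_real (1 - (norm (z $ j))\<^sup>2))"
  proof -
    have "bdd (\<lambda>z. 1 - z $ j * cnj (z $ j))"
      by (intro bdd_symbol_diff bdd_symbol_const bdd_symbol_mult bdd_coord bdd_cnj_coord)
    thus ?thesis by (simp add: complex_norm_square[symmetric])
  qed
  have "(nrm (\<lambda>z. of_real (1 - (norm (z $ j))\<^sup>2) * g z))\<^sup>2 \<le> (LINT z|pdm. (norm (g z))\<^sup>2 - (norm (z $ j * g z))\<^sup>2)"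
    unfolding L2_norm_sq
  proof (intro integral_mono_AE AE_I2 Bochner_Integration.integrable_diff L2_integrable A2_L2[OF g] A2_L2[OF A2_coord[OF g]] L2_mult[OF b A2_L2[OF g]])
    fix z :: "complex ^ 'a" assume "z \<in> space pdm"
    hence "norm (z $ j) \<le> 1" using norm_coord_le by (simp add: space_pdm)
    hence t: "0 \<le> 1 - (norm (z $ j))\<^sup>2" "1 - (norm (z $ j))\<^sup>2 \<le> 1" by (simp_all add: power_le_one)
    have "(norm (of_real (1 - (norm (z $ j))\<^sup>2) * g z))\<^sup>2 = (1 - (norm (z $ j))\<^sup>2)\<^sup>2 * (norm (g z))\<^sup>2"
      by (simp only: norm_mult norm_of_real power_mult_distrib power2_abs)
    also have "\<dots> \<le> (1 - (norm (z $ j))\<^sup>2) * (norm (g z))\<^sup>2"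
      using t by (intro mult_right_mono) (auto simp: power2_eq_square mult_left_le)
    finally show "(norm (of_real (1 - (norm (z $ j))\<^sup>2) * g z))\<^sup>2 \<le> (norm (g z))\<^sup>2 - (norm (z $ j * g z))\<^sup>2"
      by (simp add: norm_mult power_mult_distrib left_diff_distrib)
  qed
  also have "\<dots> = Re (ip (Mop j g) g)"
    unfolding ip_Mop_self[OF g] L2_norm_sq
    by (intro Bochner_Integration.integral_diff L2_integrable A2_L2[OF g] A2_L2[OF A2_coord[OF g]])
  also have "\<dots> \<le> nrm (Mop j g) * nrm g"
    using complex_Re_le_cmod L2_cauchy_schwarz[OF A2_L2[OF Mop_A2[OF g]] A2_L2[OF g]] by (rule order_trans)
  finally show ?thesis .
qed

subsection \<open>Calculus modulo operators controlled by \<open>M\<close>\<close>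

type_synonym 'n op = "(complex ^ 'n \<Rightarrow> complex) \<Rightarrow> (complex ^ 'n \<Rightarrow> complex)"

text \<open>The norm of \<open>M g\<close> is small for \<open>g\<close> concentrated near \<open>\<bar>z\<^sub>j\<bar> = 1\<close>.\<close>

definition null :: "'n \<Rightarrow> 'n::finite op \<Rightarrow> bool" where
  "null j X \<longleftrightarrow> (\<forall>g\<in>A2. X g \<in> L2) \<and>
     (\<forall>e>0. \<exists>C\<ge>0. \<forall>g\<in>A2. nrm (X g) \<le> e * nrm g + C * nrm (Mop j g))"

definition nulleq :: "'n \<Rightarrow> 'n::finite op \<Rightarrow> 'n op \<Rightarrow> bool" where
  "nulleq j X Y \<longleftrightarrow> null j (\<lambda>g z. X g z - Y g z)"

definition bddop :: "'n::finite op \<Rightarrow> bool" where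
  "bddop X \<longleftrightarrow> (\<forall>g\<in>A2. X g \<in> A2) \<and> (\<exists>B\<ge>0. \<forall>g\<in>A2. nrm (X g) \<le> B * nrm g)"

text \<open>The operators that may stand to the right of a null operator: they carry functions with
  small M g to functions of the same kind.\<close>

definition adm :: "'n \<Rightarrow> 'n::finite op \<Rightarrow> bool" where
  "adm j Y \<longleftrightarrow> bddop Y \<and> null j (\<lambda>g. Mop j (Y g))"

lemma nullD: "null j X \<Longrightarrow> g \<in> A2 \<Longrightarrow> X g \<in> L2"
  by (simp add: null_def)

lemma nullE:
  assumes "null j X" "e > 0"
  obtains C where "C \<ge> 0" "\<And>g. g \<in> A2 \<Longrightarrow> nrm (X g) \<le> e * nrm g + C * nrm (Mop j g)"
  using assms unfolding null_def by blast

lemma nullI: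
  assumes "\<And>g. g \<in> A2 \<Longrightarrow> X g \<in> L2"
    and "\<And>e. e > 0 \<Longrightarrow> \<exists>C\<ge>0. \<forall>g\<in>A2. nrm (X g) \<le> e * nrm g + C * nrm (Mop j g)"
  shows "null j X"
  using assms unfolding null_def by blast

lemma null_cong:
  assumes "null j X" "\<And>g. g \<in> A2 \<Longrightarrow> X g = Y g" shows "null j Y"
  using assms unfolding null_def by simp

text \<open>Allows estimates to lose a fixed factor K in front of \<open>e\<close>; rescaling by K +
  1 covers K = 0 as well.\<close>

lemma null_bound:
  assumes X: "\<And>g. g \<in> A2 \<Longrightarrow> X g \<in> L2" and K: "K \<ge> 0"
    and le: "\<And>e. e > 0 \<Longrightarrow> \<exists>C\<ge>0. \<forall>g\<in>A2. nrm (X g) \<le> K * e * nrm g + C * nrm (Mop j g)"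
  shows "null j X"
proof (rule nullI[OF X])
  fix e :: real assume e: "e > 0"
  have "e / (K + 1) > 0" using e K by simp
  from le[OF this] obtain C where C: "C \<ge> 0" "\<And>g. g \<in> A2 \<Longrightarrow> nrm (X g) \<le> K * (e / (K + 1)) * nrm g + C * nrm (Mop j g)"
    by blast
  have "K * (e / (K + 1)) \<le> e" using e K by (simp add: field_simps)
  hence le: "K * (e / (K + 1)) * nrm g \<le> e * nrm g" for g :: "complex ^ 'a \<Rightarrow> complex" by (intro mult_right_mono) auto
  have "nrm (X g) \<le> e * nrm g + C * nrm (Mop j g)" if "g \<in> A2" for g
    using C(2)[OF that] le[of g] by linarith
  thus "\<exists>C\<ge>0. \<forall>g\<in>A2. nrm (X g) \<le> e * nrm g + C * nrm (Mop j g)" using C(1) by blast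
qed auto

lemma null_add:
  assumes X: "null j X" and Y: "null j Y" shows "null j (\<lambda>g z. X g z + Y g z)"
proof (rule null_bound[where K = 2])
  show "(\<lambda>z. X g z + Y g z) \<in> L2" if "g \<in> A2" for g by (intro L2_add nullD[OF X that] nullD[OF Y that])
  fix e :: real assume e: "e > 0"
  obtain C where C: "C \<ge> 0" "\<And>g. g \<in> A2 \<Longrightarrow> nrm (X g) \<le> e * nrm g + C * nrm (Mop j g)" using nullE[OF X e] by blast
  obtain D where D: "D \<ge> 0" "\<And>g. g \<in> A2 \<Longrightarrow> nrm (Y g) \<le> e * nrm g + D * nrm (Mop j g)" using nullE[OF Y e] by blast
  show "\<exists>C\<ge>0. \<forall>g\<in>A2. nrm (\<lambda>z. X g z + Y g z) \<le> 2 * e * nrm g + C * nrm (Mop j g)"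
  proof (intro exI[of _ "C + D"] conjI ballI)
    fix g :: "complex ^ 'a \<Rightarrow> complex" assume g: "g \<in> A2"
    have "nrm (\<lambda>z. X g z + Y g z) \<le> nrm (X g) + nrm (Y g)" by (intro L2_norm_triangle nullD[OF X g] nullD[OF Y g])
    thus "nrm (\<lambda>z. X g z + Y g z) \<le> 2 * e * nrm g + (C + D) * nrm (Mop j g)"
      using C(2)[OF g] D(2)[OF g] by (simp add: distrib_right)
  qed (use C D in auto)
qed auto

lemma null_left:
  assumes X: "null j X" and Z: "\<And>g. g \<in> A2 \<Longrightarrow> Z g \<in> L2" "\<And>g. g \<in> A2 \<Longrightarrow> nrm (Z g) \<le> B * nrm (X g)" and B: "B \<ge> 0"
  shows "null j Z"
proof (rule null_bound[OF Z(1) B])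
  fix e :: real assume e: "e > 0"
  obtain C where C: "C \<ge> 0" "\<And>g. g \<in> A2 \<Longrightarrow> nrm (X g) \<le> e * nrm g + C * nrm (Mop j g)" using nullE[OF X e] by blast
  show "\<exists>C\<ge>0. \<forall>g\<in>A2. nrm (Z g) \<le> B * e * nrm g + C * nrm (Mop j g)"
  proof (intro exI[of _ "B * C"] conjI ballI)
    fix g :: "complex ^ 'a \<Rightarrow> complex" assume g: "g \<in> A2"
    have "nrm (Z g) \<le> B * nrm (X g)" by (rule Z(2)[OF g])
    also have "\<dots> \<le> B * (e * nrm g + C * nrm (Mop j g))" by (rule mult_left_mono[OF C(2)[OF g] B])
    finally show "nrm (Z g) \<le> B * e * nrm g + B * C * nrm (Mop j g)" by (simp add: algebra_simps)
  qed (use B C in auto)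
qed auto

lemma null_scale: "null j X \<Longrightarrow> null j (\<lambda>g z. c * X g z)"
  by (rule null_left[where B = "norm c"]) (auto intro: L2_scale nullD simp: L2_norm_scale)

lemma null_diff:
  assumes X: "null j X" and Y: "null j Y" shows "null j (\<lambda>g z. X g z - Y g z)"
  using null_add[OF X null_scale[OF Y, of "-1"]] by simp

lemma null_Mop: "null j (Mop j)"
  by (rule nullI) (auto intro!: A2_L2 Mop_A2 exI[of _ 1])

lemma null_zero: "null j (\<lambda>g z. 0)"
  by (rule null_left[OF null_Mop, where B = 0]) (auto intro: L2_zero)

text \<open>Null operators are closed under norm limits, which is what makes uniform approximation
  of symbols effective.\<close>

lemma null_limit:
  assumes X: "\<And>g. g \<in> A2 \<Longrightarrow> X g \<in> L2"
    and ex: "\<And>e. e > 0 \<Longrightarrow> \<exists>Y. null j Y \<and> (\<forall>g\<in>A2. nrm (\<lambda>z. X g z - Y g z) \<le> e * nrm g)"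
  shows "null j X"
proof (rule null_bound[OF X, where K = 2])
  fix e :: real assume e: "e > 0"
  obtain Y where Y: "null j Y" "\<And>g. g \<in> A2 \<Longrightarrow> nrm (\<lambda>z. X g z - Y g z) \<le> e * nrm g" using ex[OF e] by blast
  obtain C where C: "C \<ge> 0" "\<And>g. g \<in> A2 \<Longrightarrow> nrm (Y g) \<le> e * nrm g + C * nrm (Mop j g)" using nullE[OF Y(1) e] by blast
  show "\<exists>C\<ge>0. \<forall>g\<in>A2. nrm (X g) \<le> 2 * e * nrm g + C * nrm (Mop j g)"
  proof (intro exI[of _ C] conjI ballI)
    fix g :: "complex ^ 'a \<Rightarrow> complex" assume g: "g \<in> A2"
    show "nrm (X g) \<le> 2 * e * nrm g + C * nrm (Mop j g)"
      using L2_norm_triangle_sub[OF X[OF g] nullD[OF Y(1) g]] Y(2)[OF g] C(2)[OF g] by (simp add: field_simps)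
  qed (use C in auto)
qed auto

lemma nulleq_sym: "nulleq j X Y \<Longrightarrow> nulleq j Y X"
  unfolding nulleq_def using null_scale[of j "\<lambda>g z. X g z - Y g z" "-1"] by simp

lemma nulleq_trans [trans]: "nulleq j X Y \<Longrightarrow> nulleq j Y Z \<Longrightarrow> nulleq j X Z"
  unfolding nulleq_def using null_add[of j "\<lambda>g z. X g z - Y g z" "\<lambda>g z. Y g z - Z g z"] by simp

lemma nulleq_eq: "(\<And>g. g \<in> A2 \<Longrightarrow> X g = Y g) \<Longrightarrow> nulleq j X Y"
  unfolding nulleq_def by (rule null_cong[OF null_zero]) simp

lemma nulleq_add:
  "nulleq j X X' \<Longrightarrow> nulleq j Y Y' \<Longrightarrow> nulleq j (\<lambda>g z. X g z + Y g z) (\<lambda>g z. X' g z + Y' g z)"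
  unfolding nulleq_def using null_add[of j "\<lambda>g z. X g z - X' g z" "\<lambda>g z. Y g z - Y' g z"] by (simp add: algebra_simps)

lemma nulleq_diff:
  "nulleq j X X' \<Longrightarrow> nulleq j Y Y' \<Longrightarrow> nulleq j (\<lambda>g z. X g z - Y g z) (\<lambda>g z. X' g z - Y' g z)"
  unfolding nulleq_def using null_diff[of j "\<lambda>g z. X g z - X' g z" "\<lambda>g z. Y g z - Y' g z"] by (simp add: algebra_simps)

section \<open>Bounded and admissible operators\<close>

lemma bddopD: "bddop X \<Longrightarrow> g \<in> A2 \<Longrightarrow> X g \<in> A2"
  by (simp add: bddop_def)

lemma bddopE:
  assumes "bddop X" obtains B where "B \<ge> 0" "\<And>g. g \<in> A2 \<Longrightarrow> nrm (X g) \<le> B * nrm g"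
  using assms unfolding bddop_def by blast

lemma adm_bddop: "adm j Y \<Longrightarrow> bddop Y"
  by (simp add: adm_def)

lemma bddE:
  assumes "bdd \<phi>" obtains C where "C \<ge> 0" "\<And>z. z \<in> polydisk \<Longrightarrow> norm (\<phi> z) \<le> C"
proof -
  obtain C where C: "\<forall>z\<in>polydisk. norm (\<phi> z) \<le> C" using assms by (auto simp: bdd_symbol_def)
  have "norm (\<phi> z) \<le> \<bar>C\<bar>" if "z \<in> polydisk" for z using C that by force
  thus ?thesis using that[of "\<bar>C\<bar>"] by auto
qed

lemma bddop_T: assumes "bdd \<phi>" shows "bddop (T \<phi>)"
proof -
  obtain C where "C \<ge> 0" "\<And>z. z \<in> polydisk \<Longrightarrow> norm (\<phi> z) \<le> C" using bddE[OF assms] by blast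
  thus ?thesis using T_norm_le[OF assms] T_A2[OF assms] unfolding bddop_def by blast
qed

lemma bddop_comp: assumes X: "bddop X" and Y: "bddop Y" shows "bddop (\<lambda>g. X (Y g))"
proof -
  obtain A where A: "A \<ge> 0" "\<And>g. g \<in> A2 \<Longrightarrow> nrm (X g) \<le> A * nrm g" using bddopE[OF X] by blast
  obtain B where B: "B \<ge> 0" "\<And>g. g \<in> A2 \<Longrightarrow> nrm (Y g) \<le> B * nrm g" using bddopE[OF Y] by blast
  have "nrm (X (Y g)) \<le> A * B * nrm g" if g: "g \<in> A2" for g
    using order_trans[OF A(2)[OF bddopD[OF Y g]] mult_left_mono[OF B(2)[OF g] A(1)]] by (simp add: mult.assoc)
  moreover have "A * B \<ge> 0" using A B by simp
  ultimately show ?thesis unfolding bddop_def using bddopD[OF X bddopD[OF Y]] by blast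
qed

lemma bddop_diff: assumes X: "bddop X" and Y: "bddop Y" shows "bddop (\<lambda>g z. X g z - Y g z)"
proof -
  obtain A where A: "A \<ge> 0" "\<And>g. g \<in> A2 \<Longrightarrow> nrm (X g) \<le> A * nrm g" using bddopE[OF X] by blast
  obtain B where B: "B \<ge> 0" "\<And>g. g \<in> A2 \<Longrightarrow> nrm (Y g) \<le> B * nrm g" using bddopE[OF Y] by blast
  have "nrm (\<lambda>z. X g z - Y g z) \<le> (A + B) * nrm g" if g: "g \<in> A2" for g
    using L2_norm_triangle_diff[OF A2_L2[OF bddopD[OF X g]] A2_L2[OF bddopD[OF Y g]]] A(2)[OF g] B(2)[OF g]
    by (simp add: distrib_right)
  moreover have "A + B \<ge> 0" using A B by simp
  ultimately show ?thesis unfolding bddop_def using A2_diff[OF bddopD[OF X] bddopD[OF Y]] by blast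
qed

text \<open>The term C ||M (Y g)|| is the danger: C already depends on \<open>e\<close>.
  Admissibility is applied afterwards, with an accuracy chosen in terms of C.\<close>

lemma null_comp:
  assumes X: "null j X" and Y: "adm j Y" shows "null j (\<lambda>g. X (Y g))"
proof -
  have bY: "bddop Y" and mY: "null j (\<lambda>g. Mop j (Y g))" using Y by (simp_all add: adm_def)
  obtain B where B: "B \<ge> 0" "\<And>g. g \<in> A2 \<Longrightarrow> nrm (Y g) \<le> B * nrm g" using bddopE[OF bY] by blast
  show ?thesis
  proof (rule null_bound[where K = "B + 1"])
    fix e :: real assume e: "e > 0"
    obtain C where C: "C \<ge> 0" "\<And>g. g \<in> A2 \<Longrightarrow> nrm (X g) \<le> e * nrm g + C * nrm (Mop j g)" using nullE[OF X e] by blast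
    \<comment> \<open>Chosen after C, so that C times this accuracy stays below
      \<open>e\<close>.\<close>
    have "e / (C + 1) > 0" using e C by simp
    then obtain D where D: "D \<ge> 0" "\<And>g. g \<in> A2 \<Longrightarrow> nrm (Mop j (Y g)) \<le> e / (C + 1) * nrm g + D * nrm (Mop j g)" using nullE[OF mY] by blast
    show "\<exists>C\<ge>0. \<forall>g\<in>A2. nrm (X (Y g)) \<le> (B + 1) * e * nrm g + C * nrm (Mop j g)"
    proof (intro exI[of _ "C * D"] conjI ballI)
      fix g :: "complex ^ 'a \<Rightarrow> complex" assume g: "g \<in> A2"
      have "nrm (X (Y g)) \<le> e * nrm (Y g) + C * nrm (Mop j (Y g))" by (rule C(2)[OF bddopD[OF bY g]])
      also have "\<dots> \<le> e * (B * nrm g) + C * (e / (C + 1) * nrm g + D * nrm (Mop j g))"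
        using e C(1) by (intro add_mono mult_left_mono B D g) auto
      also have "\<dots> = (B * e) * nrm g + (C * (e / (C + 1))) * nrm g + C * D * nrm (Mop j g)" by (simp add: algebra_simps)
      also have "C * (e / (C + 1)) * nrm g \<le> e * nrm g"
        using e C(1) by (intro mult_right_mono) (auto simp: field_simps)
      finally show "nrm (X (Y g)) \<le> (B + 1) * e * nrm g + C * D * nrm (Mop j g)" by (simp add: algebra_simps)
    qed (use C D in auto)
  qed (use B bddopD[OF bY] nullD[OF X] in auto)
qed

lemma nulleq_comp: "nulleq j X X' \<Longrightarrow> adm j Y \<Longrightarrow> nulleq j (\<lambda>g. X (Y g)) (\<lambda>g. X' (Y g))"
  unfolding nulleq_def by (rule null_comp)

lemma adm_comp: assumes "adm j X" "adm j Y" shows "adm j (\<lambda>g. X (Y g))"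
  using bddop_comp[of X Y] null_comp[of j "\<lambda>g. Mop j (X g)" Y] assms by (simp add: adm_def)

lemma adm_diff: assumes X: "adm j X" and Y: "adm j Y" shows "adm j (\<lambda>g z. X g z - Y g z)"
proof -
  have "null j (\<lambda>g z. Mop j (X g) z - Mop j (Y g) z)" using X Y by (intro null_diff) (simp_all add: adm_def)
  hence "null j (\<lambda>g. Mop j (\<lambda>z. X g z - Y g z))"
    by (rule null_cong) (simp add: Mop_diff bddopD[OF adm_bddop[OF X]] bddopD[OF adm_bddop[OF Y]])
  thus ?thesis using bddop_diff[OF adm_bddop[OF X] adm_bddop[OF Y]] by (simp add: adm_def)
qed

text \<open>M is bounded, so it carries the null difference of the two operators to a null
  operator.\<close>

lemma adm_perturb:
  assumes Y: "adm j Y" and Y': "bddop Y'" and eq: "nulleq j Y' Y" shows "adm j Y'"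
proof -
  have bY: "bddop Y" using Y by (simp add: adm_def)
  have "null j (\<lambda>g. Mop j (\<lambda>z. Y' g z - Y g z))"
  proof (rule null_left[OF eq[unfolded nulleq_def], where B = 2])
    fix g :: "complex ^ 'a \<Rightarrow> complex" assume g: "g \<in> A2"
    have d: "(\<lambda>z. Y' g z - Y g z) \<in> A2" by (intro A2_diff bddopD[OF Y' g] bddopD[OF bY g])
    show "Mop j (\<lambda>z. Y' g z - Y g z) \<in> L2" by (rule A2_L2[OF Mop_A2[OF d]])
    show "nrm (Mop j (\<lambda>z. Y' g z - Y g z)) \<le> 2 * nrm (\<lambda>z. Y' g z - Y g z)" by (rule nrm_Mop_le[OF d])
  qed simp
  moreover have "null j (\<lambda>g. Mop j (Y g))" using Y by (simp add: adm_def)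
  ultimately have "null j (\<lambda>g z. Mop j (\<lambda>z. Y' g z - Y g z) z + Mop j (Y g) z)" by (rule null_add)
  hence "null j (\<lambda>g. Mop j (Y' g))"
    by (rule null_cong) (simp add: Mop_diff bddopD[OF Y'] bddopD[OF bY])
  thus ?thesis using Y' by (simp add: adm_def)
qed

lemma nulleq_T:
  assumes \<phi>: "bdd \<phi>" and X: "\<And>g. g \<in> A2 \<Longrightarrow> X g \<in> A2" and Y: "\<And>g. g \<in> A2 \<Longrightarrow> Y g \<in> A2" and eq: "nulleq j X Y"
  shows "nulleq j (\<lambda>g. T \<phi> (X g)) (\<lambda>g. T \<phi> (Y g))"
proof -
  obtain C where C: "C \<ge> 0" "\<And>z. z \<in> polydisk \<Longrightarrow> norm (\<phi> z) \<le> C" using bddE[OF \<phi>] by blast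
  show ?thesis unfolding nulleq_def
  proof (rule null_left[OF eq[unfolded nulleq_def] _ _ C(1)])
    fix g :: "complex ^ 'a \<Rightarrow> complex" assume g: "g \<in> A2"
    have e: "(\<lambda>z. T \<phi> (X g) z - T \<phi> (Y g) z) = T \<phi> (\<lambda>z. X g z - Y g z)"
      by (rule T_diff[OF \<phi> X[OF g] Y[OF g], symmetric])
    have d: "(\<lambda>z. X g z - Y g z) \<in> A2" by (intro A2_diff X Y g)
    show "(\<lambda>z. T \<phi> (X g) z - T \<phi> (Y g) z) \<in> L2" unfolding e by (rule T_L2[OF \<phi> d])
    show "nrm (\<lambda>z. T \<phi> (X g) z - T \<phi> (Y g) z) \<le> C * nrm (\<lambda>z. X g z - Y g z)"
      unfolding e by (rule T_norm_le[OF \<phi> d C(2,1)])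
  qed
qed

lemma nulleq_limit:
  assumes X: "\<And>g. g \<in> A2 \<Longrightarrow> X g \<in> A2" and Z: "\<And>g. g \<in> A2 \<Longrightarrow> Z g \<in> A2"
    and ex: "\<And>e. e > 0 \<Longrightarrow> \<exists>X' Z'. nulleq j X' Z' \<and> (\<forall>g\<in>A2. X' g \<in> A2 \<and> Z' g \<in> A2 \<and>
        nrm (\<lambda>z. X g z - X' g z) \<le> e * nrm g \<and> nrm (\<lambda>z. Z g z - Z' g z) \<le> e * nrm g)"
  shows "nulleq j X Z"
  unfolding nulleq_def
proof (rule null_limit)
  show "(\<lambda>z. X g z - Z g z) \<in> L2" if "g \<in> A2" for g by (intro A2_L2[OF A2_diff[OF X[OF that] Z[OF that]]])
  fix e :: real assume "e > 0"
  hence "e / 2 > 0" by simp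
  from ex[OF this] obtain X' Z' where X'Z': "nulleq j X' Z'" "\<And>g. g \<in> A2 \<Longrightarrow> X' g \<in> A2" "\<And>g. g \<in> A2 \<Longrightarrow> Z' g \<in> A2"
        "\<And>g. g \<in> A2 \<Longrightarrow> nrm (\<lambda>z. X g z - X' g z) \<le> e / 2 * nrm g" "\<And>g. g \<in> A2 \<Longrightarrow> nrm (\<lambda>z. Z g z - Z' g z) \<le> e / 2 * nrm g"
    by blast
  show "\<exists>Y. null j Y \<and> (\<forall>g\<in>A2. nrm (\<lambda>z. (X g z - Z g z) - Y g z) \<le> e * nrm g)"
  proof (intro exI conjI ballI)
    show "null j (\<lambda>g z. X' g z - Z' g z)" using X'Z'(1) by (simp add: nulleq_def)
    fix g :: "complex ^ 'a \<Rightarrow> complex" assume g: "g \<in> A2"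
    have "nrm (\<lambda>z. (X g z - X' g z) - (Z g z - Z' g z)) \<le> nrm (\<lambda>z. X g z - X' g z) + nrm (\<lambda>z. Z g z - Z' g z)"
      by (intro L2_norm_triangle_diff A2_L2[OF A2_diff[OF X[OF g] X'Z'(2)[OF g]]] A2_L2[OF A2_diff[OF Z[OF g] X'Z'(3)[OF g]]])
    moreover have "(\<lambda>z. (X g z - X' g z) - (Z g z - Z' g z)) = (\<lambda>z. (X g z - Z g z) - (X' g z - Z' g z))" by auto
    ultimately show "nrm (\<lambda>z. (X g z - Z g z) - (X' g z - Z' g z)) \<le> e * nrm g"
      using X'Z'(4)[OF g] X'Z'(5)[OF g] by (simp add: field_simps)
  qed
qed

lemma adm_limit:
  assumes X: "bddop X"
    and ex: "\<And>e. e > 0 \<Longrightarrow> \<exists>Y. adm j Y \<and> (\<forall>g\<in>A2. nrm (\<lambda>z. X g z - Y g z) \<le> e * nrm g)"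
  shows "adm j X"
proof -
  have "null j (\<lambda>g. Mop j (X g))"
  proof (rule null_limit)
    show "Mop j (X g) \<in> L2" if "g \<in> A2" for g by (rule A2_L2[OF Mop_A2[OF bddopD[OF X that]]])
    fix e :: real assume "e > 0"
    hence "e / 2 > 0" by simp
    from ex[OF this] obtain Y where Y: "adm j Y" "\<And>g. g \<in> A2 \<Longrightarrow> nrm (\<lambda>z. X g z - Y g z) \<le> e / 2 * nrm g" by blast
    show "\<exists>Y. null j Y \<and> (\<forall>g\<in>A2. nrm (\<lambda>z. Mop j (X g) z - Y g z) \<le> e * nrm g)"
    proof (intro exI conjI ballI)
      show "null j (\<lambda>g. Mop j (Y g))" using Y(1) by (simp add: adm_def)
      fix g :: "complex ^ 'a \<Rightarrow> complex" assume g: "g \<in> A2"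
      note XY = bddopD[OF X g] bddopD[OF adm_bddop[OF Y(1)] g]
      show "nrm (\<lambda>z. Mop j (X g) z - Mop j (Y g) z) \<le> e * nrm g"
        unfolding Mop_diff[OF XY, symmetric]
        using nrm_Mop_le[OF A2_diff[OF XY], of j] Y(2)[OF g] by (simp add: field_simps)
    qed
  qed
  thus ?thesis using X by (simp add: adm_def)
qed

section \<open>Hankel operators and products of symbols\<close>

text \<open>The failure of T to be multiplicative is the projection of \<phi> times the part of
  \<kappa> g orthogonal to the Bergman space.\<close>

lemma T_mult_split:
  assumes \<phi>: "bdd \<phi>" and \<kappa>: "bdd \<kappa>" and g: "g \<in> A2"
  shows "T (\<lambda>z. \<phi> z * \<kappa> z) g = (\<lambda>z. T \<phi> (T \<kappa> g) z + proj (\<lambda>z. \<phi> z * (\<kappa> z * g z - T \<kappa> g z)) z)"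
proof -
  have R: "(\<lambda>z. \<kappa> z * g z - T \<kappa> g z) \<in> L2" by (intro L2_diff sym_L2[OF \<kappa> g] T_L2[OF \<kappa> g])
  have "(\<lambda>z. \<phi> z * \<kappa> z * g z) = (\<lambda>z. \<phi> z * T \<kappa> g z + \<phi> z * (\<kappa> z * g z - T \<kappa> g z))"
    by (simp add: fun_eq_iff algebra_simps)
  thus ?thesis
    unfolding T_eq[of "\<lambda>z. \<phi> z * \<kappa> z"] T_eq[of \<phi>]
    using proj_add[OF sym_L2[OF \<phi> T_A2[OF \<kappa> g]] L2_mult[OF \<phi> R]] by simp
qed

abbreviation hankel :: "(complex ^ 'n \<Rightarrow> complex) \<Rightarrow> 'n::finite op" where
  "hankel \<kappa> \<equiv> \<lambda>g z. \<kappa> z * g z - T \<kappa> g z"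

lemma hankel_L2: "bdd \<kappa> \<Longrightarrow> g \<in> A2 \<Longrightarrow> hankel \<kappa> g \<in> L2"
  by (intro L2_diff sym_L2 T_L2)

text \<open>Only the right-hand symbol needs a null Hankel operator; the left-hand one is an
  arbitrary bounded symbol and acts as a bounded left factor on the defect.\<close>

lemma nulleq_T_mult:
  assumes \<phi>: "bdd \<phi>" and \<kappa>: "bdd \<kappa>" and null: "null j (hankel \<kappa>)"
  shows "nulleq j (T (\<lambda>z. \<phi> z * \<kappa> z)) (\<lambda>g. T \<phi> (T \<kappa> g))"
proof -
  obtain C where C: "C \<ge> 0" "\<And>z. z \<in> polydisk \<Longrightarrow> norm (\<phi> z) \<le> C" using bddE[OF \<phi>] by blast
  show ?thesis unfolding nulleq_def
  proof (rule null_left[OF null _ _ C(1)])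
    fix g :: "complex ^ 'a \<Rightarrow> complex" assume g: "g \<in> A2"
    have e: "(\<lambda>z. T (\<lambda>z. \<phi> z * \<kappa> z) g z - T \<phi> (T \<kappa> g) z) = proj (\<lambda>z. \<phi> z * hankel \<kappa> g z)"
      unfolding T_mult_split[OF \<phi> \<kappa> g] by simp
    note R = L2_mult[OF \<phi> hankel_L2[OF \<kappa> g]]
    show "(\<lambda>z. T (\<lambda>z. \<phi> z * \<kappa> z) g z - T \<phi> (T \<kappa> g) z) \<in> L2" unfolding e by (rule proj_L2[OF R])
    show "nrm (\<lambda>z. T (\<lambda>z. \<phi> z * \<kappa> z) g z - T \<phi> (T \<kappa> g) z) \<le> C * nrm (hankel \<kappa> g)"
      unfolding e using nrm_proj_le[OF R] L2_norm_mult_le[OF \<phi> hankel_L2[OF \<kappa> g] C(2,1)] by linarith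
  qed
qed

lemma nulleq_mult_T:
  assumes \<phi>: "bdd \<phi>" and X: "\<And>g. g \<in> A2 \<Longrightarrow> X g \<in> L2" and Y: "\<And>g. g \<in> A2 \<Longrightarrow> Y g \<in> L2" and eq: "nulleq j X Y"
  shows "nulleq j (\<lambda>g z. \<phi> z * X g z) (\<lambda>g z. \<phi> z * Y g z)"
proof -
  obtain C where C: "C \<ge> 0" "\<And>z. z \<in> polydisk \<Longrightarrow> norm (\<phi> z) \<le> C" using bddE[OF \<phi>] by blast
  have d: "(\<lambda>z. X g z - Y g z) \<in> L2" if "g \<in> A2" for g by (intro L2_diff X Y that)
  have e: "(\<lambda>z. \<phi> z * X g z - \<phi> z * Y g z) = (\<lambda>z. \<phi> z * (X g z - Y g z))" for g by (simp add: algebra_simps)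
  show ?thesis unfolding nulleq_def e
    by (rule null_left[OF eq[unfolded nulleq_def] L2_mult[OF \<phi> d] L2_norm_mult_le[OF \<phi> d C(2,1)] C(1)])
qed

subsection \<open>Symbols depending on one coordinate\<close>

definition jfree :: "'n \<Rightarrow> (complex ^ 'n \<Rightarrow> complex) \<Rightarrow> bool" where
  "jfree j h \<longleftrightarrow> indep j h \<and> continuous_on polydisk h \<and> bdd h"

lemma jfreeD: "jfree j h \<Longrightarrow> indep j h" "jfree j h \<Longrightarrow> continuous_on polydisk h" "jfree j h \<Longrightarrow> bdd h"
  by (simp_all add: jfree_def)

lemma adm_T_jfree: assumes h: "jfree j h" shows "adm j (T h)"
proof -
  obtain C where C: "C \<ge> 0" "\<And>z. z \<in> polydisk \<Longrightarrow> norm (h z) \<le> C" using bddE[OF jfreeD(3)[OF h]] by blast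
  have "null j (\<lambda>g. Mop j (T h g))"
  proof (rule null_left[OF null_Mop _ _ C(1)])
    fix g :: "complex ^ 'a \<Rightarrow> complex" assume g: "g \<in> A2"
    show "Mop j (T h g) \<in> L2" by (intro A2_L2[OF Mop_A2] T_A2 jfreeD(3)[OF h] g)
    show "nrm (Mop j (T h g)) \<le> C * nrm (Mop j g)"
      unfolding T_indep_Mop[OF jfreeD[OF h] g, symmetric] by (rule T_norm_le[OF jfreeD(3)[OF h] Mop_A2[OF g] C(2,1)])
  qed
  thus ?thesis using bddop_T[OF jfreeD(3)[OF h]] by (simp add: adm_def)
qed

text \<open>Collects everything needed of a symbol \<kappa>(z_j) in a form stable under sums,
  products and uniform limits, so that Stone-Weierstrass reduces all continuous \<kappa> to z_j and
  its conjugate.\<close>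

definition Cclass :: "'n \<Rightarrow> (complex ^ 'n \<Rightarrow> complex) \<Rightarrow> bool" where
  "Cclass j \<kappa> \<longleftrightarrow> bdd \<kappa> \<and> null j (hankel \<kappa>) \<and> adm j (T \<kappa>) \<and>
     (\<forall>h. jfree j h \<longrightarrow> nulleq j (\<lambda>g. T \<kappa> (T h g)) (\<lambda>g. T h (T \<kappa> g)))"

lemma CclassD: 
  assumes "Cclass j \<kappa>" 
  shows "bdd \<kappa>" "null j (hankel \<kappa>)" "adm j (T \<kappa>)" "jfree j h \<Longrightarrow> nulleq j (\<lambda>g. T \<kappa> (T h g)) (\<lambda>g. T h (T \<kappa> g))"
  using assms by (simp_all add: Cclass_def)

lemma Cclass_const: "Cclass j (\<lambda>_. c)"
proof -
  have Tc: "T (\<lambda>_. c) g = (\<lambda>z. c * g z)" if "g \<in> A2" for g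
    using that by (intro T_holomorphic bdd_symbol_const) (simp add: sephol_def hol_in_const)
  have jf: "jfree j (\<lambda>_. c)" by (simp add: jfree_def indep_def bdd_symbol_const)
  have "null j (hankel (\<lambda>_. c))" by (rule null_cong[OF null_zero]) (simp add: Tc)
  moreover have "nulleq j (\<lambda>g. T (\<lambda>_. c) (T h g)) (\<lambda>g. T h (T (\<lambda>_. c) g))" if "jfree j h" for h
    by (rule nulleq_eq) (simp add: Tc T_A2 jfreeD(3)[OF that] T_scale[OF jfreeD(3)[OF that]])
  ultimately show ?thesis using adm_T_jfree[OF jf] by (simp add: Cclass_def bdd_symbol_const)
qed

lemma Cclass_coord: "Cclass j (\<lambda>z. z $ j)"
proof -
  have "null j (hankel (\<lambda>z. z $ j))" by (rule null_cong[OF null_zero]) (simp add: T_coord)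
  moreover have "adm j (T (\<lambda>z. z $ j))"
    unfolding adm_def
  proof (intro conjI bddop_T bdd_coord)
    show "null j (\<lambda>g. Mop j (T (\<lambda>z. z $ j) g))"
      by (rule null_left[OF null_Mop, where B = 1])
         (simp_all add: T_coord nrm_Mop_coord A2_L2[OF Mop_A2[OF A2_coord]])
  qed
  moreover have "nulleq j (\<lambda>g. T (\<lambda>z. z $ j) (T h g)) (\<lambda>g. T h (T (\<lambda>z. z $ j) g))" if "jfree j h" for h
    by (rule nulleq_eq) (simp add: T_coord T_A2 jfreeD(3)[OF that] T_indep_commutes_coord[OF jfreeD[OF that]])
  ultimately show ?thesis by (simp add: Cclass_def bdd_coord)
qed

text \<open>The case that carries the analysis: the factor sqrt 2 is the Hankel estimate, the factor
  3 the relation between M and \<open>Bs\<close>.\<close>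

lemma Cclass_cnj_coord: "Cclass j (\<lambda>z. cnj (z $ j))"
proof -
  have "null j (hankel (\<lambda>z. cnj (z $ j)))"
  proof (rule null_left[OF null_Mop, where B = "sqrt 2"])
    fix g :: "complex ^ 'a \<Rightarrow> complex" assume g: "g \<in> A2"
    show "hankel (\<lambda>z. cnj (z $ j)) g \<in> L2" by (rule hankel_L2[OF bdd_cnj_coord g])
    show "nrm (hankel (\<lambda>z. cnj (z $ j)) g) \<le> sqrt 2 * nrm (Mop j g)"
      using real_sqrt_le_mono[OF hankel_cnj_coord[OF g, of j]] by (simp add: real_sqrt_mult)
  qed simp
  moreover have "adm j (Bs j)"
    unfolding adm_def
  proof (intro conjI bddop_T bdd_cnj_coord)
    show "null j (\<lambda>g. Mop j (Bs j g))"
      by (rule null_left[OF null_Mop, where B = 3])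
         (simp_all add: nrm_Mop_Bs A2_L2[OF Mop_A2[OF Bs_A2]])
  qed
  moreover have "nulleq j (\<lambda>g. Bs j (T h g)) (\<lambda>g. T h (Bs j g))" if "jfree j h" for h
    by (rule nulleq_eq) (simp add: T_indep_Bs[OF jfreeD[OF that]])
  ultimately show ?thesis by (simp add: Cclass_def bdd_cnj_coord)
qed

lemma nulleq_cong: 
  assumes "nulleq j X Y" "\<And>g. g \<in> A2 \<Longrightarrow> X g = X' g" "\<And>g. g \<in> A2 \<Longrightarrow> Y g = Y' g" shows "nulleq j X' Y'"
  using assms unfolding nulleq_def by (auto intro: null_cong)

lemma Mop_L2: "g \<in> A2 \<Longrightarrow> Mop j g \<in> L2"
  by (rule A2_L2[OF Mop_A2])

lemma adm_add: assumes X: "adm j X" and Y: "adm j Y" shows "adm j (\<lambda>g z. X g z + Y g z)"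
proof -
  have z: "adm j (\<lambda>g z. 0)"
    using adm_diff[OF Y Y] by simp
  show ?thesis using adm_diff[OF X adm_diff[OF z Y]] by simp
qed

lemma Cclass_add: assumes a: "Cclass j \<phi>" and b: "Cclass j \<psi>" shows "Cclass j (\<lambda>z. \<phi> z + \<psi> z)"
proof -
  note a' = CclassD[OF a] and b' = CclassD[OF b]
  have bd: "bdd (\<lambda>z. \<phi> z + \<psi> z)" by (intro bdd_symbol_add a' b')
  have Ts: "T (\<lambda>z. \<phi> z + \<psi> z) g = (\<lambda>z. T \<phi> g z + T \<psi> g z)" if "g \<in> A2" for g by (rule T_sym_add[OF a'(1) b'(1) that])
  have "null j (hankel (\<lambda>z. \<phi> z + \<psi> z))"
    by (rule null_cong[OF null_add[OF a'(2) b'(2)]]) (simp add: Ts algebra_simps)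
  moreover have "adm j (T (\<lambda>z. \<phi> z + \<psi> z))"
    by (rule adm_perturb[OF adm_add[OF a'(3) b'(3)] bddop_T[OF bd] nulleq_eq]) (rule Ts)
  moreover have "nulleq j (\<lambda>g. T (\<lambda>z. \<phi> z + \<psi> z) (T h g)) (\<lambda>g. T h (T (\<lambda>z. \<phi> z + \<psi> z) g))" if h: "jfree j h" for h
    by (rule nulleq_cong[OF nulleq_add[OF a'(4)[OF h] b'(4)[OF h]]])
       (simp_all add: Ts T_A2 a'(1) b'(1) jfreeD(3)[OF h] T_add[OF jfreeD(3)[OF h]])
  ultimately show ?thesis using bd by (simp add: Cclass_def)
qed

lemma Cclass_mult: assumes a: "Cclass j \<phi>" and b: "Cclass j \<psi>" shows "Cclass j (\<lambda>z. \<phi> z * \<psi> z)"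
proof -
  note a' = CclassD[OF a] and b' = CclassD[OF b]
  have bd: "bdd (\<lambda>z. \<phi> z * \<psi> z)" by (intro bdd_symbol_mult a' b')
  note eq = nulleq_T_mult[OF a'(1) b'(1,2)]
  have adm: "adm j (T (\<lambda>z. \<phi> z * \<psi> z))" by (rule adm_perturb[OF adm_comp[OF a'(3) b'(3)] bddop_T[OF bd] eq])
  have n1: "null j (\<lambda>g. hankel \<phi> (T \<psi> g))" by (rule null_comp[OF a'(2) b'(3)])
  have "nulleq j (\<lambda>g z. \<phi> z * (\<psi> z * g z)) (\<lambda>g z. \<phi> z * T \<psi> g z)"
    using b'(2) by (intro nulleq_mult_T a' sym_L2 T_L2 b') (simp_all add: nulleq_def)
  hence n2: "null j (\<lambda>g z. \<phi> z * \<psi> z * g z - \<phi> z * T \<psi> g z)" by (simp add: nulleq_def mult.assoc)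
  have n3: "null j (\<lambda>g z. T (\<lambda>z. \<phi> z * \<psi> z) g z - T \<phi> (T \<psi> g) z)" using eq by (simp add: nulleq_def)
  \<comment> \<open>The Hankel operator of a product: H_\<phi> after T_\<psi>, plus \<phi> times
    H_\<psi>, minus the defect of multiplicativity of T. Each summand is null by a different
    property of the class.\<close>
  have "null j (\<lambda>g z. hankel \<phi> (T \<psi> g) z + (\<phi> z * \<psi> z * g z - \<phi> z * T \<psi> g z - (T (\<lambda>z. \<phi> z * \<psi> z) g z - T \<phi> (T \<psi> g) z)))"
    by (rule null_add[OF n1 null_diff[OF n2 n3]])
  hence "null j (hankel (\<lambda>z. \<phi> z * \<psi> z))" by (rule null_cong) simp
  moreover have "nulleq j (\<lambda>g. T (\<lambda>z. \<phi> z * \<psi> z) (T h g)) (\<lambda>g. T h (T (\<lambda>z. \<phi> z * \<psi> z) g))" if h: "jfree j h" for h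
  proof -
    note bh = jfreeD(3)[OF h]
    note A = T_A2[OF a'(1)] T_A2[OF b'(1)] T_A2[OF bh] T_A2[OF bd]
    have "nulleq j (\<lambda>g. T (\<lambda>z. \<phi> z * \<psi> z) (T h g)) (\<lambda>g. T \<phi> (T \<psi> (T h g)))"
      by (rule nulleq_comp[OF eq adm_T_jfree[OF h]])
    also have "nulleq j (\<lambda>g. T \<phi> (T \<psi> (T h g))) (\<lambda>g. T \<phi> (T h (T \<psi> g)))"
      by (rule nulleq_T[OF a'(1) _ _ b'(4)[OF h]]) (intro A; assumption)+
    also have "nulleq j (\<lambda>g. T \<phi> (T h (T \<psi> g))) (\<lambda>g. T h (T \<phi> (T \<psi> g)))"
      by (rule nulleq_comp[OF a'(4)[OF h] b'(3)])
    also have "nulleq j (\<lambda>g. T h (T \<phi> (T \<psi> g))) (\<lambda>g. T h (T (\<lambda>z. \<phi> z * \<psi> z) g))"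
      by (rule nulleq_T[OF bh _ _ nulleq_sym[OF eq]]) (intro A; assumption)+
    finally show ?thesis .
  qed
  ultimately show ?thesis using bd adm by (simp add: Cclass_def)
qed

lemma nrm_T_diff_le:
  assumes "bdd \<phi>" "bdd \<psi>" "g \<in> A2" "\<And>z. z \<in> polydisk \<Longrightarrow> norm (\<phi> z - \<psi> z) \<le> e" "0 \<le> e"
  shows "nrm (\<lambda>z. T \<phi> g z - T \<psi> g z) \<le> e * nrm g"
  unfolding T_sym_diff[OF assms(1-3), symmetric]
  by (rule T_norm_le[OF bdd_symbol_diff[OF assms(1,2)] assms(3-5)])

lemma adm_T_limit:
  assumes \<kappa>: "bdd \<kappa>"
    and ex: "\<And>e. e > 0 \<Longrightarrow> \<exists>\<psi>. bdd \<psi> \<and> adm j (T \<psi>) \<and> (\<forall>z\<in>polydisk. norm (\<kappa> z - \<psi> z) \<le> e)"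
  shows "adm j (T \<kappa>)"
proof (rule adm_limit[OF bddop_T[OF \<kappa>]])
  fix e :: real assume e: "e > 0"
  obtain \<psi> where \<psi>: "bdd \<psi>" "adm j (T \<psi>)" "\<And>z. z \<in> polydisk \<Longrightarrow> norm (\<kappa> z - \<psi> z) \<le> e" using ex[OF e] by blast
  have "nrm (\<lambda>z. T \<kappa> g z - T \<psi> g z) \<le> e * nrm g" if "g \<in> A2" for g
    using e by (intro nrm_T_diff_le \<kappa> \<psi> that) auto
  thus "\<exists>Y. adm j Y \<and> (\<forall>g\<in>A2. nrm (\<lambda>z. T \<kappa> g z - Y g z) \<le> e * nrm g)" using \<psi>(2) by blast
qed

text \<open>Both orders of composition depend continuously on the symbol, with the bound of
  \<open>h\<close> as modulus; hence the accuracy is divided by C + 1.\<close>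

lemma commute_T_limit:
  assumes \<kappa>: "bdd \<kappa>" and h: "bdd h"
    and ex: "\<And>e. e > 0 \<Longrightarrow> \<exists>\<psi>. bdd \<psi> \<and> nulleq j (\<lambda>g. T \<psi> (T h g)) (\<lambda>g. T h (T \<psi> g)) \<and> (\<forall>z\<in>polydisk. norm (\<kappa> z - \<psi> z) \<le> e)"
  shows "nulleq j (\<lambda>g. T \<kappa> (T h g)) (\<lambda>g. T h (T \<kappa> g))"
proof (rule nulleq_limit)
  show "T \<kappa> (T h g) \<in> A2" "T h (T \<kappa> g) \<in> A2" if "g \<in> A2" for g by (intro T_A2 \<kappa> h that)+
  obtain C where C: "C \<ge> 0" "\<And>z. z \<in> polydisk \<Longrightarrow> norm (h z) \<le> C" using bddE[OF h] by blast
  fix e :: real assume e: "e > 0"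
  define d where "d = e / (C + 1)"
  have d: "d > 0" "C * d \<le> e" unfolding d_def using e C(1) by (auto simp: field_simps)
  obtain \<psi> where \<psi>: "bdd \<psi>" "nulleq j (\<lambda>g. T \<psi> (T h g)) (\<lambda>g. T h (T \<psi> g))" "\<And>z. z \<in> polydisk \<Longrightarrow> norm (\<kappa> z - \<psi> z) \<le> d"
    using ex[OF d(1)] by blast
  have 1: "nrm (\<lambda>z. T \<kappa> (T h g) z - T \<psi> (T h g) z) \<le> e * nrm g" if g: "g \<in> A2" for g
  proof -
    have "nrm (\<lambda>z. T \<kappa> (T h g) z - T \<psi> (T h g) z) \<le> d * nrm (T h g)"
      using d by (intro nrm_T_diff_le \<kappa> \<psi> T_A2 h g) auto
    also have "\<dots> \<le> d * (C * nrm g)" using d by (intro mult_left_mono T_norm_le h g C) auto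
    also have "\<dots> \<le> e * nrm g" using mult_right_mono[OF d(2), of "nrm g"] by (simp add: mult_ac)
    finally show ?thesis .
  qed
  have 2: "nrm (\<lambda>z. T h (T \<kappa> g) z - T h (T \<psi> g) z) \<le> e * nrm g" if g: "g \<in> A2" for g
  proof -
    have A: "(\<lambda>z. T \<kappa> g z - T \<psi> g z) \<in> A2" by (intro A2_diff T_A2 \<kappa> \<psi> g)
    have "nrm (\<lambda>z. T h (T \<kappa> g) z - T h (T \<psi> g) z) \<le> C * nrm (\<lambda>z. T \<kappa> g z - T \<psi> g z)"
      unfolding T_diff[OF h T_A2[OF \<kappa> g] T_A2[OF \<psi>(1) g], symmetric] by (rule T_norm_le[OF h A C(2,1)])
    also have "\<dots> \<le> C * (d * nrm g)" using d C by (intro mult_left_mono nrm_T_diff_le \<kappa> \<psi> g) auto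
    also have "\<dots> \<le> e * nrm g" using mult_right_mono[OF d(2), of "nrm g"] by (simp add: mult_ac)
    finally show ?thesis .
  qed
  show "\<exists>X' Z'. nulleq j X' Z' \<and> (\<forall>g\<in>A2. X' g \<in> A2 \<and> Z' g \<in> A2 \<and>
        nrm (\<lambda>z. T \<kappa> (T h g) z - X' g z) \<le> e * nrm g \<and> nrm (\<lambda>z. T h (T \<kappa> g) z - Z' g z) \<le> e * nrm g)"
    by (intro exI[of _ "\<lambda>g. T \<psi> (T h g)"] exI[of _ "\<lambda>g. T h (T \<psi> g)"] conjI ballI \<psi>(2) 1 2 T_A2[OF \<psi>(1) T_A2[OF h]] T_A2[OF h T_A2[OF \<psi>(1)]])
qed

lemma Cclass_limit:
  assumes \<kappa>: "bdd \<kappa>"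
    and ex: "\<And>e. e > 0 \<Longrightarrow> \<exists>\<psi>. Cclass j \<psi> \<and> (\<forall>z\<in>polydisk. norm (\<kappa> z - \<psi> z) \<le> e)"
  shows "Cclass j \<kappa>"
proof -
  have "null j (hankel \<kappa>)"
  proof (rule null_limit[OF hankel_L2[OF \<kappa>]])
    fix e :: real assume e: "e > 0"
    obtain \<psi> where \<psi>: "Cclass j \<psi>" "\<And>z. z \<in> polydisk \<Longrightarrow> norm (\<kappa> z - \<psi> z) \<le> e" using ex[OF e] by blast
    note \<psi>' = CclassD[OF \<psi>(1)]
    have d: "bdd (\<lambda>z. \<kappa> z - \<psi> z)" by (intro bdd_symbol_diff \<kappa> \<psi>')
    have "nrm (\<lambda>z. hankel \<kappa> g z - hankel \<psi> g z) \<le> e * nrm g" if g: "g \<in> A2" for g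
    proof -
      have "(\<lambda>z. hankel \<kappa> g z - hankel \<psi> g z) = (\<lambda>z. (\<kappa> z - \<psi> z) * g z - proj (\<lambda>z. (\<kappa> z - \<psi> z) * g z) z)"
        using T_sym_diff[OF \<kappa> \<psi>'(1) g] by (simp add: T_eq fun_eq_iff algebra_simps)
      thus ?thesis
        using order_trans[OF nrm_coproj_le[OF sym_L2[OF d g]] L2_norm_mult_le[OF d A2_L2[OF g] \<psi>(2)]] e by simp
    qed
    thus "\<exists>Y. null j Y \<and> (\<forall>g\<in>A2. nrm (\<lambda>z. hankel \<kappa> g z - Y g z) \<le> e * nrm g)" using \<psi>'(2) by blast
  qed
  moreover have "adm j (T \<kappa>)" by (rule adm_T_limit[OF \<kappa>]) (meson ex CclassD(1,3))
  moreover have "nulleq j (\<lambda>g. T \<kappa> (T h g)) (\<lambda>g. T h (T \<kappa> g))" if h: "jfree j h" for h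
  proof (rule commute_T_limit[OF \<kappa> jfreeD(3)[OF h]])
    fix e :: real assume "e > 0"
    from ex[OF this] obtain \<psi> where \<psi>: "Cclass j \<psi>" "\<forall>z\<in>polydisk. norm (\<kappa> z - \<psi> z) \<le> e" by blast
    show "\<exists>\<psi>. bdd \<psi> \<and> nulleq j (\<lambda>g. T \<psi> (T h g)) (\<lambda>g. T h (T \<psi> g)) \<and> (\<forall>z\<in>polydisk. norm (\<kappa> z - \<psi> z) \<le> e)"
      using CclassD(1)[OF \<psi>(1)] CclassD(4)[OF \<psi>(1) h] \<psi>(2) by blast
  qed
  ultimately show ?thesis using \<kappa> by (simp add: Cclass_def)
qed

lemma bdd_of_continuous:
  assumes "continuous_on (cpoly 1) \<phi>" shows "bdd \<phi>"
proof -
  have "compact (\<phi> ` cpoly 1)" by (intro compact_continuous_image assms compact_cpoly)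
  then obtain C where "\<forall>y\<in>\<phi> ` cpoly 1. norm y \<le> C" using compact_imp_bounded bounded_iff by blast
  moreover have sub: "polydisk \<subseteq> (cpoly 1 :: (complex ^ 'a) set)" using closure_subset closure_polydisk by metis
  ultimately have "\<forall>z\<in>polydisk. norm (\<phi> z) \<le> C" by blast
  thus ?thesis unfolding bdd_symbol_def using pd_measurable[OF continuous_on_subset[OF assms sub]] by blast
qed

lemma coord_cball: "z \<in> cpoly 1 \<Longrightarrow> z $ j \<in> cball 0 1"
  by (simp add: cpoly_def)

lemma polydisk_cpoly: "z \<in> polydisk \<Longrightarrow> z \<in> cpoly 1"
  using closure_subset closure_polydisk by blast

lemma Cclass_real_polynomial:
  "real_polynomial_function q \<Longrightarrow> Cclass j (\<lambda>z. of_real (q (z $ j)))"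
proof (induction rule: real_polynomial_function.induct)
  case (linear f)
  have f: "f w = Re w * f 1 + Im w * f \<i>" for w
  proof -
    have "w = Re w *\<^sub>R 1 + Im w *\<^sub>R \<i>" by (simp add: complex_eq_iff)
    hence "f w = f (Re w *\<^sub>R 1 + Im w *\<^sub>R \<i>)" by (rule arg_cong)
    thus ?thesis using linear_add[OF bounded_linear.linear[OF linear]] linear_scale[OF bounded_linear.linear[OF linear]] by simp
  qed
  \<comment> \<open>Re w and Im w written through w and \<open>cnj w\<close>; a and b are the
    resulting complex coefficients.\<close>
  define a where "a = (of_real (f 1) - \<i> * of_real (f \<i>)) / 2"
  define b where "b = (of_real (f 1) + \<i> * of_real (f \<i>)) / 2"
  have "Cclass j (\<lambda>z. a * z $ j + b * cnj (z $ j))"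
    by (intro Cclass_add Cclass_mult Cclass_const Cclass_coord Cclass_cnj_coord)
  moreover have "of_real (f w) = a * w + b * cnj w" for w
    by (simp add: f[of w] a_def b_def complex_eq_iff field_simps)
  ultimately show ?case by simp
next
  case (const c) show ?case by (rule Cclass_const)
next
  case (add f g) thus ?case using Cclass_add[of j "\<lambda>z. of_real (f (z $ j))" "\<lambda>z. of_real (g (z $ j))"] by simp
next
  case (mult f g) thus ?case using Cclass_mult[of j "\<lambda>z. of_real (f (z $ j))" "\<lambda>z. of_real (g (z $ j))"] by simp
qed

lemma Cclass_continuous:
  fixes \<kappa> :: "complex \<Rightarrow> complex"
  assumes "continuous_on (cball 0 1) \<kappa>"
  shows "Cclass j (\<lambda>z. \<kappa> (z $ j))"
proof (rule Cclass_limit)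
  show "bdd (\<lambda>z. \<kappa> (z $ j))"
    by (rule bdd_of_continuous, rule continuous_on_compose2[OF assms]) (auto intro!: continuous_intros coord_cball)
  fix e :: real assume e: "e > 0"
  obtain p where p: "polynomial_function p" "\<And>w. w \<in> cball 0 1 \<Longrightarrow> norm (\<kappa> w - p w) < e"
    using Stone_Weierstrass_polynomial_function[OF compact_cball assms e] by blast
  have "real_polynomial_function (Re \<circ> p)" "real_polynomial_function (Im \<circ> p)"
    using p(1) bounded_linear_Re bounded_linear_Im unfolding polynomial_function_def by blast+
  hence "Cclass j (\<lambda>z. of_real ((Re \<circ> p) (z $ j)) + \<i> * of_real ((Im \<circ> p) (z $ j)))"
    by (intro Cclass_add Cclass_mult Cclass_const Cclass_real_polynomial)
  hence "Cclass j (\<lambda>z. p (z $ j))" by (simp add: complex_eq[symmetric])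
  moreover have "norm (\<kappa> (z $ j) - p (z $ j)) \<le> e" if "z \<in> polydisk" for z
    using p(2)[OF coord_cball[OF polydisk_cpoly[OF that]]] by (rule less_imp_le)
  ultimately show "\<exists>\<psi>. Cclass j \<psi> \<and> (\<forall>z\<in>polydisk. norm (\<kappa> (z $ j) - \<psi> z) \<le> e)" by blast
qed

subsection \<open>Continuous symbols\<close>

text \<open>For symbols involving the other coordinates the Hankel operator need not be null in j,
  so \<open>Cclass\<close> is too much to ask. Admissibility and commuting with functions of z_j
  modulo null operators survive.\<close>

definition Dclass :: "'n \<Rightarrow> (complex ^ 'n \<Rightarrow> complex) \<Rightarrow> bool" where
  "Dclass j \<phi> \<longleftrightarrow> bdd \<phi> \<and> adm j (T \<phi>) \<and>
     (\<forall>\<kappa>. continuous_on (cball 0 1) \<kappa> \<longrightarrow>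
       nulleq j (\<lambda>g. T \<phi> (T (\<lambda>z. \<kappa> (z $ j)) g)) (\<lambda>g. T (\<lambda>z. \<kappa> (z $ j)) (T \<phi> g)))"

text \<open>Modulo null operators T of the product is T_h T_\<kappa>. Two functions of z_j commute
  because both orders agree with T of their product, and T_h passes by membership of the other
  factor in \<open>Cclass\<close>.\<close>

lemma Dclass_prod:
  assumes h: "jfree j h" and \<kappa>: "continuous_on (cball 0 1) \<kappa>"
  shows "Dclass j (\<lambda>z. h z * \<kappa> (z $ j))"
proof -
  let ?\<kappa> = "\<lambda>z. \<kappa> (z $ j)"
  note bh = jfreeD(3)[OF h] and c = CclassD[OF Cclass_continuous[OF \<kappa>, of j]]
  have bd: "bdd (\<lambda>z. h z * ?\<kappa> z)" by (intro bdd_symbol_mult bh c)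
  have eq: "nulleq j (T (\<lambda>z. h z * ?\<kappa> z)) (\<lambda>g. T h (T ?\<kappa> g))"
    by (rule nulleq_T_mult[OF bh c(1,2)])
  have "adm j (T (\<lambda>z. h z * ?\<kappa> z))"
    by (rule adm_perturb[OF adm_comp[OF adm_T_jfree[OF h] c(3)] bddop_T[OF bd] eq])
  moreover have "nulleq j (\<lambda>g. T (\<lambda>z. h z * ?\<kappa> z) (T (\<lambda>z. \<eta> (z $ j)) g)) (\<lambda>g. T (\<lambda>z. \<eta> (z $ j)) (T (\<lambda>z. h z * ?\<kappa> z) g))"
    if \<eta>: "continuous_on (cball 0 1) \<eta>" for \<eta>
  proof -
    let ?\<eta> = "\<lambda>z. \<eta> (z $ j)"
    note e = CclassD[OF Cclass_continuous[OF \<eta>, of j]]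
    note A = T_A2[OF bh] T_A2[OF c(1)] T_A2[OF e(1)] T_A2[OF bd]
    have "nulleq j (\<lambda>g. T (\<lambda>z. h z * ?\<kappa> z) (T ?\<eta> g)) (\<lambda>g. T h (T ?\<kappa> (T ?\<eta> g)))"
      by (rule nulleq_comp[OF eq e(3)])
    also have "nulleq j \<dots> (\<lambda>g. T h (T (\<lambda>z. ?\<kappa> z * ?\<eta> z) g))"
      by (rule nulleq_T[OF bh _ _ nulleq_sym[OF nulleq_T_mult[OF c(1) e(1,2)]]])
         (intro A T_A2[OF bdd_symbol_mult[OF c(1) e(1)]]; assumption)+
    also have "(\<lambda>z. ?\<kappa> z * ?\<eta> z) = (\<lambda>z. ?\<eta> z * ?\<kappa> z)" by (simp add: mult.commute)
    also have "nulleq j (\<lambda>g. T h (T (\<lambda>z. ?\<eta> z * ?\<kappa> z) g)) (\<lambda>g. T h (T ?\<eta> (T ?\<kappa> g)))"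
      by (rule nulleq_T[OF bh _ _ nulleq_T_mult[OF e(1) c(1,2)]])
         (intro A T_A2[OF bdd_symbol_mult[OF e(1) c(1)]]; assumption)+
    also have "nulleq j \<dots> (\<lambda>g. T ?\<eta> (T h (T ?\<kappa> g)))"
      by (rule nulleq_comp[OF nulleq_sym[OF e(4)[OF h]] c(3)])
    also have "nulleq j \<dots> (\<lambda>g. T ?\<eta> (T (\<lambda>z. h z * ?\<kappa> z) g))"
      by (rule nulleq_T[OF e(1) _ _ nulleq_sym[OF eq]]) (intro A; assumption)+
    finally show ?thesis .
  qed
  ultimately show ?thesis using bd by (simp add: Dclass_def)
qed

lemma Dclass_add:
  assumes a: "Dclass j \<phi>" and b: "Dclass j \<psi>" shows "Dclass j (\<lambda>z. \<phi> z + \<psi> z)"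
proof -
  have bp: "bdd \<phi>" "bdd \<psi>" "adm j (T \<phi>)" "adm j (T \<psi>)" using a b by (simp_all add: Dclass_def)
  have bd: "bdd (\<lambda>z. \<phi> z + \<psi> z)" by (intro bdd_symbol_add bp)
  have Ts: "T (\<lambda>z. \<phi> z + \<psi> z) g = (\<lambda>z. T \<phi> g z + T \<psi> g z)" if "g \<in> A2" for g by (rule T_sym_add[OF bp(1,2) that])
  have "adm j (T (\<lambda>z. \<phi> z + \<psi> z))"
    by (rule adm_perturb[OF adm_add[OF bp(3,4)] bddop_T[OF bd] nulleq_eq]) (rule Ts)
  moreover have "nulleq j (\<lambda>g. T (\<lambda>z. \<phi> z + \<psi> z) (T (\<lambda>z. \<kappa> (z $ j)) g)) (\<lambda>g. T (\<lambda>z. \<kappa> (z $ j)) (T (\<lambda>z. \<phi> z + \<psi> z) g))"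
    if \<kappa>: "continuous_on (cball 0 1) \<kappa>" for \<kappa>
  proof -
    note c = CclassD(1)[OF Cclass_continuous[OF \<kappa>, of j]]
    have 1: "nulleq j (\<lambda>g. T \<phi> (T (\<lambda>z. \<kappa> (z $ j)) g)) (\<lambda>g. T (\<lambda>z. \<kappa> (z $ j)) (T \<phi> g))"
         "nulleq j (\<lambda>g. T \<psi> (T (\<lambda>z. \<kappa> (z $ j)) g)) (\<lambda>g. T (\<lambda>z. \<kappa> (z $ j)) (T \<psi> g))"
      using a b \<kappa> by (simp_all add: Dclass_def)
    show ?thesis
      by (rule nulleq_cong[OF nulleq_add[OF 1]]) (simp_all add: Ts T_A2 bp c T_add)
  qed
  ultimately show ?thesis using bd by (simp add: Dclass_def)
qed

lemma Dclass_limit: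
  assumes \<kappa>: "bdd \<kappa>"
    and ex: "\<And>e. e > 0 \<Longrightarrow> \<exists>\<psi>. Dclass j \<psi> \<and> (\<forall>z\<in>polydisk. norm (\<kappa> z - \<psi> z) \<le> e)"
  shows "Dclass j \<kappa>"
proof -
  have "adm j (T \<kappa>)" by (rule adm_T_limit[OF \<kappa>]) (use ex in \<open>unfold Dclass_def, blast\<close>)
  moreover have "nulleq j (\<lambda>g. T \<kappa> (T (\<lambda>z. \<eta> (z $ j)) g)) (\<lambda>g. T (\<lambda>z. \<eta> (z $ j)) (T \<kappa> g))"
    if \<eta>: "continuous_on (cball 0 1) \<eta>" for \<eta>
    by (rule commute_T_limit[OF \<kappa> CclassD(1)[OF Cclass_continuous[OF \<eta>]]]) (use ex \<eta> in \<open>unfold Dclass_def, blast\<close>)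
  ultimately show ?thesis using \<kappa> by (simp add: Dclass_def)
qed

text \<open>Finite sums of products that separate z_j from the other coordinates. Polynomials have
  this form, so these symbols approximate every continuous one on the closed polydisk.\<close>

inductive split_symbol :: "'n \<Rightarrow> (complex ^ 'n \<Rightarrow> complex) \<Rightarrow> bool" for j where
  prod: "indep j h \<Longrightarrow> continuous_on UNIV h \<Longrightarrow> continuous_on UNIV \<kappa> \<Longrightarrow> split_symbol j (\<lambda>z. h z * \<kappa> (z $ j))"
| add: "split_symbol j \<phi> \<Longrightarrow> split_symbol j \<psi> \<Longrightarrow> split_symbol j (\<lambda>z. \<phi> z + \<psi> z)"

lemma split_symbol_mult:
  assumes "split_symbol j \<phi>" "split_symbol j \<psi>" shows "split_symbol j (\<lambda>z. \<phi> z * \<psi> z)"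
  using assms(1)
proof (induction rule: split_symbol.induct)
  case (prod h \<kappa>)
  note p = prod
  show ?case using assms(2)
  proof (induction rule: split_symbol.induct)
    case (prod h' \<kappa>')
    have "split_symbol j (\<lambda>z. (h z * h' z) * (\<kappa> (z $ j) * \<kappa>' (z $ j)))"
      using p prod by (intro split_symbol.prod[of j "\<lambda>z. h z * h' z" "\<lambda>w. \<kappa> w * \<kappa>' w"]) (auto simp: indep_def intro!: continuous_intros)
    thus ?case by (simp add: mult_ac)
  next
    case (add \<phi> \<psi>)
    thus ?case using split_symbol.add by (simp add: distrib_left)
  qed
next
  case (add \<phi> \<psi>')
  thus ?case using split_symbol.add by (simp add: distrib_right)
qed

lemma split_symbol_const: "split_symbol j (\<lambda>_. c)"
  using split_symbol.prod[of j "\<lambda>_. c" "\<lambda>_. 1"] by (simp add: indep_def)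

lemma split_symbol_real_polynomial:
  fixes q :: "complex ^ 'n \<Rightarrow> real"
  shows "real_polynomial_function q \<Longrightarrow> split_symbol j (\<lambda>z. of_real (q z))"
proof (induction rule: real_polynomial_function.induct)
  case (linear f)
  \<comment> \<open>A real-linear functional is the sum of a part free of z_j and a part depending
    on z_j alone.\<close>
  have f: "f z = f (upd z j 0) + f (axis j (z $ j))" for z
  proof -
    have "z = upd z j 0 + axis j (z $ j)" by (simp add: vec_eq_iff upd_nth axis_def)
    thus ?thesis using linear_add[OF bounded_linear.linear[OF linear], of "upd z j 0" "axis j (z $ j)"] by simp
  qed
  have cf: "continuous_on UNIV f" by (rule linear_continuous_on[OF linear])
  have "split_symbol j (\<lambda>z. of_real (f (upd z j 0)) * 1)"
    by (rule split_symbol.prod[of j "\<lambda>z. of_real (f (upd z j 0))" "\<lambda>_. 1"])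
       (auto simp: indep_def intro!: continuous_intros continuous_on_compose2[OF cf])
  moreover have "split_symbol j (\<lambda>z. 1 * of_real (f (axis j (z $ j))))"
  proof (rule split_symbol.prod[of j "\<lambda>_. 1" "\<lambda>w. of_real (f (axis j w))"])
    have "continuous_on UNIV (\<lambda>w::complex. axis j w)"
      unfolding axis_def
    proof (intro continuous_on_vec_lambda)
      fix i show "continuous_on UNIV (\<lambda>w::complex. if i = j then w else 0)" by (cases "i = j") auto
    qed
    thus "continuous_on UNIV (\<lambda>w. complex_of_real (f (axis j w)))"
      by (intro continuous_intros continuous_on_compose2[OF cf]) auto
  qed (auto simp: indep_def)
  ultimately have "split_symbol j (\<lambda>z. of_real (f (upd z j 0)) * 1 + 1 * of_real (f (axis j (z $ j))))"
    by (rule split_symbol.add)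
  thus ?case by (subst f) simp
next
  case (const c) show ?case by (rule split_symbol_const)
next
  case (add f g) thus ?case using split_symbol.add[of j "\<lambda>z. of_real (f z)" "\<lambda>z. of_real (g z)"] by simp
next
  case (mult f g) thus ?case using split_symbol_mult[of j "\<lambda>z. of_real (f z)" "\<lambda>z. of_real (g z)"] by simp
qed

lemma Dclass_split_symbol: "split_symbol j \<phi> \<Longrightarrow> Dclass j \<phi>"
proof (induction rule: split_symbol.induct)
  case (prod h \<kappa>)
  have "jfree j h" unfolding jfree_def
    using prod bdd_of_continuous[of h] continuous_on_subset[OF prod(2)] by auto
  thus ?case using prod by (intro Dclass_prod) (auto intro: continuous_on_subset)
qed (rule Dclass_add)

lemma Dclass_continuous:
  fixes \<phi> :: "complex ^ 'n \<Rightarrow> complex"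
  assumes "continuous_on (cpoly 1) \<phi>" shows "Dclass j \<phi>"
proof (rule Dclass_limit[OF bdd_of_continuous[OF assms]])
  fix e :: real assume e: "e > 0"
  obtain p where p: "polynomial_function p" "\<And>w. w \<in> cpoly 1 \<Longrightarrow> norm (\<phi> w - p w) < e"
    using Stone_Weierstrass_polynomial_function[OF compact_cpoly assms e] by blast
  have "real_polynomial_function (Re \<circ> p)" "real_polynomial_function (Im \<circ> p)"
    using p(1) bounded_linear_Re bounded_linear_Im unfolding polynomial_function_def by blast+
  hence "split_symbol j (\<lambda>z. of_real ((Re \<circ> p) z) + \<i> * of_real ((Im \<circ> p) z))"
    by (intro split_symbol.add split_symbol_mult split_symbol_const split_symbol_real_polynomial)
  hence "Dclass j p" using Dclass_split_symbol by (simp add: complex_eq[symmetric])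
  moreover have "norm (\<phi> z - p z) \<le> e" if "z \<in> polydisk" for z
    using p(2)[OF polydisk_cpoly[OF that]] by (rule less_imp_le)
  ultimately show "\<exists>\<psi>. Dclass j \<psi> \<and> (\<forall>z\<in>polydisk. norm (\<phi> z - \<psi> z) \<le> e)" by blast
qed

subsection \<open>Analytic discs in the boundary\<close>

text \<open>The Moebius automorphism of the disc that fixes 1 and -1 and sends 0 to s; the parameter
  -s gives the inverse. As s tends to 1, compact subsets are pushed to 1.\<close>

definition disc_auto :: "real \<Rightarrow> complex \<Rightarrow> complex" where
  "disc_auto s \<zeta> = (\<zeta> + of_real s) / (1 + of_real s * \<zeta>)"

text \<open>The disc runs from \<open>p\<close> (at \<open>\<zeta> = 1\<close>) to \<open>q\<close> (at \<open>\<zeta> = -1\<close>). Since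
  \<open>\<bar>1 + \<zeta>\<bar>\<^sup>2 + \<bar>1 - \<zeta>\<bar>\<^sup>2 \<le> 4\<close>, it stays in the polydisk. Rescaled by
  disc automorphisms near \<open>1\<close> and near \<open>-1\<close>, it converges for \<open>s \<rightarrow> 1\<close> to coordinate discs around \<open>p\<close>
  and \<open>q\<close>, in the directions \<open>i\<close> and \<open>k\<close>.\<close>

definition bdisc :: "'n \<Rightarrow> complex \<Rightarrow> complex ^ 'n \<Rightarrow> complex ^ 'n \<Rightarrow> 'n \<Rightarrow> 'n \<Rightarrow> real \<Rightarrow> real \<Rightarrow> complex \<Rightarrow> complex ^ 'n" where
  "bdisc j \<theta> p q i k \<rho> s \<zeta> = (\<chi> c. if c = j then \<theta> else
     p $ c * ((1 + \<zeta>) / 2)\<^sup>2 + q $ c * ((1 - \<zeta>) / 2)\<^sup>2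
     + (if c = i then of_real \<rho> * ((1 + \<zeta>) / 2) * disc_auto (-s) \<zeta> else 0)
     + (if c = k then of_real \<rho> * ((1 - \<zeta>) / 2) * disc_auto s \<zeta> else 0))"

lemma one_plus_nonzero:
  assumes "\<bar>s\<bar> < 1" "norm (\<zeta>::complex) \<le> 1" shows "1 + of_real s * \<zeta> \<noteq> 0"
proof
  assume "1 + of_real s * \<zeta> = 0"
  hence "of_real s * \<zeta> = -1" by (simp add: add_eq_0_iff)
  hence "norm (of_real s * \<zeta>) = 1" by simp
  moreover have "norm (of_real s * \<zeta>) \<le> \<bar>s\<bar> * 1" using assms by (simp add: norm_mult mult_left_le)
  ultimately show False using assms by simp
qed

lemma disc_auto_norm_le:
  assumes s: "\<bar>s\<bar> < 1" and z: "norm \<zeta> \<le> 1" shows "norm (disc_auto s \<zeta>) \<le> 1"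
proof -
  have "(norm (1 + of_real s * \<zeta>))\<^sup>2 - (norm (\<zeta> + of_real s))\<^sup>2 = (1 - s\<^sup>2) * (1 - (norm \<zeta>)\<^sup>2)"
    unfolding cmod_power2 by (simp add: power2_eq_square algebra_simps)
  moreover have "0 \<le> (1 - s\<^sup>2) * (1 - (norm \<zeta>)\<^sup>2)"
    using s z by (intro mult_nonneg_nonneg) (auto simp: abs_square_less_1 power_le_one intro: less_imp_le)
  ultimately have "(norm (\<zeta> + of_real s))\<^sup>2 \<le> (norm (1 + of_real s * \<zeta>))\<^sup>2" by linarith
  hence "norm (\<zeta> + of_real s) \<le> norm (1 + of_real s * \<zeta>)" by (rule power2_le_imp_le) simp
  thus ?thesis using one_plus_nonzero[OF s z] by (simp add: disc_auto_def norm_divide)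
qed

lemma disc_auto_norm_less:
  assumes s: "\<bar>s\<bar> < 1" and z: "norm \<zeta> < 1" shows "norm (disc_auto s \<zeta>) < 1"
proof -
  have "(norm (1 + of_real s * \<zeta>))\<^sup>2 - (norm (\<zeta> + of_real s))\<^sup>2 = (1 - s\<^sup>2) * (1 - (norm \<zeta>)\<^sup>2)"
    unfolding cmod_power2 by (simp add: power2_eq_square algebra_simps)
  moreover have "0 < (1 - s\<^sup>2) * (1 - (norm \<zeta>)\<^sup>2)"
    using s z by (intro mult_pos_pos) (auto simp: abs_square_less_1)
  ultimately have "(norm (\<zeta> + of_real s))\<^sup>2 < (norm (1 + of_real s * \<zeta>))\<^sup>2" by linarith
  hence "norm (\<zeta> + of_real s) < norm (1 + of_real s * \<zeta>)" by (rule power2_less_imp_less) simp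
  moreover have "norm (1 + of_real s * \<zeta>) > 0" using one_plus_nonzero[OF s] z by simp
  ultimately show ?thesis by (simp add: disc_auto_def norm_divide)
qed

lemma disc_auto_inverse:
  assumes s: "\<bar>s\<bar> < 1" and z: "norm \<zeta> < 1" shows "disc_auto (-s) (disc_auto s \<zeta>) = \<zeta>"
proof -
  have n: "1 + of_real s * \<zeta> \<noteq> 0" using one_plus_nonzero[OF s] z by simp
  have s2: "s\<^sup>2 < 1" using s by (simp add: abs_square_less_1)
  hence n2: "(1::complex) - of_real (s\<^sup>2) \<noteq> 0" by (metis eq_iff_diff_eq_0 less_irrefl of_real_1 of_real_eq_iff)
  have "disc_auto s \<zeta> + of_real (-s) = (1 - of_real (s\<^sup>2)) * \<zeta> / (1 + of_real s * \<zeta>)"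
    using n by (simp add: disc_auto_def field_simps power2_eq_square)
  moreover have "1 + of_real (-s) * disc_auto s \<zeta> = (1 - of_real (s\<^sup>2)) / (1 + of_real s * \<zeta>)"
    using n by (simp add: disc_auto_def field_simps power2_eq_square)
  ultimately show ?thesis using n n2 unfolding disc_auto_def[of "-s"] by simp
qed

lemma disc_auto_holomorphic: "\<bar>s\<bar> < 1 \<Longrightarrow> disc_auto s holomorphic_on ball 0 1"
  unfolding disc_auto_def[abs_def] using one_plus_nonzero[of s] by (intro holomorphic_intros) force

lemma disc_auto_uminus: "disc_auto s (- \<zeta>) = - disc_auto (-s) \<zeta>"
  by (simp add: disc_auto_def divide_minus_left[symmetric] del: divide_minus_left)

lemma one_minus_disc_auto:
  assumes s: "0 \<le> s" "s < 1" and z: "norm \<zeta> \<le> r" "r < 1"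
  shows "norm (1 - disc_auto s \<zeta>) \<le> 2 * (1 - s) / (1 - r)"
proof -
  have n: "1 + of_real s * \<zeta> \<noteq> 0" using one_plus_nonzero[of s \<zeta>] s z by simp
  have "1 - disc_auto s \<zeta> = of_real (1 - s) * (1 - \<zeta>) / (1 + of_real s * \<zeta>)"
    using n by (simp add: disc_auto_def field_simps)
  hence e: "norm (1 - disc_auto s \<zeta>) = (1 - s) * norm (1 - \<zeta>) / norm (1 + of_real s * \<zeta>)"
    using s by (simp only: norm_mult norm_divide norm_of_real abs_of_nonneg)
  have "norm (1 - \<zeta>) \<le> 2" using norm_triangle_ineq4[of 1 \<zeta>] z by simp
  moreover have "1 - r \<le> norm (1 + of_real s * \<zeta>)"
  proof -
    have "norm (of_real s * \<zeta>) \<le> 1 * r" unfolding norm_mult using s z by (intro mult_mono) auto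
    thus ?thesis using norm_triangle_ineq2[of 1 "- (of_real s * \<zeta>)"] by simp
  qed
  moreover from calculation(1) have "(1 - s) * norm (1 - \<zeta>) \<le> (1 - s) * 2" using s by (intro mult_left_mono) auto
  ultimately show ?thesis unfolding e using s z
    by (intro frac_le) (auto simp: mult.commute[of 2])
qed

text \<open>Reversing the disc exchanges the two ends, so only one end has to be analysed. The sign
  of \<rho> changes because \<open>disc_auto\<close> anticommutes with negation up to s becoming
  -s.\<close>

lemma bdisc_swap: "bdisc j \<theta> p q i k \<rho> s (- \<zeta>) = bdisc j \<theta> q p k i (- \<rho>) s \<zeta>"
  by (auto simp: bdisc_def vec_eq_iff disc_auto_uminus)

lemma bdisc_holomorphic:
  assumes "\<bar>s\<bar> < 1" shows "holomorphic_map_on (bdisc j \<theta> p q i k \<rho> s) (ball 0 1)"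
  unfolding holomorphic_map_on_def
proof
  fix c
  have h: "(\<lambda>\<zeta>. if b then of_real \<rho> * f \<zeta> * disc_auto t \<zeta> else 0) holomorphic_on ball 0 1"
    if "f holomorphic_on ball 0 1" "\<bar>t\<bar> < 1" for b f t
    using that disc_auto_holomorphic[OF that(2)] by (cases b) (auto intro!: holomorphic_intros)
  show "(\<lambda>\<zeta>. bdisc j \<theta> p q i k \<rho> s \<zeta> $ c) holomorphic_on ball 0 1"
    unfolding bdisc_def using assms
    by (cases "c = j") (auto intro!: holomorphic_intros h)
qed

lemma frontier_polydisk: "frontier (polydisk :: (complex ^ 'n) set) = cpoly 1 - polydisk"
  by (simp add: frontier_def closure_polydisk interior_open[OF open_polydisk])

text \<open>The squared weights add up to at most 1, so the base part stays within R; each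
  perturbation costs at most |\<rho>|. Both costs may fall on one coordinate, since i = k is
  possible. The non-strict bound suffices: coordinate j already forces the boundary.\<close>

lemma bdisc_norm:
  assumes s: "\<bar>s\<bar> < 1" and z: "norm \<zeta> \<le> 1" and p: "p \<in> cpoly R" and q: "q \<in> cpoly R" and \<rho>: "R + 2 * \<bar>\<rho>\<bar> \<le> 1" and c: "c \<noteq> j" 
  shows "norm (bdisc j \<theta> p q i k \<rho> s \<zeta> $ c) \<le> 1"
proof -
  have R: "0 \<le> R" using p order_trans[OF norm_ge_zero[of "p $ c"]] by (auto simp: cpoly_def)
  have a: "norm ((1 + \<zeta>) / 2) \<le> 1" "norm ((1 - \<zeta>) / 2) \<le> 1"
    using z norm_triangle_ineq[of 1 \<zeta>] norm_triangle_ineq4[of 1 \<zeta>] by (simp_all add: norm_divide)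
  have par: "(norm ((1 + \<zeta>) / 2))\<^sup>2 + (norm ((1 - \<zeta>) / 2))\<^sup>2 \<le> 1"
  proof -
    have "(norm (1 + \<zeta>))\<^sup>2 + (norm (1 - \<zeta>))\<^sup>2 = 2 + 2 * (norm \<zeta>)\<^sup>2"
      unfolding cmod_power2 by (simp add: power2_eq_square algebra_simps)
    also have "\<dots> \<le> 4" using z by (simp add: power_le_one)
    finally show ?thesis by (simp add: norm_divide power_divide)
  qed
  have "norm (p $ c * ((1 + \<zeta>) / 2)\<^sup>2 + q $ c * ((1 - \<zeta>) / 2)\<^sup>2)
      \<le> norm (p $ c) * (norm ((1 + \<zeta>) / 2))\<^sup>2 + norm (q $ c) * (norm ((1 - \<zeta>) / 2))\<^sup>2"
    by (rule norm_triangle_le) (simp add: norm_mult norm_power norm_divide)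
  also have "\<dots> \<le> R * (norm ((1 + \<zeta>) / 2))\<^sup>2 + R * (norm ((1 - \<zeta>) / 2))\<^sup>2"
    using p q by (intro add_mono mult_right_mono) (auto simp: cpoly_def)
  also have "\<dots> \<le> R * 1" unfolding distrib_left[symmetric] using par R by (rule mult_left_mono)
  finally have 1: "norm (p $ c * ((1 + \<zeta>) / 2)\<^sup>2 + q $ c * ((1 - \<zeta>) / 2)\<^sup>2) \<le> R" by simp
  have h: "norm (if b then of_real \<rho> * v * w else 0) \<le> \<bar>\<rho>\<bar>" if "norm v \<le> 1" "norm w \<le> 1" for b and v w :: complex
  proof -
    have "norm v * norm w \<le> 1 * 1" using that by (intro mult_mono) auto
    thus ?thesis by (simp add: norm_mult mult.assoc mult_left_le)
  qed
  have 2: "norm (if c = i then of_real \<rho> * ((1 + \<zeta>) / 2) * disc_auto (-s) \<zeta> else 0) \<le> \<bar>\<rho>\<bar>"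
    using s z a by (intro h disc_auto_norm_le) auto
  have 3: "norm (if c = k then of_real \<rho> * ((1 - \<zeta>) / 2) * disc_auto s \<zeta> else 0) \<le> \<bar>\<rho>\<bar>"
    using s z a by (intro h disc_auto_norm_le) auto
  have "norm (bdisc j \<theta> p q i k \<rho> s \<zeta> $ c) \<le> (R + \<bar>\<rho>\<bar>) + \<bar>\<rho>\<bar>"
  proof -
    have "bdisc j \<theta> p q i k \<rho> s \<zeta> $ c = (p $ c * ((1 + \<zeta>) / 2)\<^sup>2 + q $ c * ((1 - \<zeta>) / 2)\<^sup>2)
      + (if c = i then of_real \<rho> * ((1 + \<zeta>) / 2) * disc_auto (-s) \<zeta> else 0)
      + (if c = k then of_real \<rho> * ((1 - \<zeta>) / 2) * disc_auto s \<zeta> else 0)"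
      unfolding bdisc_def using c by simp
    thus ?thesis using norm_triangle_mono[OF norm_triangle_mono[OF 1 2] 3] by simp
  qed
  thus ?thesis using \<rho> by linarith
qed

lemma bdisc_frontier:
  assumes s: "\<bar>s\<bar> < 1" and p: "p \<in> cpoly R" and q: "q \<in> cpoly R" and \<rho>: "R + 2 * \<bar>\<rho>\<bar> \<le> 1" and \<theta>: "norm \<theta> = 1"
  shows "bdisc j \<theta> p q i k \<rho> s ` ball 0 1 \<subseteq> frontier polydisk"
proof safe
  fix \<zeta> :: complex assume "\<zeta> \<in> ball 0 1"
  hence z: "norm \<zeta> \<le> 1" by simp
  have "bdisc j \<theta> p q i k \<rho> s \<zeta> $ j = \<theta>" by (simp add: bdisc_def)
  moreover from this have "norm (bdisc j \<theta> p q i k \<rho> s \<zeta> $ c) \<le> 1" for c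
    using bdisc_norm[OF s z p q \<rho>, of c j] \<theta> by (cases "c = j") auto
  ultimately show "bdisc j \<theta> p q i k \<rho> s \<zeta> \<in> frontier polydisk"
    unfolding frontier_polydisk using \<theta> by (auto simp: cpoly_def dest!: polydisk_nth[where i = j])
qed

text \<open>At u = \<open>disc_auto s\<close> \<zeta>, which is near 1, the weight (1+u)/2 is almost
  1 and (1-u)/2 almost 0, while \<open>disc_auto (-s)\<close> undoes the zoom and returns \<zeta>.
  So only the coordinate disc in direction i remains.\<close>

lemma bdisc_rescaled_limit:
  fixes p q :: "complex ^ 'n"
  assumes s: "0 \<le> s" "s < 1" and z: "norm \<zeta> \<le> r" "r < 1" and p: "p \<in> cpoly 1" and q: "q \<in> cpoly 1" and \<rho>: "\<bar>\<rho>\<bar> \<le> 1" and ij: "i \<noteq> j"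
  shows "norm (bdisc j \<theta> p q i k \<rho> s (disc_auto s \<zeta>) - upd (upd p j \<theta>) i (p $ i + of_real \<rho> * \<zeta>))
    \<le> real CARD('n) * (3 * (2 * (1 - s) / (1 - r)))"
proof -
  define u where "u = disc_auto s \<zeta>"
  have s': "\<bar>s\<bar> < 1" using s by simp
  have z1: "norm \<zeta> < 1" using z by simp
  have u1: "norm u \<le> 1" unfolding u_def using disc_auto_norm_le[OF s'] z1 by simp
  have du: "norm (1 - u) \<le> 2 * (1 - s) / (1 - r)" unfolding u_def by (rule one_minus_disc_auto[OF s z])
  have inv: "disc_auto (-s) u = \<zeta>" unfolding u_def by (rule disc_auto_inverse[OF s' z1])
  have b1: "norm (disc_auto s u) \<le> 1" by (rule disc_auto_norm_le[OF s' u1])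
  have m1: "norm ((1 - u) / 2) \<le> norm (1 - u)" by (simp add: norm_divide)
  have m2: "norm ((1 - u) / 2) \<le> 1" using norm_triangle_ineq4[of 1 u] u1 by (simp add: norm_divide)
  have key: "norm ((bdisc j \<theta> p q i k \<rho> s u - upd (upd p j \<theta>) i (p $ i + of_real \<rho> * \<zeta>)) $ c) \<le> 3 * norm (1 - u)" for c
  proof (cases "c = j")
    case True thus ?thesis using ij by (simp add: bdisc_def upd_nth)
  next
    case False
    define A where "A = p $ c * (((1 + u) / 2)\<^sup>2 - 1)"
    define B where "B = q $ c * ((1 - u) / 2)\<^sup>2"
    define C where "C = (if c = i then of_real \<rho> * ((1 + u) / 2 - 1) * \<zeta> else 0)"
    define E where "E = (if c = k then of_real \<rho> * ((1 - u) / 2) * disc_auto s u else 0)"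
    have eq: "(bdisc j \<theta> p q i k \<rho> s u - upd (upd p j \<theta>) i (p $ i + of_real \<rho> * \<zeta>)) $ c = A + B + C + E"
      using False by (simp add: bdisc_def upd_nth A_def B_def C_def E_def inv algebra_simps)
    have pq: "norm (p $ c) \<le> 1" "norm (q $ c) \<le> 1" using p q by (auto simp: cpoly_def)
    have "((1 + u) / 2)\<^sup>2 - 1 = - ((1 - u) * ((3 + u) / 4))" by (simp add: power2_eq_square field_simps)
    hence "norm A = norm (p $ c) * (norm (1 - u) * norm ((3 + u) / 4))" by (simp only: A_def norm_mult norm_minus_cancel)
    also have "\<dots> \<le> 1 * (norm (1 - u) * 1)"
      using pq u1 norm_triangle_ineq[of 3 u] by (intro mult_mono) (auto simp: norm_divide)
    finally have A: "norm A \<le> norm (1 - u)" by simp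
    have "norm B = norm (q $ c) * (norm ((1 - u) / 2) * norm ((1 - u) / 2))" by (simp only: B_def norm_mult power2_eq_square)
    also have "\<dots> \<le> 1 * (norm ((1 - u) / 2) * 1)" using pq m2 by (intro mult_mono) auto
    finally have B: "norm B \<le> norm ((1 - u) / 2)" by simp
    have "(1 + u) / 2 - 1 = - ((1 - u) / 2)" by (simp add: field_simps)
    hence "norm C \<le> \<bar>\<rho>\<bar> * norm ((1 - u) / 2) * norm \<zeta>" by (simp add: C_def norm_mult norm_divide)
    also have "\<dots> \<le> 1 * norm ((1 - u) / 2) * 1" using \<rho> z1 by (intro mult_mono) auto
    finally have C: "norm C \<le> norm ((1 - u) / 2)" by simp
    have "norm E \<le> \<bar>\<rho>\<bar> * norm ((1 - u) / 2) * norm (disc_auto s u)" by (simp add: E_def norm_mult norm_divide)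
    also have "\<dots> \<le> 1 * norm ((1 - u) / 2) * 1" using \<rho> b1 by (intro mult_mono) auto
    finally have E: "norm E \<le> norm ((1 - u) / 2)" by simp
    \<comment> \<open>One full and three half multiples of the norm of 1 - u; 5/2 is rounded up to
      3.\<close>
    have "norm (A + B + C + E) \<le> norm (1 - u) + norm ((1 - u) / 2) + norm ((1 - u) / 2) + norm ((1 - u) / 2)"
      by (intro norm_triangle_mono A B C E)
    also have "\<dots> \<le> 3 * norm (1 - u)" by (simp add: norm_divide)
    finally show ?thesis unfolding eq .
  qed
  let ?v = "bdisc j \<theta> p q i k \<rho> s u - upd (upd p j \<theta>) i (p $ i + of_real \<rho> * \<zeta>)"
  have "norm ?v \<le> (\<Sum>c\<in>UNIV. norm (?v $ c))" unfolding norm_vec_def by (rule L2_set_le_sum) auto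
  also have "\<dots> \<le> (\<Sum>c\<in>(UNIV::'n set). 3 * (2 * (1 - s) / (1 - r)))"
    using key du by (intro sum_mono) (meson mult_left_mono order_trans zero_le_numeral)
  also have "\<dots> = real CARD('n) * (3 * (2 * (1 - s) / (1 - r)))" by simp
  finally show ?thesis unfolding u_def .
qed

definition sseq :: "nat \<Rightarrow> real" where "sseq n = 1 - 1 / (real n + 2)"

lemma sseq: "0 \<le> sseq n" "sseq n < 1" "\<bar>sseq n\<bar> < 1"
  by (auto simp: sseq_def field_simps)

text \<open>Rescaling by automorphisms preserves holomorphy and converges locally uniformly to the
  coordinate disc. A subsequence is enough, so holomorphy is required for infinitely many n only,
  which is what a pigeonhole argument can supply.\<close>

lemma coordinate_disc_holomorphic:
  fixes p q :: "complex ^ 'n"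
  assumes F: "continuous_on (cpoly 1) F" and p: "p \<in> cpoly R" and q: "q \<in> cpoly R" and \<rho>: "R + 2 * \<bar>\<rho>\<bar> \<le> 1" and R: "0 \<le> R"
    and ij: "i \<noteq> j" and \<theta>: "norm \<theta> = 1"
    and inf: "infinite {n. (F \<circ> bdisc j \<theta> p q i k \<rho> (sseq n)) holomorphic_on ball 0 1}"
  shows "(\<lambda>\<zeta>. F (upd (upd p j \<theta>) i (p $ i + of_real \<rho> * \<zeta>))) holomorphic_on ball 0 1"
proof -
  from infinite_enumerate[OF inf]
  obtain N :: "nat \<Rightarrow> nat" where "strict_mono N \<and> (\<forall>n. N n \<in> {n. (F \<circ> bdisc j \<theta> p q i k \<rho> (sseq n)) holomorphic_on ball 0 1})" ..
  hence N: "strict_mono N" "\<And>n. (F \<circ> bdisc j \<theta> p q i k \<rho> (sseq (N n))) holomorphic_on ball 0 1"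
    by simp_all
  let ?P = "\<lambda>\<zeta>. upd (upd p j \<theta>) i (p $ i + of_real \<rho> * \<zeta>)"
  let ?G = "\<lambda>n \<zeta>. bdisc j \<theta> p q i k \<rho> (sseq (N n)) (disc_auto (sseq (N n)) \<zeta>)"
  have R1: "R \<le> 1" "\<bar>\<rho>\<bar> \<le> 1" using \<rho> R by linarith+
  have p1: "p \<in> cpoly 1" "q \<in> cpoly 1" using p q cpoly_mono[OF R1(1)] by blast+
  have G: "?G n \<zeta> \<in> cpoly 1" if "norm \<zeta> < 1" for n \<zeta>
  proof -
    have "disc_auto (sseq (N n)) \<zeta> \<in> ball 0 1" using disc_auto_norm_less[OF sseq(3) that] by simp
    thus ?thesis using bdisc_frontier[OF sseq(3) p q \<rho> \<theta>] frontier_polydisk by blast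
  qed
  have P: "?P \<zeta> \<in> cpoly 1" if "norm \<zeta> < 1" for \<zeta>
  proof -
    have "norm (p $ i + of_real \<rho> * \<zeta>) \<le> R + \<bar>\<rho>\<bar> * 1"
      using p that by (intro norm_triangle_mono) (auto simp: cpoly_def norm_mult intro!: mult_left_le)
    hence "norm (p $ i + of_real \<rho> * \<zeta>) \<le> 1" using \<rho> by linarith
    thus ?thesis using p1 \<theta> by (intro upd_cpoly) auto
  qed
  have "(\<lambda>\<zeta>. F (?P \<zeta>)) holomorphic_on ball 0 1"
  proof (rule holomorphic_uniform_sequence[where f = "\<lambda>n \<zeta>. F (?G n \<zeta>)"])
    fix n
    have "(F \<circ> bdisc j \<theta> p q i k \<rho> (sseq (N n))) \<circ> disc_auto (sseq (N n)) holomorphic_on ball 0 1"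
      using N(2) disc_auto_holomorphic[OF sseq(3)] disc_auto_norm_less[OF sseq(3)]
      by (intro holomorphic_on_compose_gen[where t = "ball 0 1"]) auto
    thus "(\<lambda>\<zeta>. F (?G n \<zeta>)) holomorphic_on ball 0 1" by (simp add: o_def)
  next
    fix x :: complex assume x: "x \<in> ball 0 1"
    define d where "d = (1 - norm x) / 2"
    define r where "r = (1 + norm x) / 2"
    have d: "d > 0" and r: "r < 1" using x by (auto simp: d_def r_def)
    have sub: "norm y \<le> r" if "y \<in> cball x d" for y
    proof -
      have "norm y \<le> norm x + norm (y - x)" by (rule norm_triangle_sub)
      moreover have "norm (y - x) \<le> d" using that by (simp add: dist_norm norm_minus_commute)
      ultimately show ?thesis unfolding d_def r_def by (simp add: field_simps)
    qed
    have "uniform_limit (cball x d) (\<lambda>n \<zeta>. F (?G n \<zeta>)) (\<lambda>\<zeta>. F (?P \<zeta>)) sequentially"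
    proof (rule uniform_limitI)
      fix e :: real assume e: "e > 0"
      have "uniformly_continuous_on (cpoly 1) F" by (intro compact_uniformly_continuous F compact_cpoly)
      then obtain \<delta> where \<delta>: "\<delta> > 0" "\<And>a b. a \<in> cpoly 1 \<Longrightarrow> b \<in> cpoly 1 \<Longrightarrow> dist b a < \<delta> \<Longrightarrow> dist (F b) (F a) < e"
        unfolding uniformly_continuous_on_def using e by metis
      have "(\<lambda>n. real CARD('n) * (3 * (2 * (1 / (real n + 2)) / (1 - r)))) \<longlonglongrightarrow> real CARD('n) * (3 * (2 * 0 / (1 - r)))"
        using r by (intro tendsto_intros) (real_asymp | simp)+
      hence "(\<lambda>n. real CARD('n) * (3 * (2 * (1 - sseq n) / (1 - r)))) \<longlonglongrightarrow> 0" by (simp add: sseq_def)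
      hence "(\<lambda>n. real CARD('n) * (3 * (2 * (1 - sseq (N n)) / (1 - r)))) \<longlonglongrightarrow> 0"
        using LIMSEQ_subseq_LIMSEQ[OF _ N(1)] by (simp add: o_def)
      hence "\<forall>\<^sub>F n in sequentially. real CARD('n) * (3 * (2 * (1 - sseq (N n)) / (1 - r))) < \<delta>"
        using \<delta>(1) by (rule order_tendstoD(2))
      thus "\<forall>\<^sub>F n in sequentially. \<forall>\<zeta>\<in>cball x d. dist (F (?G n \<zeta>)) (F (?P \<zeta>)) < e"
      proof eventually_elim
        case (elim n)
        show ?case
        proof
          fix \<zeta> assume "\<zeta> \<in> cball x d"
          hence z: "norm \<zeta> \<le> r" by (rule sub)
          hence z1: "norm \<zeta> < 1" using r by simp
          have "dist (?G n \<zeta>) (?P \<zeta>) < \<delta>"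
            unfolding dist_norm
            using bdisc_rescaled_limit[OF sseq(1,2) z r p1 R1(2) ij, of \<theta> k "N n"] elim by linarith
          thus "dist (F (?G n \<zeta>)) (F (?P \<zeta>)) < e" by (intro \<delta>(2) G P z1)
        qed
      qed
    qed
    moreover have "cball x d \<subseteq> ball 0 1" using sub r by fastforce
    ultimately show "\<exists>d>0. cball x d \<subseteq> ball 0 1 \<and> uniform_limit (cball x d) (\<lambda>n \<zeta>. F (?G n \<zeta>)) (\<lambda>\<zeta>. F (?P \<zeta>)) sequentially"
      using d by blast
  qed simp
  thus ?thesis .
qed

section \<open>Slices of the symbols over a boundary point\<close>

text \<open>The linking discs reach only a small coordinate disc, so failure of holomorphy must be
  located at a point where it persists at every radius.\<close>

lemma not_holomorphic_locally:
  assumes "\<not> (f holomorphic_on S \<and> g holomorphic_on S)" "open S"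
  obtains d where "d \<in> S" "\<And>r. r > 0 \<Longrightarrow> \<not> (f holomorphic_on ball d r \<and> g holomorphic_on ball d r)"
proof (rule ccontr)
  assume "\<not> thesis"
  hence "\<forall>d\<in>S. \<exists>r>0. f holomorphic_on ball d r \<and> g holomorphic_on ball d r" using that by blast
  hence "\<forall>d\<in>S. f field_differentiable at d within S \<and> g field_differentiable at d within S"
    by (meson centre_in_ball field_differentiable_at_within holomorphic_on_imp_differentiable_at open_ball)
  thus False using assms by (auto simp: holomorphic_on_def)
qed

abbreviation slice :: "'n \<Rightarrow> complex \<Rightarrow> (complex ^ 'n \<Rightarrow> complex) \<Rightarrow> complex ^ 'n \<Rightarrow> complex" where
  "slice j \<theta> F \<equiv> \<lambda>z. F (upd z j \<theta>)"

lemma slice_continuous: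
  assumes F: "continuous_on (cpoly 1) F" and \<theta>: "norm \<theta> = 1"
  shows "continuous_on (cpoly 1) (slice j \<theta> F)"
  by (rule continuous_on_compose2[OF F]) (use \<theta> in \<open>auto intro!: continuous_intros upd_cpoly\<close>)

lemma slice_not_sephol:
  fixes F G :: "complex ^ 'n \<Rightarrow> complex"
  assumes F: "continuous_on (cpoly 1) F" and G: "continuous_on (cpoly 1) G" and \<theta>: "norm \<theta> = 1"
    and n: "\<not> (sephol (slice j \<theta> F) \<and> sephol (slice j \<theta> G))"
  obtains p i where "p \<in> polydisk" "i \<noteq> j"
    "\<And>r. r > 0 \<Longrightarrow> \<not> ((\<lambda>w. F (upd (upd p j \<theta>) i w)) holomorphic_on ball (p $ i) r \<and>
                       (\<lambda>w. G (upd (upd p j \<theta>) i w)) holomorphic_on ball (p $ i) r)"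
proof -
  have sub: "polydisk \<subseteq> (cpoly 1 :: (complex ^ 'n) set)" using polydisk_cpoly by blast
  have c: "continuous_on polydisk (slice j \<theta> F)" "continuous_on polydisk (slice j \<theta> G)"
    using slice_continuous[OF F \<theta>] slice_continuous[OF G \<theta>] sub continuous_on_subset by blast+
  from n obtain p i where p: "p \<in> polydisk" and
     ni: "\<not> ((\<lambda>w. slice j \<theta> F (upd p i w)) holomorphic_on ball 0 1 \<and> (\<lambda>w. slice j \<theta> G (upd p i w)) holomorphic_on ball 0 1)"
    using c unfolding sephol_def hol_in_def by blast
  \<comment> \<open>In direction j the slice is constant, hence holomorphic, so the failure lies in
    another coordinate.\<close>
  have ij: "i \<noteq> j" using ni by auto
  obtain d where d: "d \<in> ball 0 1" "\<And>r. r > 0 \<Longrightarrow> \<not> ((\<lambda>w. slice j \<theta> F (upd p i w)) holomorphic_on ball d r \<and> (\<lambda>w. slice j \<theta> G (upd p i w)) holomorphic_on ball d r)"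
    using not_holomorphic_locally[OF ni] by blast
  have e: "upd (upd (upd p i d) j \<theta>) i w = upd (upd p i w) j \<theta>" for w
    using ij by (auto simp: vec_eq_iff upd_nth)
  show ?thesis
  proof (rule that[of "upd p i d" i])
    show "upd p i d \<in> polydisk" using p d(1) by (intro upd_polydisk) auto
    fix r :: real assume "r > 0"
    from d(2)[OF this]
    show "\<not> ((\<lambda>w. F (upd (upd (upd p i d) j \<theta>) i w)) holomorphic_on ball (upd p i d $ i) r \<and>
             (\<lambda>w. G (upd (upd (upd p i d) j \<theta>) i w)) holomorphic_on ball (upd p i d $ i) r)"
      unfolding e upd_same .
  qed (rule ij)
qed

lemma holomorphic_rescale:
  assumes h: "(\<lambda>\<zeta>. f (a + of_real \<rho> * \<zeta>)) holomorphic_on ball 0 1" and \<rho>: "\<rho> \<noteq> 0"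
  shows "f holomorphic_on ball a \<bar>\<rho>\<bar>"
proof -
  have "(\<lambda>\<zeta>. f (a + of_real \<rho> * \<zeta>)) \<circ> (\<lambda>w. (w - a) / of_real \<rho>) holomorphic_on ball a \<bar>\<rho>\<bar>"
    using \<rho> by (intro holomorphic_on_compose_gen[OF _ h]) (auto intro!: holomorphic_intros simp: norm_divide dist_norm norm_minus_commute)
  thus ?thesis using \<rho> by (simp add: o_def)
qed

text \<open>If both alternatives failed, there would be a point p where the pair is not holomorphic
  and a point q where the conjugate pair is not. A single sequence of discs approaches coordinate
  discs at both; one alternative holds for infinitely many of them and is inherited in the limit,
  contradicting the choice of p or of q.\<close>

lemma slice_dichotomy:
  fixes \<phi> \<psi> :: "complex ^ 'n \<Rightarrow> complex"
  assumes \<phi>: "continuous_on (cpoly 1) \<phi>" and \<psi>: "continuous_on (cpoly 1) \<psi>" and \<theta>: "norm \<theta> = 1"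
    and hyp: "\<And>g :: complex \<Rightarrow> complex ^ 'n.
           holomorphic_map_on g (ball 0 1) \<Longrightarrow> g ` ball 0 1 \<subseteq> frontier polydisk \<Longrightarrow>
           ((\<phi> \<circ> g) holomorphic_on ball 0 1 \<and> (\<psi> \<circ> g) holomorphic_on ball 0 1) \<or>
           ((cnj \<circ> \<phi> \<circ> g) holomorphic_on ball 0 1 \<and> (cnj \<circ> \<psi> \<circ> g) holomorphic_on ball 0 1)"
  shows "(sephol (slice j \<theta> \<phi>) \<and> sephol (slice j \<theta> \<psi>)) \<or>
         (sephol (slice j \<theta> (\<lambda>z. cnj (\<phi> z))) \<and> sephol (slice j \<theta> (\<lambda>z. cnj (\<psi> z))))"
proof (rule ccontr)
  assume neg: "\<not> ?thesis"
  let ?c\<phi> = "\<lambda>z. cnj (\<phi> z)" and ?c\<psi> = "\<lambda>z. cnj (\<psi> z)"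
  have c: "continuous_on (cpoly 1) ?c\<phi>" "continuous_on (cpoly 1) ?c\<psi>"
    using \<phi> \<psi> by (auto intro!: continuous_intros)
  obtain p i where p: "p \<in> polydisk" "i \<noteq> j"
    "\<And>r. r > 0 \<Longrightarrow> \<not> ((\<lambda>w. \<phi> (upd (upd p j \<theta>) i w)) holomorphic_on ball (p $ i) r \<and>
                       (\<lambda>w. \<psi> (upd (upd p j \<theta>) i w)) holomorphic_on ball (p $ i) r)"
    using slice_not_sephol[OF \<phi> \<psi> \<theta>, of j] neg by blast
  obtain q k where q: "q \<in> polydisk" "k \<noteq> j"
    "\<And>r. r > 0 \<Longrightarrow> \<not> ((\<lambda>w. ?c\<phi> (upd (upd q j \<theta>) k w)) holomorphic_on ball (q $ k) r \<and>
                       (\<lambda>w. ?c\<psi> (upd (upd q j \<theta>) k w)) holomorphic_on ball (q $ k) r)"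
    using slice_not_sephol[OF c \<theta>, of j] neg by blast
  obtain r1 where r1: "0 < r1" "r1 < 1" "p \<in> interior (cpoly r1)" using polydisk_interior_cpoly[OF p(1)] .
  obtain r2 where r2: "0 < r2" "r2 < 1" "q \<in> interior (cpoly r2)" using polydisk_interior_cpoly[OF q(1)] .
  define R where "R = max r1 r2"
  have R: "0 \<le> R" "R < 1" "r1 \<le> R" "r2 \<le> R" using r1 r2 by (auto simp: R_def)
  have pR: "p \<in> cpoly R" using r1(3) interior_subset cpoly_mono[OF R(3)] by blast
  have qR: "q \<in> cpoly R" using r2(3) interior_subset cpoly_mono[OF R(4)] by blast
  \<comment> \<open>The room left between R and 1, shared by the two perturbations of the
    disc.\<close>
  define \<rho> where "\<rho> = (1 - R) / 2"
  have \<rho>: "\<rho> \<noteq> 0" "R + 2 * \<bar>\<rho>\<bar> \<le> 1" "R + 2 * \<bar>- \<rho>\<bar> \<le> 1" using R by (auto simp: \<rho>_def field_simps)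
  let ?g = "\<lambda>n. bdisc j \<theta> p q i k \<rho> (sseq n)"
  let ?H = "{n. (\<phi> \<circ> ?g n) holomorphic_on ball 0 1 \<and> (\<psi> \<circ> ?g n) holomorphic_on ball 0 1}"
  let ?A = "{n. (?c\<phi> \<circ> ?g n) holomorphic_on ball 0 1 \<and> (?c\<psi> \<circ> ?g n) holomorphic_on ball 0 1}"
  have "?H \<union> ?A = UNIV"
  proof -
    have "n \<in> ?H \<union> ?A" for n
    proof -
      have e: "cnj \<circ> F \<circ> ?g n = (\<lambda>z. cnj (F z)) \<circ> ?g n" for F :: "complex ^ 'n \<Rightarrow> complex" by (simp add: fun_eq_iff)
      have "((\<phi> \<circ> ?g n) holomorphic_on ball 0 1 \<and> (\<psi> \<circ> ?g n) holomorphic_on ball 0 1) \<or>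
           ((cnj \<circ> \<phi> \<circ> ?g n) holomorphic_on ball 0 1 \<and> (cnj \<circ> \<psi> \<circ> ?g n) holomorphic_on ball 0 1)"
        by (rule hyp[OF bdisc_holomorphic[OF sseq(3)] bdisc_frontier[OF sseq(3) pR qR \<rho>(2) \<theta>]])
      thus ?thesis unfolding e by blast
    qed
    thus ?thesis by blast
  qed
  \<comment> \<open>Pigeonhole over the sequence of discs.\<close>
  moreover have "infinite X \<or> infinite Y" if "X \<union> Y = (UNIV :: nat set)" for X Y
    using finite_UnI[of X Y] that by auto
  ultimately have "infinite ?H \<or> infinite ?A" by blast
  thus False
  proof
    assume H: "infinite ?H"
    have "(\<lambda>\<zeta>. \<phi> (upd (upd p j \<theta>) i (p $ i + of_real \<rho> * \<zeta>))) holomorphic_on ball 0 1"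
      by (rule coordinate_disc_holomorphic[OF \<phi> pR qR \<rho>(2) R(1) p(2) \<theta> infinite_super[OF _ H]]) auto
    moreover have "(\<lambda>\<zeta>. \<psi> (upd (upd p j \<theta>) i (p $ i + of_real \<rho> * \<zeta>))) holomorphic_on ball 0 1"
      by (rule coordinate_disc_holomorphic[OF \<psi> pR qR \<rho>(2) R(1) p(2) \<theta> infinite_super[OF _ H]]) auto
    ultimately show False
      using p(3)[of "\<bar>\<rho>\<bar>"] holomorphic_rescale[OF _ \<rho>(1)] \<rho>(1) by force
  next
    assume A: "infinite ?A"
    \<comment> \<open>The antiholomorphic alternative is to be contradicted at q, the other end, so
      the discs are traversed backwards.\<close>
    have swap: "(F \<circ> bdisc j \<theta> q p k i (-\<rho>) (sseq n)) holomorphic_on ball 0 1"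
      if "(F \<circ> ?g n) holomorphic_on ball 0 1" for F n
    proof -
      have "(F \<circ> ?g n) \<circ> uminus holomorphic_on ball 0 1"
        using that by (intro holomorphic_on_compose_gen[where t = "ball 0 1"]) (auto intro!: holomorphic_intros)
      thus ?thesis by (simp add: o_def bdisc_swap)
    qed
    have "(\<lambda>\<zeta>. ?c\<phi> (upd (upd q j \<theta>) k (q $ k + of_real (-\<rho>) * \<zeta>))) holomorphic_on ball 0 1"
      by (rule coordinate_disc_holomorphic[OF c(1) qR pR \<rho>(3) R(1) q(2) \<theta> infinite_super[OF _ A]]) (use swap in blast)
    moreover have "(\<lambda>\<zeta>. ?c\<psi> (upd (upd q j \<theta>) k (q $ k + of_real (-\<rho>) * \<zeta>))) holomorphic_on ball 0 1"
      by (rule coordinate_disc_holomorphic[OF c(2) qR pR \<rho>(3) R(1) q(2) \<theta> infinite_super[OF _ A]]) (use swap in blast)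
    moreover have "-\<rho> \<noteq> 0" using \<rho>(1) by simp
    ultimately have "(\<lambda>w. ?c\<phi> (upd (upd q j \<theta>) k w)) holomorphic_on ball (q $ k) \<bar>-\<rho>\<bar>"
        "(\<lambda>w. ?c\<psi> (upd (upd q j \<theta>) k w)) holomorphic_on ball (q $ k) \<bar>-\<rho>\<bar>"
      by (blast intro: holomorphic_rescale)+
    thus False using q(3)[of "\<bar>-\<rho>\<bar>"] \<rho>(1) by simp
  qed
qed

lemma slice_jfree:
  assumes F: "continuous_on (cpoly 1) F" and \<theta>: "norm \<theta> = 1"
  shows "jfree j (slice j \<theta> F)"
  unfolding jfree_def
  using bdd_of_continuous[OF slice_continuous[OF F \<theta>]] continuous_on_subset[OF slice_continuous[OF F \<theta>]] polydisk_cpoly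
  by (auto simp: indep_def)

text \<open>In either case both products are the Toeplitz operator of the product symbol: the right
  factor is multiplication in the holomorphic case, and the left factor is the adjoint of one in the
  other.\<close>

lemma slice_toeplitz_commute:
  fixes \<phi> \<psi> :: "complex ^ 'n \<Rightarrow> complex"
  assumes \<phi>: "continuous_on (cpoly 1) \<phi>" and \<psi>: "continuous_on (cpoly 1) \<psi>" and \<theta>: "norm \<theta> = 1"
    and alt: "(sephol (slice j \<theta> \<phi>) \<and> sephol (slice j \<theta> \<psi>)) \<or>
         (sephol (slice j \<theta> (\<lambda>z. cnj (\<phi> z))) \<and> sephol (slice j \<theta> (\<lambda>z. cnj (\<psi> z))))"
    and g: "g \<in> A2"
  shows "T (slice j \<theta> \<phi>) (T (slice j \<theta> \<psi>) g) = T (slice j \<theta> \<psi>) (T (slice j \<theta> \<phi>) g)"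
  using alt
proof
  have b: "bdd (slice j \<theta> \<phi>)" "bdd (slice j \<theta> \<psi>)" using slice_jfree[OF \<phi> \<theta>] slice_jfree[OF \<psi> \<theta>] by (simp_all add: jfree_def)
  assume s: "sephol (slice j \<theta> \<phi>) \<and> sephol (slice j \<theta> \<psi>)"
  thus ?thesis using T_T_holomorphic[OF b(2) _ b(1) g] T_T_holomorphic[OF b(1) _ b(2) g] by (simp add: mult.commute)
next
  have b: "bdd (slice j \<theta> \<phi>)" "bdd (slice j \<theta> \<psi>)" using slice_jfree[OF \<phi> \<theta>] slice_jfree[OF \<psi> \<theta>] by (simp_all add: jfree_def)
  note cb = bdd_symbol_cnj[OF b(1)] bdd_symbol_cnj[OF b(2)]
  assume s: "sephol (slice j \<theta> (\<lambda>z. cnj (\<phi> z))) \<and> sephol (slice j \<theta> (\<lambda>z. cnj (\<psi> z)))"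
  thus ?thesis using T_antiholomorphic_T[OF cb(1) _ b(2) g] T_antiholomorphic_T[OF cb(2) _ b(1) g] by (simp add: mult.commute)
qed

subsection \<open>The commutator is null in every coordinate\<close>

text \<open>A relative form of nullity that keeps the main term as a multiple of the localised norm
  of \<eta> g. Over a partition of unity these main terms add up in squares to the norm of g,
  independently of the number of pieces.\<close>

definition le_null :: "'n \<Rightarrow> real \<Rightarrow> (complex ^ 'n \<Rightarrow> complex) \<Rightarrow> 'n::finite op \<Rightarrow> bool" where
  "le_null j a \<eta> X \<longleftrightarrow> (\<forall>g\<in>A2. X g \<in> L2) \<and>
     (\<forall>e>0. \<exists>C\<ge>0. \<forall>g\<in>A2. nrm (X g) \<le> a * nrm (\<lambda>z. \<eta> z * g z) + e * nrm g + C * nrm (Mop j g))"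

lemma le_nullI:
  assumes "\<And>g. g \<in> A2 \<Longrightarrow> X g \<in> L2" "\<And>g. g \<in> A2 \<Longrightarrow> nrm (X g) \<le> a * nrm (\<lambda>z. \<eta> z * g z)"
  shows "le_null j a \<eta> X"
  unfolding le_null_def
proof (intro conjI ballI allI impI exI[of _ 0])
  fix e :: real and g :: "complex ^ 'a \<Rightarrow> complex" assume "e > 0" "g \<in> A2"
  moreover have "0 \<le> e * nrm g" using \<open>e > 0\<close> by simp
  ultimately show "nrm (X g) \<le> a * nrm (\<lambda>z. \<eta> z * g z) + e * nrm g + 0 * nrm (Mop j g)"
    using assms(2)[of g] by linarith
qed (use assms in auto)

lemma le_null_null:
  assumes "null j X" "0 \<le> a" shows "le_null j a \<eta> X"
  unfolding le_null_def
proof (intro conjI ballI allI impI)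
  fix e :: real assume "e > 0"
  then obtain C where C: "C \<ge> 0" "\<And>g. g \<in> A2 \<Longrightarrow> nrm (X g) \<le> e * nrm g + C * nrm (Mop j g)" using nullE[OF assms(1)] by blast
  have "nrm (X g) \<le> a * nrm (\<lambda>z. \<eta> z * g z) + e * nrm g + C * nrm (Mop j g)" if "g \<in> A2" for g
    using C(2)[OF that] mult_nonneg_nonneg[OF assms(2) L2_norm_nonneg[of polydisk "\<lambda>z. \<eta> z * g z"]] by linarith
  thus "\<exists>C\<ge>0. \<forall>g\<in>A2. nrm (X g) \<le> a * nrm (\<lambda>z. \<eta> z * g z) + e * nrm g + C * nrm (Mop j g)" using C(1) by blast
qed (use assms nullD in auto)

lemma le_null_cong: "le_null j a \<eta> X \<Longrightarrow> (\<And>g. g \<in> A2 \<Longrightarrow> X g = Y g) \<Longrightarrow> le_null j a \<eta> Y"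
  unfolding le_null_def by simp

lemma le_null_add:
  assumes X: "le_null j a \<eta> X" and Y: "le_null j b \<eta> Y"
  shows "le_null j (a + b) \<eta> (\<lambda>g z. X g z + Y g z)"
  unfolding le_null_def
proof (intro conjI ballI allI impI)
  have L: "X g \<in> L2" "Y g \<in> L2" if "g \<in> A2" for g using X Y that by (simp_all add: le_null_def)
  show "(\<lambda>z. X g z + Y g z) \<in> L2" if "g \<in> A2" for g by (rule L2_add[OF L[OF that]])
  fix e :: real assume "e > 0"
  hence e: "e / 2 > 0" by simp
  obtain C where C: "C \<ge> 0" "\<And>g. g \<in> A2 \<Longrightarrow> nrm (X g) \<le> a * nrm (\<lambda>z. \<eta> z * g z) + e / 2 * nrm g + C * nrm (Mop j g)"
    using X e unfolding le_null_def by blast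
  obtain D where D: "D \<ge> 0" "\<And>g. g \<in> A2 \<Longrightarrow> nrm (Y g) \<le> b * nrm (\<lambda>z. \<eta> z * g z) + e / 2 * nrm g + D * nrm (Mop j g)"
    using Y e unfolding le_null_def by blast
  show "\<exists>C\<ge>0. \<forall>g\<in>A2. nrm (\<lambda>z. X g z + Y g z) \<le> (a + b) * nrm (\<lambda>z. \<eta> z * g z) + e * nrm g + C * nrm (Mop j g)"
  proof (intro exI[of _ "C + D"] conjI ballI)
    fix g :: "complex ^ 'a \<Rightarrow> complex" assume g: "g \<in> A2"
    show "nrm (\<lambda>z. X g z + Y g z) \<le> (a + b) * nrm (\<lambda>z. \<eta> z * g z) + e * nrm g + (C + D) * nrm (Mop j g)"
      using L2_norm_triangle[OF L[OF g]] C(2)[OF g] D(2)[OF g] by (simp add: algebra_simps)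
  qed (use C D in auto)
qed

lemma le_null_left:
  assumes X: "le_null j a \<eta> X" and Z: "\<And>g. g \<in> A2 \<Longrightarrow> Z g \<in> L2" "\<And>g. g \<in> A2 \<Longrightarrow> nrm (Z g) \<le> B * nrm (X g)" and B: "B \<ge> 0"
  shows "le_null j (B * a) \<eta> Z"
  unfolding le_null_def
proof (intro conjI ballI allI impI Z(1))
  fix e :: real assume e: "e > 0"
  have "e / (B + 1) > 0" using e B by simp
  then obtain C where C: "C \<ge> 0" "\<And>g. g \<in> A2 \<Longrightarrow> nrm (X g) \<le> a * nrm (\<lambda>z. \<eta> z * g z) + e / (B + 1) * nrm g + C * nrm (Mop j g)"
    using X unfolding le_null_def by blast
  have Be: "B * (e / (B + 1)) \<le> e" using e B by (simp add: field_simps)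
  show "\<exists>C\<ge>0. \<forall>g\<in>A2. nrm (Z g) \<le> B * a * nrm (\<lambda>z. \<eta> z * g z) + e * nrm g + C * nrm (Mop j g)"
  proof (intro exI[of _ "B * C"] conjI ballI)
    fix g :: "complex ^ 'a \<Rightarrow> complex" assume g: "g \<in> A2"
    have "nrm (Z g) \<le> B * nrm (X g)" by (rule Z(2)[OF g])
    also have "\<dots> \<le> B * (a * nrm (\<lambda>z. \<eta> z * g z) + e / (B + 1) * nrm g + C * nrm (Mop j g))" by (rule mult_left_mono[OF C(2)[OF g] B])
    also have "\<dots> = B * a * nrm (\<lambda>z. \<eta> z * g z) + B * (e / (B + 1)) * nrm g + B * C * nrm (Mop j g)" by (simp add: algebra_simps)
    also have "B * (e / (B + 1)) * nrm g \<le> e * nrm g" by (rule mult_right_mono[OF Be]) simp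
    finally show "nrm (Z g) \<le> B * a * nrm (\<lambda>z. \<eta> z * g z) + e * nrm g + B * C * nrm (Mop j g)" by simp
  qed (use B C in auto)
qed

lemma le_null_diff:
  assumes X: "le_null j a \<eta> X" and Y: "le_null j b \<eta> Y"
  shows "le_null j (a + b) \<eta> (\<lambda>g z. X g z - Y g z)"
proof -
  have L: "Y g \<in> L2" if "g \<in> A2" for g using Y that by (simp add: le_null_def)
  have "le_null j (1 * b) \<eta> (\<lambda>g z. -1 * Y g z)"
  proof (rule le_null_left[OF Y])
    fix g :: "complex ^ 'a \<Rightarrow> complex" assume g: "g \<in> A2"
    show "(\<lambda>z. -1 * Y g z) \<in> L2" by (rule L2_scale[OF L[OF g]])
    show "nrm (\<lambda>z. -1 * Y g z) \<le> 1 * nrm (Y g)" unfolding L2_norm_scale by simp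
  qed simp
  from le_null_add[OF X this] show ?thesis by simp
qed

text \<open>The localised norm after Y is again controlled by the localised norm before it, so the
  constants a and b multiply and everything else goes into the error.\<close>

lemma le_null_comp:
  assumes X: "le_null j a \<eta> X" and Y: "adm j Y" and Z: "le_null j b \<eta> (\<lambda>g z. \<eta> z * Y g z)" and a: "0 \<le> a"
  shows "le_null j (a * b) \<eta> (\<lambda>g. X (Y g))"
  unfolding le_null_def
proof (intro conjI ballI allI impI)
  have YA: "Y g \<in> A2" if "g \<in> A2" for g using bddopD[OF adm_bddop[OF Y] that] .
  show "X (Y g) \<in> L2" if "g \<in> A2" for g using X YA[OF that] by (simp add: le_null_def)
  obtain B where B: "B \<ge> 0" "\<And>g. g \<in> A2 \<Longrightarrow> nrm (Y g) \<le> B * nrm g" using bddopE[OF adm_bddop[OF Y]] by blast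
  fix e :: real assume e: "e > 0"
  \<comment> \<open>Small enough that the three errors a d, d B and d together stay below
    \<open>e\<close>.\<close>
  define d where "d = e / (a + B + 2)"
  have d: "d > 0" using e a B(1) by (simp add: d_def)
  have de: "a * d + d * B + d \<le> e"
  proof -
    have "d * (a + B + 2) = e" unfolding d_def using a B(1) by simp
    thus ?thesis using d by (simp add: algebra_simps)
  qed
  obtain C where C: "C \<ge> 0" "\<And>g. g \<in> A2 \<Longrightarrow> nrm (X g) \<le> a * nrm (\<lambda>z. \<eta> z * g z) + d * nrm g + C * nrm (Mop j g)"
    using X d unfolding le_null_def by blast
  obtain D where D: "D \<ge> 0" "\<And>g. g \<in> A2 \<Longrightarrow> nrm (\<lambda>z. \<eta> z * Y g z) \<le> b * nrm (\<lambda>z. \<eta> z * g z) + d * nrm g + D * nrm (Mop j g)"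
    using Z d unfolding le_null_def by blast
  have mY: "null j (\<lambda>g. Mop j (Y g))" using Y by (simp add: adm_def)
  have "d / (C + 1) > 0" using d C by simp
  then obtain E where E: "E \<ge> 0" "\<And>g. g \<in> A2 \<Longrightarrow> nrm (Mop j (Y g)) \<le> d / (C + 1) * nrm g + E * nrm (Mop j g)"
    using nullE[OF mY] by blast
  have Cd: "C * (d / (C + 1)) \<le> d" using d C by (simp add: field_simps)
  show "\<exists>C\<ge>0. \<forall>g\<in>A2. nrm (X (Y g)) \<le> a * b * nrm (\<lambda>z. \<eta> z * g z) + e * nrm g + C * nrm (Mop j g)"
  proof (intro exI[of _ "a * D + C * E"] conjI ballI)
    fix g :: "complex ^ 'a \<Rightarrow> complex" assume g: "g \<in> A2"
    have "nrm (X (Y g)) \<le> a * nrm (\<lambda>z. \<eta> z * Y g z) + d * nrm (Y g) + C * nrm (Mop j (Y g))" by (rule C(2)[OF YA[OF g]])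
    also have "\<dots> \<le> a * (b * nrm (\<lambda>z. \<eta> z * g z) + d * nrm g + D * nrm (Mop j g)) + d * (B * nrm g)
        + C * (d / (C + 1) * nrm g + E * nrm (Mop j g))"
      using a C(1) d by (intro add_mono mult_left_mono B(2) D(2) E(2) g) auto
    also have "\<dots> = a * b * nrm (\<lambda>z. \<eta> z * g z) + (a * d + d * B + C * (d / (C + 1))) * nrm g + (a * D + C * E) * nrm (Mop j g)"
      by (simp add: algebra_simps)
    also have "(a * d + d * B + C * (d / (C + 1))) * nrm g \<le> e * nrm g"
      using de Cd by (intro mult_right_mono) auto
    finally show "nrm (X (Y g)) \<le> a * b * nrm (\<lambda>z. \<eta> z * g z) + e * nrm g + (a * D + C * E) * nrm (Mop j g)" by simp
  qed (use a C D E in auto)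
qed

lemma le_null_nulleq:
  assumes X: "le_null j a \<eta> X" and eq: "nulleq j Y X" shows "le_null j a \<eta> Y"
proof -
  have "le_null j (a + 0) \<eta> (\<lambda>g z. X g z + (Y g z - X g z))"
    using eq by (intro le_null_add[OF X] le_null_null) (auto simp: nulleq_def)
  thus ?thesis by simp
qed

section \<open>Replacing symbols by their slices near a boundary point\<close>

text \<open>Modulo null operators T_\<eta> can be absorbed into the symbol, and \<phi> \<eta>
  differs from its slice times \<eta> by at most e |\<eta>| at every point.\<close>

lemma freeze_symbol:
  fixes \<phi> :: "complex ^ 'n \<Rightarrow> complex"
  assumes \<phi>: "continuous_on (cpoly 1) \<phi>" and \<theta>: "norm \<theta> = 1"
    and \<eta>: "continuous_on (cball 0 1) \<eta>" and e: "0 \<le> e"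
    and near: "\<And>z. z \<in> polydisk \<Longrightarrow> \<eta> (z $ j) \<noteq> 0 \<Longrightarrow> norm (\<phi> z - \<phi> (upd z j \<theta>)) \<le> e"
  shows "le_null j e (\<lambda>z. \<eta> (z $ j)) (\<lambda>g z. T \<phi> (T (\<lambda>z. \<eta> (z $ j)) g) z - T (slice j \<theta> \<phi>) (T (\<lambda>z. \<eta> (z $ j)) g) z)"
proof -
  let ?\<eta> = "\<lambda>z::complex^'n. \<eta> (z $ j)" and ?s = "slice j \<theta> \<phi>"
  note b = bdd_of_continuous[OF \<phi>] bdd_of_continuous[OF slice_continuous[OF \<phi> \<theta>, where j = j]]
  note c = CclassD[OF Cclass_continuous[OF \<eta>, of j]]
  have bd: "bdd (\<lambda>z. \<phi> z * ?\<eta> z)" "bdd (\<lambda>z. ?s z * ?\<eta> z)" by (intro bdd_symbol_mult b c)+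
  have 1: "nulleq j (\<lambda>g z. T \<phi> (T ?\<eta> g) z - T ?s (T ?\<eta> g) z) (\<lambda>g z. T (\<lambda>z. \<phi> z * ?\<eta> z) g z - T (\<lambda>z. ?s z * ?\<eta> z) g z)"
    by (rule nulleq_diff[OF nulleq_sym[OF nulleq_T_mult[OF b(1) c(1,2)]] nulleq_sym[OF nulleq_T_mult[OF b(2) c(1,2)]]])
  have "le_null j e ?\<eta> (\<lambda>g z. T (\<lambda>z. \<phi> z * ?\<eta> z) g z - T (\<lambda>z. ?s z * ?\<eta> z) g z)"
  proof (rule le_nullI)
    fix g :: "complex ^ 'n \<Rightarrow> complex" assume g: "g \<in> A2"
    have bd3: "bdd (\<lambda>z. \<phi> z * ?\<eta> z - ?s z * ?\<eta> z)" by (intro bdd_symbol_diff bd)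
    have eq: "(\<lambda>z. T (\<lambda>z. \<phi> z * ?\<eta> z) g z - T (\<lambda>z. ?s z * ?\<eta> z) g z) = proj (\<lambda>z. (\<phi> z * ?\<eta> z - ?s z * ?\<eta> z) * g z)"
      using T_sym_diff[OF bd g] by (simp add: T_eq)
    show "(\<lambda>z. T (\<lambda>z. \<phi> z * ?\<eta> z) g z - T (\<lambda>z. ?s z * ?\<eta> z) g z) \<in> L2"
      unfolding eq by (rule proj_L2[OF sym_L2[OF bd3 g]])
    have "nrm (proj (\<lambda>z. (\<phi> z * ?\<eta> z - ?s z * ?\<eta> z) * g z)) \<le> nrm (\<lambda>z. (\<phi> z * ?\<eta> z - ?s z * ?\<eta> z) * g z)"
      by (rule nrm_proj_le[OF sym_L2[OF bd3 g]])
    also have "\<dots> \<le> nrm (\<lambda>z. of_real e * (?\<eta> z * g z))"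
    proof (rule L2_norm_mono[OF L2_scale[OF sym_L2[OF c(1) g]] sym_L2[OF bd3 g]])
      fix z :: "complex ^ 'n" assume z: "z \<in> polydisk"
      have "(\<phi> z * ?\<eta> z - ?s z * ?\<eta> z) * g z = (\<phi> z - ?s z) * (?\<eta> z * g z)" by (simp add: algebra_simps)
      moreover have "norm (\<phi> z - ?s z) * norm (?\<eta> z * g z) \<le> e * norm (?\<eta> z * g z)"
        using near[OF z] by (cases "?\<eta> z = 0") (auto intro: mult_right_mono)
      ultimately show "norm ((\<phi> z * ?\<eta> z - ?s z * ?\<eta> z) * g z) \<le> norm (of_real e * (?\<eta> z * g z))"
        using e by (simp only: norm_mult norm_of_real abs_of_nonneg)
    qed
    also have "\<dots> = e * nrm (\<lambda>z. ?\<eta> z * g z)" unfolding L2_norm_scale using e by simp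
    finally show "nrm (\<lambda>z. T (\<lambda>z. \<phi> z * ?\<eta> z) g z - T (\<lambda>z. ?s z * ?\<eta> z) g z) \<le> e * nrm (\<lambda>z. ?\<eta> z * g z)"
      unfolding eq .
  qed
  thus ?thesis using 1 by (rule le_null_nulleq)
qed

text \<open>T_h does not move mass in the z_j direction: \<eta> T_h agrees with T_h T_\<eta> modulo
  null operators.\<close>

lemma le_null_localized_jfree:
  fixes h :: "complex ^ 'n \<Rightarrow> complex"
  assumes h: "jfree j h" and \<eta>: "continuous_on (cball 0 1) \<eta>" and C: "\<And>z. z \<in> polydisk \<Longrightarrow> norm (h z) \<le> C" "0 \<le> C"
  shows "le_null j C (\<lambda>z. \<eta> (z $ j)) (\<lambda>g z. \<eta> (z $ j) * T h g z)"
proof -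
  let ?\<eta> = "\<lambda>z::complex^'n. \<eta> (z $ j)"
  note c = CclassD[OF Cclass_continuous[OF \<eta>, of j]]
  have 1: "le_null j 0 ?\<eta> (\<lambda>g. hankel ?\<eta> (T h g))"
    by (intro le_null_null null_comp[OF c(2) adm_T_jfree[OF h]]) simp
  have "le_null j C ?\<eta> (\<lambda>g. T h (T ?\<eta> g))"
  proof (rule le_nullI)
    fix g :: "complex ^ 'n \<Rightarrow> complex" assume g: "g \<in> A2"
    note Tg = T_A2[OF c(1) g]
    show "T h (T ?\<eta> g) \<in> L2" by (rule T_L2[OF jfreeD(3)[OF h] Tg])
    have "nrm (T h (T ?\<eta> g)) \<le> C * nrm (T ?\<eta> g)" by (rule T_norm_le[OF jfreeD(3)[OF h] Tg C])
    also have "\<dots> \<le> C * nrm (\<lambda>z. ?\<eta> z * g z)"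
      unfolding T_eq by (rule mult_left_mono[OF nrm_proj_le[OF sym_L2[OF c(1) g]] C(2)])
    finally show "nrm (T h (T ?\<eta> g)) \<le> C * nrm (\<lambda>z. ?\<eta> z * g z)" .
  qed
  hence "le_null j C ?\<eta> (\<lambda>g. T ?\<eta> (T h g))" by (rule le_null_nulleq[OF _ c(4)[OF h]])
  from le_null_add[OF 1 this] show ?thesis by simp
qed

text \<open>The symbols are frozen one after the other, first \<psi> and then \<phi>, each at the
  cost C e.\<close>

lemma freeze_product:
  fixes \<phi> \<psi> :: "complex ^ 'n \<Rightarrow> complex"
  assumes \<phi>: "continuous_on (cpoly 1) \<phi>" and \<psi>: "continuous_on (cpoly 1) \<psi>" and \<theta>: "norm \<theta> = 1"
    and \<eta>: "continuous_on (cball 0 1) \<eta>" and e: "0 \<le> e" and C: "0 \<le> C"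
    and C\<phi>: "\<And>z. z \<in> cpoly 1 \<Longrightarrow> norm (\<phi> z) \<le> C" and C\<psi>: "\<And>z. z \<in> cpoly 1 \<Longrightarrow> norm (\<psi> z) \<le> C"
    and near\<phi>: "\<And>z. z \<in> polydisk \<Longrightarrow> \<eta> (z $ j) \<noteq> 0 \<Longrightarrow> norm (\<phi> z - \<phi> (upd z j \<theta>)) \<le> e"
    and near\<psi>: "\<And>z. z \<in> polydisk \<Longrightarrow> \<eta> (z $ j) \<noteq> 0 \<Longrightarrow> norm (\<psi> z - \<psi> (upd z j \<theta>)) \<le> e"
  shows "le_null j (2 * C * e) (\<lambda>z. \<eta> (z $ j)) (\<lambda>g z. T \<phi> (T \<psi> (T (\<lambda>z. \<eta> (z $ j)) g)) z
      - T (slice j \<theta> \<phi>) (T (slice j \<theta> \<psi>) (T (\<lambda>z. \<eta> (z $ j)) g)) z)"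
proof -
  let ?\<eta> = "\<lambda>z::complex^'n. \<eta> (z $ j)" and ?\<phi> = "slice j \<theta> \<phi>" and ?\<psi> = "slice j \<theta> \<psi>"
  note b\<phi> = bdd_of_continuous[OF \<phi>] and b\<psi> = bdd_of_continuous[OF \<psi>]
  note jf\<phi> = slice_jfree[OF \<phi> \<theta>, where j = j] and jf\<psi> = slice_jfree[OF \<psi> \<theta>, where j = j]
  note c = CclassD[OF Cclass_continuous[OF \<eta>, of j]]
  have C\<phi>D: "norm (\<phi> z) \<le> C" if "z \<in> polydisk" for z using C\<phi> polydisk_cpoly that by blast
  have C\<psi>s: "norm (?\<psi> z) \<le> C" if z: "z \<in> polydisk" for z
  proof (rule C\<psi>)
    show "upd z j \<theta> \<in> cpoly 1" using z polydisk_cpoly \<theta> by (intro upd_cpoly) auto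
  qed
  have 1: "le_null j (C * e) ?\<eta> (\<lambda>g z. T \<phi> (T \<psi> (T ?\<eta> g)) z - T \<phi> (T ?\<psi> (T ?\<eta> g)) z)"
  proof (rule le_null_left[OF freeze_symbol[OF \<psi> \<theta> \<eta> e near\<psi>] _ _ C])
    fix g :: "complex ^ 'n \<Rightarrow> complex" assume g: "g \<in> A2"
    note Tg = T_A2[OF b\<psi> T_A2[OF c(1) g]] T_A2[OF jfreeD(3)[OF jf\<psi>] T_A2[OF c(1) g]]
    note eq = T_diff[OF b\<phi> Tg, symmetric]
    show "(\<lambda>z. T \<phi> (T \<psi> (T ?\<eta> g)) z - T \<phi> (T ?\<psi> (T ?\<eta> g)) z) \<in> L2"
      unfolding eq by (rule T_L2[OF b\<phi> A2_diff[OF Tg]])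
    show "nrm (\<lambda>z. T \<phi> (T \<psi> (T ?\<eta> g)) z - T \<phi> (T ?\<psi> (T ?\<eta> g)) z) \<le> C * nrm (\<lambda>z. T \<psi> (T ?\<eta> g) z - T ?\<psi> (T ?\<eta> g) z)"
      unfolding eq by (rule T_norm_le[OF b\<phi> A2_diff[OF Tg] C\<phi>D C])
  qed
  have A: "T ?\<eta> (T ?\<psi> g) \<in> A2" "T ?\<psi> (T ?\<eta> g) \<in> A2" if "g \<in> A2" for g
    using T_A2[OF c(1) T_A2[OF jfreeD(3)[OF jf\<psi>] that]] T_A2[OF jfreeD(3)[OF jf\<psi>] T_A2[OF c(1) that]] by blast+
  \<comment> \<open>Freezing \<phi> requires T_\<eta> directly to its right, so T_\<eta> is moved
    past the slice of \<psi>, which is free of z_j.\<close>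
  have "nulleq j (\<lambda>g. T ?\<psi> (T ?\<eta> g)) (\<lambda>g. T ?\<eta> (T ?\<psi> g))" by (rule nulleq_sym[OF c(4)[OF jf\<psi>]])
  hence eq: "nulleq j (\<lambda>g z. T \<phi> (T ?\<psi> (T ?\<eta> g)) z - T ?\<phi> (T ?\<psi> (T ?\<eta> g)) z)
      (\<lambda>g z. T \<phi> (T ?\<eta> (T ?\<psi> g)) z - T ?\<phi> (T ?\<eta> (T ?\<psi> g)) z)"
    by (intro nulleq_diff nulleq_T b\<phi> jfreeD(3)[OF jf\<phi>] A)
  have "le_null j (e * C) ?\<eta> (\<lambda>g z. T \<phi> (T ?\<eta> (T ?\<psi> g)) z - T ?\<phi> (T ?\<eta> (T ?\<psi> g)) z)"
    by (rule le_null_comp[OF freeze_symbol[OF \<phi> \<theta> \<eta> e near\<phi>] adm_T_jfree[OF jf\<psi>] le_null_localized_jfree[OF jf\<psi> \<eta> C\<psi>s C] e])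
  from le_null_nulleq[OF this eq]
  have "le_null j (e * C) ?\<eta> (\<lambda>g z. T \<phi> (T ?\<psi> (T ?\<eta> g)) z - T ?\<phi> (T ?\<psi> (T ?\<eta> g)) z)" .
  from le_null_add[OF 1 this] show ?thesis by (simp add: mult_ac)
qed

lemma DclassD:
  assumes "Dclass j \<phi>"
  shows "bdd \<phi>" "adm j (T \<phi>)" "continuous_on (cball 0 1) \<kappa> \<Longrightarrow>
    nulleq j (\<lambda>g. T \<phi> (T (\<lambda>z. \<kappa> (z $ j)) g)) (\<lambda>g. T (\<lambda>z. \<kappa> (z $ j)) (T \<phi> g))"
  using assms by (simp_all add: Dclass_def)

lemma Dclass_commutes_T_T:
  assumes \<phi>: "Dclass j \<phi>" and \<psi>: "Dclass j \<psi>" and \<eta>: "continuous_on (cball 0 1) \<eta>"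
  shows "nulleq j (\<lambda>g. T (\<lambda>z. \<eta> (z $ j)) (T \<phi> (T \<psi> g))) (\<lambda>g. T \<phi> (T \<psi> (T (\<lambda>z. \<eta> (z $ j)) g)))"
proof -
  note d\<phi> = DclassD[OF \<phi>] and d\<psi> = DclassD[OF \<psi>]
  note b = CclassD(1)[OF Cclass_continuous[OF \<eta>, of j]]
  have "nulleq j (\<lambda>g. T (\<lambda>z. \<eta> (z $ j)) (T \<phi> (T \<psi> g))) (\<lambda>g. T \<phi> (T (\<lambda>z. \<eta> (z $ j)) (T \<psi> g)))"
    by (rule nulleq_comp[OF nulleq_sym[OF d\<phi>(3)[OF \<eta>]] d\<psi>(2)])
  also have "nulleq j (\<lambda>g. T \<phi> (T (\<lambda>z. \<eta> (z $ j)) (T \<psi> g))) (\<lambda>g. T \<phi> (T \<psi> (T (\<lambda>z. \<eta> (z $ j)) g)))"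
    by (rule nulleq_T[OF d\<phi>(1) _ _ nulleq_sym[OF d\<psi>(3)[OF \<eta>]]]) (intro T_A2 b d\<psi>(1); assumption)+
  finally show ?thesis .
qed

text \<open>Modulo null operators \<eta> X is T_\<eta> X and hence X T_\<eta>. Freezing both orders
  of the product costs 2 C e each, and what remains is the commutator of the slices, which
  vanishes.\<close>

lemma commutator_localized:
  fixes \<phi> \<psi> :: "complex ^ 'n \<Rightarrow> complex"
  assumes \<phi>: "continuous_on (cpoly 1) \<phi>" and \<psi>: "continuous_on (cpoly 1) \<psi>" and \<theta>: "norm \<theta> = 1"
    and \<eta>: "continuous_on (cball 0 1) \<eta>" and e: "0 \<le> e" and C: "0 \<le> C"
    and C\<phi>: "\<And>z. z \<in> cpoly 1 \<Longrightarrow> norm (\<phi> z) \<le> C" and C\<psi>: "\<And>z. z \<in> cpoly 1 \<Longrightarrow> norm (\<psi> z) \<le> C"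
    and near\<phi>: "\<And>z. z \<in> polydisk \<Longrightarrow> \<eta> (z $ j) \<noteq> 0 \<Longrightarrow> norm (\<phi> z - \<phi> (upd z j \<theta>)) \<le> e"
    and near\<psi>: "\<And>z. z \<in> polydisk \<Longrightarrow> \<eta> (z $ j) \<noteq> 0 \<Longrightarrow> norm (\<psi> z - \<psi> (upd z j \<theta>)) \<le> e"
    and comm: "\<And>g. g \<in> A2 \<Longrightarrow> T (slice j \<theta> \<phi>) (T (slice j \<theta> \<psi>) g) = T (slice j \<theta> \<psi>) (T (slice j \<theta> \<phi>) g)"
  shows "le_null j (4 * C * e) (\<lambda>z. \<eta> (z $ j)) (\<lambda>g z. \<eta> (z $ j) * toeplitz_commutator polydisk \<phi> \<psi> g z)"
proof -
  let ?\<eta> = "\<lambda>z::complex^'n. \<eta> (z $ j)" and ?X = "toeplitz_commutator polydisk \<phi> \<psi>"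
  note c = CclassD[OF Cclass_continuous[OF \<eta>, of j]]
  note D\<phi> = Dclass_continuous[OF \<phi>, of j] and D\<psi> = Dclass_continuous[OF \<psi>, of j]
  note d\<phi> = DclassD[OF D\<phi>] and d\<psi> = DclassD[OF D\<psi>]
  have X: "?X = (\<lambda>g z. T \<phi> (T \<psi> g) z - T \<psi> (T \<phi> g) z)" by (simp add: fun_eq_iff toeplitz_commutator_def)
  have admX: "adm j ?X" unfolding X by (rule adm_diff[OF adm_comp[OF d\<phi>(2) d\<psi>(2)] adm_comp[OF d\<psi>(2) d\<phi>(2)]])
  have A: "T \<phi> (T \<psi> g) \<in> A2" "T \<psi> (T \<phi> g) \<in> A2" if "g \<in> A2" for g
    by (intro T_A2 d\<phi>(1) d\<psi>(1) that)+
  have "nulleq j (\<lambda>g. T ?\<eta> (?X g)) (\<lambda>g z. T ?\<eta> (T \<phi> (T \<psi> g)) z - T ?\<eta> (T \<psi> (T \<phi> g)) z)"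
    by (rule nulleq_eq) (simp add: X T_diff[OF c(1)] A)
  also have "nulleq j \<dots> (\<lambda>g. ?X (T ?\<eta> g))"
    unfolding X by (rule nulleq_diff[OF Dclass_commutes_T_T[OF D\<phi> D\<psi> \<eta>] Dclass_commutes_T_T[OF D\<psi> D\<phi> \<eta>]])
  finally have eq: "nulleq j (\<lambda>g. T ?\<eta> (?X g)) (\<lambda>g. ?X (T ?\<eta> g))" .
  have "le_null j (2 * C * e + 2 * C * e) ?\<eta> (\<lambda>g. ?X (T ?\<eta> g))"
  proof (rule le_null_cong[OF le_null_diff[OF freeze_product[OF \<phi> \<psi> \<theta> \<eta> e C C\<phi> C\<psi> near\<phi> near\<psi>]
        freeze_product[OF \<psi> \<phi> \<theta> \<eta> e C C\<psi> C\<phi> near\<psi> near\<phi>]]])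
  qed (simp_all add: X comm T_A2[OF c(1)])
  from le_null_nulleq[OF this eq] have 1: "le_null j (4 * C * e) ?\<eta> (\<lambda>g. T ?\<eta> (?X g))" by (simp add: mult.assoc)
  have "le_null j 0 ?\<eta> (\<lambda>g. hankel ?\<eta> (?X g))"
    by (intro le_null_null null_comp[OF c(2) admX]) simp
  from le_null_add[OF this 1] show ?thesis by simp
qed

section \<open>Partition of unity along the circle and nullity of the commutator\<close>

text \<open>Squares sum to 1, because L2 norms are to be decomposed. Tents over a finite net of the
  circle cover the boundary; the remaining function is a multiple of 1 - |w|, which makes the
  interior part null.\<close>

lemma circle_partition:
  fixes \<delta> :: real
  assumes \<delta>: "\<delta> > 0"
  obtains \<Theta> :: "complex set" and \<eta> :: "complex \<Rightarrow> complex \<Rightarrow> complex" and \<eta>0 :: "complex \<Rightarrow> complex" and C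
  where "finite \<Theta>" "\<Theta> \<subseteq> sphere 0 1" "\<And>\<theta>. continuous_on (cball 0 1) (\<eta> \<theta>)" "continuous_on (cball 0 1) \<eta>0"
    "\<And>\<theta> w. \<eta> \<theta> w \<noteq> 0 \<Longrightarrow> dist w \<theta> < \<delta>"
    "\<And>w. w \<in> cball 0 1 \<Longrightarrow> (\<Sum>\<theta>\<in>\<Theta>. (norm (\<eta> \<theta> w))\<^sup>2) + (norm (\<eta>0 w))\<^sup>2 = 1"
    "0 \<le> C" "\<And>w. w \<in> cball 0 1 \<Longrightarrow> norm (\<eta>0 w) \<le> C * (1 - (norm w)\<^sup>2)"
proof -
  have "\<exists>k. finite k \<and> k \<subseteq> sphere (0::complex) 1 \<and> sphere 0 1 \<subseteq> (\<Union>x\<in>k. ball x \<delta>)"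
    using seq_compact_imp_totally_bounded[OF compact_imp_seq_compact[OF compact_sphere[of "0::complex" 1]]] \<delta> by blast
  then obtain \<Theta> where \<Theta>: "finite \<Theta>" "\<Theta> \<subseteq> sphere (0::complex) 1" "sphere 0 1 \<subseteq> (\<Union>x\<in>\<Theta>. ball x \<delta>)" by blast
  define q where "q = (\<lambda>\<theta> w::complex. max 0 (\<delta> - dist w \<theta>))"
  \<comment> \<open>Positive on the closed disc: on the circle some tent is positive, inside 1 - |w|
    is. Its minimum there gives the constant 1 / m.\<close>
  define s where "s = (\<lambda>w::complex. sqrt ((\<Sum>\<theta>\<in>\<Theta>. (q \<theta> w)\<^sup>2) + (1 - norm w)\<^sup>2))"
  have qc: "continuous_on A (q \<theta>)" for \<theta> A unfolding q_def by (intro continuous_intros)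
  have sc: "continuous_on A s" for A unfolding s_def by (intro continuous_intros qc)
  have spos: "s w > 0" if w: "w \<in> cball 0 1" for w
  proof (cases "norm w = 1")
    case True
    then obtain \<theta> where t: "\<theta> \<in> \<Theta>" "dist \<theta> w < \<delta>" using \<Theta>(3) by (auto simp: subset_iff)
    hence "q \<theta> w > 0" by (simp add: q_def dist_commute)
    hence "(\<Sum>\<theta>\<in>\<Theta>. (q \<theta> w)\<^sup>2) > 0" using t \<Theta>(1) by (intro sum_pos2[of _ \<theta>]) auto
    thus ?thesis unfolding s_def by (simp add: add_pos_nonneg)
  next
    case False
    hence "(1 - norm w)\<^sup>2 > 0" by simp
    thus ?thesis unfolding s_def by (simp add: add_nonneg_pos sum_nonneg)
  qed
  have "cball (0::complex) 1 \<noteq> {}" by simp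
  then obtain x where x: "x \<in> cball 0 1" "\<forall>y\<in>cball 0 1. s x \<le> s y"
    using continuous_attains_inf[OF compact_cball _ sc, of "0::complex" 1] by blast
  define m where "m = s x"
  have m: "m > 0" "\<And>w. w \<in> cball 0 1 \<Longrightarrow> m \<le> s w" unfolding m_def using x spos by blast+
  define \<eta> where "\<eta> = (\<lambda>\<theta> w. of_real (q \<theta> w / s w) :: complex)"
  define \<eta>0 where "\<eta>0 = (\<lambda>w. of_real ((1 - norm w) / s w) :: complex)"
  show thesis
  proof (rule that[of \<Theta> \<eta> \<eta>0 "1 / m"])
    show "continuous_on (cball 0 1) (\<eta> \<theta>)" for \<theta>
      unfolding \<eta>_def using spos by (intro continuous_intros qc sc) force
    show "continuous_on (cball 0 1) \<eta>0"
      unfolding \<eta>0_def using spos by (intro continuous_intros sc) force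
    show "dist w \<theta> < \<delta>" if "\<eta> \<theta> w \<noteq> 0" for \<theta> w
      using that by (auto simp: \<eta>_def q_def max_def split: if_splits)
    fix w :: complex assume w: "w \<in> cball 0 1"
    have s2: "(s w)\<^sup>2 = (\<Sum>\<theta>\<in>\<Theta>. (q \<theta> w)\<^sup>2) + (1 - norm w)\<^sup>2"
      unfolding s_def by (simp add: sum_nonneg)
    have "(\<Sum>\<theta>\<in>\<Theta>. (norm (\<eta> \<theta> w))\<^sup>2) + (norm (\<eta>0 w))\<^sup>2 = ((\<Sum>\<theta>\<in>\<Theta>. (q \<theta> w)\<^sup>2) + (1 - norm w)\<^sup>2) / (s w)\<^sup>2"
      unfolding \<eta>_def \<eta>0_def norm_of_real power2_abs power_divide add_divide_distrib sum_divide_distrib ..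
    also have "\<dots> = 1" unfolding s2[symmetric] using spos[OF w] by simp
    finally show "(\<Sum>\<theta>\<in>\<Theta>. (norm (\<eta> \<theta> w))\<^sup>2) + (norm (\<eta>0 w))\<^sup>2 = 1" .
    have n: "norm w \<le> 1" using w by simp
    have "norm (\<eta>0 w) = (1 - norm w) / s w" unfolding \<eta>0_def norm_of_real using n spos[OF w] by simp
    also have "\<dots> \<le> (1 - norm w) / m" using m(1) m(2)[OF w] n by (intro divide_left_mono) auto
    also have "\<dots> \<le> (1 - (norm w)\<^sup>2) / m"
      using m(1) n mult_left_le[of "norm w" "norm w"] by (intro divide_right_mono) (auto simp: power2_eq_square)
    finally show "norm (\<eta>0 w) \<le> 1 / m * (1 - (norm w)\<^sup>2)" by simp
  qed (use \<Theta> m in auto)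
qed

text \<open>The weighted norm estimate bounds the square by a product of the norms of M g and g, and
  such a product is split into \<open>e\<close> times one plus a constant times the other.\<close>

lemma null_interior_multiplier:
  fixes \<eta> :: "complex \<Rightarrow> complex"
  assumes \<eta>: "continuous_on (cball 0 1) \<eta>" and C: "0 \<le> C"
    and le: "\<And>w. w \<in> cball 0 1 \<Longrightarrow> norm (\<eta> w) \<le> C * (1 - (norm w)\<^sup>2)"
  shows "null j (\<lambda>g z. \<eta> (z $ j) * g z)"
proof (rule nullI)
  note b = CclassD(1)[OF Cclass_continuous[OF \<eta>, of j]]
  fix g :: "complex ^ 'a \<Rightarrow> complex" assume g: "g \<in> A2"
  show "(\<lambda>z. \<eta> (z $ j) * g z) \<in> L2" by (rule sym_L2[OF b g])
next
  note b = CclassD(1)[OF Cclass_continuous[OF \<eta>, of j]]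
  have b2: "bdd (\<lambda>z::complex^'a. of_real (1 - (norm (z $ j))\<^sup>2))"
    using CclassD(1)[OF Cclass_continuous[of "\<lambda>w. of_real (1 - (norm w)\<^sup>2)" j]] by (simp add: continuous_intros)
  fix e :: real assume e: "e > 0"
  show "\<exists>D\<ge>0. \<forall>g\<in>A2. nrm (\<lambda>z. \<eta> (z $ j) * g z) \<le> e * nrm g + D * nrm (Mop j g)"
  \<comment> \<open>With this constant the product of the two terms on the right is C^2 times the
    norms of M g and g.\<close>
  proof (intro exI[of _ "C\<^sup>2 / e"] conjI ballI)
    fix g :: "complex ^ 'a \<Rightarrow> complex" assume g: "g \<in> A2"
    define v where "v = nrm (\<lambda>z. \<eta> (z $ j) * g z)"
    have "v \<le> nrm (\<lambda>z. of_real C * (of_real (1 - (norm (z $ j))\<^sup>2) * g z))"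
      unfolding v_def
    proof (rule L2_norm_mono[OF L2_scale[OF sym_L2[OF b2 g]] sym_L2[OF b g]])
      fix z :: "complex ^ 'a" assume "z \<in> polydisk"
      hence n: "norm (z $ j) \<le> 1" by (simp add: polydisk_nth less_imp_le)
      hence "0 \<le> 1 - (norm (z $ j))\<^sup>2" by (simp add: power_le_one)
      hence "norm (of_real C * (of_real (1 - (norm (z $ j))\<^sup>2) * g z)) = C * (1 - (norm (z $ j))\<^sup>2) * norm (g z)"
        using C by (simp only: norm_mult norm_of_real abs_of_nonneg mult.assoc)
      thus "norm (\<eta> (z $ j) * g z) \<le> norm (of_real C * (of_real (1 - (norm (z $ j))\<^sup>2) * g z))"
        using mult_right_mono[OF le[of "z $ j"] norm_ge_zero[of "g z"]] n by (simp only: norm_mult) simp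
    qed
    also have "\<dots> = C * nrm (\<lambda>z. of_real (1 - (norm (z $ j))\<^sup>2) * g z)" unfolding L2_norm_scale using C by simp
    finally have "v\<^sup>2 \<le> (C * nrm (\<lambda>z. of_real (1 - (norm (z $ j))\<^sup>2) * g z))\<^sup>2" by (rule power_mono) (simp add: v_def)
    also have "\<dots> = C\<^sup>2 * (nrm (\<lambda>z. of_real (1 - (norm (z $ j))\<^sup>2) * g z))\<^sup>2" by (rule power_mult_distrib)
    also have "\<dots> \<le> C\<^sup>2 * (nrm (Mop j g) * nrm g)" by (rule mult_left_mono[OF weighted_norm_le[OF g]]) simp
    also have "\<dots> = e * nrm g * (C\<^sup>2 / e * nrm (Mop j g))" using e by simp
    also have "\<dots> \<le> (e * nrm g + C\<^sup>2 / e * nrm (Mop j g))\<^sup>2"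
    proof -
      have "x * y \<le> (x + y)\<^sup>2" if "0 \<le> x" "0 \<le> y" for x y :: real
        using mult_nonneg_nonneg[OF that] zero_le_square[of x] zero_le_square[of y] by (simp add: power2_eq_square algebra_simps)
      from this[of "e * nrm g" "C\<^sup>2 / e * nrm (Mop j g)"] show ?thesis using e by (simp del: times_divide_eq_left)
    qed
    finally have "v\<^sup>2 \<le> (e * nrm g + C\<^sup>2 / e * nrm (Mop j g))\<^sup>2" .
    thus "nrm (\<lambda>z. \<eta> (z $ j) * g z) \<le> e * nrm g + C\<^sup>2 / e * nrm (Mop j g)"
      unfolding v_def[symmetric] by (rule power2_le_imp_le) (use e in simp)
  qed (use e in simp)
qed

lemma nrm_partition:
  assumes f: "f \<in> L2" and fin: "finite I" and b: "\<And>i. i \<in> I \<Longrightarrow> bdd (\<eta> i)" "bdd \<eta>0"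
    and one: "\<And>z. z \<in> polydisk \<Longrightarrow> (\<Sum>i\<in>I. (norm (\<eta> i z))\<^sup>2) + (norm (\<eta>0 z))\<^sup>2 = 1"
  shows "(nrm f)\<^sup>2 = (\<Sum>i\<in>I. (nrm (\<lambda>z. \<eta> i z * f z))\<^sup>2) + (nrm (\<lambda>z. \<eta>0 z * f z))\<^sup>2"
proof -
  note int = L2_integrable[OF L2_mult[OF b(1) f]] L2_integrable[OF L2_mult[OF b(2) f]]
  have "(nrm f)\<^sup>2 = (LINT z|pdm. (norm (f z))\<^sup>2)" by (rule L2_norm_sq)
  also have "\<dots> = (LINT z|pdm. (\<Sum>i\<in>I. (norm (\<eta> i z * f z))\<^sup>2) + (norm (\<eta>0 z * f z))\<^sup>2)"
  proof (rule Bochner_Integration.integral_cong[OF refl])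
    fix z :: "complex ^ 'a" assume "z \<in> space pdm"
    hence "(\<Sum>i\<in>I. (norm (\<eta> i z))\<^sup>2) + (norm (\<eta>0 z))\<^sup>2 = 1" using one by (simp add: space_pdm)
    hence "((\<Sum>i\<in>I. (norm (\<eta> i z))\<^sup>2) + (norm (\<eta>0 z))\<^sup>2) * (norm (f z))\<^sup>2 = (norm (f z))\<^sup>2" by simp
    thus "(norm (f z))\<^sup>2 = (\<Sum>i\<in>I. (norm (\<eta> i z * f z))\<^sup>2) + (norm (\<eta>0 z * f z))\<^sup>2"
      by (simp add: norm_mult power_mult_distrib distrib_right sum_distrib_right)
  qed
  also have "\<dots> = (LINT z|pdm. (\<Sum>i\<in>I. (norm (\<eta> i z * f z))\<^sup>2)) + (LINT z|pdm. (norm (\<eta>0 z * f z))\<^sup>2)"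
    by (rule Bochner_Integration.integral_add[OF Bochner_Integration.integrable_sum[OF int(1)] int(2)])
  also have "(LINT z|pdm. (\<Sum>i\<in>I. (norm (\<eta> i z * f z))\<^sup>2)) = (\<Sum>i\<in>I. LINT z|pdm. (norm (\<eta> i z * f z))\<^sup>2)"
    by (rule Bochner_Integration.integral_sum[OF int(1)])
  finally show ?thesis unfolding L2_norm_sq .
qed

lemma cpoly_uniformly_continuous:
  fixes \<phi> :: "complex ^ 'n \<Rightarrow> complex"
  assumes \<phi>: "continuous_on (cpoly 1) \<phi>" and e: "e > 0"
  obtains \<delta> where "\<delta> > 0" "\<And>z \<theta>. z \<in> polydisk \<Longrightarrow> norm \<theta> = 1 \<Longrightarrow> dist (z $ j) \<theta> < \<delta> \<Longrightarrow> norm (\<phi> z - \<phi> (upd z j \<theta>)) \<le> e"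
proof -
  have "uniformly_continuous_on (cpoly 1) \<phi>" by (rule compact_uniformly_continuous[OF \<phi> compact_cpoly])
  then obtain \<delta> where \<delta>: "\<delta> > 0" "\<And>x y. x \<in> cpoly 1 \<Longrightarrow> y \<in> cpoly 1 \<Longrightarrow> dist y x < \<delta> \<Longrightarrow> dist (\<phi> y) (\<phi> x) < e"
    using e unfolding uniformly_continuous_on_def by blast
  show thesis
  proof (rule that[OF \<delta>(1)])
    fix z :: "complex ^ 'n" and \<theta> :: complex assume z: "z \<in> polydisk" "norm \<theta> = 1" "dist (z $ j) \<theta> < \<delta>"
    have c: "z \<in> cpoly 1" "upd z j \<theta> \<in> cpoly 1" using z polydisk_cpoly by (auto intro!: upd_cpoly)
    have "z - upd z j \<theta> = axis j (z $ j - \<theta>)" by (simp add: vec_eq_iff upd_nth axis_def)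
    hence "dist z (upd z j \<theta>) < \<delta>" using z(3) by (simp add: dist_norm norm_axis)
    from \<delta>(2)[OF c(2,1) this] show "norm (\<phi> z - \<phi> (upd z j \<theta>)) \<le> e" by (simp add: dist_norm)
  qed
qed

lemma adm_commutator:
  assumes \<phi>: "continuous_on (cpoly 1) \<phi>" and \<psi>: "continuous_on (cpoly 1) \<psi>"
  shows "adm j (toeplitz_commutator polydisk \<phi> \<psi>)"
proof -
  note d\<phi> = DclassD(2)[OF Dclass_continuous[OF \<phi>, of j]] and d\<psi> = DclassD(2)[OF Dclass_continuous[OF \<psi>, of j]]
  have X: "toeplitz_commutator polydisk \<phi> \<psi> = (\<lambda>g z. T \<phi> (T \<psi> g) z - T \<psi> (T \<phi> g) z)"
    by (simp add: fun_eq_iff toeplitz_commutator_def)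
  show ?thesis unfolding X by (rule adm_diff[OF adm_comp[OF d\<phi> d\<psi>] adm_comp[OF d\<psi> d\<phi>]])
qed

text \<open>The localised main terms are summed in squares and recombine to the norm of g, so the
  constant does not grow with the partition. Only the error terms are multiplied by the number of
  pieces, and they are chosen after it.\<close>

lemma commutator_null:
  fixes \<phi> \<psi> :: "complex ^ 'n \<Rightarrow> complex"
  assumes \<phi>: "continuous_on (cpoly 1) \<phi>" and \<psi>: "continuous_on (cpoly 1) \<psi>"
    and comm: "\<And>\<theta> g. norm \<theta> = 1 \<Longrightarrow> g \<in> A2 \<Longrightarrow>
      T (slice j \<theta> \<phi>) (T (slice j \<theta> \<psi>) g) = T (slice j \<theta> \<psi>) (T (slice j \<theta> \<phi>) g)"
  shows "null j (toeplitz_commutator polydisk \<phi> \<psi>)"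
proof -
  let ?X = "toeplitz_commutator polydisk \<phi> \<psi>"
  note admX = adm_commutator[OF \<phi> \<psi>, of j]
  have XL: "?X g \<in> L2" if "g \<in> A2" for g by (rule A2_L2[OF bddopD[OF adm_bddop[OF admX] that]])
  have "bounded (\<phi> ` cpoly 1 \<union> \<psi> ` cpoly 1)"
    using compact_imp_bounded[OF compact_continuous_image[OF \<phi> compact_cpoly]]
      compact_imp_bounded[OF compact_continuous_image[OF \<psi> compact_cpoly]] by simp
  then obtain C where C: "C > 0" "\<And>z. z \<in> cpoly 1 \<Longrightarrow> norm (\<phi> z) \<le> C" "\<And>z. z \<in> cpoly 1 \<Longrightarrow> norm (\<psi> z) \<le> C"
    unfolding bounded_pos by blast
  show ?thesis
  \<comment> \<open>8 C is twice the localised constant 4 C, from squaring a sum; the 1 pays for the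
    accumulated errors.\<close>
  proof (rule null_bound[OF XL, where K = "8 * C + 1"])
    fix e :: real assume e: "e > 0"
    obtain \<delta>1 where \<delta>1: "\<delta>1 > 0" "\<And>z \<theta>. z \<in> polydisk \<Longrightarrow> norm \<theta> = 1 \<Longrightarrow> dist (z $ j) \<theta> < \<delta>1 \<Longrightarrow> norm (\<phi> z - \<phi> (upd z j \<theta>)) \<le> e"
      using cpoly_uniformly_continuous[OF \<phi> e] by blast
    obtain \<delta>2 where \<delta>2: "\<delta>2 > 0" "\<And>z \<theta>. z \<in> polydisk \<Longrightarrow> norm \<theta> = 1 \<Longrightarrow> dist (z $ j) \<theta> < \<delta>2 \<Longrightarrow> norm (\<psi> z - \<psi> (upd z j \<theta>)) \<le> e"
      using cpoly_uniformly_continuous[OF \<psi> e] by blast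
    have m\<delta>: "min \<delta>1 \<delta>2 > 0" using \<delta>1 \<delta>2 by simp
    obtain \<Theta> :: "complex set" and \<eta> :: "complex \<Rightarrow> complex \<Rightarrow> complex" and \<eta>0 :: "complex \<Rightarrow> complex" and K where
      \<Theta>: "finite \<Theta>" "\<Theta> \<subseteq> sphere 0 1" and \<eta>: "\<And>\<theta>. continuous_on (cball 0 1) (\<eta> \<theta>)" and \<eta>0: "continuous_on (cball 0 1) \<eta>0"
      and supp: "\<And>\<theta> w. \<eta> \<theta> w \<noteq> 0 \<Longrightarrow> dist w \<theta> < min \<delta>1 \<delta>2"
      and one: "\<And>w. w \<in> cball 0 1 \<Longrightarrow> (\<Sum>\<theta>\<in>\<Theta>. (norm (\<eta> \<theta> w))\<^sup>2) + (norm (\<eta>0 w))\<^sup>2 = 1"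
      and K: "0 \<le> K" "\<And>w. w \<in> cball 0 1 \<Longrightarrow> norm (\<eta>0 w) \<le> K * (1 - (norm w)\<^sup>2)"
      by (rule circle_partition[OF m\<delta>]) (rule that)
    define N where "N = real (card \<Theta>)"
    \<comment> \<open>The partition is fixed at this point; the divisor 2 N + 1 counts two error
      squares per piece and one for the interior part.\<close>
    define d where "d = e / (2 * N + 1)"
    have N: "N \<ge> 0" by (simp add: N_def)
    have d: "d > 0" using e N by (simp add: d_def)
    have dN: "(2 * N + 1) * d = e" using N by (simp add: d_def)
    have "le_null j (4 * C * e) (\<lambda>z. \<eta> \<theta> (z $ j)) (\<lambda>g z. \<eta> \<theta> (z $ j) * ?X g z)" if t: "\<theta> \<in> \<Theta>" for \<theta>
    proof -
      have n: "norm \<theta> = 1" using t \<Theta>(2) by auto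
      show ?thesis
      proof (rule commutator_localized[OF \<phi> \<psi> n \<eta> _ _ C(2,3) _ _ comm[OF n]])
        fix z :: "complex ^ 'n" assume z: "z \<in> polydisk" "\<eta> \<theta> (z $ j) \<noteq> 0"
        show "norm (\<phi> z - \<phi> (upd z j \<theta>)) \<le> e" using \<delta>1(2)[OF z(1) n] supp[OF z(2)] by simp
        show "norm (\<psi> z - \<psi> (upd z j \<theta>)) \<le> e" using \<delta>2(2)[OF z(1) n] supp[OF z(2)] by simp
      qed (use e C in auto)
    qed
    hence "\<forall>\<theta>\<in>\<Theta>. \<exists>D. D \<ge> 0 \<and> (\<forall>g\<in>A2. nrm (\<lambda>z. \<eta> \<theta> (z $ j) * ?X g z) \<le> 4 * C * e * nrm (\<lambda>z. \<eta> \<theta> (z $ j) * g z) + d * nrm g + D * nrm (Mop j g))"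
      using d unfolding le_null_def by blast
    from bchoice[OF this] obtain D where D: "\<And>\<theta>. \<theta> \<in> \<Theta> \<Longrightarrow> D \<theta> \<ge> 0" "\<And>\<theta> g. \<theta> \<in> \<Theta> \<Longrightarrow> g \<in> A2 \<Longrightarrow>
        nrm (\<lambda>z. \<eta> \<theta> (z $ j) * ?X g z) \<le> 4 * C * e * nrm (\<lambda>z. \<eta> \<theta> (z $ j) * g z) + d * nrm g + D \<theta> * nrm (Mop j g)"
      by blast
    have n0: "null j (\<lambda>g z. \<eta>0 (z $ j) * ?X g z)"
      by (rule null_comp[where X = "\<lambda>g z. \<eta>0 (z $ j) * g z" and Y = ?X, OF null_interior_multiplier[OF \<eta>0 K] admX])
    obtain D0 where D0: "D0 \<ge> 0" "\<And>g. g \<in> A2 \<Longrightarrow> nrm (\<lambda>z. \<eta>0 (z $ j) * ?X g z) \<le> d * nrm g + D0 * nrm (Mop j g)"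
      by (rule nullE[OF n0 d]) (rule that)
    define E where "E = D0 + (\<Sum>\<theta>\<in>\<Theta>. D \<theta>)"
    have E: "D \<theta> \<le> E" if "\<theta> \<in> \<Theta>" for \<theta>
      using member_le_sum[of \<theta> \<Theta> D] that \<Theta>(1) D(1) D0(1) by (auto simp: E_def)
    have E0: "D0 \<le> E" "E \<ge> 0" using D0 D(1) by (auto simp: E_def sum_nonneg)
    show "\<exists>D\<ge>0. \<forall>g\<in>A2. nrm (?X g) \<le> (8 * C + 1) * e * nrm g + D * nrm (Mop j g)"
    proof (intro exI[of _ "(2 * N + 1) * E"] conjI ballI)
      fix g :: "complex ^ 'n \<Rightarrow> complex" assume g: "g \<in> A2"
      define a where "a = 4 * C * e"
      define b where "b = d * nrm g + E * nrm (Mop j g)"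
      have a: "a \<ge> 0" using C e by (simp add: a_def)
      have b: "b \<ge> 0" using d E0 by (simp add: b_def)
      have bd: "bdd (\<lambda>z::complex^'n. \<eta> \<theta> (z $ j))" "bdd (\<lambda>z::complex^'n. \<eta>0 (z $ j))" for \<theta>
        using CclassD(1)[OF Cclass_continuous] \<eta> \<eta>0 by blast+
      have one': "(\<Sum>\<theta>\<in>\<Theta>. (norm (\<eta> \<theta> (z $ j)))\<^sup>2) + (norm (\<eta>0 (z $ j)))\<^sup>2 = 1" if "z \<in> polydisk" for z :: "complex ^ 'n"
        using that by (intro one) (simp add: polydisk_nth less_imp_le)
      have sq: "(nrm (\<lambda>z. \<eta> \<theta> (z $ j) * ?X g z))\<^sup>2 \<le> 2 * a\<^sup>2 * (nrm (\<lambda>z. \<eta> \<theta> (z $ j) * g z))\<^sup>2 + 2 * b\<^sup>2" if t: "\<theta> \<in> \<Theta>" for \<theta>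
      proof -
        let ?x = "a * nrm (\<lambda>z. \<eta> \<theta> (z $ j) * g z)"
        have "D \<theta> * nrm (Mop j g) \<le> E * nrm (Mop j g)" by (rule mult_right_mono[OF E[OF t]]) simp
        hence "nrm (\<lambda>z. \<eta> \<theta> (z $ j) * ?X g z) \<le> ?x + b"
          using D(2)[OF t g] unfolding a_def b_def by linarith
        hence "(nrm (\<lambda>z. \<eta> \<theta> (z $ j) * ?X g z))\<^sup>2 \<le> (?x + b)\<^sup>2" by (rule power_mono) simp
        also have "\<dots> \<le> 2 * ?x\<^sup>2 + 2 * b\<^sup>2"
          using zero_le_power2[of "?x - b"] by (simp add: power2_sum power2_diff)
        finally show ?thesis by (simp add: power_mult_distrib)
      qed
      have "D0 * nrm (Mop j g) \<le> E * nrm (Mop j g)" by (rule mult_right_mono[OF E0(1)]) simp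
      hence "nrm (\<lambda>z. \<eta>0 (z $ j) * ?X g z) \<le> b" using D0(2)[OF g] unfolding b_def by linarith
      hence sq0: "(nrm (\<lambda>z. \<eta>0 (z $ j) * ?X g z))\<^sup>2 \<le> b\<^sup>2" by (rule power_mono) simp
      have "(nrm (?X g))\<^sup>2 = (\<Sum>\<theta>\<in>\<Theta>. (nrm (\<lambda>z. \<eta> \<theta> (z $ j) * ?X g z))\<^sup>2) + (nrm (\<lambda>z. \<eta>0 (z $ j) * ?X g z))\<^sup>2"
        by (rule nrm_partition[OF XL[OF g] \<Theta>(1) bd one'])
      also have "\<dots> \<le> (\<Sum>\<theta>\<in>\<Theta>. 2 * a\<^sup>2 * (nrm (\<lambda>z. \<eta> \<theta> (z $ j) * g z))\<^sup>2 + 2 * b\<^sup>2) + b\<^sup>2"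
        by (intro add_mono sum_mono sq sq0)
      also have "\<dots> = 2 * a\<^sup>2 * (\<Sum>\<theta>\<in>\<Theta>. (nrm (\<lambda>z. \<eta> \<theta> (z $ j) * g z))\<^sup>2) + (2 * N + 1) * b\<^sup>2"
        unfolding N_def by (simp add: sum.distrib sum_distrib_left algebra_simps)
      also have "\<dots> \<le> 2 * a\<^sup>2 * (nrm g)\<^sup>2 + (2 * N + 1) * b\<^sup>2"
      proof -
        have "(\<Sum>\<theta>\<in>\<Theta>. (nrm (\<lambda>z. \<eta> \<theta> (z $ j) * g z))\<^sup>2) \<le> (nrm g)\<^sup>2"
          using nrm_partition[OF A2_L2[OF g] \<Theta>(1) bd one'] by simp
        thus ?thesis by (intro add_right_mono mult_left_mono) auto
      qed
      also have "\<dots> \<le> (2 * a * nrm g + (2 * N + 1) * b)\<^sup>2"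
      proof -
        have "(2 * N + 1) * b\<^sup>2 \<le> (2 * N + 1)\<^sup>2 * b\<^sup>2"
          using N by (intro mult_right_mono self_le_power) auto
        hence 1: "(2 * N + 1) * b\<^sup>2 \<le> ((2 * N + 1) * b)\<^sup>2" unfolding power_mult_distrib .
        have 2: "2 * (a * nrm g)\<^sup>2 \<le> 4 * (a * nrm g)\<^sup>2 + 4 * (a * nrm g) * ((2 * N + 1) * b)"
          using a b N by simp
        have "(2 * (a * nrm g) + (2 * N + 1) * b)\<^sup>2 =
            4 * (a * nrm g)\<^sup>2 + 4 * (a * nrm g) * ((2 * N + 1) * b) + ((2 * N + 1) * b)\<^sup>2"
          unfolding power2_sum by (simp add: power2_eq_square)
        with add_mono[OF 2 1] show ?thesis by (simp only: power_mult_distrib mult.assoc)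
      qed
      finally have "nrm (?X g) \<le> 2 * a * nrm g + (2 * N + 1) * b"
        by (rule power2_le_imp_le) (use a b N in simp)
      also have "(2 * N + 1) * b = (2 * N + 1) * d * nrm g + (2 * N + 1) * E * nrm (Mop j g)"
        unfolding b_def by (simp add: distrib_left mult.assoc)
      finally show "nrm (?X g) \<le> (8 * C + 1) * e * nrm g + (2 * N + 1) * E * nrm (Mop j g)"
        unfolding dN a_def by (simp add: algebra_simps)
    qed (use N E0 in simp)
  qed (use C in auto)
qed

subsection \<open>Normal families in the Bergman space\<close>

lemma convex_cpoly: "convex (cpoly r)"
proof (rule convexI)
  fix x y :: "complex ^ 'n" and u v :: real
  assume xy: "x \<in> cpoly r" "y \<in> cpoly r" and uv: "0 \<le> u" "0 \<le> v" "u + v = 1"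
  have "norm ((u *\<^sub>R x + v *\<^sub>R y) $ i) \<le> r" for i
  proof -
    have "norm ((u *\<^sub>R x + v *\<^sub>R y) $ i) \<le> norm (u *\<^sub>R (x $ i)) + norm (v *\<^sub>R (y $ i))"
      using norm_triangle_ineq[of "u *\<^sub>R (x $ i)" "v *\<^sub>R (y $ i)"] by simp
    also have "\<dots> = u * norm (x $ i) + v * norm (y $ i)" using uv by (simp only: norm_scaleR abs_of_nonneg)
    also have "\<dots> \<le> u * r + v * r" using xy uv by (intro add_mono mult_left_mono) (auto simp: cpoly_def)
    also have "\<dots> = r" using uv(3) by (simp add: distrib_right[symmetric])
    finally show ?thesis .
  qed
  thus "u *\<^sub>R x + v *\<^sub>R y \<in> cpoly r" by (simp add: cpoly_def)
qed

text \<open>Point evaluations bound f on a slightly larger polydisk, Cauchy's estimate bounds the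
  partial derivatives, and convexity turns this into a Lipschitz bound proportional to the norm of
  f.\<close>

lemma local_Lipschitz_bound:
  assumes r: "0 < r" "r < 1"
  obtains L where "L \<ge> 0" "\<And>f x y. f \<in> A2 \<Longrightarrow> x \<in> (cpoly r :: (complex ^ 'n) set) \<Longrightarrow> y \<in> cpoly r \<Longrightarrow>
    norm (f x - f y) \<le> L * nrm f * norm (x - y)"
proof -
  \<comment> \<open>Halfway between r and 1; coordinate discs of radius \<open>s\<close> about
    points of \<open>cpoly r\<close> then lie in \<open>cpoly R\<close>.\<close>
  define R where "R = (1 + r) / 2"
  define s where "s = (1 - r) / 2"
  have R: "0 < R" "R < 1" and s: "s > 0" "r + s = R" "s < 1 - r" using r by (auto simp: R_def s_def field_simps)
  obtain K where K: "K \<ge> 0" "\<And>f a. sephol f \<Longrightarrow> f \<in> L2 \<Longrightarrow> a \<in> (cpoly R :: (complex ^ 'n) set) \<Longrightarrow> norm (f a) \<le> K * nrm f"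
    using point_evaluation_bound[OF R] by blast
  define L where "L = real CARD('n) * (K / s)"
  have L: "L \<ge> 0" using K s by (simp add: L_def)
  have "norm (f x - f y) \<le> L * nrm f * norm (x - y)" if f: "f \<in> A2" and xy: "x \<in> (cpoly r :: (complex ^ 'n) set)" "y \<in> cpoly r" for f x y
  proof (rule differentiable_bound[OF convex_cpoly _ _ xy])
    fix z :: "complex ^ 'n" assume z: "z \<in> cpoly r"
    have zD: "z \<in> polydisk" using z cpoly_subset_polydisk[OF r(2)] by blast
    have zi: "norm (z $ i) \<le> r" for i using z by (simp add: cpoly_def)
    show "(f has_derivative (\<lambda>v. \<Sum>i\<in>UNIV. deriv (line f z i) 0 * v $ i)) (at z within cpoly r)"
      by (rule has_derivative_at_withinI[OF sephol_has_derivative[OF A2_sephol[OF f] zD]])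
    have d: "norm (deriv (line f z i) 0) \<le> K * nrm f / s" for i
    proof -
      have hol: "line f z i holomorphic_on ball 0 (1 - r)"
        using zi[of i] by (intro line_holomorphic[OF A2_sephol[OF f] zD]) simp
      have "norm ((deriv ^^ 1) (line f z i) 0) \<le> fact 1 * (K * nrm f) / s ^ 1"
      proof (rule Cauchy_inequality)
        show "line f z i holomorphic_on ball 0 s" using s by (intro holomorphic_on_subset[OF hol]) auto
        show "continuous_on (cball 0 s) (line f z i)"
          using s by (intro continuous_on_subset[OF holomorphic_on_imp_continuous_on[OF hol]]) auto
        show "s > 0" by (rule s)
        fix w :: complex assume w: "norm (0 - w) = s"
        have "norm ((z + axis i w) $ k) \<le> R" for k
          using zi[of k] w s R norm_triangle_ineq[of "z $ k" w] by (cases "k = i") (auto simp: axis_def)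
        hence "z + axis i w \<in> cpoly R" by (simp add: cpoly_def)
        thus "norm (line f z i w) \<le> K * nrm f" unfolding line_def by (rule K(2)[OF A2_sephol[OF f] A2_L2[OF f]])
      qed
      thus ?thesis by simp
    qed
    show "onorm (\<lambda>v. \<Sum>i\<in>UNIV. deriv (line f z i) 0 * v $ i) \<le> L * nrm f"
    proof (rule onorm_le)
      fix v :: "complex ^ 'n"
      have "norm (\<Sum>i\<in>UNIV. deriv (line f z i) 0 * v $ i) \<le> (\<Sum>i\<in>UNIV. norm (deriv (line f z i) 0 * v $ i))" by (rule norm_sum)
      also have "\<dots> \<le> (\<Sum>i\<in>(UNIV::'n set). K * nrm f / s * norm v)"
        unfolding norm_mult using K s by (intro sum_mono mult_mono d Finite_Cartesian_Product.norm_nth_le) auto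
      also have "\<dots> = L * nrm f * norm v" by (simp add: L_def)
      finally show "norm (\<Sum>i\<in>UNIV. deriv (line f z i) 0 * v $ i) \<le> L * nrm f * norm v" .
    qed
  qed
  thus thesis using that L by blast
qed

text \<open>Equicontinuity comes from the common Lipschitz constant. The Cauchy property is recorded
  instead of a limit, because the limits on different polydisks still have to be glued.\<close>

lemma Arzela_Ascoli_cpoly:
  fixes F :: "nat \<Rightarrow> complex ^ 'n \<Rightarrow> complex"
  assumes F: "\<And>k. F k \<in> A2" "\<And>k. nrm (F k) \<le> B" and r: "0 < r" "r < 1"
  obtains k where "strict_mono (k :: nat \<Rightarrow> nat)" "uniformly_Cauchy_on (cpoly r) (\<lambda>n. F (k n))"
proof -
  obtain K where K: "K \<ge> 0" "\<And>f a. sephol f \<Longrightarrow> f \<in> L2 \<Longrightarrow> a \<in> (cpoly r :: (complex ^ 'n) set) \<Longrightarrow> norm (f a) \<le> K * nrm f"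
    using point_evaluation_bound[OF r] by blast
  obtain L where L: "L \<ge> 0" "\<And>f x y. f \<in> A2 \<Longrightarrow> x \<in> (cpoly r :: (complex ^ 'n) set) \<Longrightarrow> y \<in> cpoly r \<Longrightarrow>
    norm (f x - f y) \<le> L * nrm f * norm (x - y)" using local_Lipschitz_bound[OF r] by blast
  have B: "B \<ge> 0" using F(2)[of 0] order_trans[OF L2_norm_nonneg] by blast
  have eq: "\<exists>d>0. \<forall>n y. y \<in> cpoly r \<and> norm (x - y) < d \<longrightarrow> norm (F n x - F n y) < e" if x: "x \<in> cpoly r" and e: "e > 0" for x e
  proof (intro exI[of _ "e / (L * B + 1)"] conjI allI impI)
    have LB: "0 \<le> L * B" using L B by simp
    show "e / (L * B + 1) > 0" using e LB by simp
    fix n y assume y: "y \<in> cpoly r \<and> norm (x - y) < e / (L * B + 1)"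
    have "norm (F n x - F n y) \<le> L * nrm (F n) * norm (x - y)" using L(2)[OF F(1) x] y by blast
    also have "\<dots> \<le> L * B * norm (x - y)" by (intro mult_right_mono mult_left_mono F(2) L(1)) simp
    also have "\<dots> \<le> L * B * (e / (L * B + 1))" using y LB by (intro mult_left_mono) auto
    also have "\<dots> < e" using e LB by (simp add: field_simps)
    finally show "norm (F n x - F n y) < e" .
  qed
  have bd: "norm (F n x) \<le> K * B" if "x \<in> cpoly r" for n x
    using K(2)[OF A2_sephol[OF F(1)] A2_L2[OF F(1)] that, of n] mult_left_mono[OF F(2)[of n] K(1)] by linarith
  obtain g k where g: "strict_mono (k :: nat \<Rightarrow> nat)"
      "\<And>e. 0 < e \<Longrightarrow> \<exists>N. \<forall>n x. n \<ge> N \<and> x \<in> cpoly r \<longrightarrow> norm (F (k n) x - g x) < e"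
    by (rule Arzela_Ascoli[of "cpoly r" F "K * B", OF compact_cpoly bd eq]) (assumption | rule that | blast)+
  have "uniform_limit (cpoly r) (\<lambda>n. F (k n)) g sequentially"
    unfolding uniform_limit_sequentially_iff using g(2) by (simp add: dist_norm) blast
  hence "uniformly_Cauchy_on (cpoly r) (\<lambda>n. F (k n))"
    by (intro uniformly_convergent_Cauchy) (auto simp: uniformly_convergent_on_def)
  with g(1) show thesis by (rule that)
qed

text \<open>Diagonal choice over polydisks of radius tending to 1; the limit stays in the Bergman
  space with the same norm bound by Fatou's lemma.\<close>

lemma A2_Montel:
  fixes F :: "nat \<Rightarrow> complex ^ 'n \<Rightarrow> complex"
  assumes F: "\<And>k. F k \<in> A2" "\<And>k. nrm (F k) \<le> B"
  obtains k h where "strict_mono (k :: nat \<Rightarrow> nat)" "h \<in> A2" "nrm h \<le> B"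
    "\<And>r. 0 < r \<Longrightarrow> r < 1 \<Longrightarrow> uniform_limit (cpoly r) (\<lambda>n. F (k n)) h sequentially"
proof -
  define \<rho> where "\<rho> = (\<lambda>i::nat. 1 - 1 / (real i + 2))"
  have \<rho>: "0 < \<rho> i" "\<rho> i < 1" for i by (auto simp: \<rho>_def field_simps)
  define P where "P = (\<lambda>i (k::nat \<Rightarrow> nat). uniformly_Cauchy_on (cpoly (\<rho> i)) (\<lambda>n. F (k n)))"
  have 1: "\<exists>k. strict_mono (k :: nat \<Rightarrow> nat) \<and> P i (r \<circ> k)" for i and r :: "nat \<Rightarrow> nat"
    using Arzela_Ascoli_cpoly[of "\<lambda>n. F (r n)", OF F \<rho>] unfolding P_def o_def by blast
  \<comment> \<open>What the diagonalisation asks for: the Cauchy property passes to sequences that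
    are eventually subsequences.\<close>
  have 2: "P i (r \<circ> k2)" if P: "P i (r \<circ> k1)" and sub: "\<And>j. N \<le> j \<Longrightarrow> \<exists>j'. j \<le> j' \<and> k2 j = k1 j'" for i r k1 k2 N
    unfolding P_def uniformly_Cauchy_on_def
  proof (intro allI impI)
    fix e :: real assume "e > 0"
    then obtain M where M: "\<And>x m n. x \<in> cpoly (\<rho> i) \<Longrightarrow> m \<ge> M \<Longrightarrow> n \<ge> M \<Longrightarrow> dist (F ((r \<circ> k1) m) x) (F ((r \<circ> k1) n) x) < e"
      using P unfolding P_def uniformly_Cauchy_on_def by blast
    have "dist (F ((r \<circ> k2) m) x) (F ((r \<circ> k2) n) x) < e" if x: "x \<in> cpoly (\<rho> i)" and mn: "m \<ge> max M N" "n \<ge> max M N" for x m n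
    proof -
      obtain m' n' where "m \<le> m'" "k2 m = k1 m'" "n \<le> n'" "k2 n = k1 n'" using sub[of m] sub[of n] mn by auto
      thus ?thesis using M[OF x, of m' n'] mn by simp
    qed
    thus "\<exists>M. \<forall>x\<in>cpoly (\<rho> i). \<forall>m\<ge>M. \<forall>n\<ge>M. dist (F ((r \<circ> k2) m) x) (F ((r \<circ> k2) n) x) < e" by blast
  qed
  obtain k where k: "strict_mono (k :: nat \<Rightarrow> nat)" "\<And>i. P i (id \<circ> k)"
  proof (rule subsequence_diagonalization_lemma[of P id])
    show "\<exists>k. strict_mono (k :: nat \<Rightarrow> nat) \<and> P i (r \<circ> k)" for i r by (rule 1)
    show "P i (r \<circ> k2)" if "P i (r \<circ> k1)" "\<And>j. N \<le> j \<Longrightarrow> \<exists>j'. j \<le> j' \<and> k2 j = k1 j'" for i r k1 k2 N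
      by (rule 2[OF that])
  qed (rule that)
  have cau: "uniformly_Cauchy_on (cpoly r) (\<lambda>n. F (k n))" if r: "0 < r" "r < 1" for r
  proof -
    obtain i :: nat where i: "1 / (1 - r) < real i" using reals_Archimedean2 by blast
    have "1 < real i * (1 - r)" using i r by (simp add: field_simps)
    also have "\<dots> \<le> (real i + 2) * (1 - r)" using r by (intro mult_right_mono) auto
    finally have "1 / (real i + 2) < 1 - r" by (simp add: field_simps)
    hence "r \<le> \<rho> i" by (simp add: \<rho>_def)
    hence "cpoly r \<subseteq> (cpoly (\<rho> i) :: (complex ^ 'n) set)" by (rule cpoly_mono)
    thus ?thesis using k(2)[of i] unfolding P_def uniformly_Cauchy_on_def by (simp add: subset_iff) blast
  qed
  obtain h where h: "\<And>z. z \<notin> polydisk \<Longrightarrow> h z = 0" 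
    "\<And>r. 0 < r \<Longrightarrow> r < 1 \<Longrightarrow> uniform_limit (cpoly r) (\<lambda>n. F (k n)) h sequentially"
    using cpoly_Cauchy_limit[of "\<lambda>n. F (k n)", OF cau] by blast
  have "h \<in> A2" "nrm h \<le> B" using A2_sequence_limit[of "\<lambda>n. F (k n)" B h, OF F h(2,1)] by blast+
  thus thesis using that k(1) h(2) by blast
qed

subsection \<open>Compactness\<close>

text \<open>Each factor is written with \<open>cnj (z $ i) * z $ i\<close>, so that its Toeplitz
  operator splits into a conjugate coordinate on the left and a coordinate on the right.\<close>

definition weight :: "'n set \<Rightarrow> complex ^ 'n \<Rightarrow> complex" where
  "weight S z = (\<Prod>i\<in>S. 1 - cnj (z $ i) * z $ i)"

lemma weight_jfree: "j \<notin> S \<Longrightarrow> jfree j (weight S)"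
proof -
  assume j: "j \<notin> S"
  have c: "continuous_on A (weight S)" for A unfolding weight_def by (intro continuous_intros)
  have "weight S (upd z j w) = weight S z" for z w
    unfolding weight_def using j by (intro prod.cong refl) (auto simp: upd_nth)
  thus ?thesis using c bdd_of_continuous[OF c] by (simp add: jfree_def indep_def)
qed

lemma weight_bdd: "bdd (weight S)"
  unfolding weight_def by (intro bdd_of_continuous continuous_intros)

text \<open>Iterated, this writes T of the weight as the product of the operators M over the
  coordinates in S. It uses that T of the smaller weight commutes with multiplication by
  z_j.\<close>

lemma T_weight_insert:
  assumes j: "j \<notin> S" and f: "f \<in> A2"
  shows "T (weight (insert j S)) f = Mop j (T (weight S) f)"
proof -
  let ?h = "weight S"
  note jf = jfreeD[OF weight_jfree[OF j]]
  note bz = bdd_coord[of j] and sz = sephol_coord[of j]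
  have b1: "bdd (\<lambda>z. ?h z * z $ j)" by (rule bdd_symbol_mult[OF jf(3) bz])
  have b2: "bdd (\<lambda>z. cnj (z $ j) * (?h z * z $ j))" by (rule bdd_symbol_mult[OF bdd_cnj_coord b1])
  have "weight (insert j S) = (\<lambda>z. ?h z - cnj (z $ j) * (?h z * z $ j))"
    using j by (simp add: weight_def fun_eq_iff algebra_simps)
  hence "T (weight (insert j S)) f = (\<lambda>z. T ?h f z - T (\<lambda>z. cnj (z $ j) * (?h z * z $ j)) f z)"
    using T_sym_diff[OF jf(3) b2 f] by simp
  also have "T (\<lambda>z. cnj (z $ j) * (?h z * z $ j)) f = Bs j (T (\<lambda>z. ?h z * z $ j) f)"
    by (rule T_antiholomorphic_T[OF bz sz b1 f, symmetric])
  also have "T (\<lambda>z. ?h z * z $ j) f = T ?h (\<lambda>z. z $ j * f z)"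
    using T_T_holomorphic[OF bz sz jf(3) f] by (simp add: T_coord[OF f])
  also have "\<dots> = (\<lambda>z. z $ j * T ?h f z)" by (rule T_indep_commutes_coord[OF jf f])
  finally show ?thesis by (simp add: Mop_def Aop_def)
qed

text \<open>1 - A^s is the sum of the A^l M for l < s, and A is a contraction.\<close>

lemma nrm_diff_Aop_pow:
  assumes v: "v \<in> A2" shows "nrm (\<lambda>z. v z - (Aop j ^^ s) v z) \<le> real s * nrm (Mop j v)"
proof (induction s)
  case (Suc s)
  note As = Aop_pow_A2[OF v, of s j]
  note d = A2_diff[OF v As]
  have "(\<lambda>z. v z - (Aop j ^^ Suc s) v z) = (\<lambda>z. Mop j v z + Aop j (\<lambda>z. v z - (Aop j ^^ s) v z) z)"
    unfolding Aop_diff[OF v As] by (simp add: Mop_def)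
  hence "nrm (\<lambda>z. v z - (Aop j ^^ Suc s) v z) \<le> nrm (Mop j v) + nrm (Aop j (\<lambda>z. v z - (Aop j ^^ s) v z))"
    using L2_norm_triangle[OF Mop_L2[OF v] A2_L2[OF Aop_A2[OF d]]] by simp
  also have "nrm (Aop j (\<lambda>z. v z - (Aop j ^^ s) v z)) \<le> nrm (\<lambda>z. v z - (Aop j ^^ s) v z)" by (rule nrm_Aop_le[OF d])
  also note Suc
  finally show ?case by (simp add: algebra_simps)
qed (simp add: L2_norm_def)

lemma T_jfree_Aop_pow:
  assumes h: "jfree j h" and f: "f \<in> A2" shows "T h ((Aop j ^^ s) f) = (Aop j ^^ s) (T h f)"
proof (induction s)
  case (Suc s)
  show ?case using T_indep_Aop[OF jfreeD[OF h] Aop_pow_A2[OF f, of s j]] Suc by simp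
qed simp

text \<open>Induction on \<open>S\<close>: \<open>A\<^sub>j\<^sup>s f\<close> is taken care of by nullity in the coordinate \<open>j\<close>, and
  \<open>f - A\<^sub>j\<^sup>s f\<close> satisfies the hypothesis for the smaller set.\<close>

lemma null_imp_vanishing:
  fixes X :: "'n::finite op"
  assumes null: "\<And>j. null j X" and bX: "bddop X"
    and add: "\<And>f g. f \<in> A2 \<Longrightarrow> g \<in> A2 \<Longrightarrow> X (\<lambda>z. f z + g z) = (\<lambda>z. X f z + X g z)"
    and fin: "finite S"
    and F: "\<And>k. F k \<in> A2" "\<And>k. nrm (F k) \<le> B" and lim: "(\<lambda>k. nrm (T (weight S) (F k))) \<longlonglongrightarrow> 0"
  shows "(\<lambda>k. nrm (X (F k))) \<longlonglongrightarrow> 0"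
  using fin F lim
proof (induction S arbitrary: F B rule: finite_induct)
  case empty
  have one: "T (weight {}) f = f" if "f \<in> A2" for f :: "complex ^ 'n \<Rightarrow> complex"
  proof -
    have "sephol (weight {} :: complex ^ 'n \<Rightarrow> complex)" by (simp add: weight_def[abs_def] sephol_def hol_in_const)
    thus ?thesis using T_holomorphic[OF weight_bdd _ that] by (simp add: weight_def)
  qed
  \<comment> \<open>The empty weight is the constant 1, so the hypothesis is already norm
    convergence to 0 and boundedness of X suffices.\<close>
  obtain D where D: "D \<ge> 0" "\<And>g. g \<in> A2 \<Longrightarrow> nrm (X g) \<le> D * nrm g" using bddopE[OF bX] by blast
  have "(\<lambda>k. D * nrm (F k)) \<longlonglongrightarrow> D * 0" using empty by (intro tendsto_intros) (simp add: one)
  hence "(\<lambda>k. D * nrm (F k)) \<longlonglongrightarrow> 0" by simp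
  thus ?case by (rule real_tendsto_sandwich[rotated -1, where f = "\<lambda>_. 0"]) (use D empty in auto)
next
  case (insert j S)
  note F = insert.prems(1,2)
  note h = weight_jfree[OF insert.hyps(2)]
  have B: "B \<ge> 0" using F(2)[of 0] order_trans[OF L2_norm_nonneg] by blast
  show ?case
  proof (rule LIMSEQ_I)
    fix e :: real assume e: "e > 0"
    have e1: "e / (4 * (B + 1)) > 0" using e B by simp
    obtain C where C: "C \<ge> 0" "\<And>g. g \<in> A2 \<Longrightarrow> nrm (X g) \<le> e / (4 * (B + 1)) * nrm g + C * nrm (Mop j g)"
      using nullE[OF null e1] by blast
    \<comment> \<open>The norm of M A^s f is at most B / sqrt(s + 1); this s makes C times it at
      most e / 4.\<close>
    obtain s :: nat where s: "(4 * C * B / e)\<^sup>2 < real s" using reals_Archimedean2 by blast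
    have small: "nrm (X ((Aop j ^^ s) (F k))) \<le> e / 2" for k
    proof -
      let ?g = "(Aop j ^^ s) (F k)"
      note g = Aop_pow_A2[OF F(1)[of k], of s j]
      have 1: "e / (4 * (B + 1)) * nrm ?g \<le> e / 4"
      proof -
        have "e / (4 * (B + 1)) * nrm ?g \<le> e / (4 * (B + 1)) * B"
          using nrm_Aop_pow[OF F(1)[of k], of s j] F(2)[of k] e1 by (intro mult_left_mono) auto
        also have "\<dots> \<le> e / 4" using e B by (simp add: field_simps)
        finally show ?thesis .
      qed
      have 2: "C * nrm (Mop j ?g) \<le> e / 4"
      proof (rule power2_le_imp_le)
        have "real (Suc s) * (nrm (Mop j ?g))\<^sup>2 \<le> B\<^sup>2"
          using order_trans[OF Mop_Aop_pow[OF F(1)] power_mono[OF F(2) L2_norm_nonneg]] .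
        hence "C\<^sup>2 * (real (Suc s) * (nrm (Mop j ?g))\<^sup>2) \<le> C\<^sup>2 * B\<^sup>2" by (rule mult_left_mono) simp
        hence "real (Suc s) * (C * nrm (Mop j ?g))\<^sup>2 \<le> (C * B)\<^sup>2" by (simp only: power_mult_distrib mult_ac)
        also have "\<dots> = (4 * C * B / e)\<^sup>2 * (e / 4)\<^sup>2" using e by (simp add: power2_eq_square)
        also have "\<dots> \<le> real (Suc s) * (e / 4)\<^sup>2" using s by (intro mult_right_mono) auto
        finally show "(C * nrm (Mop j ?g))\<^sup>2 \<le> (e / 4)\<^sup>2" by (rule mult_left_le_imp_le) simp
      qed (use e in simp)
      show ?thesis using C(2)[OF g] 1 2 by linarith
    qed
    define G where "G = (\<lambda>k z. F k z - (Aop j ^^ s) (F k) z)"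
    have G: "G k \<in> A2" "nrm (G k) \<le> 2 * B" for k
    proof -
      note As = Aop_pow_A2[OF F(1)[of k], of s j]
      show "G k \<in> A2" unfolding G_def by (rule A2_diff[OF F(1) As])
      show "nrm (G k) \<le> 2 * B" unfolding G_def
        using L2_norm_triangle_diff[OF A2_L2[OF F(1)] A2_L2[OF As], of k] nrm_Aop_pow[OF F(1)[of k], of s j] F(2)[of k] by linarith
    qed
    have "(\<lambda>k. nrm (T (weight S) (G k))) \<longlonglongrightarrow> 0"
    proof (rule real_tendsto_sandwich[where f = "\<lambda>_. 0"])
      \<comment> \<open>T of the smaller weight commutes with A, so it carries F k - A^s (F k) to (1
        - A^s) v, and M v is T of the larger weight applied to F k.\<close>
      have "nrm (T (weight S) (G k)) \<le> real s * nrm (T (weight (insert j S)) (F k))" for k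
        unfolding G_def T_diff[OF jfreeD(3)[OF h] F(1) Aop_pow_A2[OF F(1)]] T_jfree_Aop_pow[OF h F(1)] T_weight_insert[OF insert.hyps(2) F(1)]
        by (rule nrm_diff_Aop_pow[OF T_A2[OF jfreeD(3)[OF h] F(1)]])
      thus "\<forall>\<^sub>F k in sequentially. nrm (T (weight S) (G k)) \<le> real s * nrm (T (weight (insert j S)) (F k))" by simp
      show "(\<lambda>k. real s * nrm (T (weight (insert j S)) (F k))) \<longlonglongrightarrow> 0"
        using tendsto_mult_left[OF insert.prems(3), of "real s"] by simp
      show "(\<lambda>_::nat. 0 :: real) \<longlonglongrightarrow> 0" by simp
    qed simp
    from insert.IH[OF G this] have "(\<lambda>k. nrm (X (G k))) \<longlonglongrightarrow> 0" .
    moreover have "e / 2 > 0" using e by simp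
    ultimately obtain N where N: "\<And>k. k \<ge> N \<Longrightarrow> nrm (X (G k)) < e / 2"
      using LIMSEQ_D[of "\<lambda>k. nrm (X (G k))" 0 "e / 2"] by auto
    have "nrm (X (F k)) < e" if k: "k \<ge> N" for k
    proof -
      note As = Aop_pow_A2[OF F(1)[of k], of s j]
      have "F k = (\<lambda>z. (Aop j ^^ s) (F k) z + G k z)" by (simp add: G_def)
      hence "X (F k) = (\<lambda>z. X ((Aop j ^^ s) (F k)) z + X (G k) z)" using add[OF As G(1), of k] by simp
      thus ?thesis
        using L2_norm_triangle[OF A2_L2[OF bddopD[OF bX As]] A2_L2[OF bddopD[OF bX G(1)]], of k] small[of k] N[OF k] by simp
    qed
    thus "\<exists>N. \<forall>k\<ge>N. norm (nrm (X (F k)) - 0) < e" by auto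
  qed
qed

lemma norm_weight_factor:
  assumes "norm w \<le> 1" shows "norm (1 - cnj w * w) = 1 - (norm w)\<^sup>2"
proof -
  have "1 - cnj w * w = of_real (1 - (norm w)\<^sup>2)" by (simp only: of_real_diff of_real_1 complex_norm_square mult.commute)
  moreover have "0 \<le> 1 - (norm w)\<^sup>2" using assms by (simp add: power_le_one)
  ultimately show ?thesis by (simp only: norm_of_real abs_of_nonneg)
qed

lemma norm_weight_le:
  fixes z :: "complex ^ 'n"
  assumes z: "z \<in> polydisk" shows "norm (weight UNIV z) \<le> 1 - (norm (z $ i))\<^sup>2"
proof -
  have f: "norm (1 - cnj (z $ k) * z $ k) = 1 - (norm (z $ k))\<^sup>2" "0 \<le> 1 - (norm (z $ k))\<^sup>2" "1 - (norm (z $ k))\<^sup>2 \<le> 1" for k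
    using polydisk_nth[OF z, of k] norm_weight_factor[of "z $ k"] by (auto simp: power_le_one less_imp_le)
  have "norm (weight UNIV z) = (\<Prod>k\<in>UNIV. 1 - (norm (z $ k))\<^sup>2)" unfolding weight_def prod_norm[symmetric] f ..
  also have "\<dots> = (1 - (norm (z $ i))\<^sup>2) * (\<Prod>k\<in>UNIV - {i}. 1 - (norm (z $ k))\<^sup>2)" by (rule prod.remove) auto
  also have "\<dots> \<le> (1 - (norm (z $ i))\<^sup>2) * 1" by (intro mult_left_mono prod_le_1) (use f in auto)
  finally show ?thesis by simp
qed

text \<open>On \<open>cpoly r\<close> the sequence is uniformly small. Outside it some coordinate
  has modulus above r, so the weight is at most 1 - r^2 there and the norm bound suffices.\<close>

lemma weight_vanishing:
  fixes F :: "nat \<Rightarrow> complex ^ 'n \<Rightarrow> complex"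
  assumes F: "\<And>k. F k \<in> A2" "\<And>k. nrm (F k) \<le> B"
    and lim: "\<And>r. 0 < r \<Longrightarrow> r < 1 \<Longrightarrow> uniform_limit (cpoly r) F (\<lambda>_. 0) sequentially"
  shows "(\<lambda>k. nrm (T (weight UNIV) (F k))) \<longlonglongrightarrow> 0"
proof (rule LIMSEQ_I)
  let ?W = "weight (UNIV :: 'n set)"
  define V where "V = nrm (\<lambda>_::complex^'n. 1)"
  have V: "V > 0" unfolding V_def by (rule nrm_one_pos)
  have B: "B \<ge> 0" using F(2)[of 0] order_trans[OF L2_norm_nonneg] by blast
  fix e :: real assume e: "e > 0"
  \<comment> \<open>With r = 1 - t the weight outside is at most 2 t, and 2 t B < e / 2;
    \<open>d\<close> is chosen so that d times the norm of 1 is e / 2.\<close>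
  define t where "t = min (1 / 2) (e / (4 * (B + 1)))"
  define r where "r = 1 - t"
  define d where "d = e / (2 * V)"
  have t: "0 < t" "t < 1" using e B by (auto simp: t_def)
  hence r: "0 < r" "r < 1" by (auto simp: r_def)
  have d: "d > 0" using e V by (simp add: d_def)
  have rt: "1 - r\<^sup>2 \<le> 2 * t" "0 \<le> 1 - r\<^sup>2" using t by (auto simp: r_def power2_eq_square algebra_simps intro: mult_le_one)
  have tB: "2 * t * B < e / 2"
  proof -
    have "t * (4 * (B + 1)) \<le> e"
      using B pos_le_divide_eq[of "4 * (B + 1)" t e] by (simp add: t_def)
    thus ?thesis using t B by (simp add: algebra_simps)
  qed
  have "\<exists>N. \<forall>k\<ge>N. \<forall>z\<in>cpoly r. norm (F k z) < d"
    using lim[OF r] d unfolding uniform_limit_sequentially_iff by (simp add: dist_norm)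
  then obtain N where N: "\<And>k z. k \<ge> N \<Longrightarrow> z \<in> cpoly r \<Longrightarrow> norm (F k z) < d" by blast
  have "nrm (T ?W (F k)) < e" if k: "k \<ge> N" for k
  proof -
    let ?I = "\<lambda>z. indicator (cpoly r) z :: complex"
    note WF = sym_L2[OF weight_bdd F(1)[of k], of UNIV]
    have IWF: "(\<lambda>z. ?I z * (?W z * F k z)) \<in> L2" by (rule L2_mult[OF indicator_cpoly_bdd WF])
    have dL: "(\<lambda>z::complex^'n. complex_of_real d * 1) \<in> L2" by (rule L2_scale[where f = "\<lambda>_. 1"]) (rule one_in_L2)
    have "nrm (T ?W (F k)) \<le> nrm (\<lambda>z. ?W z * F k z)" unfolding T_eq by (rule nrm_proj_le[OF WF])
    also have "\<dots> = nrm (\<lambda>z. ?I z * (?W z * F k z) + (?W z * F k z - ?I z * (?W z * F k z)))" by simp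
    also have "\<dots> \<le> nrm (\<lambda>z. ?I z * (?W z * F k z)) + nrm (\<lambda>z. ?W z * F k z - ?I z * (?W z * F k z))"
      by (rule L2_norm_triangle[OF IWF L2_diff[OF WF IWF]])
    also have "nrm (\<lambda>z. ?I z * (?W z * F k z)) \<le> nrm (\<lambda>z::complex^'n. of_real d * 1)"
    proof (rule L2_norm_mono[OF dL IWF])
      fix z :: "complex ^ 'n" assume z: "z \<in> polydisk"
      have "norm (?W z) \<le> 1" using norm_weight_le[OF z, of undefined] by (rule order_trans) simp
      hence "norm (?W z) * norm (F k z) \<le> 1 * d" if "z \<in> cpoly r" using N[OF k that] by (intro mult_mono) auto
      thus "norm (?I z * (?W z * F k z)) \<le> norm (complex_of_real d * 1)"
        using d by (cases "z \<in> cpoly r") (auto simp: norm_mult)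
    qed
    also have "nrm (\<lambda>z::complex^'n. of_real d * 1) = d * V" unfolding L2_norm_scale V_def using d by simp
    also have "nrm (\<lambda>z. ?W z * F k z - ?I z * (?W z * F k z)) \<le> nrm (\<lambda>z. of_real (1 - r\<^sup>2) * F k z)"
    proof (rule L2_norm_mono[OF L2_scale[OF A2_L2[OF F(1)]] L2_diff[OF WF IWF]])
      fix z :: "complex ^ 'n" assume z: "z \<in> polydisk"
      show "norm (?W z * F k z - ?I z * (?W z * F k z)) \<le> norm (complex_of_real (1 - r\<^sup>2) * F k z)"
      proof (cases "z \<in> cpoly r")
        case False
        then obtain i where "r < norm (z $ i)" by (auto simp: cpoly_def not_le)
        hence "r\<^sup>2 \<le> (norm (z $ i))\<^sup>2" using r by (intro power_mono) auto
        hence "norm (?W z) \<le> 1 - r\<^sup>2" using norm_weight_le[OF z, of i] by linarith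
        hence "norm (?W z) * norm (F k z) \<le> (1 - r\<^sup>2) * norm (F k z)" by (rule mult_right_mono) simp
        moreover have "norm (complex_of_real (1 - r\<^sup>2)) = 1 - r\<^sup>2" unfolding norm_of_real using rt by simp
        ultimately show ?thesis using False by (simp only: norm_mult indicator_simps) (simp add: norm_mult)
      qed simp
    qed
    also have "\<dots> = (1 - r\<^sup>2) * nrm (F k)" unfolding L2_norm_scale norm_of_real using rt by simp
    also have "\<dots> \<le> 2 * t * B" using rt t F(2)[of k] by (intro mult_mono) auto
    finally show ?thesis using tB d V by (simp add: d_def)
  qed
  thus "\<exists>N. \<forall>k\<ge>N. norm (nrm (T ?W (F k)) - 0) < e" by auto
qed

theorem corollary2:
  fixes \<phi> \<psi> :: "complex ^ 'n \<Rightarrow> complex"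
  assumes "C1_closure polydisk \<phi>" and "C1_closure polydisk \<psi>"
    and "\<not> \<phi> constant_on closure polydisk" and "\<not> \<psi> constant_on closure polydisk"
    and "\<And>g :: complex \<Rightarrow> complex ^ 'n.
           holomorphic_map_on g (ball 0 1) \<Longrightarrow> g ` ball 0 1 \<subseteq> frontier polydisk \<Longrightarrow>
           ((\<phi> \<circ> g) holomorphic_on ball 0 1 \<and> (\<psi> \<circ> g) holomorphic_on ball 0 1) \<or>
           ((cnj \<circ> \<phi> \<circ> g) holomorphic_on ball 0 1 \<and> (cnj \<circ> \<psi> \<circ> g) holomorphic_on ball 0 1)"
  shows "compact_operator_on_bergman polydisk (toeplitz_commutator polydisk \<phi> \<psi>)"
proof -
  let ?X = "toeplitz_commutator polydisk \<phi> \<psi>"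
  have \<phi>: "continuous_on (cpoly 1) \<phi>" and \<psi>: "continuous_on (cpoly 1) \<psi>"
    using assms(1,2) by (simp_all add: C1_closure_def closure_polydisk)
  note b\<phi> = bdd_of_continuous[OF \<phi>] and b\<psi> = bdd_of_continuous[OF \<psi>]
  \<comment> \<open>Boundedness does not depend on the coordinate, so any index serves.\<close>
  have bX: "bddop ?X" by (rule adm_bddop[OF adm_commutator[OF \<phi> \<psi>, of undefined]])
  have null: "null j ?X" for j
    by (rule commutator_null[OF \<phi> \<psi>]) (rule slice_toeplitz_commute[OF \<phi> \<psi> _ slice_dichotomy[OF \<phi> \<psi> _ assms(5)]]; assumption)
  have X: "?X f = (\<lambda>z. T \<phi> (T \<psi> f) z - T \<psi> (T \<phi> f) z)" for f
    by (simp add: fun_eq_iff toeplitz_commutator_def)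
  have Tlin: "T \<kappa> (\<lambda>z. a * f z + b * g z) = (\<lambda>z. a * T \<kappa> f z + b * T \<kappa> g z)"
    if "bdd \<kappa>" "f \<in> A2" "g \<in> A2" for \<kappa> :: "complex ^ 'n \<Rightarrow> complex" and f g a b
    using T_add[OF that(1) A2_scale[OF that(2)] A2_scale[OF that(3)], of a b] that by (simp add: T_scale)
  have lin: "?X (\<lambda>z. a * f z + b * g z) = (\<lambda>z. a * ?X f z + b * ?X g z)" if fg: "f \<in> A2" "g \<in> A2" for f g a b
    unfolding X Tlin[OF b\<phi> fg] Tlin[OF b\<psi> fg]
      Tlin[OF b\<phi> T_A2[OF b\<psi> fg(1)] T_A2[OF b\<psi> fg(2)]] Tlin[OF b\<psi> T_A2[OF b\<phi> fg(1)] T_A2[OF b\<phi> fg(2)]]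
    by (simp add: algebra_simps)
  have add: "?X (\<lambda>z. f z + g z) = (\<lambda>z. ?X f z + ?X g z)" if "f \<in> A2" "g \<in> A2" for f g
    using lin[OF that, of 1 1] by simp
  show ?thesis
    unfolding compact_operator_on_bergman_def
  proof (intro conjI ballI allI impI)
    fix F :: "nat \<Rightarrow> complex ^ 'n \<Rightarrow> complex"
    assume "(\<forall>k. F k \<in> A2) \<and> (\<exists>B. \<forall>k. nrm (F k) \<le> B)"
    then obtain B where F: "\<And>k. F k \<in> A2" "\<And>k. nrm (F k) \<le> B" by blast
    obtain r h where r: "strict_mono (r :: nat \<Rightarrow> nat)" and h: "h \<in> A2" "nrm h \<le> B"
      and lim: "\<And>s. 0 < s \<Longrightarrow> s < 1 \<Longrightarrow> uniform_limit (cpoly s) (\<lambda>n. F (r n)) h sequentially"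
      by (rule A2_Montel[OF F]) (rule that)
    \<comment> \<open>Nullity treats sequences tending to 0 locally uniformly; subtracting the
      Montel limit h reduces to this case, and by linearity the norm limit of the images is the
      image of h.\<close>
    define G where "G = (\<lambda>k z. F (r k) z - h z)"
    have G: "G k \<in> A2" "nrm (G k) \<le> 2 * B" for k
      unfolding G_def using A2_diff[OF F(1) h(1)] L2_norm_triangle_diff[OF A2_L2[OF F(1)] A2_L2[OF h(1)], of "r k"] F(2)[of "r k"] h(2)
      by auto
    have "uniform_limit (cpoly s) G (\<lambda>_. 0) sequentially" if "0 < s" "s < 1" for s
      using lim[OF that] unfolding uniform_limit_sequentially_iff by (simp add: G_def dist_norm)
    from null_imp_vanishing[OF null bX add finite[of UNIV] G weight_vanishing[OF G this]]
    have "(\<lambda>k. nrm (?X (G k))) \<longlonglongrightarrow> 0" .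
    moreover have "?X (G k) = (\<lambda>z. ?X (F (r k)) z - ?X h z)" for k
      unfolding G_def using lin[OF F(1)[of "r k"] h(1), of 1 "-1"] by simp
    ultimately show "\<exists>h\<in>A2. \<exists>r. strict_mono r \<and> (\<lambda>k. nrm (\<lambda>z. ?X (F (r k)) z - h z)) \<longlonglongrightarrow> 0"
      using r bddopD[OF bX h(1)] by auto
  qed (use bddopD[OF bX] lin in auto)
qed

end
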